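(* Let $Z=\|\mu\|$ be the total mass of the limit measure $\mu=\mu^{[0,1]}$ of the exact scaling log-infinitely divisible cascade on $[0,1]$ defined in the context. (1) The following assertions are equivalent: $(\alpha)$ $0<\mathbb{E}(Z^q)<\infty$ for all $q>1$; $(\beta)$ $\sigma=0$, $\nu$ is carried by $(-\infty,0]$, $\int_{-\infty}^0 1\wedge|x|\,\nu(dx)<\infty$, and $$\gamma=\int_{-\infty}^0(1-e^x)\,\nu(dx)\le 1.$$ (2) If $(\beta)$ holds, then $$\lim_{q\to\infty}\frac{\log\mathbb{E}(Z^q)}{q\log q}=\gamma.$$
   Context: Lévy data. Let $a,\sigma\in\mathbb{R}$ and let $\nu$ be a Lévy measure on $\mathbb{R}$, i.e. $\nu(\{0\})=0$ and $\int_{\mathbb{R}}1\wedge|x|^2\,\nu(dx)<\infty$. Put $\psi(q)=iaq-\tfrac12\sigma^2q^2+\int_{\mathbb{R}}(e^{iqx}-1-iqx\mathbf{1}_{|x|\le1})\,\nu(dx)$. Let $I_\nu$ be the interval of all $q\in\mathbb{R}$ with $\int_{|x|\ge1}e^{qx}\,\nu(dx)<\infty$. Standing assumptions: $\sigma$ and $\nu$ are not both zero, $[0,1]\subset I_\nu$, and $a=-\tfrac{\sigma^2}{2}-\int_{\mathbb{R}}(e^x-1-x\mathbf{1}_{|x|\le1})\,\nu(dx)$. Random measure. Let $\mathbb{H}=\{x+iy:x\in\mathbb{R},y>0\}$ with the measure $\lambda(dx\,dy)=y^{-2}dx\,dy$, and let $\Lambda$ be a homogeneous independently scattered random measure on $\mathbb{H}$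 with Lévy exponent $\psi$ and intensity $\lambda$: for Borel $B$ with $\lambda(B)<\infty$, $\mathbb{E}(e^{iq\Lambda(B)})=e^{\psi(q)\lambda(B)}$ for all $q\in\mathbb{R}$, and for every at most countable family of disjoint Borel sets $B_j$ of finite $\lambda$-measure with union of finite $\lambda$-measure, the $\Lambda(B_j)$ are independent and $\Lambda(\bigcup_jB_j)=\sum_j\Lambda(B_j)$ almost surely. Put $Q(B)=e^{\Lambda(B)}$; by the choice of $a$, $\mathbb{E}(Q(B))=1$. Cascade. For $t\in\mathbb{R}$ let $V(t)=\{x+iy\in\mathbb{H}:-y/2<x-t\le y/2\}$. For a nontrivial compact interval $I$ let $V(I)=\bigcap_{t\in I}V(t)$, and for $t\in I$, $\epsilon>0$ let $V^I(t)=V(t)\setminus V(I)$ and $V^I_\epsilon(t)=V^I(t)\cap\{\mathrm{Im}(z)\ge\epsilon\}$ (which has finite $\lambda$-measure); $t\mapsto\Lambda(V^I_\epsilon(t))$ is taken in a càdlàg modification. Let $\mu^I_\epsilon(dx)=|I|^{-1}Q(V^I_\epsilon(x))\,dx$ on $I$. Then $\{\mu^I_{1/t}\}_{t>0}$ is a measure-valued martingale; it has a right-continuous modification, used throughout, which converges weakly almost surely as $t\to\infty$ to a random measure $\mu^I$ on $I$. Write $\mu=\mu^{[0,1]}$ and $Z=\|\mu\|=\mu([0,1])$; $\|\cdot\|$ denotes total mass. *)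

theory Defs
  imports "HOL-Probability.Probability"
begin

section \<open>Levy data\<close>

definition levy_measure :: "real measure \<Rightarrow> bool" where
  "levy_measure \<nu> \<longleftrightarrow> sets \<nu> = sets borel \<and> emeasure \<nu> {0} = 0 \<and>
     (\<integral>\<^sup>+x. ennreal (min 1 (\<bar>x\<bar>\<^sup>2)) \<partial>\<nu>) < \<infinity>"

definition levy_exponent :: "real \<Rightarrow> real \<Rightarrow> real measure \<Rightarrow> real \<Rightarrow> complex" where
  "levy_exponent a \<sigma> \<nu> q =
     \<i> * of_real (a * q) - of_real (\<sigma>\<^sup>2 * q\<^sup>2 / 2) +
     (CLINT x|\<nu>. iexp (q * x) - 1 - \<i> * of_real (q * x * indicator {-1..1} x))"

definition exp_moment_interval :: "real measure \<Rightarrow> real set" where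
  "exp_moment_interval \<nu> = {q. (\<integral>\<^sup>+x\<in>{x. \<bar>x\<bar> \<ge> 1}. ennreal (exp (q * x)) \<partial>\<nu>) < \<infinity>}"

text \<open>The choice of the drift in the last conjunct is the normalisation
  \<open>\<psi> (- \<i>) = 0\<close>, that is, \<open>Q B = exp (\<Lambda> B)\<close> has mean one.\<close>

definition cascade_levy_data :: "real \<Rightarrow> real \<Rightarrow> real measure \<Rightarrow> bool" where
  "cascade_levy_data a \<sigma> \<nu> \<longleftrightarrow>
     levy_measure \<nu> \<and>
     \<not> (\<sigma> = 0 \<and> \<nu> = null_measure borel) \<and>
     {0..1} \<subseteq> exp_moment_interval \<nu> \<and>
     a = - \<sigma>\<^sup>2 / 2 - (LINT x|\<nu>. exp x - 1 - x * indicator {-1..1} x)"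

section \<open>The independently scattered random measure\<close>

definition upper_half_plane :: "complex set" where
  "upper_half_plane = {z. Im z > 0}"

text \<open>The measurable sets are exactly the Borel subsets of the upper half-plane, so
  \<open>fmeasurable hyperbolic_measure\<close> consists of the Borel sets of finite measure.\<close>

definition hyperbolic_measure :: "complex measure" where
  "hyperbolic_measure =
     density (restrict_space lborel upper_half_plane) (\<lambda>z. ennreal (1 / (Im z)\<^sup>2))"

text \<open>At most countable families are rendered as sequences; a finite family is padded with
  empty sets, for which \<open>\<Lambda> {} = 0\<close> almost surely by the formula for the characteristic function.
  The series is an ordinary convergent series (\<open>sums\<close>): it need not be almost surely
  absolutely convergent, so \<open>has_sum\<close> would be too strong.\<close>

definition indep_scattered_random_measure ::
    "'w measure \<Rightarrow> (real \<Rightarrow> complex) \<Rightarrow> 'p measure \<Rightarrow> ('p set \<Rightarrow> 'w \<Rightarrow> real) \<Rightarrow> bool" where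
  "indep_scattered_random_measure M \<psi> L \<Lambda> \<longleftrightarrow>
     prob_space M \<and>
     (\<forall>B\<in>fmeasurable L. \<Lambda> B \<in> borel_measurable M \<and>
        (\<forall>q. (CLINT \<omega>|M. iexp (q * \<Lambda> B \<omega>)) = exp (\<psi> q * of_real (measure L B)))) \<and>
     (\<forall>B :: nat \<Rightarrow> 'p set.
        disjoint_family B \<and> range B \<subseteq> fmeasurable L \<and> (\<Union>j. B j) \<in> fmeasurable L \<longrightarrow>
          prob_space.indep_vars M (\<lambda>_. borel) (\<lambda>j. \<Lambda> (B j)) UNIV \<and>
          (AE \<omega> in M. (\<lambda>j. \<Lambda> (B j) \<omega>) sums \<Lambda> (\<Union>j. B j) \<omega>))"

section \<open>The cones\<close>

definition cone :: "real \<Rightarrow> complex set" where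
  "cone t = {z \<in> upper_half_plane. - Im z / 2 < Re z - t \<and> Re z - t \<le> Im z / 2}"

definition cone_common :: "real set \<Rightarrow> complex set" where
  "cone_common I = (\<Inter>t\<in>I. cone t)"

definition cone_rel :: "real set \<Rightarrow> real \<Rightarrow> complex set" where
  "cone_rel I t = cone t - cone_common I"

definition cone_trunc :: "real set \<Rightarrow> real \<Rightarrow> real \<Rightarrow> complex set" where
  "cone_trunc I \<epsilon> t = cone_rel I t \<inter> {z. Im z \<ge> \<epsilon>}"

section \<open>Modifications\<close>

definition cadlag_on :: "real set \<Rightarrow> (real \<Rightarrow> real) \<Rightarrow> bool" where
  "cadlag_on I f \<longleftrightarrow>
     (\<forall>t\<in>I. (f \<longlongrightarrow> f t) (at t within I \<inter> {t<..}) \<and>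
             (\<exists>l. (f \<longlongrightarrow> l) (at t within I \<inter> {..<t})))"

definition cadlag_modification ::
    "'w measure \<Rightarrow> real set \<Rightarrow> (real \<Rightarrow> 'w \<Rightarrow> real) \<Rightarrow> (real \<Rightarrow> 'w \<Rightarrow> real) \<Rightarrow> bool" where
  "cadlag_modification M I X Y \<longleftrightarrow>
     (\<forall>t\<in>I. Y t \<in> borel_measurable M \<and> (AE \<omega> in M. Y t \<omega> = X t \<omega>)) \<and>
     (\<forall>\<omega>\<in>space M. cadlag_on I (\<lambda>t. Y t \<omega>))"

definition random_measure_on ::
    "'w measure \<Rightarrow> real set \<Rightarrow> ('w \<Rightarrow> real measure) \<Rightarrow> bool" where
  "random_measure_on M I m \<longleftrightarrow>
     (\<forall>\<omega>\<in>space M. finite_measure (m \<omega>) \<and> sets (m \<omega>) = sets (restrict_space borel I)) \<and>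
     (\<forall>B\<in>sets (restrict_space borel I). (\<lambda>\<omega>. emeasure (m \<omega>) B) \<in> borel_measurable M)"

text \<open>Weak convergence of finite Borel measures on \<open>I\<close> along an arbitrary filter; the library
  notion \<open>weak_conv_m\<close> only covers sequences of distributions on the real line.\<close>

definition weakly_tendsto_on ::
    "real set \<Rightarrow> ('i \<Rightarrow> real measure) \<Rightarrow> real measure \<Rightarrow> 'i filter \<Rightarrow> bool" where
  "weakly_tendsto_on I m m' F \<longleftrightarrow>
     (\<forall>f :: real \<Rightarrow> real. continuous_on I f \<and> bounded (f ` I) \<longrightarrow>
        ((\<lambda>s. LINT x|m s. f x) \<longlongrightarrow> (LINT x|m'. f x)) F)"

definition right_continuous_measure_modification ::
    "'w measure \<Rightarrow> real set \<Rightarrow> (real \<Rightarrow> 'w \<Rightarrow> real measure) \<Rightarrow>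
     (real \<Rightarrow> 'w \<Rightarrow> real measure) \<Rightarrow> bool" where
  "right_continuous_measure_modification M I n m \<longleftrightarrow>
     (\<forall>t>0. random_measure_on M I (m t) \<and> (AE \<omega> in M. m t \<omega> = n t \<omega>)) \<and>
     (\<forall>\<omega>\<in>space M. \<forall>t>0. weakly_tendsto_on I (\<lambda>s. m s \<omega>) (m t \<omega>) (at_right t))"

section \<open>The cascade measure\<close>

text \<open>Here \<open>Y\<close> stands for the chosen modification of \<open>\<lambda>t. \<Lambda> (cone_trunc I \<epsilon> t)\<close>, so that
  \<open>exp (Y x \<omega>)\<close> is \<open>Q (cone_trunc I \<epsilon> x)\<close>.\<close>

definition cascade_approx ::
    "real set \<Rightarrow> (real \<Rightarrow> 'w \<Rightarrow> real) \<Rightarrow> 'w \<Rightarrow> real measure" where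
  "cascade_approx I Y \<omega> =
     density (restrict_space lborel I) (\<lambda>x. ennreal (exp (Y x \<omega>) / measure lborel I))"

text \<open>The limit measure depends on the chosen modifications only up to a null event;
  the predicate holds for every version of it.\<close>

definition cascade_limit ::
    "'w measure \<Rightarrow> (complex set \<Rightarrow> 'w \<Rightarrow> real) \<Rightarrow> real set \<Rightarrow> ('w \<Rightarrow> real measure) \<Rightarrow> bool" where
  "cascade_limit M \<Lambda> I \<mu> \<longleftrightarrow>
     random_measure_on M I \<mu> \<and>
     (\<exists>Y m.
        (\<forall>\<epsilon>>0. cadlag_modification M I (\<lambda>t. \<Lambda> (cone_trunc I \<epsilon> t)) (Y \<epsilon>)) \<and>
        right_continuous_measure_modification M I (\<lambda>t. cascade_approx I (Y (1 / t))) m \<and>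
        (AE \<omega> in M. weakly_tendsto_on I (\<lambda>t. m t \<omega>) (\<mu> \<omega>) at_top))"

definition total_mass :: "'a measure \<Rightarrow> real" where
  "total_mass m = measure m (space m)"

definition moment :: "'w measure \<Rightarrow> ('w \<Rightarrow> real) \<Rightarrow> real \<Rightarrow> ennreal" where
  "moment M Z q = (\<integral>\<^sup>+\<omega>. ennreal (Z \<omega> powr q) \<partial>M)"

section \<open>The condition on the Levy data\<close>

definition levy_gamma :: "real measure \<Rightarrow> real" where
  "levy_gamma \<nu> = (LINT x:{..0}|\<nu>. 1 - exp x)"

definition condition_beta :: "real \<Rightarrow> real measure \<Rightarrow> bool" where
  "condition_beta \<sigma> \<nu> \<longleftrightarrow>
     \<sigma> = 0 \<and>
     emeasure \<nu> {0<..} = 0 \<and>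
     (\<integral>\<^sup>+x\<in>{..0}. ennreal (min 1 \<bar>x\<bar>) \<partial>\<nu>) < \<infinity> \<and>
     levy_gamma \<nu> \<le> 1"

end

theory Submission
  imports Defs "HOL-Real_Asymp.Real_Asymp" "HOL-Library.Nat_Bijection"
begin

text \<open>Under \<open>(\<beta>)\<close> the variable \<open>\<Lambda> B\<close> has a drift \<open>\<gamma> * \<lambda> B\<close> and negative jumps only, so all its
  exponential moments are finite. By Fubini the \<open>n\<close>-th moment of the truncated mass is \<open>n!\<close> times an
  integral over ordered points \<open>x\<^sub>1 < \<cdots> < x\<^sub>n\<close> of \<open>exp (\<Sum>i<j. \<alpha> (j - i) * \<lambda> (V x\<^sub>i \<inter> V x\<^sub>j))\<close>, where
  \<open>\<alpha> k = \<integral> exp ((k - 1) x) (1 - exp x)\<^sup>2 d\<nu>\<close> sums to \<open>\<gamma>\<close> and \<open>\<lambda> (V x \<inter> V y)\<close> is essentially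
  \<open>- ln \<bar>x - y\<bar>\<close>. Splitting at the largest gap between consecutive points bounds the integral from
  above; one point in each of the cells \<open>(i / n, (i + 1) / n)\<close> bounds it from below. Both bounds are
  \<open>exp (\<gamma> n ln n + o(n ln n))\<close> once the truncation is below \<open>1 / n\<close>.

  Conversely, each half of \<open>[0,1]\<close> carries a copy of \<open>Z / 2\<close> multiplied by an independent factor
  \<open>exp (\<Lambda> C)\<close> with \<open>\<lambda> C = ln 2\<close>. As \<open>(u + v)\<^sup>k \<ge> u\<^sup>k + v\<^sup>k\<close>, finiteness of the \<open>k\<close>-th moment of \<open>Z\<close>
  forces \<open>E (exp (k * \<Lambda> C)) \<le> 2\<^sup>k / 2\<close>. For \<open>k \<rightarrow> \<infinity>\<close> this gives \<open>\<Lambda> B \<le> \<lambda> B\<close>, so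
  \<open>\<lambda> B - \<Lambda> B\<close> is a positive infinitely divisible variable; therefore there is no Gaussian part and
  there are no positive jumps, the negative jumps have finite variation, and the drift \<open>\<gamma>\<close> is at most
  one.\<close>

section \<open>Integrals over ordered points\<close>

text \<open>The law of \<Lambda> is given by its characteristic function at real arguments only.
  Exponential moments therefore come from weak approximation by laws on a half-line, where the
  exponential is bounded, and the Levy measure is recovered from second differences of the exponent,
  which remove drift and centring.

  The weights \<alpha> are second differences of log E exp (k \<Lambda>) per unit area. The cones
  containing a given point of the half-plane have consecutive ranks, so the exponent of each atom is
  a sum over pairs and only pairwise overlaps remain.

  Merely bounding every gap by one would lose the volume 1 / n! of the simplex, which matters at the
  order n ln n. Factors exp (- \<theta> s) on the gaps, with \<theta> of order n, recover it. For
  \<gamma> = 1 the integrals still converge at zero because the first weight is strictly below one.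

  The lower bound for the truncated masses survives the limit since the next higher moments are
  bounded uniformly in the truncation. In the converse direction no such bound is at hand, so powers
  are capped before passing to the limit.\<close>

locale gap_weights =
  fixes al :: "nat \<Rightarrow> real"
  assumes al_nonneg: "\<And>k. 0 \<le> al k"
    and al_sum_le: "\<And>n. (\<Sum>k=1..n. al k) \<le> 1"
    and al_1: "al 1 < 1"
begin

definition pair_sum :: "nat \<Rightarrow> nat \<Rightarrow> real" where
  "pair_sum a b = (\<Sum>i\<in>{a..b}. \<Sum>j\<in>{i<..b}. al (j - i))"

definition cross_sum :: "nat \<Rightarrow> nat \<Rightarrow> nat \<Rightarrow> real" where
  "cross_sum a l b = (\<Sum>i\<in>{a..l}. \<Sum>j\<in>{l<..b}. al (j - i))"

text \<open>Degree of homogeneity of the integral of \<open>gap_prod a b\<close> over gaps up to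
  \<open>r\<close>: each of the \<open>b - a\<close> gaps contributes one, and
  \<open>gap_prod\<close> has degree \<open>- pair_sum a b\<close>.\<close>

definition excess :: "nat \<Rightarrow> nat \<Rightarrow> real" where
  "excess a b = real (b - a) - pair_sum a b"

text \<open>\<open>s l\<close> is the gap between the points \<open>l\<close> and
  \<open>l + 1\<close>, so the inner sum is the distance of the points \<open>i\<close> and
  \<open>j\<close>. A joint moment takes this form when the overlap of two cones is replaced by
  minus the logarithm of the distance.\<close>

definition gap_prod :: "nat \<Rightarrow> nat \<Rightarrow> (nat \<Rightarrow> real) \<Rightarrow> real" where
  "gap_prod a b s = (\<Prod>i\<in>{a..b}. \<Prod>j\<in>{i<..b}. (\<Sum>l\<in>{i..<j}. s l) powr - al (j - i))"

lemma split_interval: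
  fixes a l b :: nat
  assumes "a \<le> l" "l < b"
  shows "{a..b} = {a..l} \<union> {Suc l..b}" "{a..l} \<inter> {Suc l..b} = {}"
    "i \<in> {a..l} \<Longrightarrow> {i<..b} = {i<..l} \<union> {l<..b}" "{i<..l} \<inter> {l<..b} = {}"
  using assms by auto

lemma pair_sum_split:
  assumes "a \<le> l" "l < b"
  shows "pair_sum a b = pair_sum a l + pair_sum (Suc l) b + cross_sum a l b"
proof -
  have "pair_sum a b = (\<Sum>i\<in>{a..l}. \<Sum>j\<in>{i<..b}. al (j - i)) + pair_sum (Suc l) b"
    unfolding pair_sum_def split_interval(1)[OF assms]
    by (rule sum.union_disjoint) (use split_interval(2)[OF assms] in auto)
  also have "(\<Sum>i\<in>{a..l}. \<Sum>j\<in>{i<..b}. al (j - i)) =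
      (\<Sum>i\<in>{a..l}. (\<Sum>j\<in>{i<..l}. al (j - i)) + (\<Sum>j\<in>{l<..b}. al (j - i)))"
    by (intro sum.cong refl, subst split_interval(3)[OF assms], assumption, rule sum.union_disjoint) auto
  finally show ?thesis
    by (simp add: sum.distrib pair_sum_def cross_sum_def)
qed

lemma cross_sum_nonneg: "0 \<le> cross_sum a l b"
  unfolding cross_sum_def by (intro sum_nonneg al_nonneg)

lemma pair_sum_Suc:
  assumes "a \<le> b"
  shows "pair_sum a (Suc b) = pair_sum a b + (\<Sum>k=1..Suc b - a. al k)"
proof -
  have "pair_sum (Suc b) (Suc b) = 0"
    by (simp add: pair_sum_def)
  moreover have "cross_sum a b (Suc b) = (\<Sum>k=1..Suc b - a. al k)"
  proof -
    have "{b<..Suc b} = {Suc b}" by auto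
    then have "cross_sum a b (Suc b) = (\<Sum>i\<in>{a..b}. al (Suc b - i))"
      by (simp add: cross_sum_def)
    also have "\<dots> = (\<Sum>k=1..Suc b - a. al k)"
      by (rule sum.reindex_bij_witness[of _ "\<lambda>k. Suc b - k" "\<lambda>i. Suc b - i"]) (use assms in auto)
    finally show ?thesis .
  qed
  ultimately show ?thesis
    using pair_sum_split[of a b "Suc b"] assms by simp
qed

lemma pair_sum_self [simp]: "pair_sum a a = 0"
  by (simp add: pair_sum_def)

lemma excess_self [simp]: "excess a a = 0"
  by (simp add: excess_def)

text \<open>A new last point brings one more integration and, by \<open>al_sum_le\<close>, weights
  of total at most one. So the excess equals \<open>1 - al 1\<close> for two points and never
  decreases. This positive bound, independent of the number of points, makes the gap integrals
  converge at zero with a uniform constant.\<close>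

lemma excess_ge:
  assumes "a < b"
  shows "1 - al 1 \<le> excess a b"
proof -
  from assms have "Suc a \<le> b" by simp
  then show ?thesis
proof (induction b rule: dec_induct)
  case base
  then show ?case
    using pair_sum_Suc[of a a] by (simp add: excess_def)
next
  case (step n)
  then show ?case
    using pair_sum_Suc[of a n] al_sum_le[of "Suc n - a"] by (simp add: excess_def of_nat_diff)
qed
qed

lemma excess_split:
  assumes "a \<le> l" "l < b"
  shows "excess a b = excess a l + excess (Suc l) b + 1 - cross_sum a l b"
  using assms pair_sum_split[OF assms] by (simp add: excess_def of_nat_diff)

lemma gap_prod_nonneg: "0 \<le> gap_prod a b s"
  unfolding gap_prod_def by (intro prod_nonneg) auto

lemma gap_prod_cong:
  assumes "\<And>l. l \<in> {a..<b} \<Longrightarrow> s l = s' l"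
  shows "gap_prod a b s = gap_prod a b s'"
  unfolding gap_prod_def
  using assms by (intro prod.cong refl arg_cong2[of _ _ _ _ "(powr)"] sum.cong) auto

lemma gap_prod_measurable [measurable]:
  assumes "{a..<b} \<subseteq> I"
  shows "gap_prod a b \<in> borel_measurable (PiM I (\<lambda>_. lborel))"
proof -
  have [measurable]: "(\<lambda>s. s l) \<in> borel_measurable (PiM I (\<lambda>_. lborel))" if "l \<in> {a..<b}" for l
    using measurable_component_singleton[of l I "\<lambda>_. lborel"] that assms by auto
  show ?thesis
    unfolding gap_prod_def[abs_def]
  proof (intro borel_measurable_prod)
    fix i j assume "i \<in> {a..b}" "j \<in> {i<..b}"
    then have "(\<lambda>s. \<Sum>l\<in>{i..<j}. s l) \<in> borel_measurable (PiM I (\<lambda>_. lborel))"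
      by (intro borel_measurable_sum) auto
    then show "(\<lambda>s. (\<Sum>l\<in>{i..<j}. s l) powr - al (j - i)) \<in> borel_measurable (PiM I (\<lambda>_. lborel))"
      by measurable
  qed
qed

text \<open>Two points on different sides of gap \<open>l\<close> are at least \<open>s l\<close>
  apart, and all exponents are nonpositive.\<close>

lemma gap_prod_split:
  assumes "a \<le> l" "l < b" and pos: "\<And>k. k \<in> {a..<b} \<Longrightarrow> 0 < s k"
  shows "gap_prod a b s \<le> gap_prod a l s * gap_prod (Suc l) b s * s l powr - cross_sum a l b"
proof -
  let ?f = "\<lambda>i j. (\<Sum>l\<in>{i..<j}. s l) powr - al (j - i)"
  have "gap_prod a b s = (\<Prod>i\<in>{a..l}. \<Prod>j\<in>{i<..b}. ?f i j) * gap_prod (Suc l) b s"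
    unfolding gap_prod_def split_interval(1)[OF assms(1,2)]
    by (rule prod.union_disjoint) (use split_interval(2)[OF assms(1,2)] in auto)
  also have "(\<Prod>i\<in>{a..l}. \<Prod>j\<in>{i<..b}. ?f i j) =
      (\<Prod>i\<in>{a..l}. (\<Prod>j\<in>{i<..l}. ?f i j) * (\<Prod>j\<in>{l<..b}. ?f i j))"
    by (intro prod.cong refl, subst split_interval(3)[OF assms(1,2)], assumption, rule prod.union_disjoint) auto
  also have "\<dots> = gap_prod a l s * (\<Prod>i\<in>{a..l}. \<Prod>j\<in>{l<..b}. ?f i j)"
    by (simp add: prod.distrib gap_prod_def)
  also have "gap_prod a l s * (\<Prod>i\<in>{a..l}. \<Prod>j\<in>{l<..b}. ?f i j) * gap_prod (Suc l) b s \<le>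
      gap_prod a l s * (\<Prod>i\<in>{a..l}. \<Prod>j\<in>{l<..b}. s l powr - al (j - i)) * gap_prod (Suc l) b s"
  proof (intro mult_right_mono mult_left_mono prod_mono conjI prod_nonneg gap_prod_nonneg)
    fix i j assume ij: "i \<in> {a..l}" "j \<in> {l<..b}"
    have "s l \<le> (\<Sum>l\<in>{i..<j}. s l)"
      by (rule member_le_sum) (use ij pos in \<open>auto intro: less_imp_le\<close>)
    then show "?f i j \<le> s l powr - al (j - i)"
      using pos[of l] assms al_nonneg[of "j - i"] by (intro powr_mono2') auto
  qed auto
  also have "(\<Prod>i\<in>{a..l}. \<Prod>j\<in>{l<..b}. s l powr - al (j - i)) = s l powr - cross_sum a l b"
  proof -
    have "0 < s l" by (rule pos) (use assms in auto)
    then have "s l \<noteq> 0" by simp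
    then show ?thesis by (simp add: cross_sum_def sum_negf[symmetric] powr_sum del: sum_negf)
  qed
  finally show ?thesis
    by (simp add: mult_ac)
qed

text \<open>The cutoff \<open>r\<close> records the largest gap of a surrounding configuration. The
  exponential stands in for the constraint that all gaps add up to at most one; unlike the
  constraint it factorises over the gaps.\<close>

definition gap_weight :: "real \<Rightarrow> real \<Rightarrow> real \<Rightarrow> real" where
  "gap_weight \<theta> r x = exp (- (\<theta> * x)) * indicator {0<..r} x"

lemma gap_weight_nonneg: "0 \<le> gap_weight \<theta> r x"
  by (simp add: gap_weight_def)

lemma gap_weight_measurable [measurable]: "gap_weight \<theta> r \<in> borel_measurable borel"
  unfolding gap_weight_def[abs_def] by measurable

definition gap_integral :: "real \<Rightarrow> nat \<Rightarrow> nat \<Rightarrow> real \<Rightarrow> ennreal" where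
  "gap_integral \<theta> a b r =
    (\<integral>\<^sup>+s. ennreal (gap_prod a b s * (\<Prod>l\<in>{a..<b}. gap_weight \<theta> r (s l))) \<partial>PiM {a..<b} (\<lambda>_. lborel))"

lemma gap_integrand_measurable [measurable]:
  assumes "{a..<b} \<subseteq> I"
  shows "(\<lambda>s. gap_prod a b s * (\<Prod>l\<in>{a..<b}. gap_weight \<theta> r (s l))) \<in> borel_measurable (PiM I (\<lambda>_. lborel))"
proof -
  have [measurable]: "(\<lambda>s. s l) \<in> borel_measurable (PiM I (\<lambda>_. lborel))" if "l \<in> {a..<b}" for l
    using measurable_component_singleton[of l I "\<lambda>_. lborel"] that assms by auto
  show ?thesis
    by (intro borel_measurable_times borel_measurable_prod gap_prod_measurable assms)
      (measurable)
qed

lemma gap_integral_self [simp]: "gap_integral \<theta> a a r = 1"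
proof -
  interpret product_sigma_finite "\<lambda>_::nat. lborel :: real measure" by standard
  show ?thesis
    by (simp add: gap_integral_def gap_prod_def PiM_empty nn_integral_count_space_finite)
qed

text \<open>Whichever gap \<open>l\<close> is the largest one, the points before it and the points after it only
  interact through distances that are at least that gap.\<close>

lemma gap_integral_le_sum:
  assumes "a < b"
  shows "gap_integral \<theta> a b r \<le> (\<Sum>l\<in>{a..<b}. \<integral>\<^sup>+t. ennreal (gap_weight \<theta> r t * t powr - cross_sum a l b) *
    (gap_integral \<theta> a l t * gap_integral \<theta> (Suc l) b t) \<partial>lborel)"
proof -
  interpret product_sigma_finite "\<lambda>_::nat. lborel :: real measure" by standard
  let ?M = "\<lambda>I. PiM I (\<lambda>_::nat. lborel :: real measure)"
  let ?F = "\<lambda>s. gap_prod a b s * (\<Prod>l\<in>{a..<b}. gap_weight \<theta> r (s l))"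
  \<comment> \<open>The indicators keep the configurations in which gap \<open>l\<close> is a
    largest one. Ties are counted several times, which is harmless for an upper bound.\<close>
  let ?G = "\<lambda>l s. ?F s * (\<Prod>k\<in>{a..<b}. indicator {..0} (s k - s l))"
  have comp [measurable]: "(\<lambda>s. s l) \<in> borel_measurable (?M I)" if "l \<in> I" for l I
    using measurable_component_singleton[of l I "\<lambda>_. lborel"] that by auto
  have F_nonneg: "0 \<le> ?F s" for s
    by (intro mult_nonneg_nonneg gap_prod_nonneg prod_nonneg gap_weight_nonneg ballI)
  have Gmeas [measurable]: "?G l \<in> borel_measurable (?M {a..<b})" if "l \<in> {a..<b}" for l
  proof -
    have [measurable]: "(\<lambda>s. s l) \<in> borel_measurable (?M {a..<b})" using that by (rule comp)
    have "(\<lambda>s. \<Prod>k\<in>{a..<b}. indicator {..0} (s k - s l)::real) \<in> borel_measurable (?M {a..<b})"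
    proof (rule borel_measurable_prod)
      fix k assume "k \<in> {a..<b}"
      then have [measurable]: "(\<lambda>s. s k) \<in> borel_measurable (?M {a..<b})" by (rule comp)
      show "(\<lambda>s. indicator {..0} (s k - s l)::real) \<in> borel_measurable (?M {a..<b})"
        by measurable
    qed
    then show ?thesis
      by (intro borel_measurable_times gap_integrand_measurable) auto
  qed
  have "?F s \<le> (\<Sum>l\<in>{a..<b}. ?G l s)" for s
  proof -
    obtain l where l: "l \<in> {a..<b}" "\<And>k. k \<in> {a..<b} \<Longrightarrow> s k \<le> s l"
    proof -
      have "Max (s ` {a..<b}) \<in> s ` {a..<b}" using assms by (intro Max_in) auto
      then obtain l where "l \<in> {a..<b}" "s l = Max (s ` {a..<b})" by auto
      then show ?thesis using that[of l] by auto
    qed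
    then have "?F s = ?G l s"
      by (simp add: prod.neutral)
    also have "\<dots> \<le> (\<Sum>l\<in>{a..<b}. ?G l s)"
      using l(1) by (intro member_le_sum) (auto intro!: mult_nonneg_nonneg prod_nonneg gap_prod_nonneg gap_weight_nonneg)
    finally show ?thesis .
  qed
  then have "gap_integral \<theta> a b r \<le> (\<integral>\<^sup>+s. (\<Sum>l\<in>{a..<b}. ennreal (?G l s)) \<partial>?M {a..<b})"
    unfolding gap_integral_def
    by (intro nn_integral_mono, subst sum_ennreal)
      (auto intro!: mult_nonneg_nonneg prod_nonneg gap_prod_nonneg gap_weight_nonneg ennreal_leI)
  also have "\<dots> = (\<Sum>l\<in>{a..<b}. \<integral>\<^sup>+s. ennreal (?G l s) \<partial>?M {a..<b})"
    by (rule nn_integral_sum) (intro measurable_compose[OF Gmeas measurable_ennreal])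
  also have "\<dots> \<le> (\<Sum>l\<in>{a..<b}. \<integral>\<^sup>+t. ennreal (gap_weight \<theta> r t * t powr - cross_sum a l b) *
    (gap_integral \<theta> a l t * gap_integral \<theta> (Suc l) b t) \<partial>lborel)"
  proof (rule sum_mono)
    fix l assume l: "l \<in> {a..<b}"
    let ?I = "{a..<l}" and ?J = "{Suc l..<b}"
    let ?A = "\<lambda>t x. gap_prod a l x * (\<Prod>l\<in>{a..<l}. gap_weight \<theta> t (x l))"
    let ?B = "\<lambda>t x. gap_prod (Suc l) b x * (\<Prod>l\<in>{Suc l..<b}. gap_weight \<theta> t (x l))"
    have eq: "{a..<b} = insert l (?I \<union> ?J)" and disj: "l \<notin> ?I \<union> ?J" "?I \<inter> ?J = {}"
      using l by auto
    have meas: "(\<lambda>s. ennreal (?G l s)) \<in> borel_measurable (?M (insert l (?I \<union> ?J)))"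
      using Gmeas[OF l] unfolding eq by measurable
    have "(\<integral>\<^sup>+s. ennreal (?G l s) \<partial>?M {a..<b}) =
        (\<integral>\<^sup>+t. \<integral>\<^sup>+s. ennreal (?G l (s(l := t))) \<partial>?M (?I \<union> ?J) \<partial>lborel)"
      unfolding eq by (rule product_nn_integral_insert_rev[OF _ disj(1) meas[unfolded eq]]) auto
    also have "\<dots> \<le> (\<integral>\<^sup>+t. ennreal (gap_weight \<theta> r t * t powr - cross_sum a l b) *
      (gap_integral \<theta> a l t * gap_integral \<theta> (Suc l) b t) \<partial>lborel)"
    proof (rule nn_integral_mono)
      fix t :: real
      let ?w = "gap_weight \<theta> r t * t powr - cross_sum a l b"
      have meas': "(\<lambda>s. ennreal (?G l (s(l := t)))) \<in> borel_measurable (?M (?I \<union> ?J))"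
        by (rule measurable_compose[OF _ meas], rule measurable_fun_upd[where J="?I \<union> ?J"])
          (use disj in auto)
      have "(\<integral>\<^sup>+s. ennreal (?G l (s(l := t))) \<partial>?M (?I \<union> ?J)) =
         (\<integral>\<^sup>+x. \<integral>\<^sup>+y. ennreal (?G l ((merge ?I ?J (x, y))(l := t))) \<partial>?M ?J \<partial>?M ?I)"
        by (rule product_nn_integral_fold[OF disj(2) _ _ meas']) auto
      also have "\<dots> \<le> (\<integral>\<^sup>+x. \<integral>\<^sup>+y. ennreal ?w * (ennreal (?A t x) * ennreal (?B t y)) \<partial>?M ?J \<partial>?M ?I)"
      proof (intro nn_integral_mono)
        fix x y
        define s where "s = (merge ?I ?J (x, y))(l := t)"
        have sx: "s k = x k" if "k \<in> ?I" for k using that l by (auto simp: merge_def s_def)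
        have sy: "s k = y k" if "k \<in> ?J" for k using that l by (auto simp: merge_def s_def)
        have sl: "s l = t" by (simp add: s_def)
        have A: "?A t x \<ge> 0" and B: "?B t y \<ge> 0" and w: "?w \<ge> 0"
          by (intro mult_nonneg_nonneg gap_prod_nonneg prod_nonneg ballI gap_weight_nonneg powr_ge_zero)+
        have "?G l s \<le> ?w * (?A t x * ?B t y)"
        \<comment> \<open>As no gap exceeds \<open>t\<close>, the cutoff \<open>r\<close> of the
          other gaps may be lowered to \<open>t\<close>; this produces the integrals of the two
          sides with cutoff \<open>t\<close>.\<close>
        proof (cases "\<forall>k\<in>{a..<b}. 0 < s k \<and> s k \<le> r \<and> s k \<le> t")
          case True
          have wI: "gap_weight \<theta> r (s k) = gap_weight \<theta> t (x k)" if "k \<in> ?I" for k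
          proof -
            have "k \<in> {a..<b}" using that l by auto
            from bspec[OF True this] show ?thesis
              unfolding sx[OF that] by (simp add: gap_weight_def)
          qed
          have wJ: "gap_weight \<theta> r (s k) = gap_weight \<theta> t (y k)" if "k \<in> ?J" for k
          proof -
            have "k \<in> {a..<b}" using that l by auto
            from bspec[OF True this] show ?thesis
              unfolding sy[OF that] by (simp add: gap_weight_def)
          qed
          have "(\<Prod>k\<in>{a..<b}. gap_weight \<theta> r (s k)) =
              gap_weight \<theta> r t * ((\<Prod>k\<in>?I. gap_weight \<theta> r (s k)) * (\<Prod>k\<in>?J. gap_weight \<theta> r (s k)))"
            unfolding eq using disj sl by (subst prod.insert) (auto simp: prod.union_disjoint)
          also have "(\<Prod>k\<in>?I. gap_weight \<theta> r (s k)) = (\<Prod>k\<in>?I. gap_weight \<theta> t (x k))"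
            by (rule prod.cong[OF refl wI])
          also have "(\<Prod>k\<in>?J. gap_weight \<theta> r (s k)) = (\<Prod>k\<in>?J. gap_weight \<theta> t (y k))"
            by (rule prod.cong[OF refl wJ])
          finally have *: "(\<Prod>k\<in>{a..<b}. gap_weight \<theta> r (s k)) =
              gap_weight \<theta> r t * ((\<Prod>k\<in>?I. gap_weight \<theta> t (x k)) * (\<Prod>k\<in>?J. gap_weight \<theta> t (y k)))" .
          have "?G l s \<le> ?F s"
            by (rule mult_left_le[OF _ F_nonneg]) (auto intro!: prod_le_1 simp: indicator_def)
          also have "\<dots> \<le> (gap_prod a l s * gap_prod (Suc l) b s * s l powr - cross_sum a l b) *
              (\<Prod>k\<in>{a..<b}. gap_weight \<theta> r (s k))"
            by (rule mult_right_mono[OF gap_prod_split])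
              (use l True in \<open>auto intro!: prod_nonneg gap_weight_nonneg\<close>)
          also have "gap_prod a l s = gap_prod a l x" by (rule gap_prod_cong) (rule sx)
          also have "gap_prod (Suc l) b s = gap_prod (Suc l) b y" by (rule gap_prod_cong) (rule sy)
          finally show ?thesis
            unfolding * sl by (simp add: mult_ac)
        next
          case False
          then obtain k where k: "k \<in> {a..<b}" "\<not> (0 < s k \<and> s k \<le> r \<and> s k \<le> t)" by auto
          have "?G l s = 0"
          proof (cases "s k \<le> t")
            case True
            then have "gap_weight \<theta> r (s k) = 0" using k by (auto simp: gap_weight_def)
            then have "(\<Prod>k\<in>{a..<b}. gap_weight \<theta> r (s k)) = 0" using k(1) by (intro prod_zero) auto
            then show ?thesis by simp
          next
            case False
            then have "(\<Prod>k\<in>{a..<b}. indicator {..0} (s k - s l) :: real) = 0"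
              using k(1) sl by (intro prod_zero) (auto simp: indicator_def)
            then show ?thesis by simp
          qed
          moreover have "0 \<le> ?w * (?A t x * ?B t y)"
            using A B w by (intro mult_nonneg_nonneg[of ?w] mult_nonneg_nonneg[of "?A t x"])
          ultimately show ?thesis by (simp only:)
        qed
        then show "ennreal (?G l ((merge ?I ?J (x, y))(l := t))) \<le> ennreal ?w * (ennreal (?A t x) * ennreal (?B t y))"
          unfolding s_def[symmetric] using A B w by (simp add: ennreal_mult[symmetric] ennreal_leI)
      qed
      also have "\<dots> = ennreal ?w * (gap_integral \<theta> a l t * gap_integral \<theta> (Suc l) b t)"
      proof -
        have [measurable]: "(\<lambda>x. ennreal (?A t x)) \<in> borel_measurable (?M ?I)"
          "(\<lambda>x. ennreal (?B t x)) \<in> borel_measurable (?M ?J)"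
          by (intro measurable_compose[OF gap_integrand_measurable measurable_ennreal] order_refl)+
        show ?thesis
          unfolding gap_integral_def
          by (simp add: nn_integral_cmult nn_integral_multc)
      qed
      finally show "(\<integral>\<^sup>+s. ennreal (?G l (s(l := t))) \<partial>?M (?I \<union> ?J)) \<le>
          ennreal ?w * (gap_integral \<theta> a l t * gap_integral \<theta> (Suc l) b t)" .
    qed
    finally show "(\<integral>\<^sup>+s. ennreal (?G l s) \<partial>?M {a..<b}) \<le>
      (\<integral>\<^sup>+t. ennreal (gap_weight \<theta> r t * t powr - cross_sum a l b) *
      (gap_integral \<theta> a l t * gap_integral \<theta> (Suc l) b t) \<partial>lborel)" .
  qed
  finally show ?thesis .
qed

section \<open>The one-dimensional integral over the largest gap, and the constants of the
  recursion\<close>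

lemma nn_integral_powr_Ioc:
  assumes "0 < e" "0 \<le> R"
  shows "(\<integral>\<^sup>+t. ennreal (t powr (e - 1) * indicator {0<..R} t) \<partial>lborel) = ennreal (R powr e / e)"
proof -
  have "((\<lambda>t. t powr (e - 1)) has_integral (R powr e / e)) {0..R}"
    using has_integral_powr_from_0[of "e - 1" R] assms by simp
  then have "((\<lambda>t. if t \<in> {0..R} then t powr (e - 1) else 0) has_integral (R powr e / e)) UNIV"
    by (subst has_integral_restrict_UNIV)
  also have "(\<lambda>t. if t \<in> {0..R} then t powr (e - 1) else 0) = (\<lambda>t. t powr (e - 1) * indicator {0<..R} t)"
    by (auto simp: fun_eq_iff indicator_def)
  finally show ?thesis
    by (intro nn_integral_has_integral_lborel) auto
qed

lemma nn_integral_exp_neg: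
  assumes "0 < \<theta>"
  shows "(\<integral>\<^sup>+t. ennreal (exp (- (\<theta> * t))) * indicator {0..} t \<partial>lborel) = ennreal (1 / \<theta>)"
proof -
  have "((\<lambda>t. - exp (- (\<theta> * t)) / \<theta>) \<longlongrightarrow> 0) at_top"
    using assms by real_asymp
  then have "(\<integral>\<^sup>+t. ennreal (exp (- (\<theta> * t))) * indicator {0..} t \<partial>lborel) = ennreal (0 - (- exp (- (\<theta> * 0)) / \<theta>))"
    using assms by (intro nn_integral_FTC_atLeast) (auto intro!: derivative_eq_intros)
  then show ?thesis by simp
qed

text \<open>One step of the recursion: \<open>x\<close> is the cross interaction, \<open>u\<close>
  the sum of the two smaller excesses and \<open>e\<close> the resulting excess. Up to
  \<open>1 / \<theta>\<close> the integrand is at most \<open>t powr (e - 1)\<close>. Beyond it the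
  powers are at most their values at \<open>1 / \<theta>\<close>, and the exponential integrates to
  at most \<open>1 / \<theta>\<close>. The lower bound \<open>c\<close> on \<open>e\<close> keeps
  the constant independent of the number of points.\<close>

lemma gap_weight_nn_integral_le:
  assumes "0 < \<theta>" "0 < r" "0 < c" "c \<le> e" "0 \<le> x" and u: "u = e - 1 + x"
  shows "(\<integral>\<^sup>+t. ennreal (gap_weight \<theta> r t * t powr - x * min t (1 / \<theta>) powr u) \<partial>lborel) \<le>
    ennreal ((1 / c + 1) * min r (1 / \<theta>) powr e)"
proof -
  let ?R = "min r (1 / \<theta>)"
  \<comment> \<open>The value of \<open>t powr - x * t powr u\<close> at
    \<open>t = 1 / \<theta>\<close>; the range beyond \<open>1 / \<theta>\<close> is present only if
    the cutoff exceeds it.\<close>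
  let ?k = "(if 1 / \<theta> < r then \<theta> powr (x - u) else 0) :: real"
  have "(\<integral>\<^sup>+t. ennreal (gap_weight \<theta> r t * t powr - x * min t (1 / \<theta>) powr u) \<partial>lborel) \<le>
     (\<integral>\<^sup>+t. ennreal (t powr (e - 1) * indicator {0<..?R} t) +
       ennreal ?k * (ennreal (exp (- (\<theta> * t))) * indicator {0..} t) \<partial>lborel)"
  proof (intro nn_integral_mono)
    fix t :: real
    consider "t \<le> 0 \<or> r < t" | "0 < t" "t \<le> ?R" | "1 / \<theta> < t" "t \<le> r" by fastforce
    then show "ennreal (gap_weight \<theta> r t * t powr - x * min t (1 / \<theta>) powr u) \<le>
      ennreal (t powr (e - 1) * indicator {0<..?R} t) + ennreal ?k * (ennreal (exp (- (\<theta> * t))) * indicator {0..} t)"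
    proof cases
      case 1
      then show ?thesis by (auto simp: gap_weight_def)
    next
      case 2
      then have "t powr - x * min t (1 / \<theta>) powr u = t powr (e - 1)"
        by (simp add: powr_add[symmetric] u)
      moreover have "exp (- (\<theta> * t)) \<le> 1" using 2 assms by simp
      ultimately have "gap_weight \<theta> r t * t powr - x * min t (1 / \<theta>) powr u \<le> t powr (e - 1)"
        using 2 by (simp add: gap_weight_def mult.assoc mult_left_le_one_le)
      then show ?thesis
        using 2 by (auto intro: add_increasing2 ennreal_leI)
    next
      case 3
      then have t: "0 < t" "1 / \<theta> < r" using assms by (auto intro: less_trans[of 0 "1 / \<theta>"])
      have "t powr - x \<le> (1 / \<theta>) powr - x"
        using 3 assms t by (intro powr_mono2') auto
      then have "t powr - x * min t (1 / \<theta>) powr u \<le> (1 / \<theta>) powr - x * (1 / \<theta>) powr u"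
        using 3 by (intro mult_mono) auto
      also have "\<dots> = ?k" using assms t by (simp add: powr_add[symmetric] powr_divide powr_minus_divide[symmetric])
      finally have "exp (- (\<theta> * t)) * (t powr - x * min t (1 / \<theta>) powr u) \<le> exp (- (\<theta> * t)) * ?k"
        by (intro mult_left_mono) auto
      then have "ennreal (gap_weight \<theta> r t * t powr - x * min t (1 / \<theta>) powr u) \<le>
          ennreal ?k * (ennreal (exp (- (\<theta> * t))) * indicator {0..} t)"
        using 3 t by (simp add: gap_weight_def ennreal_mult[symmetric] mult_ac ennreal_leI)
      then show ?thesis by (simp add: add_increasing)
    qed
  qed
  also have "\<dots> = ennreal (?R powr e / e) + ennreal ?k * ennreal (1 / \<theta>)"
    using assms by (subst nn_integral_add) (auto simp: nn_integral_cmult nn_integral_powr_Ioc nn_integral_exp_neg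
        simp del: minus_mult_left[symmetric])
  also have "\<dots> = ennreal (?R powr e / e + ?k / \<theta>)"
    using assms by (simp add: ennreal_mult[symmetric])
  also have "\<dots> \<le> ennreal ((1 / c + 1) * ?R powr e)"
  proof (rule ennreal_leI)
    have "?R powr e / e \<le> ?R powr e * (1 / c)"
      using assms by (simp add: frac_le divide_inverse mult_left_mono le_imp_inverse_le)
    moreover have "?k / \<theta> \<le> ?R powr e"
    proof (cases "1 / \<theta> < r")
      case True
      have "\<theta> powr (x - u) / \<theta> = \<theta> powr (x - u - 1)"
        using \<open>0 < \<theta>\<close> by (simp add: powr_diff)
      also have "\<dots> = \<theta> powr - e"
        by (simp add: u)
      also have "\<dots> = (1 / \<theta>) powr e"
        using assms unfolding powr_minus_divide by (simp add: powr_divide)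
      finally show ?thesis using True by (simp add: min_def)
    qed simp
    ultimately show "?R powr e / e + ?k / \<theta> \<le> (1 / c + 1) * ?R powr e"
      by (simp add: algebra_simps)
  qed
  finally show ?thesis .
qed

lemma sum_inverse_squares_le: "(\<Sum>l=1..n. 1 / (real l)\<^sup>2) \<le> 2"
proof (cases n)
  case (Suc m)
  have "(\<Sum>l=1..Suc m. 1 / (real l)\<^sup>2) \<le> 2 - 1 / real (Suc m)"
  proof (induction m)
    case (Suc m)
    have "1 / (real (Suc (Suc m)))\<^sup>2 \<le> 1 / (real (Suc m) * real (Suc (Suc m)))"
      by (intro divide_left_mono) (auto simp: power2_eq_square)
    also have "\<dots> = 1 / real (Suc m) - 1 / real (Suc (Suc m))"
      by (simp add: field_simps)
    finally show ?case using Suc by simp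
  qed simp
  moreover have "0 \<le> 1 / real (Suc m)" by simp
  ultimately show ?thesis unfolding Suc by linarith
qed simp

text \<open>For X = l + 1 and Y = n - l, whose sum is n + 1, the inequality (X + Y)^2 \<le> 2 (X^2 +
  Y^2) bounds each product by 2 / (n + 1)^2 times the sum of its two factors. The two resulting sums
  are at most 2 each, hence the 8.\<close>

lemma inverse_square_convolution_le:
  "(\<Sum>l<n. (1 / (real (l + 1))\<^sup>2) * (1 / (real (n - l))\<^sup>2)) \<le> 8 / (real (n + 1))\<^sup>2"
proof -
  have "(1 / (real (l + 1))\<^sup>2) * (1 / (real (n - l))\<^sup>2) \<le>
      2 / (real (n + 1))\<^sup>2 * (1 / (real (l + 1))\<^sup>2 + 1 / (real (n - l))\<^sup>2)" if "l < n" for l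
  proof -
    define x y where "x = real (l + 1)" and "y = real (n - l)"
    have xy: "0 < x" "0 < y" "real (n + 1) = x + y" using that by (auto simp: x_def y_def of_nat_diff)
    have "(x + y)\<^sup>2 \<le> 2 * (x\<^sup>2 + y\<^sup>2)"
      using sum_squares_bound[of x y] by (simp add: power2_sum)
    then have "(x + y)\<^sup>2 / (x\<^sup>2 * y\<^sup>2 * (x + y)\<^sup>2) \<le> 2 * (x\<^sup>2 + y\<^sup>2) / (x\<^sup>2 * y\<^sup>2 * (x + y)\<^sup>2)"
      by (intro divide_right_mono) auto
    then show ?thesis
      unfolding xy(3) x_def[symmetric] y_def[symmetric] using xy(1,2) by (simp add: field_simps)
  qed
  then have "(\<Sum>l<n. (1 / (real (l + 1))\<^sup>2) * (1 / (real (n - l))\<^sup>2)) \<le>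
      (\<Sum>l<n. 2 / (real (n + 1))\<^sup>2 * (1 / (real (l + 1))\<^sup>2 + 1 / (real (n - l))\<^sup>2))"
    by (intro sum_mono) auto
  also have "\<dots> = 2 / (real (n + 1))\<^sup>2 * ((\<Sum>l<n. 1 / (real (l + 1))\<^sup>2) + (\<Sum>l<n. 1 / (real (n - l))\<^sup>2))"
    by (simp only: sum_distrib_left[symmetric] sum.distrib)
  also have "(\<Sum>l<n. 1 / (real (l + 1))\<^sup>2) = (\<Sum>l=1..n. 1 / (real l)\<^sup>2)"
    by (rule sum.reindex_bij_witness[of _ "\<lambda>l. l - 1" "\<lambda>l. l + 1"]) auto
  also have "(\<Sum>l<n. 1 / (real (n - l))\<^sup>2) = (\<Sum>l=1..n. 1 / (real l)\<^sup>2)"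
    by (rule sum.reindex_bij_witness[of _ "\<lambda>l. n - l" "\<lambda>l. n - l"]) auto
  also have "2 / (real (n + 1))\<^sup>2 * ((\<Sum>l=1..n. 1 / (real l)\<^sup>2) + (\<Sum>l=1..n. 1 / (real l)\<^sup>2)) \<le>
      2 / (real (n + 1))\<^sup>2 * (2 + 2)"
    by (intro mult_left_mono add_mono sum_inverse_squares_le) auto
  finally show ?thesis by simp
qed

text \<open>The 8 of \<open>inverse_square_convolution_le\<close> times the constant of
  \<open>gap_weight_nn_integral_le\<close> for \<open>c = 1 - al 1\<close>.\<close>

definition gap_base :: real where
  "gap_base = 8 * (1 / (1 - al 1) + 1)"

lemma gap_base_pos: "0 < gap_base"
  using al_1 by (simp add: gap_base_def add_pos_pos)

text \<open>The weights \<open>1 / (n + 1)\<^sup>2\<close> reproduce themselves under convolution, which solves the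
  Catalan-type recursion coming from the largest gap.\<close>

theorem gap_integral_le:
  assumes "0 < \<theta>" "0 < r" "a \<le> b"
  shows "gap_integral \<theta> a b r \<le>
    ennreal (gap_base ^ (b - a) / (real (b - a + 1))\<^sup>2 * min r (1 / \<theta>) powr excess a b)"
  using assms(2,3)
proof (induction "b - a" arbitrary: a b r rule: less_induct)
  case less
  show ?case
  proof (cases "a = b")
    case True
    then show ?thesis using less.prems assms by (simp add: min_def)
  next
    case False
    with less.prems have ab: "a < b" by simp
    define n where "n = b - a"
    define C where "C = (\<lambda>n::nat. gap_base ^ n / (real (n + 1))\<^sup>2)"
    define K where "K = 1 / (1 - al 1) + 1"
    have C_nonneg: "0 \<le> C n" for n using gap_base_pos by (simp add: C_def)
    have "gap_integral \<theta> a b r \<le> (\<Sum>l\<in>{a..<b}. \<integral>\<^sup>+t. ennreal (gap_weight \<theta> r t * t powr - cross_sum a l b) *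
      (gap_integral \<theta> a l t * gap_integral \<theta> (Suc l) b t) \<partial>lborel)"
      by (rule gap_integral_le_sum[OF ab])
    also have "\<dots> \<le> (\<Sum>l\<in>{a..<b}. ennreal (C (l - a) * C (b - Suc l) * (K * min r (1 / \<theta>) powr excess a b)))"
    proof (rule sum_mono)
      fix l assume l: "l \<in> {a..<b}"
      let ?u = "excess a l + excess (Suc l) b"
      have "(\<integral>\<^sup>+t. ennreal (gap_weight \<theta> r t * t powr - cross_sum a l b) *
          (gap_integral \<theta> a l t * gap_integral \<theta> (Suc l) b t) \<partial>lborel) \<le>
        (\<integral>\<^sup>+t. ennreal (C (l - a) * C (b - Suc l)) *
          ennreal (gap_weight \<theta> r t * t powr - cross_sum a l b * min t (1 / \<theta>) powr ?u) \<partial>lborel)"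
      proof (rule nn_integral_mono)
        fix t :: real
        show "ennreal (gap_weight \<theta> r t * t powr - cross_sum a l b) *
          (gap_integral \<theta> a l t * gap_integral \<theta> (Suc l) b t) \<le>
          ennreal (C (l - a) * C (b - Suc l)) *
          ennreal (gap_weight \<theta> r t * t powr - cross_sum a l b * min t (1 / \<theta>) powr ?u)"
        proof (cases "0 < t")
          case True
          have 1: "gap_integral \<theta> a l t \<le> ennreal (C (l - a) * min t (1 / \<theta>) powr excess a l)"
            unfolding C_def using less.hyps[of l a t] l True by auto
          have 2: "gap_integral \<theta> (Suc l) b t \<le> ennreal (C (b - Suc l) * min t (1 / \<theta>) powr excess (Suc l) b)"
            unfolding C_def using less.hyps[of b "Suc l" t] l True by auto
          have "gap_integral \<theta> a l t * gap_integral \<theta> (Suc l) b t \<le>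
            ennreal (C (l - a) * min t (1 / \<theta>) powr excess a l) *
            ennreal (C (b - Suc l) * min t (1 / \<theta>) powr excess (Suc l) b)"
            by (intro mult_mono 1 2) auto
          also have "\<dots> = ennreal (C (l - a) * C (b - Suc l) * min t (1 / \<theta>) powr ?u)"
            using C_nonneg by (simp add: ennreal_mult[symmetric] powr_add mult_ac)
          finally have "ennreal (gap_weight \<theta> r t * t powr - cross_sum a l b) *
            (gap_integral \<theta> a l t * gap_integral \<theta> (Suc l) b t) \<le>
            ennreal (gap_weight \<theta> r t * t powr - cross_sum a l b) *
            ennreal (C (l - a) * C (b - Suc l) * min t (1 / \<theta>) powr ?u)"
            by (intro mult_left_mono) auto
          also have "\<dots> = ennreal (C (l - a) * C (b - Suc l)) *
            ennreal (gap_weight \<theta> r t * t powr - cross_sum a l b * min t (1 / \<theta>) powr ?u)"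
            using C_nonneg gap_weight_nonneg by (simp add: ennreal_mult[symmetric] mult_ac)
          finally show ?thesis .
        qed (simp add: gap_weight_def)
      qed
      also have "\<dots> = ennreal (C (l - a) * C (b - Suc l)) * (\<integral>\<^sup>+t.
          ennreal (gap_weight \<theta> r t * t powr - cross_sum a l b * min t (1 / \<theta>) powr ?u) \<partial>lborel)"
        by (rule nn_integral_cmult) measurable
      also have "\<dots> \<le> ennreal (C (l - a) * C (b - Suc l)) * ennreal (K * min r (1 / \<theta>) powr excess a b)"
        unfolding K_def
        by (intro mult_left_mono gap_weight_nn_integral_le)
          (use assms less.prems al_1 excess_ge[OF ab] cross_sum_nonneg excess_split[of a l b] l in auto)
      also have "\<dots> = ennreal (C (l - a) * C (b - Suc l) * (K * min r (1 / \<theta>) powr excess a b))"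
        using C_nonneg al_1 by (simp add: ennreal_mult K_def add_nonneg_nonneg)
      finally show "(\<integral>\<^sup>+t. ennreal (gap_weight \<theta> r t * t powr - cross_sum a l b) *
          (gap_integral \<theta> a l t * gap_integral \<theta> (Suc l) b t) \<partial>lborel) \<le>
        ennreal (C (l - a) * C (b - Suc l) * (K * min r (1 / \<theta>) powr excess a b))" .
    qed
    also have "\<dots> = ennreal ((\<Sum>l\<in>{a..<b}. C (l - a) * C (b - Suc l)) * (K * min r (1 / \<theta>) powr excess a b))"
      using C_nonneg al_1 by (subst sum_ennreal) (auto simp: K_def sum_distrib_right intro!: mult_nonneg_nonneg add_nonneg_nonneg)
    also have "\<dots> \<le> ennreal (C n * min r (1 / \<theta>) powr excess a b)"
    proof (rule ennreal_leI)
      have "(\<Sum>l\<in>{a..<b}. C (l - a) * C (b - Suc l)) = (\<Sum>l<n. C l * C (n - Suc l))"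
        by (rule sum.reindex_bij_witness[of _ "\<lambda>l. l + a" "\<lambda>l. l - a"]) (auto simp: n_def)
      \<comment> \<open>The exponents of the two sides add up to \<open>n - 1\<close>; the missing
        factor \<open>gap_base\<close> is made up of the 8 of the convolution and of
        \<open>K\<close>.\<close>
      also have "\<dots> = (\<Sum>l<n. gap_base ^ (n - 1) * ((1 / (real (l + 1))\<^sup>2) * (1 / (real (n - l))\<^sup>2)))"
      proof (rule sum.cong[OF refl])
        fix l assume "l \<in> {..<n}"
        then have 1: "n - 1 = l + (n - Suc l)" and 2: "n - Suc l + 1 = n - l" by auto
        show "C l * C (n - Suc l) = gap_base ^ (n - 1) * ((1 / (real (l + 1))\<^sup>2) * (1 / (real (n - l))\<^sup>2))"
          unfolding C_def 1 2 power_add by simp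
      qed
      also have "\<dots> \<le> gap_base ^ (n - 1) * (8 / (real (n + 1))\<^sup>2)"
        unfolding sum_distrib_left[symmetric]
        by (intro mult_left_mono inverse_square_convolution_le) (use gap_base_pos in auto)
      finally have "(\<Sum>l\<in>{a..<b}. C (l - a) * C (b - Suc l)) * K \<le> gap_base ^ (n - 1) * (8 / (real (n + 1))\<^sup>2) * K"
        using al_1 by (intro mult_right_mono) (auto simp: K_def)
      also have "\<dots> = gap_base ^ (n - 1) * gap_base / (real (n + 1))\<^sup>2"
        by (simp add: gap_base_def K_def)
      also have "\<dots> = C n"
        using ab by (cases n) (auto simp: C_def n_def)
      finally show "(\<Sum>l\<in>{a..<b}. C (l - a) * C (b - Suc l)) * (K * min r (1 / \<theta>) powr excess a b) \<le>
          C n * min r (1 / \<theta>) powr excess a b"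
        unfolding mult.assoc[symmetric] by (rule mult_right_mono) auto
    qed
    finally show ?thesis by (simp add: C_def n_def)
  qed
qed

end

section \<open>Independently scattered random measures\<close>

locale scattered =
  fixes M :: "'w measure" and \<psi> :: "real \<Rightarrow> complex" and L :: "'p measure"
    and \<Lambda> :: "'p set \<Rightarrow> 'w \<Rightarrow> real"
  assumes isrm: "indep_scattered_random_measure M \<psi> L \<Lambda>"

sublocale scattered \<subseteq> prob_space M
  using isrm by (simp add: indep_scattered_random_measure_def)

context scattered
begin

lemma Lam_measurable [measurable]: "B \<in> fmeasurable L \<Longrightarrow> \<Lambda> B \<in> borel_measurable M"
  using isrm by (simp add: indep_scattered_random_measure_def)

lemma char_Lam:
  assumes "B \<in> fmeasurable L"
  shows "char (distr M borel (\<Lambda> B)) q = exp (\<psi> q * of_real (measure L B))"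
  using isrm assms unfolding indep_scattered_random_measure_def char_def
  by (subst integral_distr) auto

lemma real_distribution_Lam: "B \<in> fmeasurable L \<Longrightarrow> real_distribution (distr M borel (\<Lambda> B))"
  by (intro real_distribution_distr Lam_measurable)

lemma distr_Lam_eq:
  assumes "A \<in> fmeasurable L" "B \<in> fmeasurable L" "measure L A = measure L B"
  shows "distr M borel (\<Lambda> A) = distr M borel (\<Lambda> B)"
  using assms by (intro Levy_uniqueness real_distribution_Lam) (auto simp: char_Lam)

lemma Lam_empty: "AE \<omega> in M. \<Lambda> {} \<omega> = 0"
proof -
  have "real_distribution (return borel (0::real))"
    by (simp add: real_distribution_def real_distribution_axioms_def prob_space_return)
  moreover have "char (return borel 0) = char (distr M borel (\<Lambda> {}))"
    unfolding char_def[of "return _ _"] by (auto simp: char_Lam integral_return)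
  ultimately have eq: "distr M borel (\<Lambda> {}) = return borel 0"
    by (intro Levy_uniqueness real_distribution_Lam) auto
  have "AE x in distr M borel (\<Lambda> {}). x = 0"
    unfolding eq by (simp add: AE_return)
  then show ?thesis
    by (subst (asm) AE_distr_iff) auto
qed

text \<open>Padding with empty sets turns the finite family into a sequence, and by
  \<open>Lam_empty\<close> the series of its values has only finitely many nonzero terms.\<close>

lemma finite_disjoint_family:
  fixes A :: "nat \<Rightarrow> 'p set"
  assumes "finite J" "\<And>j. j \<in> J \<Longrightarrow> A j \<in> fmeasurable L" "disjoint_family_on A J"
  shows indep_vars_Lam: "indep_vars (\<lambda>_. borel) (\<lambda>j. \<Lambda> (A j)) J"
    and Lam_UN: "AE \<omega> in M. \<Lambda> (\<Union>j\<in>J. A j) \<omega> = (\<Sum>j\<in>J. \<Lambda> (A j) \<omega>)"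
proof -
  define B where "B j = (if j \<in> J then A j else {})" for j
  have "disjoint_family B"
    using assms(3) by (auto simp: B_def disjoint_family_on_def)
  moreover have "range B \<subseteq> fmeasurable L"
    using assms(2) by (auto simp: B_def)
  moreover have U: "(\<Union>j. B j) = (\<Union>j\<in>J. A j)"
    by (auto simp: B_def split: if_splits)
  moreover have "(\<Union>j\<in>J. A j) \<in> fmeasurable L"
    using assms(1,2) by (intro fmeasurable.finite_UN) auto
  ultimately have iv: "indep_vars (\<lambda>_. borel) (\<lambda>j. \<Lambda> (B j)) UNIV"
    and sums: "AE \<omega> in M. (\<lambda>j. \<Lambda> (B j) \<omega>) sums \<Lambda> (\<Union>j\<in>J. A j) \<omega>"
    using isrm[unfolded indep_scattered_random_measure_def, THEN conjunct2, THEN conjunct2, rule_format, of B]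
    unfolding U by blast+
  have "indep_vars (\<lambda>_. borel) (\<lambda>j. \<Lambda> (B j)) J"
    by (rule indep_vars_subset[OF iv]) simp
  then show "indep_vars (\<lambda>_. borel) (\<lambda>j. \<Lambda> (A j)) J"
    by (rule indep_vars_cong[THEN iffD1, rotated 3]) (auto simp: B_def)
  show "AE \<omega> in M. \<Lambda> (\<Union>j\<in>J. A j) \<omega> = (\<Sum>j\<in>J. \<Lambda> (A j) \<omega>)"
    using sums Lam_empty
  proof eventually_elim
    case (elim \<omega>)
    have "(\<lambda>j. \<Lambda> (B j) \<omega>) sums (\<Sum>j\<in>J. \<Lambda> (B j) \<omega>)"
      using assms(1) elim(2) by (intro sums_finite) (auto simp: B_def)
    with elim(1) have "\<Lambda> (\<Union>j\<in>J. A j) \<omega> = (\<Sum>j\<in>J. \<Lambda> (B j) \<omega>)"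
      by (rule sums_unique2)
    also have "\<dots> = (\<Sum>j\<in>J. \<Lambda> (A j) \<omega>)"
      by (rule sum.cong) (auto simp: B_def)
    finally show ?case .
  qed
qed

lemma Lam_Un:
  assumes "A \<in> fmeasurable L" "B \<in> fmeasurable L" "A \<inter> B = {}"
  shows "AE \<omega> in M. \<Lambda> (A \<union> B) \<omega> = \<Lambda> A \<omega> + \<Lambda> B \<omega>"
proof -
  let ?A = "\<lambda>j::nat. if j = 0 then A else B"
  have eq: "(\<Union>j\<in>{0, 1}. ?A j) = A \<union> B" by auto
  have "AE \<omega> in M. \<Lambda> (\<Union>j\<in>{0, 1}. ?A j) \<omega> = (\<Sum>j\<in>{0, 1}. \<Lambda> (?A j) \<omega>)"
    using assms by (intro Lam_UN) (auto simp: disjoint_family_on_def)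
  then show ?thesis
    unfolding eq by simp
qed

end

subsection \<open>Atoms of a finite family\<close>

text \<open>The set bits of \<open>m\<close> are the indices of the sets containing the atom.\<close>

definition atom :: "(nat \<Rightarrow> 'p set) \<Rightarrow> nat \<Rightarrow> nat \<Rightarrow> 'p set" where
  "atom B n m = {z. \<forall>i<n. z \<in> B i \<longleftrightarrow> i \<in> set_decode m} \<inter> (\<Union>i<n. B i)"

lemma set_encode_less:
  assumes "A \<subseteq> {..<n}"
  shows "set_encode A < 2 ^ n"
proof -
  have "set_encode A \<le> (\<Sum>i<n. 2 ^ i)"
    unfolding set_encode_def by (intro sum_mono2 assms) auto
  also have "\<dots> < 2 ^ n"
    by (simp add: lessThan_atLeast0 sum_power2)
  finally show ?thesis .
qed

lemma disjoint_atoms: "disjoint_family_on (atom B n) {1..<2 ^ n}"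
proof -
  have "k = m" if "z \<in> atom B n k" "z \<in> atom B n m" "k < 2 ^ n" "m < 2 ^ n" for z k m
  proof -
    have bound: "set_decode m \<subseteq> {..<n}" if "m < 2 ^ n" for m
    proof
      fix i assume "i \<in> set_decode m"
      then have "2 ^ i \<le> m" by (auto simp: set_decode_def intro: ccontr)
      with that have "(2::nat) ^ i < 2 ^ n" by (rule le_less_trans[rotated])
      then show "i \<in> {..<n}" by simp
    qed
    have "i \<in> set_decode k \<longleftrightarrow> i \<in> set_decode m" if "i < n" for i
      using that \<open>z \<in> atom B n k\<close> \<open>z \<in> atom B n m\<close> by (auto simp: atom_def)
    then have "set_decode k = set_decode m"
      using bound[OF that(3)] bound[OF that(4)] by blast
    then show ?thesis by (metis set_decode_inverse)
  qed
  then show ?thesis by (auto simp: disjoint_family_on_def)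
qed

text \<open>Used with \<open>K = {i}\<close> for the values of \<Lambda> and with
  \<open>K = {i, j}\<close> for the areas of overlaps. Code 0 is left out of the index range because
  its atom is empty: it would have to avoid all sets and yet lie in their union.\<close>

lemma UN_atoms:
  assumes "K \<subseteq> {..<n}" "K \<noteq> {}"
  shows "(\<Union>m\<in>{m\<in>{1..<2 ^ n}. K \<subseteq> set_decode m}. atom B n m) = (\<Inter>i\<in>K. B i)"
proof (intro set_eqI iffI)
  fix z assume z: "z \<in> (\<Inter>i\<in>K. B i)"
  define A where "A = {i. i < n \<and> z \<in> B i}"
  define m where "m = set_encode A"
  have A: "A \<subseteq> {..<n}" "finite A" by (auto simp: A_def)
  have "K \<subseteq> A" using z assms by (auto simp: A_def)
  moreover have dm: "set_decode m = A"
    using A by (simp add: m_def set_encode_inverse)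
  moreover have "m < 2 ^ n" using set_encode_less[OF A(1)] by (simp add: m_def)
  moreover have "m \<noteq> 0"
    using dm \<open>K \<subseteq> A\<close> assms(2) by auto
  moreover have "z \<in> atom B n m"
    using dm \<open>K \<subseteq> A\<close> assms(2) by (auto simp: atom_def A_def)
  ultimately show "z \<in> (\<Union>m\<in>{m\<in>{1..<2 ^ n}. K \<subseteq> set_decode m}. atom B n m)"
    by (intro UN_I[of m]) auto
qed (use assms in \<open>auto simp: atom_def\<close>)

lemma atom_fmeasurable:
  assumes "\<And>i. i < n \<Longrightarrow> B i \<in> fmeasurable L"
  shows "atom B n m \<in> fmeasurable L"
proof (rule fmeasurableI2)
  show U: "(\<Union>i<n. B i) \<in> fmeasurable L"
    using assms by (intro fmeasurable.finite_UN) auto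
  have "B i \<in> sets L" if "i < n" for i using assms[OF that] by auto
  then have "(\<Union>i<n. B i) \<inter> (\<Inter>i\<in>{..<n}. if i \<in> set_decode m then B i else space L - B i) \<in> sets L" if "0 < n"
    using that U by (intro sets.Int sets.finite_INT) auto
  moreover have "atom B n m = (\<Union>i<n. B i) \<inter> (\<Inter>i\<in>{..<n}. if i \<in> set_decode m then B i else space L - B i)"
  proof (rule set_eqI)
    fix z
    let ?S = "\<lambda>i. if i \<in> set_decode m then B i else space L - B i"
    show "z \<in> atom B n m \<longleftrightarrow> z \<in> (\<Union>i<n. B i) \<inter> (\<Inter>i\<in>{..<n}. ?S i)"
    proof (cases "z \<in> (\<Union>i<n. B i)")
      case True
      with U have "z \<in> space L" using fmeasurableD sets.sets_into_space by blast
      then have "z \<in> ?S i \<longleftrightarrow> (z \<in> B i \<longleftrightarrow> i \<in> set_decode m)" for i by simp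
      then show ?thesis unfolding atom_def Int_iff INT_iff by simp blast
    qed (simp add: atom_def)
  qed
  ultimately show "atom B n m \<in> sets L"
    by (cases "0 < n") (auto simp: atom_def)
qed (auto simp: atom_def)

context scattered
begin

context
  fixes B :: "nat \<Rightarrow> 'p set" and n :: nat
  assumes B: "\<And>i. i < n \<Longrightarrow> B i \<in> fmeasurable L"
begin

lemma Lam_eq_sum_atoms:
  "AE \<omega> in M. \<forall>i<n. \<Lambda> (B i) \<omega> = (\<Sum>m\<in>{m\<in>{1..<2 ^ n}. i \<in> set_decode m}. \<Lambda> (atom B n m) \<omega>)"
proof -
  have "AE \<omega> in M. i < n \<longrightarrow> \<Lambda> (B i) \<omega> = (\<Sum>m\<in>{m\<in>{1..<2 ^ n}. i \<in> set_decode m}. \<Lambda> (atom B n m) \<omega>)" for i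
  proof (cases "i < n")
    case True
    have "AE \<omega> in M. \<Lambda> (\<Union>m\<in>{m\<in>{1..<2 ^ n}. {i} \<subseteq> set_decode m}. atom B n m) \<omega> =
        (\<Sum>m\<in>{m\<in>{1..<2 ^ n}. {i} \<subseteq> set_decode m}. \<Lambda> (atom B n m) \<omega>)"
      by (intro Lam_UN atom_fmeasurable B disjoint_family_on_mono[OF _ disjoint_atoms]) auto
    then show ?thesis using True by (subst (asm) UN_atoms) auto
  qed auto
  then show ?thesis by (subst AE_all_countable) auto
qed

lemma measure_Int_eq_sum_atoms:
  assumes "i < n" "j < n"
  shows "measure L (B i \<inter> B j) = (\<Sum>m\<in>{1..<2 ^ n}. if i \<in> set_decode m \<and> j \<in> set_decode m then measure L (atom B n m) else 0)"
proof -
  let ?J = "{m\<in>{1..<2 ^ n}. {i, j} \<subseteq> set_decode m}"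
  have "measure L (\<Union>m\<in>?J. atom B n m) = (\<Sum>m\<in>?J. measure L (atom B n m))"
    by (intro measure_finite_Union disjoint_family_on_mono[OF _ disjoint_atoms]) (auto intro!: fmeasurableD2 fmeasurableD atom_fmeasurable B)
  also have "(\<Union>m\<in>?J. atom B n m) = B i \<inter> B j"
    using assms by (subst UN_atoms) auto
  also have "(\<Sum>m\<in>?J. measure L (atom B n m)) =
      (\<Sum>m\<in>{1..<2 ^ n}. if {i, j} \<subseteq> set_decode m then measure L (atom B n m) else 0)"
    by (rule sum.inter_filter) simp
  finally show ?thesis by simp
qed

text \<open>In the sum the value on an atom is counted once for every set that contains the atom.
  Values on different atoms are independent, so the expectation factorises.\<close>

lemma nn_integral_exp_sum_Lam:
  fixes p :: "nat \<Rightarrow> real"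
  assumes moments: "\<And>A k. A \<in> fmeasurable L \<Longrightarrow> 0 < k \<Longrightarrow>
      (\<integral>\<^sup>+\<omega>. ennreal (exp (real k * \<Lambda> A \<omega>)) \<partial>M) = ennreal (exp (p k * measure L A))"
  shows "(\<integral>\<^sup>+\<omega>. ennreal (exp (\<Sum>i<n. \<Lambda> (B i) \<omega>)) \<partial>M) =
    ennreal (exp (\<Sum>m\<in>{1..<2 ^ n}. p (card {i\<in>{..<n}. i \<in> set_decode m}) * measure L (atom B n m)))"
proof -
  let ?J = "{1..<2 ^ n} :: nat set"
  let ?N = "\<lambda>m. card {i\<in>{..<n}. i \<in> set_decode m}"
  have N: "0 < ?N m" if ne: "atom B n m \<noteq> {}" for m
  proof -
    obtain z where "z \<in> atom B n m" using ne by auto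
    then obtain i where "i < n" "i \<in> set_decode m" by (auto simp: atom_def)
    then show ?thesis by (auto simp: card_gt_0_iff)
  qed
  have *: "(\<integral>\<^sup>+\<omega>. ennreal (exp (real (?N m) * \<Lambda> (atom B n m) \<omega>)) \<partial>M) = ennreal (exp (p (?N m) * measure L (atom B n m)))"
    if "m \<in> ?J" for m
  proof (cases "?N m = 0")
    \<comment> \<open>Nothing is known about \<open>p 0\<close>, but the atom is empty here, so its
      measure is zero and both sides equal one.\<close>
    case True
    have "atom B n m = {}" using N[of m] unfolding True by fast
    show ?thesis unfolding True \<open>atom B n m = {}\<close> by (simp add: emeasure_space_1)
  next
    case False
    then have "0 < ?N m" by (simp only: neq0_conv)
    then show ?thesis by (intro moments atom_fmeasurable B)
  qed
  have "indep_vars (\<lambda>_. borel) (\<lambda>m. \<Lambda> (atom B n m)) ?J"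
    by (intro indep_vars_Lam atom_fmeasurable B disjoint_atoms) auto
  then have iv: "indep_vars (\<lambda>_. borel) (\<lambda>m \<omega>. ennreal (exp (real (?N m) * \<Lambda> (atom B n m) \<omega>))) ?J"
    by (rule indep_vars_compose2) measurable
  have "(\<integral>\<^sup>+\<omega>. ennreal (exp (\<Sum>i<n. \<Lambda> (B i) \<omega>)) \<partial>M) =
      (\<integral>\<^sup>+\<omega>. (\<Prod>m\<in>?J. ennreal (exp (real (?N m) * \<Lambda> (atom B n m) \<omega>))) \<partial>M)"
  proof (intro nn_integral_cong_AE, use Lam_eq_sum_atoms in eventually_elim)
    case (elim \<omega>)
    have "(\<Sum>i<n. \<Lambda> (B i) \<omega>) = (\<Sum>i<n. \<Sum>m\<in>?J. if i \<in> set_decode m then \<Lambda> (atom B n m) \<omega> else 0)"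
      using elim by (intro sum.cong refl) (simp add: sum.inter_filter[symmetric] del: One_nat_def)
    also have "\<dots> = (\<Sum>m\<in>?J. \<Sum>i<n. if i \<in> set_decode m then \<Lambda> (atom B n m) \<omega> else 0)"
      by (rule sum.swap)
    also have "\<dots> = (\<Sum>m\<in>?J. real (?N m) * \<Lambda> (atom B n m) \<omega>)"
      by (simp add: sum.inter_filter[symmetric] del: One_nat_def)
    finally show ?case
      by (simp add: exp_sum prod_ennreal)
  qed
  also have "\<dots> = (\<Prod>m\<in>?J. \<integral>\<^sup>+\<omega>. ennreal (exp (real (?N m) * \<Lambda> (atom B n m) \<omega>)) \<partial>M)"
    by (rule indep_vars_nn_integral) (use iv in auto)
  also have "\<dots> = (\<Prod>m\<in>?J. ennreal (exp (p (?N m) * measure L (atom B n m))))"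
    by (intro prod.cong refl *)
  also have "\<dots> = ennreal (exp (\<Sum>m\<in>?J. p (?N m) * measure L (atom B n m)))"
    by (simp add: exp_sum prod_ennreal)
  finally show ?thesis .
qed

text \<open>When the exponent of every atom is a sum over the pairs of sets containing it,
  exchanging the sums collapses exponentially many atoms into pairs, and only the areas of pairwise
  intersections are left.\<close>

lemma nn_integral_exp_sum_Lam_pairs:
  fixes p :: "nat \<Rightarrow> real" and al :: "nat \<Rightarrow> real"
  assumes moments: "\<And>A k. A \<in> fmeasurable L \<Longrightarrow> 0 < k \<Longrightarrow>
      (\<integral>\<^sup>+\<omega>. ennreal (exp (real k * \<Lambda> A \<omega>)) \<partial>M) = ennreal (exp (p k * measure L A))"
    and pairs: "\<And>z. z \<in> (\<Union>i<n. B i) \<Longrightarrow> p (card {i\<in>{..<n}. z \<in> B i}) =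
      (\<Sum>i<n. \<Sum>j\<in>{i<..<n}. if z \<in> B i \<and> z \<in> B j then al (j - i) else 0)"
  shows "(\<integral>\<^sup>+\<omega>. ennreal (exp (\<Sum>i<n. \<Lambda> (B i) \<omega>)) \<partial>M) =
    ennreal (exp (\<Sum>i<n. \<Sum>j\<in>{i<..<n}. al (j - i) * measure L (B i \<inter> B j)))"
proof -
  let ?J = "{1..<2 ^ n} :: nat set"
  have "p (card {i\<in>{..<n}. i \<in> set_decode m}) * measure L (atom B n m) =
     (\<Sum>i<n. \<Sum>j\<in>{i<..<n}. al (j - i) * (if i \<in> set_decode m \<and> j \<in> set_decode m then measure L (atom B n m) else 0))" for m
  proof (cases "atom B n m = {}")
    case False
    then obtain z where z: "z \<in> atom B n m" by auto
    then have *: "z \<in> B i \<longleftrightarrow> i \<in> set_decode m" if "i < n" for i using that by (auto simp: atom_def)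
    have "p (card {i\<in>{..<n}. i \<in> set_decode m}) = p (card {i\<in>{..<n}. z \<in> B i})"
      using * by (intro arg_cong[of _ _ p] arg_cong[of _ _ card]) auto
    also have "\<dots> = (\<Sum>i<n. \<Sum>j\<in>{i<..<n}. if z \<in> B i \<and> z \<in> B j then al (j - i) else 0)"
      using z by (intro pairs) (auto simp: atom_def)
    also have "\<dots> = (\<Sum>i<n. \<Sum>j\<in>{i<..<n}. if i \<in> set_decode m \<and> j \<in> set_decode m then al (j - i) else 0)"
      using * by (intro sum.cong refl) auto
    finally show ?thesis
      by (simp only: sum_distrib_right) (intro sum.cong refl, auto)
  next
    case True
    then show ?thesis by (simp cong: if_cong)
  qed
  then have "(\<Sum>m\<in>?J. p (card {i\<in>{..<n}. i \<in> set_decode m}) * measure L (atom B n m)) =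
    (\<Sum>m\<in>?J. \<Sum>i<n. \<Sum>j\<in>{i<..<n}. al (j - i) * (if i \<in> set_decode m \<and> j \<in> set_decode m then measure L (atom B n m) else 0))"
    by simp
  also have "\<dots> = (\<Sum>i<n. \<Sum>m\<in>?J. \<Sum>j\<in>{i<..<n}. al (j - i) * (if i \<in> set_decode m \<and> j \<in> set_decode m then measure L (atom B n m) else 0))"
    by (rule sum.swap)
  also have "\<dots> = (\<Sum>i<n. \<Sum>j\<in>{i<..<n}. \<Sum>m\<in>?J. al (j - i) * (if i \<in> set_decode m \<and> j \<in> set_decode m then measure L (atom B n m) else 0))"
    by (intro sum.cong refl sum.swap)
  also have "\<dots> = (\<Sum>i<n. \<Sum>j\<in>{i<..<n}. al (j - i) * measure L (B i \<inter> B j))"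
    by (intro sum.cong refl) (simp add: measure_Int_eq_sum_atoms sum_distrib_left)
  finally show ?thesis
    using nn_integral_exp_sum_Lam[OF moments] by simp
qed

end

text \<open>The atoms of \<open>B'\<close> have the same measures as those of \<open>B\<close>, and \<open>C\<close> is disjoint from
  \<open>B'\<close>: the vector \<open>\<Lambda> (B' i)\<close> is independent of \<open>\<Lambda> C\<close> and has the law of \<open>\<Lambda> (B i)\<close>.\<close>

lemma nn_integral_Lam_indep_copy:
  fixes f :: "real \<Rightarrow> (nat \<Rightarrow> real) \<Rightarrow> ennreal"
  assumes B: "\<And>i. i < n \<Longrightarrow> B i \<in> fmeasurable L" and B': "\<And>i. i < n \<Longrightarrow> B' i \<in> fmeasurable L"
    and C: "C \<in> fmeasurable L" "\<And>i. i < n \<Longrightarrow> C \<inter> B' i = {}"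
    and eq: "\<And>m. measure L (atom B' n m) = measure L (atom B n m)"
    and f: "(\<lambda>(r, y). f r y) \<in> borel_measurable (borel \<Otimes>\<^sub>M PiM {..<n} (\<lambda>_. borel))"
    and n: "0 < n"
  shows "(\<integral>\<^sup>+\<omega>. f (\<Lambda> C \<omega>) (\<lambda>i\<in>{..<n}. \<Lambda> (B' i) \<omega>) \<partial>M) =
    (\<integral>\<^sup>+\<omega>. \<integral>\<^sup>+\<omega>'. f (\<Lambda> C \<omega>) (\<lambda>i\<in>{..<n}. \<Lambda> (B i) \<omega>') \<partial>M \<partial>M)"
proof -
  let ?J = "{1..<2 ^ n} :: nat set"
  let ?P = "PiM ?J (\<lambda>_. borel :: real measure)"
  define h :: "(nat \<Rightarrow> real) \<Rightarrow> nat \<Rightarrow> real" where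
    "h y = (\<lambda>i\<in>{..<n}. \<Sum>m\<in>{m\<in>?J. i \<in> set_decode m}. y m)" for y
  have h [measurable]: "h \<in> ?P \<rightarrow>\<^sub>M PiM {..<n} (\<lambda>_. borel)"
    unfolding h_def[abs_def]
    by (intro measurable_restrict borel_measurable_sum measurable_component_singleton) auto
  have f' [measurable]: "(\<lambda>(r, y). f r (h y)) \<in> borel_measurable (borel \<Otimes>\<^sub>M ?P)"
  proof -
    have "(\<lambda>x. (fst x, h (snd x))) \<in> borel \<Otimes>\<^sub>M ?P \<rightarrow>\<^sub>M borel \<Otimes>\<^sub>M PiM {..<n} (\<lambda>_. borel)"
      by measurable
    from measurable_compose[OF this f] show ?thesis by (simp add: case_prod_beta')
  qed
  have J: "?J \<noteq> {}" using one_less_power[of "2::nat" n] n by auto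
  let ?X = "\<lambda>B \<omega>. \<lambda>m\<in>?J. \<Lambda> (atom B n m) \<omega>"
  have law: "distr M ?P (?X B) = PiM ?J (\<lambda>m. distr M borel (\<Lambda> (atom B n m)))"
    if "\<And>i. i < n \<Longrightarrow> B i \<in> fmeasurable L" for B
    using indep_vars_Lam[of ?J "atom B n"] atom_fmeasurable[of n B, OF that] disjoint_atoms J
    by (subst indep_vars_iff_distr_eq_PiM'[symmetric]) auto
  have X [measurable]: "?X B \<in> M \<rightarrow>\<^sub>M ?P" if "\<And>i. i < n \<Longrightarrow> B i \<in> fmeasurable L" for B
    using atom_fmeasurable[of n B, OF that] by (intro measurable_restrict) auto
  have XB': "?X B' \<in> M \<rightarrow>\<^sub>M ?P" by (rule X[OF B'])
  have law_eq: "distr M ?P (?X B') = distr M ?P (?X B)"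
    using law[of B, OF B] law[of B', OF B'] eq
    by (auto intro!: PiM_cong distr_Lam_eq atom_fmeasurable B B')
  \<comment> \<open>The single value on \<open>C\<close> is stored as a vector with one component,
    so that it can be treated as a block of an independent family.\<close>
  let ?Q = "PiM {0} (\<lambda>_. borel :: real measure)"
  define U where "U \<omega> = (\<lambda>m\<in>{0::nat}. \<Lambda> C \<omega>)" for \<omega>
  have U [measurable]: "U \<in> M \<rightarrow>\<^sub>M ?Q"
    unfolding U_def[abs_def] by (intro measurable_restrict Lam_measurable C)
  have [measurable]: "(\<lambda>x. x 0) \<in> borel_measurable ?Q"
    by (intro measurable_component_singleton) simp
  have g [measurable]: "(\<lambda>(u, y). f (u 0) (h y)) \<in> borel_measurable (?Q \<Otimes>\<^sub>M ?P)"
  proof -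
    have "(\<lambda>x. (fst x 0, snd x)) \<in> ?Q \<Otimes>\<^sub>M ?P \<rightarrow>\<^sub>M borel \<Otimes>\<^sub>M ?P" by measurable
    from measurable_compose[OF this f'] show ?thesis by (simp add: case_prod_beta')
  qed
  have atoms: "AE \<omega> in M. \<forall>i<n. \<Lambda> (A i) \<omega> = (\<Sum>m\<in>{m\<in>?J. i \<in> set_decode m}. \<Lambda> (atom A n m) \<omega>)"
    if "\<And>i. i < n \<Longrightarrow> A i \<in> fmeasurable L" for A
    by (rule Lam_eq_sum_atoms[OF that])
  \<comment> \<open>Atoms are numbered from 1, so index 0 is free for \<open>C\<close>. The
    independence of \<open>C\<close> from all atoms becomes the independence of two blocks of one
    family.\<close>
  define D where "D m = (if m = 0 then C else atom B' n m)" for m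
  have D: "indep_vars (\<lambda>_. borel) (\<lambda>m. \<Lambda> (D m)) (insert 0 ?J)"
  proof (rule indep_vars_Lam)
    show "disjoint_family_on D (insert 0 ?J)"
      using disjoint_atoms[of B' n] C(2) unfolding D_def disjoint_family_on_def
      by (auto simp: atom_def)
    show "D j \<in> fmeasurable L" for j by (auto simp: D_def C intro!: atom_fmeasurable B')
  qed simp
  have "indep_var ?Q (\<lambda>\<omega>. restrict (\<lambda>m. \<Lambda> (D m) \<omega>) {0}) ?P (\<lambda>\<omega>. restrict (\<lambda>m. \<Lambda> (D m) \<omega>) ?J)"
    by (rule indep_var_restrict[OF D]) auto
  moreover have "(\<lambda>\<omega>. restrict (\<lambda>m. \<Lambda> (D m) \<omega>) {0}) = U"
    by (auto simp: D_def U_def fun_eq_iff restrict_def)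
  moreover have "(\<lambda>\<omega>. restrict (\<lambda>m. \<Lambda> (D m) \<omega>) ?J) = ?X B'"
    by (auto simp: D_def fun_eq_iff restrict_def)
  ultimately have iv: "indep_var ?Q U ?P (?X B')" by simp
  note [measurable] = C(1)
  have AB: "AE \<omega> in M. \<forall>i<n. \<Lambda> (B i) \<omega> = (\<Sum>m\<in>{m\<in>?J. i \<in> set_decode m}. \<Lambda> (atom B n m) \<omega>)"
    by (rule atoms[OF B])
  interpret D2: prob_space "distr M ?P (?X B')" by (rule prob_space_distr[OF X[of B', OF B']])
  have "(\<integral>\<^sup>+\<omega>. f (\<Lambda> C \<omega>) (\<lambda>i\<in>{..<n}. \<Lambda> (B' i) \<omega>) \<partial>M) = (\<integral>\<^sup>+\<omega>. f (\<Lambda> C \<omega>) (h (?X B' \<omega>)) \<partial>M)"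
  proof (intro nn_integral_cong_AE, rule AE_mp[OF atoms[OF B']], assumption, intro AE_I2 impI)
    fix \<omega> assume "\<forall>i<n. \<Lambda> (B' i) \<omega> = (\<Sum>m\<in>{m\<in>?J. i \<in> set_decode m}. \<Lambda> (atom B' n m) \<omega>)"
    then have eq: "(\<lambda>i\<in>{..<n}. \<Lambda> (B' i) \<omega>) = h (?X B' \<omega>)"
      by (auto simp: h_def fun_eq_iff restrict_def intro!: sum.cong)
    show "f (\<Lambda> C \<omega>) (\<lambda>i\<in>{..<n}. \<Lambda> (B' i) \<omega>) = f (\<Lambda> C \<omega>) (h (?X B' \<omega>))"
      unfolding eq ..
  qed
  also have "\<dots> = (\<integral>\<^sup>+x. (\<lambda>(u, y). f (u 0) (h y)) x \<partial>distr M (?Q \<Otimes>\<^sub>M ?P) (\<lambda>\<omega>. (U \<omega>, ?X B' \<omega>)))"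
    by (subst nn_integral_distr[OF measurable_Pair[OF U XB']], simp only: measurable_distr_eq1, rule g)
      (simp add: U_def)
  also have "distr M (?Q \<Otimes>\<^sub>M ?P) (\<lambda>\<omega>. (U \<omega>, ?X B' \<omega>)) = distr M ?Q U \<Otimes>\<^sub>M distr M ?P (?X B')"
    using iv by (simp add: indep_var_distribution_eq)
  also have "(\<integral>\<^sup>+x. (\<lambda>(u, y). f (u 0) (h y)) x \<partial>(distr M ?Q U \<Otimes>\<^sub>M distr M ?P (?X B'))) =
      (\<integral>\<^sup>+u. \<integral>\<^sup>+y. f (u 0) (h y) \<partial>distr M ?P (?X B') \<partial>distr M ?Q U)"
    by (subst D2.nn_integral_fst[symmetric]) (simp_all add: g del: One_nat_def cong: measurable_cong_sets)
  also have "\<dots> = (\<integral>\<^sup>+u. \<integral>\<^sup>+y. f (u 0) (h y) \<partial>distr M ?P (?X B) \<partial>distr M ?Q U)"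
    by (simp only: law_eq)
  also have "\<dots> = (\<integral>\<^sup>+u. \<integral>\<^sup>+\<omega>'. f (u 0) (h (?X B \<omega>')) \<partial>M \<partial>distr M ?Q U)"
  proof (rule nn_integral_cong)
    fix u assume "u \<in> space (distr M ?Q U)"
    then have "(\<lambda>y. (u, y)) \<in> ?P \<rightarrow>\<^sub>M ?Q \<Otimes>\<^sub>M ?P" by (intro measurable_Pair1') simp
    from measurable_compose[OF this g] have "(\<lambda>y. f (u 0) (h y)) \<in> borel_measurable ?P" by simp
    then show "(\<integral>\<^sup>+y. f (u 0) (h y) \<partial>distr M ?P (?X B)) = (\<integral>\<^sup>+\<omega>'. f (u 0) (h (?X B \<omega>')) \<partial>M)"
      by (subst nn_integral_distr[OF X[OF B]]) (simp_all del: One_nat_def)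
  qed
  also have "\<dots> = (\<integral>\<^sup>+\<omega>. \<integral>\<^sup>+\<omega>'. f (\<Lambda> C \<omega>) (h (?X B \<omega>')) \<partial>M \<partial>M)"
  proof (subst nn_integral_distr[OF U])
    have "(\<lambda>x. (fst x, ?X B (snd x))) \<in> ?Q \<Otimes>\<^sub>M M \<rightarrow>\<^sub>M ?Q \<Otimes>\<^sub>M ?P"
      by (intro measurable_Pair measurable_fst measurable_compose[OF measurable_snd X[OF B]])
    from measurable_compose[OF this g]
    have "(\<lambda>(u, \<omega>'). f (u 0) (h (?X B \<omega>'))) \<in> borel_measurable (?Q \<Otimes>\<^sub>M M)" by (simp add: case_prod_beta')
    then show "(\<lambda>u. \<integral>\<^sup>+\<omega>'. f (u 0) (h (?X B \<omega>')) \<partial>M) \<in> borel_measurable (distr M ?Q U)"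
      unfolding measurable_distr_eq1 by (rule borel_measurable_nn_integral)
    have "U \<omega> 0 = \<Lambda> C \<omega>" for \<omega> by (simp add: U_def)
    then show "(\<integral>\<^sup>+\<omega>. \<integral>\<^sup>+\<omega>'. f (U \<omega> 0) (h (?X B \<omega>')) \<partial>M \<partial>M) =
        (\<integral>\<^sup>+\<omega>. \<integral>\<^sup>+\<omega>'. f (\<Lambda> C \<omega>) (h (?X B \<omega>')) \<partial>M \<partial>M)"
      by (simp only:)
  qed
  also have "\<dots> = (\<integral>\<^sup>+\<omega>. \<integral>\<^sup>+\<omega>'. f (\<Lambda> C \<omega>) (\<lambda>i\<in>{..<n}. \<Lambda> (B i) \<omega>') \<partial>M \<partial>M)"
  proof (rule nn_integral_cong, rule nn_integral_cong_AE)
    show "AE \<omega>' in M. f (\<Lambda> C \<omega>) (h (?X B \<omega>')) = f (\<Lambda> C \<omega>) (\<lambda>i\<in>{..<n}. \<Lambda> (B i) \<omega>')" for \<omega>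
      using AB
    proof eventually_elim
      case (elim \<omega>')
      have "(\<lambda>i\<in>{..<n}. \<Lambda> (B i) \<omega>') = h (?X B \<omega>')"
        using elim by (auto simp: h_def fun_eq_iff restrict_def intro!: sum.cong)
      then show ?case by (rule arg_cong[OF sym])
    qed
  qed
  finally show ?thesis .
qed

end

section \<open>Exponential moments for negative jumps\<close>

text \<open>In the closed unit ball the powers satisfy |a^n - b^n| \<le> n |a - b|. With a = 1 + z /
  n and b = exp (z / n) the difference of the bases is O(1 / n^2), so the powers differ by O(1 / n).
  This way no complex logarithm is involved.\<close>

lemma tendsto_power_exp:
  fixes z :: "nat \<Rightarrow> 'a :: {banach, real_normed_field}"
  assumes z: "z \<longlonglongrightarrow> w"
    and 1: "\<And>n. norm (1 + z n / of_nat (Suc n)) \<le> 1" and 2: "\<And>n. norm (exp (z n / of_nat (Suc n))) \<le> 1"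
  shows "(\<lambda>n. (1 + z n / of_nat (Suc n)) ^ Suc n) \<longlonglongrightarrow> exp w"
proof -
  obtain B where B: "\<And>n. norm (z n) \<le> B"
    using convergent_imp_Bseq[of z] z unfolding Bseq_def convergent_def by blast
  have B0: "0 \<le> B" using B[of 0] norm_ge_zero order_trans by blast
  have bound: "norm ((1 + z n / of_nat (Suc n)) ^ Suc n - exp (z n)) \<le> exp B * B\<^sup>2 / real (Suc n)" for n
  proof -
    let ?u = "z n / of_nat (Suc n)"
    have u: "norm ?u \<le> B / real (Suc n)" using B[of n] by (simp add: norm_divide divide_right_mono del: of_nat_Suc)
    have "B / real (Suc n) \<le> B / 1" using B0 by (intro divide_left_mono) auto
    with u have u': "norm ?u \<le> B" by linarith
    have "exp (z n) = exp ?u ^ Suc n"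
      by (subst exp_of_nat_mult[symmetric]) (simp del: of_nat_Suc)
    then have "norm ((1 + ?u) ^ Suc n - exp (z n)) \<le> real (Suc n) * norm ((1 + ?u) - exp ?u)"
      using norm_power_diff[OF 1[of n] 2[of n], of "Suc n"] by simp
    also have "norm ((1 + ?u) - exp ?u) \<le> exp (norm ?u) * norm ?u ^ 2"
      using Taylor_exp_field[of ?u 1] by (simp add: norm_minus_commute power2_eq_square mult.assoc)
    also have "\<dots> \<le> exp B * (B / real (Suc n)) ^ 2"
      using u u' B0 by (intro mult_mono power_mono) auto
    also have "real (Suc n) * \<dots> = exp B * B\<^sup>2 / real (Suc n)"
      by (simp add: power2_eq_square field_simps del: of_nat_Suc)
    finally show ?thesis by (simp add: mult_left_mono)
  qed
  have "(\<lambda>n. exp B * B\<^sup>2 / real (Suc n)) \<longlonglongrightarrow> 0"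
    by real_asymp
  then have "(\<lambda>n. (1 + z n / of_nat (Suc n)) ^ Suc n - exp (z n)) \<longlonglongrightarrow> 0"
    by (rule Lim_null_comparison[rotated]) (use bound in auto)
  from tendsto_add[OF this tendsto_exp[OF z]] show ?thesis by simp
qed

locale negative_levy =
  fixes \<nu> :: "real measure"
  assumes sets_nu [measurable_cong]: "sets \<nu> = sets borel"
    and neg: "AE x in \<nu>. x < 0"
    and fin: "(\<integral>\<^sup>+x. ennreal (min 1 \<bar>x\<bar>) \<partial>\<nu>) < \<infinity>"
    and nontrivial: "emeasure \<nu> UNIV \<noteq> 0"
begin

lemma space_nu [simp]: "space \<nu> = UNIV"
  using sets_eq_imp_space_eq[OF sets_nu] by simp

lemma not_AE_False: "\<not> (AE x in \<nu>. False)"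
proof -
  have "UNIV \<in> sets \<nu>" by (simp add: sets_nu)
  then show ?thesis using AE_iff_measurable[of UNIV \<nu> "\<lambda>_. False"] nontrivial by simp
qed

lemma integrable_min: "integrable \<nu> (\<lambda>x. min 1 \<bar>x\<bar>)"
  using fin by (intro integrableI_nonneg) auto

lemma integrable_dominated:
  fixes f :: "real \<Rightarrow> 'a :: {banach, second_countable_topology}"
  assumes "f \<in> borel_measurable borel" "\<And>x. x < 0 \<Longrightarrow> norm (f x) \<le> C * min 1 \<bar>x\<bar>"
  shows "integrable \<nu> f"
proof (rule Bochner_Integration.integrable_bound)
  show "integrable \<nu> (\<lambda>x. C * min 1 \<bar>x\<bar>)" by (intro integrable_mult_right integrable_min)
  show "AE x in \<nu>. norm (f x) \<le> norm (C * min 1 \<bar>x\<bar>)"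
    using neg
  proof eventually_elim
    case (elim x)
    show ?case using order_trans[OF assms(2)[OF elim] abs_ge_self] by (simp only: real_norm_def)
  qed
qed (use assms(1) in measurable)

lemma le_mult_min_1:
  fixes n a b y :: real
  assumes "n \<le> a * y" "n \<le> b" "0 \<le> a" "0 \<le> b" "0 \<le> y"
  shows "n \<le> (a + b) * min 1 y"
proof (cases "y \<le> 1")
  case True
  moreover have "n \<le> a * y + b * y" using assms(1) mult_nonneg_nonneg[OF assms(4,5)] by linarith
  ultimately show ?thesis by (simp add: min_absorb2 distrib_right)
qed (use assms in simp)

lemma exp_bound:
  fixes x :: real assumes "x \<le> 0" shows "\<bar>1 - exp (real k * x)\<bar> \<le> (real k + 1) * min 1 \<bar>x\<bar>"
proof (rule le_mult_min_1)
  have *: "exp (real k * x) \<le> 1" using assms by (simp add: mult_nonneg_nonpos)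
  then have "\<bar>1 - exp (real k * x)\<bar> = 1 - exp (real k * x)" by simp
  moreover have "real k * \<bar>x\<bar> = - (real k * x)" using assms by simp
  ultimately show "\<bar>1 - exp (real k * x)\<bar> \<le> real k * \<bar>x\<bar>"
    using exp_ge_add_one_self[of "real k * x"] by linarith
  show "\<bar>1 - exp (real k * x)\<bar> \<le> 1" using * by (simp add: abs_if)
qed auto

lemma iexp_bound: "norm (iexp (\<theta> * x) - 1) \<le> (\<bar>\<theta>\<bar> + 2) * min 1 \<bar>x\<bar>"
proof (rule le_mult_min_1)
  show "norm (iexp (\<theta> * x) - 1) \<le> \<bar>\<theta>\<bar> * \<bar>x\<bar>"
    using iexp_approx1[of "\<theta> * x" 0] by (simp add: abs_mult)
  show "norm (iexp (\<theta> * x) - 1) \<le> 2"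
    using norm_triangle_ineq4[of "iexp (\<theta> * x)" 1] by simp
qed auto

lemma integrable_exp: "integrable \<nu> (\<lambda>x. 1 - exp (real k * x))"
proof (rule integrable_dominated[where C="real k + 1"])
  show "norm (1 - exp (real k * x)) \<le> (real k + 1) * min 1 \<bar>x\<bar>" if "x < 0" for x
    using exp_bound[of x k] that by simp
qed measurable

lemma integrable_iexp: "complex_integrable \<nu> (\<lambda>x. iexp (\<theta> * x) - 1)"
proof (rule integrable_dominated[where C="\<bar>\<theta>\<bar> + 2"])
  show "norm (iexp (\<theta> * x) - 1) \<le> (\<bar>\<theta>\<bar> + 2) * min 1 \<bar>x\<bar>" for x
    by (rule iexp_bound)
qed measurable

context
  fixes t :: real
  assumes t: "0 \<le> t"
begin

text \<open>An infinitely divisible law without Gaussian part and with Levy measure \<open>t \<nu>\<close> is the weak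
  limit of sums of \<open>m + 1\<close> independent jumps. Each jump occurs with probability
  \<open>t * jump_rate m / (m + 1)\<close>, and \<open>kap\<close> is so small that this is at most one.\<close>

definition kap :: real where
  "kap = 1 / (t * (LINT x|\<nu>. min 1 \<bar>x\<bar>) + 1)"

text \<open>A fraction A / (1 + A) with A proportional to \<open>m + 1\<close> and to
  \<open>min 1 \<bar>x\<bar>\<close>. Being at most A it makes the thinned measure finite, and it
  tends to 1 away from the origin: a soft version of discarding the small jumps.\<close>

definition thin :: "nat \<Rightarrow> real \<Rightarrow> real" where
  "thin m x = real (Suc m) * kap * min 1 \<bar>x\<bar> / (1 + real (Suc m) * kap * min 1 \<bar>x\<bar>)"

definition jump_rate :: "nat \<Rightarrow> real" where
  "jump_rate m = (LINT x|\<nu>. thin m x)"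

definition jump_space :: "nat \<Rightarrow> (bool \<times> real) measure" where
  "jump_space m = measure_pmf (bernoulli_pmf (t * jump_rate m / real (Suc m))) \<Otimes>\<^sub>M
     density \<nu> (\<lambda>x. ennreal (thin m x / jump_rate m))"

text \<open>The minimum makes jumps nonpositive everywhere and not just almost everywhere, so that
  exponentials of jump sums are bounded pointwise.\<close>

definition jump :: "bool \<times> real \<Rightarrow> real" where
  "jump p = (if fst p then min (snd p) 0 else 0)"

lemma min_integral_nonneg: "0 \<le> (LINT x|\<nu>. min 1 \<bar>x\<bar>)"
  by (rule integral_nonneg_AE) auto

lemma kap_pos: "0 < kap"
  using t min_integral_nonneg by (simp add: kap_def add_nonneg_pos)

lemma thin_measurable [measurable]: "thin m \<in> borel_measurable borel"
  unfolding thin_def[abs_def] by measurable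

lemma thin_bounds: "0 \<le> thin m x" "thin m x \<le> 1" "thin m x \<le> real (Suc m) * kap * min 1 \<bar>x\<bar>"
proof -
  define a where "a = real (Suc m) * kap * min 1 \<bar>x\<bar>"
  have a: "0 \<le> a" using kap_pos by (auto simp: a_def intro!: mult_nonneg_nonneg)
  have "thin m x = a / (1 + a)" by (simp add: thin_def a_def)
  then show "0 \<le> thin m x" "thin m x \<le> 1" "thin m x \<le> real (Suc m) * kap * min 1 \<bar>x\<bar>"
    using a unfolding a_def[symmetric] by (auto simp: divide_le_eq algebra_simps)
qed

lemma thin_pos: "x \<noteq> 0 \<Longrightarrow> 0 < thin m x"
  using kap_pos unfolding thin_def by (intro divide_pos_pos mult_pos_pos add_pos_pos) auto

lemma thin_tendsto: "x \<noteq> 0 \<Longrightarrow> (\<lambda>m. thin m x) \<longlonglongrightarrow> 1"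
proof -
  assume "x \<noteq> 0"
  then have "0 < kap * min 1 \<bar>x\<bar>" using kap_pos by simp
  moreover have "(\<lambda>m. real (Suc m) * c / (1 + real (Suc m) * c)) \<longlonglongrightarrow> 1" if "0 < c" for c :: real
    using that by real_asymp
  ultimately have "(\<lambda>m. real (Suc m) * (kap * min 1 \<bar>x\<bar>) / (1 + real (Suc m) * (kap * min 1 \<bar>x\<bar>))) \<longlonglongrightarrow> 1"
    by blast
  then show ?thesis by (simp add: thin_def mult.assoc)
qed

lemma integrable_thin: "integrable \<nu> (thin m)"
proof (rule integrable_dominated[where C="real (Suc m) * kap"])
  show "norm (thin m x) \<le> real (Suc m) * kap * min 1 \<bar>x\<bar>" for x
    using thin_bounds(1,3)[of m x] by (simp only: real_norm_def abs_of_nonneg)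
qed measurable

lemma integrable_thin_mult:
  fixes f :: "real \<Rightarrow> 'a :: {banach, second_countable_topology}"
  assumes [measurable]: "f \<in> borel_measurable borel" and "\<And>x. norm (f x) \<le> B"
  shows "integrable \<nu> (\<lambda>x. thin m x *\<^sub>R f x)"
proof (rule Bochner_Integration.integrable_bound[of _ "\<lambda>x. B * thin m x"])
  show "AE x in \<nu>. norm (thin m x *\<^sub>R f x) \<le> norm (B * thin m x)"
    using assms(2) thin_bounds(1)[of m] order_trans[OF norm_ge_zero assms(2)]
    by (intro AE_I2) (auto simp: abs_mult mult.commute intro!: mult_right_mono)
qed (auto intro: integrable_thin)

lemma jump_rate_pos: "0 < jump_rate m"
proof -
  have "jump_rate m \<noteq> 0"
  proof
    assume "jump_rate m = 0"
    then have "AE x in \<nu>. thin m x = 0"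
      using integral_nonneg_eq_0_iff_AE[OF integrable_thin[of m]] thin_bounds(1)[of m]
      by (simp add: jump_rate_def)
    with neg have "AE x in \<nu>. False"
    proof eventually_elim
      case (elim x)
      then show ?case using thin_pos[of x m] by simp
    qed
    then show False by (simp add: not_AE_False)
  qed
  moreover have "0 \<le> jump_rate m"
    unfolding jump_rate_def by (rule integral_nonneg_AE) (simp add: thin_bounds)
  ultimately show ?thesis by simp
qed

lemma jump_prob: "0 \<le> t * jump_rate m / real (Suc m)" "t * jump_rate m / real (Suc m) \<le> 1"
proof -
  show "0 \<le> t * jump_rate m / real (Suc m)"
    using t jump_rate_pos[of m] by simp
  have "jump_rate m \<le> (LINT x|\<nu>. real (Suc m) * kap * min 1 \<bar>x\<bar>)"
    unfolding jump_rate_def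
    by (intro integral_mono integrable_thin integrable_mult_right integrable_min thin_bounds)
  also have "\<dots> = real (Suc m) * (kap * (LINT x|\<nu>. min 1 \<bar>x\<bar>))" by (simp del: of_nat_Suc)
  finally have "t * jump_rate m \<le> t * (real (Suc m) * (kap * (LINT x|\<nu>. min 1 \<bar>x\<bar>)))"
    using t by (rule mult_left_mono)
  also have "\<dots> = real (Suc m) * (t * (LINT x|\<nu>. min 1 \<bar>x\<bar>) / (t * (LINT x|\<nu>. min 1 \<bar>x\<bar>) + 1))"
    by (simp add: kap_def)
  also have "\<dots> \<le> real (Suc m) * 1"
    using t min_integral_nonneg by (intro mult_left_mono) (simp_all add: divide_le_eq add_nonneg_pos)
  finally show "t * jump_rate m / real (Suc m) \<le> 1" by (simp add: divide_le_eq)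
qed

lemma prob_space_jump_size: "prob_space (density \<nu> (\<lambda>x. ennreal (thin m x / jump_rate m)))"
proof (rule prob_spaceI)
  have "(\<integral>\<^sup>+x. ennreal (thin m x / jump_rate m) \<partial>\<nu>) = ennreal (LINT x|\<nu>. thin m x / jump_rate m)"
    using jump_rate_pos[of m] thin_bounds(1)[of m]
    by (intro nn_integral_eq_integral integrable_divide integrable_thin) auto
  also have "\<dots> = 1" using jump_rate_pos[of m] by (simp add: jump_rate_def[symmetric])
  finally show "emeasure (density \<nu> (\<lambda>x. ennreal (thin m x / jump_rate m)))
      (space (density \<nu> (\<lambda>x. ennreal (thin m x / jump_rate m)))) = 1"
    by (subst emeasure_density) auto
qed

lemma prob_space_jump: "prob_space (jump_space m)"
  unfolding jump_space_def
  by (intro prob_space_pair prob_space_measure_pmf prob_space_jump_size)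

lemma jump_measurable [measurable]: "jump \<in> borel_measurable (jump_space m)"
  unfolding jump_def[abs_def] jump_space_def by measurable

text \<open>The probability of a jump is proportional to \<open>jump_rate m\<close>, the density of
  its size has \<open>jump_rate m\<close> in the denominator, and the two cancel. What remains is a
  perturbation of \<open>f 0\<close> of order \<open>1 / (m + 1)\<close>.\<close>

lemma integral_jump:
  fixes f :: "real \<Rightarrow> 'a :: {banach, second_countable_topology}"
  assumes [measurable]: "f \<in> borel_measurable borel" and B: "\<And>x. norm (f x) \<le> B"
  shows "(\<integral>p. f (jump p) \<partial>jump_space m) = f 0 + (t / real (Suc m)) *\<^sub>R (\<integral>x. thin m x *\<^sub>R (f x - f 0) \<partial>\<nu>)"
proof -
  let ?N = "density \<nu> (\<lambda>x. ennreal (thin m x / jump_rate m))"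
  let ?c = "t * jump_rate m / real (Suc m)"
  interpret J: prob_space "jump_space m" by (rule prob_space_jump)
  interpret N: prob_space ?N by (rule prob_space_jump_size)
  interpret P: pair_sigma_finite "measure_pmf (bernoulli_pmf ?c)" ?N ..
  have [simp]: "N.prob UNIV = 1" using N.prob_space by simp
  have int: "integrable (jump_space m) (\<lambda>p. f (jump p))"
    by (rule J.integrable_const_bound[where B=B]) (use B in auto)
  have "(\<integral>p. f (jump p) \<partial>jump_space m) = (\<integral>b. \<integral>x. f (jump (b, x)) \<partial>?N \<partial>measure_pmf (bernoulli_pmf ?c))"
    using P.integral_fst'[OF int[unfolded jump_space_def]] by (simp add: jump_space_def)
  also have "\<dots> = ?c *\<^sub>R (\<integral>x. f (min x 0) \<partial>?N) + (1 - ?c) *\<^sub>R f 0"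
    using jump_prob[of m]
    by (subst integral_measure_pmf[of UNIV]) (auto simp: UNIV_bool jump_def N.prob_space)
  also have "(\<integral>x. f (min x 0) \<partial>?N) = (\<integral>x. (1 / jump_rate m) *\<^sub>R (thin m x *\<^sub>R f (min x 0)) \<partial>\<nu>)"
    using thin_bounds(1)[of m] jump_rate_pos[of m] by (subst integral_density) auto
  also have "\<dots> = (1 / jump_rate m) *\<^sub>R (\<integral>x. thin m x *\<^sub>R f (min x 0) \<partial>\<nu>)"
    by (rule integral_scaleR_right)
  also have "?c *\<^sub>R \<dots> + (1 - ?c) *\<^sub>R f 0 =
      f 0 + (t / real (Suc m)) *\<^sub>R ((\<integral>x. thin m x *\<^sub>R f (min x 0) \<partial>\<nu>) - jump_rate m *\<^sub>R f 0)"
    using jump_rate_pos[of m] by (simp add: scaleR_diff_left scaleR_diff_right)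
  also have "jump_rate m *\<^sub>R f 0 = (\<integral>x. thin m x *\<^sub>R f 0 \<partial>\<nu>)"
    unfolding jump_rate_def by (simp add: integrable_thin)
  also have "(\<integral>x. thin m x *\<^sub>R f (min x 0) \<partial>\<nu>) - (\<integral>x. thin m x *\<^sub>R f 0 \<partial>\<nu>) =
      (\<integral>x. thin m x *\<^sub>R f (min x 0) - thin m x *\<^sub>R f 0 \<partial>\<nu>)"
    by (rule Bochner_Integration.integral_diff[symmetric]; rule integrable_thin_mult) (use B in auto)
  also have "\<dots> = (\<integral>x. thin m x *\<^sub>R (f x - f 0) \<partial>\<nu>)"
    by (rule integral_cong_AE) (measurable, use neg in eventually_elim, simp add: scaleR_diff_right min_def)
  finally show ?thesis .
qed

definition sum_space :: "nat \<Rightarrow> (nat \<Rightarrow> bool \<times> real) measure" where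
  "sum_space m = PiM {..<Suc m} (\<lambda>_. jump_space m)"

definition jump_sum :: "nat \<Rightarrow> (nat \<Rightarrow> bool \<times> real) \<Rightarrow> real" where
  "jump_sum m \<omega> = (\<Sum>i<Suc m. jump (\<omega> i))"

lemma jump_sum_measurable [measurable]: "jump_sum m \<in> borel_measurable (sum_space m)"
  unfolding jump_sum_def[abs_def] sum_space_def
  by (intro borel_measurable_sum measurable_compose[OF _ jump_measurable[of m]] measurable_component_singleton)

lemma prob_space_sum_space: "prob_space (sum_space m)"
  unfolding sum_space_def by (intro prob_space_PiM prob_space_jump)

lemma integral_jump_sum:
  fixes f :: "real \<Rightarrow> 'a :: {banach, real_normed_field, second_countable_topology}"
  assumes [measurable]: "f \<in> borel_measurable borel" and B: "\<And>x. norm (f x) \<le> B"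
    and 0: "f 0 = 1" and mult: "\<And>x y. f (x + y) = f x * f y"
  shows "(\<integral>\<omega>. f (jump_sum m \<omega>) \<partial>sum_space m) =
    (1 + t *\<^sub>R (\<integral>x. thin m x *\<^sub>R (f x - 1) \<partial>\<nu>) / of_nat (Suc m)) ^ Suc m"
proof -
  interpret J: prob_space "jump_space m" by (rule prob_space_jump)
  interpret product_sigma_finite "\<lambda>_::nat. jump_space m" ..
  have int: "integrable (jump_space m) (\<lambda>p. f (jump p))"
    by (rule J.integrable_const_bound[where B=B]) (use B in auto)
  have prod: "f (\<Sum>i\<in>I. g i) = (\<Prod>i\<in>I. f (g i))" if "finite I" for I :: "nat set" and g
    using that by (induction rule: finite_induct) (auto simp: 0 mult)
  have "(\<integral>\<omega>. f (jump_sum m \<omega>) \<partial>sum_space m) = (\<integral>\<omega>. (\<Prod>i<Suc m. f (jump (\<omega> i))) \<partial>sum_space m)"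
    by (simp only: jump_sum_def prod[OF finite_lessThan])
  also have "\<dots> = (\<Prod>i<Suc m. \<integral>p. f (jump p) \<partial>jump_space m)"
    unfolding sum_space_def by (rule product_integral_prod) (use int in auto)
  also have "\<dots> = (1 + t *\<^sub>R (\<integral>x. thin m x *\<^sub>R (f x - 1) \<partial>\<nu>) / of_nat (Suc m)) ^ Suc m"
    unfolding integral_jump[OF assms(1) B, of m] 0 prod_constant
    by (simp add: scaleR_conv_of_real del: of_nat_Suc)
  finally show ?thesis .
qed

lemma thin_integral_tendsto:
  fixes f :: "real \<Rightarrow> 'a :: {banach, real_normed_field, second_countable_topology}"
  assumes [measurable]: "f \<in> borel_measurable borel"
    and C: "\<And>x. x < 0 \<Longrightarrow> norm (f x) \<le> C * min 1 \<bar>x\<bar>"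
  shows "(\<lambda>m. \<integral>x. thin m x *\<^sub>R f x \<partial>\<nu>) \<longlonglongrightarrow> (\<integral>x. f x \<partial>\<nu>)"
proof (rule integral_dominated_convergence[where w="\<lambda>x. C * min 1 \<bar>x\<bar>"])
  show "integrable \<nu> (\<lambda>x. C * min 1 \<bar>x\<bar>)" by (intro integrable_mult_right integrable_min)
  show "AE x in \<nu>. (\<lambda>m. thin m x *\<^sub>R f x) \<longlonglongrightarrow> f x"
    using neg
  proof eventually_elim
    case (elim x)
    then have "(\<lambda>m. thin m x *\<^sub>R f x) \<longlonglongrightarrow> 1 *\<^sub>R f x"
      by (intro tendsto_scaleR thin_tendsto tendsto_const) auto
    then show ?case by simp
  qed
  show "AE x in \<nu>. norm (thin m x *\<^sub>R f x) \<le> C * min 1 \<bar>x\<bar>" for m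
    using neg
  proof eventually_elim
    case (elim x)
    have "norm (thin m x *\<^sub>R f x) \<le> 1 * norm (f x)"
      using thin_bounds[of m x] by (simp add: mult_left_le_one_le)
    with C[OF elim] show ?case by simp
  qed
qed measurable

lemma thin_integral_nonpos:
  assumes [measurable]: "f \<in> borel_measurable borel" and "\<And>x. f x \<le> (0::real)"
  shows "(LINT x|\<nu>. thin m x * f x) \<le> 0"
proof -
  have "0 \<le> (LINT x|\<nu>. - (thin m x * f x))"
    using thin_bounds(1)[of m] assms(2) by (intro integral_nonneg_AE AE_I2) (simp add: mult_nonneg_nonpos)
  then show ?thesis by simp
qed

definition jump_law :: "nat \<Rightarrow> real measure" where
  "jump_law m = distr (sum_space m) borel (jump_sum m)"

text \<open>The characteristic functions of the approximations are powers of 1 + z / (m + 1) with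
  exponent m + 1, where z converges to the wanted exponent by dominated convergence;
  \<open>tendsto_power_exp\<close> and Levy continuity conclude.\<close>

lemma jump_law_tendsto:
  assumes \<mu>: "real_distribution \<mu>"
    and char: "\<And>\<theta>. char \<mu> \<theta> = exp (of_real t * (CLINT x|\<nu>. iexp (\<theta> * x) - 1))"
  shows "weak_conv_m jump_law \<mu>"
proof (rule levy_continuity[OF _ \<mu>])
  interpret S: prob_space "sum_space m" for m by (rule prob_space_sum_space)
  show "real_distribution (jump_law m)" for m
    unfolding jump_law_def by (intro S.real_distribution_distr) simp
  then interpret real_distribution "jump_law m" for m .
  fix \<theta> :: real
  let ?f = "\<lambda>x. iexp (\<theta> * x)"
  let ?z = "\<lambda>m. t *\<^sub>R (CLINT x|\<nu>. thin m x *\<^sub>R (?f x - 1))"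
  have eq: "char (jump_law m) \<theta> = (1 + ?z m / of_nat (Suc m)) ^ Suc m" for m
  proof -
    have "char (jump_law m) \<theta> = (CLINT \<omega>|sum_space m. ?f (jump_sum m \<omega>))"
      unfolding char_def jump_law_def by (subst integral_distr) auto
    also have "\<dots> = (1 + ?z m / of_nat (Suc m)) ^ Suc m"
      by (rule integral_jump_sum[where B=1]) (auto simp: distrib_left exp_add)
    finally show ?thesis .
  qed
  \<comment> \<open>A power of this number is a value of a characteristic function, hence has norm
    at most one, and so has the number itself.\<close>
  have "norm (1 + ?z m / of_nat (Suc m)) \<le> 1" for m
    using cmod_char_le_1[of m \<theta>] unfolding eq norm_power by (subst (asm) power_le_one_iff) simp_all
  moreover have "norm (exp (?z m / of_nat (Suc m))) \<le> 1" for m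
  proof -
    have "Re (CLINT x|\<nu>. thin m x *\<^sub>R (?f x - 1)) = (LINT x|\<nu>. Re (thin m x *\<^sub>R (?f x - 1)))"
      by (intro integral_Re[symmetric] integrable_thin_mult[where B=2])
        (auto intro!: order_trans[OF norm_triangle_ineq4])
    also have "\<dots> = (LINT x|\<nu>. thin m x * (cos (\<theta> * x) - 1))"
      by (simp add: Re_exp)
    also have "\<dots> \<le> 0" by (rule thin_integral_nonpos) auto
    finally have "Re (?z m / of_nat (Suc m)) \<le> 0"
      using t by (simp add: Re_divide_of_nat mult_nonneg_nonpos divide_nonpos_pos del: of_nat_Suc)
    then show ?thesis by (simp only: norm_exp_eq_Re exp_le_one_iff)
  qed
  moreover have "?z \<longlonglongrightarrow> t *\<^sub>R (CLINT x|\<nu>. ?f x - 1)"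
  proof (rule tendsto_scaleR[OF tendsto_const thin_integral_tendsto[where C="\<bar>\<theta>\<bar> + 2"]])
    show "norm (?f x - 1) \<le> (\<bar>\<theta>\<bar> + 2) * min 1 \<bar>x\<bar>" for x by (rule iexp_bound)
  qed measurable
  ultimately show "(\<lambda>m. char (jump_law m) \<theta>) \<longlonglongrightarrow> char \<mu> \<theta>"
    unfolding eq char scaleR_conv_of_real by (intro tendsto_power_exp)
qed

text \<open>The exponential is unbounded, so weak convergence does not apply to it directly. The
  approximations live on the negative half-line and therefore so does the limit; there the
  exponential agrees with the bounded continuous function
  \<open>exp (real k * min x 0)\<close>.\<close>

lemma nn_integral_exp_law:
  assumes \<mu>: "real_distribution \<mu>"
    and char: "\<And>\<theta>. char \<mu> \<theta> = exp (of_real t * (CLINT x|\<nu>. iexp (\<theta> * x) - 1))"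
  shows "(\<integral>\<^sup>+x. ennreal (exp (real k * x)) \<partial>\<mu>) = ennreal (exp (t * (LINT x|\<nu>. exp (real k * x) - 1)))"
proof -
  interpret \<mu>: real_distribution \<mu> by (rule \<mu>)
  interpret S: prob_space "sum_space m" for m by (rule prob_space_sum_space)
  have law: "real_distribution (jump_law m)" for m
    unfolding jump_law_def by (intro S.real_distribution_distr) simp
  note conv = weak_conv_imp_integral_bdd_continuous_conv[OF law \<mu> jump_law_tendsto[OF \<mu> char]]
  have nonpos: "jump_sum m \<omega> \<le> 0" for m \<omega>
    unfolding jump_sum_def by (intro sum_nonpos) (auto simp: jump_def)
  \<comment> \<open>A bounded continuous function that is positive exactly for positive arguments.
    Its integrals vanish for the approximations, hence for the limit law.\<close>
  have "(\<lambda>m. LINT x|jump_law m. min 1 (max 0 x)) \<longlonglongrightarrow> (LINT x|\<mu>. min 1 (max 0 x))"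
    by (rule conv[where B=1]) (auto intro!: continuous_intros)
  moreover have "(LINT x|jump_law m. min 1 (max 0 x)) = 0" for m
    using nonpos[of m] unfolding jump_law_def by (subst integral_distr) (auto simp: max_absorb1)
  ultimately have "(LINT x|\<mu>. min 1 (max 0 x)) = 0"
    by (simp add: LIMSEQ_const_iff)
  moreover have "integrable \<mu> (\<lambda>x. min 1 (max 0 x))"
    by (rule \<mu>.integrable_const_bound[where B=1]) auto
  ultimately have "AE x in \<mu>. min 1 (max 0 x) = 0"
    by (subst (asm) integral_nonneg_eq_0_iff_AE) auto
  then have le: "AE x in \<mu>. x \<le> 0"
    by eventually_elim (auto simp: min_def max_def split: if_splits)
  let ?g = "\<lambda>x. exp (real k * min x 0)"
  let ?f = "\<lambda>x::real. exp (real k * x)"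
  have g: "\<bar>?g x\<bar> \<le> 1" for x by (simp add: mult_nonneg_nonpos)
  have lim1: "(\<lambda>m. LINT x|jump_law m. ?g x) \<longlonglongrightarrow> (LINT x|\<mu>. ?g x)"
    by (rule conv[where B=1]) (use g in \<open>auto intro!: continuous_intros\<close>)
  have eq: "(LINT x|jump_law m. ?g x) = (1 + t *\<^sub>R (LINT x|\<nu>. thin m x *\<^sub>R (?g x - 1)) / of_nat (Suc m)) ^ Suc m" for m
  proof -
    interpret J: prob_space "jump_space m" by (rule prob_space_jump)
    interpret product_sigma_finite "\<lambda>_::nat. jump_space m" ..
    have int: "integrable (jump_space m) (\<lambda>p. ?g (jump p))"
      by (rule J.integrable_const_bound[where B=1]) (use g in auto)
    have eq: "?g (jump_sum m \<omega>) = (\<Prod>i<Suc m. ?g (jump (\<omega> i)))" for \<omega>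
    proof -
      have "jump p \<le> 0" for p by (simp add: jump_def)
      then show ?thesis
        using nonpos[of m \<omega>]
        by (simp add: min_absorb1 exp_sum[symmetric] jump_sum_def sum_distrib_left del: prod.lessThan_Suc sum.lessThan_Suc)
    qed
    have "(LINT x|jump_law m. ?g x) = (LINT \<omega>|sum_space m. (\<Prod>i<Suc m. ?g (jump (\<omega> i))))"
      unfolding jump_law_def eq[symmetric] by (subst integral_distr) auto
    also have "\<dots> = (\<Prod>i<Suc m. LINT p|jump_space m. ?g (jump p))"
      unfolding sum_space_def by (rule product_integral_prod) (use int in auto)
    also have "\<dots> = (1 + t *\<^sub>R (LINT x|\<nu>. thin m x *\<^sub>R (?g x - 1)) / of_nat (Suc m)) ^ Suc m"
      using integral_jump[of ?g 1 m] g by (simp del: of_nat_Suc power_Suc prod.lessThan_Suc)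
    finally show ?thesis .
  qed
  have lim2: "(\<lambda>m. (1 + t *\<^sub>R (LINT x|\<nu>. thin m x *\<^sub>R (?g x - 1)) / of_nat (Suc m)) ^ Suc m) \<longlonglongrightarrow>
      exp (t *\<^sub>R (LINT x|\<nu>. ?g x - 1))"
  proof (rule tendsto_power_exp)
    have "norm (?g x - 1) \<le> (real k + 1) * min 1 \<bar>x\<bar>" if "x < 0" for x
      using exp_bound[of x k] that by (simp add: min_absorb1 abs_minus_commute)
    then show "(\<lambda>m. t *\<^sub>R (LINT x|\<nu>. thin m x *\<^sub>R (?g x - 1))) \<longlonglongrightarrow> t *\<^sub>R (LINT x|\<nu>. ?g x - 1)"
      by (intro tendsto_scaleR tendsto_const thin_integral_tendsto) auto
    fix m
    let ?z = "t *\<^sub>R (LINT x|\<nu>. thin m x *\<^sub>R (?g x - 1)) / of_nat (Suc m)"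
    have z: "?z \<le> 0"
      using t thin_integral_nonpos[of "\<lambda>x. ?g x - 1" m] g
      by (auto simp: divide_le_0_iff mult_nonneg_nonpos abs_le_iff)
    then show "norm (exp ?z) \<le> 1" by simp
    \<comment> \<open>One plus \<open>?z\<close> is the mean of a nonnegative variable while
      \<open>?z\<close> is nonpositive, so the base of the power lies in the unit interval.\<close>
    have "0 \<le> (LINT p|jump_space m. ?g (jump p))" by (rule integral_nonneg_AE) auto
    also have "\<dots> = 1 + ?z" using integral_jump[of ?g 1 m] g by simp
    finally show "norm (1 + ?z) \<le> 1" using z by simp
  qed
  have "(LINT x|\<mu>. ?g x) = exp (t *\<^sub>R (LINT x|\<nu>. ?g x - 1))"
    by (rule LIMSEQ_unique[OF lim1[unfolded eq] lim2])
  also have "(LINT x|\<nu>. ?g x - 1) = (LINT x|\<nu>. ?f x - 1)"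
    by (rule integral_cong_AE) (measurable, use neg in eventually_elim, simp add: min_def)
  finally have *: "(LINT x|\<mu>. ?g x) = exp (t * (LINT x|\<nu>. ?f x - 1))" by simp
  have "(\<integral>\<^sup>+x. ennreal (?f x) \<partial>\<mu>) = (\<integral>\<^sup>+x. ennreal (?g x) \<partial>\<mu>)"
    by (intro nn_integral_cong_AE, use le in eventually_elim) (simp add: min_def)
  also have "\<dots> = ennreal (LINT x|\<mu>. ?g x)"
    by (intro nn_integral_eq_integral \<mu>.integrable_const_bound[where B=1]) (use g in auto)
  finally show ?thesis using * by simp
qed

end

end

section \<open>Hyperbolic areas of the cones\<close>

lemma measurable_Complex [measurable]: "(\<lambda>(x, y). Complex x y) \<in> borel_measurable (lborel \<Otimes>\<^sub>M lborel)"
proof -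
  have "(\<lambda>x. Complex (fst x) (snd x)) \<in> borel_measurable (borel \<Otimes>\<^sub>M borel)"
    unfolding borel_prod by (intro borel_measurable_continuous_onI continuous_intros continuous_on_Complex)
  then show ?thesis by (simp add: case_prod_beta')
qed

lemma lborel_complex: "(lborel :: complex measure) = distr (lborel \<Otimes>\<^sub>M lborel) borel (\<lambda>(x, y). Complex x y)"
proof (rule lborel_eqI)
  fix l u :: complex
  assume le: "\<And>b. b \<in> Basis \<Longrightarrow> l \<bullet> b \<le> u \<bullet> b"
  have le': "Re l \<le> Re u" "Im l \<le> Im u"
    using le[of 1] le[of \<i>] by (auto simp: Basis_complex_def inner_complex_def)
  have "(\<lambda>(x, y). Complex x y) -` box l u \<inter> space (lborel \<Otimes>\<^sub>M lborel) = {Re l<..<Re u} \<times> {Im l<..<Im u}"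
    by (auto simp: box_def Basis_complex_def inner_complex_def space_pair_measure)
  then have "emeasure (distr (lborel \<Otimes>\<^sub>M lborel) borel (\<lambda>(x, y). Complex x y)) (box l u) =
      emeasure (lborel \<Otimes>\<^sub>M lborel) ({Re l<..<Re u} \<times> {Im l<..<Im u})"
    by (subst emeasure_distr) (auto simp: borel_prod)
  also have "\<dots> = ennreal (Re u - Re l) * ennreal (Im u - Im l)"
    using le' by (subst lborel.emeasure_pair_measure_Times) auto
  also have "\<dots> = (\<Prod>b\<in>Basis. (u - l) \<bullet> b)"
    using le' by (simp add: Basis_complex_def inner_complex_def ennreal_mult[symmetric])
  finally show "emeasure (distr (lborel \<Otimes>\<^sub>M lborel) borel (\<lambda>(x, y). Complex x y)) (box l u) = (\<Prod>b\<in>Basis. (u - l) \<bullet> b)" .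
qed simp

abbreviation "\<H> \<equiv> hyperbolic_measure"

lemma upper_half_plane_borel [measurable]: "upper_half_plane \<in> sets borel"
proof -
  have "open upper_half_plane"
    unfolding upper_half_plane_def by (simp add: open_halfspace_Im_gt)
  then show ?thesis by simp
qed

lemma sets_hyperbolic: "A \<in> sets \<H> \<longleftrightarrow> A \<in> sets borel \<and> A \<subseteq> upper_half_plane"
  by (auto simp: hyperbolic_measure_def sets_restrict_space_iff)

lemma emeasure_hyperbolic:
  assumes "A \<in> sets borel" "A \<subseteq> upper_half_plane"
  shows "emeasure \<H> A = (\<integral>\<^sup>+z. indicator A z * ennreal (1 / (Im z)\<^sup>2) \<partial>lborel)"
proof -
  have A: "A \<in> sets \<H>" using assms by (simp add: sets_hyperbolic)
  have [measurable]: "Im \<in> borel_measurable borel"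
    by (intro borel_measurable_continuous_onI continuous_intros)
  have "emeasure \<H> A = (\<integral>\<^sup>+z. ennreal (1 / (Im z)\<^sup>2) * indicator A z \<partial>restrict_space lborel upper_half_plane)"
    using A unfolding hyperbolic_measure_def
    by (subst emeasure_density) (auto intro!: measurable_restrict_space1)
  also have "\<dots> = (\<integral>\<^sup>+z. indicator A z * ennreal (1 / (Im z)\<^sup>2) \<partial>lborel)"
    using assms(2)
    by (subst nn_integral_restrict_space) (auto intro!: nn_integral_cong simp: indicator_def)
  finally show ?thesis .
qed

lemma emeasure_hyperbolic_slices:
  assumes A: "A \<in> sets borel" "A \<subseteq> upper_half_plane"
    and slice: "\<And>y. 0 < y \<Longrightarrow> emeasure lborel {x. Complex x y \<in> A} = ennreal (w y)"
  shows "emeasure \<H> A = (\<integral>\<^sup>+y. ennreal (w y) * ennreal (1 / y\<^sup>2) * indicator {0<..} y \<partial>lborel)"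
proof -
  have [measurable]: "Im \<in> borel_measurable borel"
    by (intro borel_measurable_continuous_onI continuous_intros)
  note [measurable] = A(1)
  have [measurable]: "(\<lambda>p. Complex (fst p) (snd p)) \<in> borel_measurable (lborel \<Otimes>\<^sub>M lborel)"
    using measurable_Complex by (simp add: case_prod_beta')
  have "emeasure \<H> A = (\<integral>\<^sup>+z. indicator A z * ennreal (1 / (Im z)\<^sup>2) \<partial>distr (lborel \<Otimes>\<^sub>M lborel) borel (\<lambda>(x, y). Complex x y))"
    using A by (simp add: emeasure_hyperbolic lborel_complex[symmetric])
  also have "\<dots> = (\<integral>\<^sup>+p. indicator A (Complex (fst p) (snd p)) * ennreal (1 / (snd p)\<^sup>2) \<partial>(lborel \<Otimes>\<^sub>M lborel))"
    by (subst nn_integral_distr) (auto simp: case_prod_beta')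
  also have "\<dots> = (\<integral>\<^sup>+y. \<integral>\<^sup>+x. indicator A (Complex x y) * ennreal (1 / y\<^sup>2) \<partial>lborel \<partial>lborel)"
    by (subst lborel_pair.nn_integral_snd[symmetric]) auto
  also have "\<dots> = (\<integral>\<^sup>+y. ennreal (w y) * ennreal (1 / y\<^sup>2) * indicator {0<..} y \<partial>lborel)"
  proof (rule nn_integral_cong)
    fix y :: real
    have S: "{x. Complex x y \<in> A} \<in> sets lborel"
    proof -
      have "(\<lambda>x. Complex x y) \<in> borel_measurable borel"
        by (intro borel_measurable_continuous_onI continuous_intros continuous_on_Complex)
      from measurable_sets[OF this A(1)] show ?thesis by (simp add: vimage_def)
    qed
    have "(\<integral>\<^sup>+x. indicator A (Complex x y) * ennreal (1 / y\<^sup>2) \<partial>lborel) =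
        (\<integral>\<^sup>+x. indicator {x. Complex x y \<in> A} x * ennreal (1 / y\<^sup>2) \<partial>lborel)"
      by (intro nn_integral_cong) (auto simp: indicator_def)
    also have "\<dots> = emeasure lborel {x. Complex x y \<in> A} * ennreal (1 / y\<^sup>2)"
      using S by (subst nn_integral_multc) auto
    also have "\<dots> = ennreal (w y) * ennreal (1 / y\<^sup>2) * indicator {0<..} y"
    proof (cases "0 < y")
      case False
      then have "{x. Complex x y \<in> A} = {}" using A(2) by (auto simp: upper_half_plane_def)
      then show ?thesis using False by simp
    qed (simp add: slice)
    finally show "(\<integral>\<^sup>+x. indicator A (Complex x y) * ennreal (1 / y\<^sup>2) \<partial>lborel) =
      ennreal (w y) * ennreal (1 / y\<^sup>2) * indicator {0<..} y" .
  qed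
  finally show ?thesis .
qed

lemma nn_integral_inverse_square_atLeast:
  assumes "0 < (c::real)" "0 \<le> k"
  shows "(\<integral>\<^sup>+y. ennreal (k / y\<^sup>2) * indicator {c..} y \<partial>lborel) = ennreal (k / c)"
proof -
  have "((\<lambda>y. - k / y) \<longlongrightarrow> 0) at_top" by real_asymp
  then have "(\<integral>\<^sup>+y. ennreal (k / y\<^sup>2) * indicator {c..} y \<partial>lborel) = ennreal (0 - (- k / c))"
    using assms by (intro nn_integral_FTC_atLeast)
      (auto intro!: derivative_eq_intros simp: power2_eq_square field_simps)
  then show ?thesis by simp
qed

text \<open>A supply of disjoint sets of prescribed area: with the height cut off at 1, the area of
  a strip equals its width.\<close>

definition strip :: "real \<Rightarrow> nat \<Rightarrow> complex set" where
  "strip s j = {z. real j * s < Re z \<and> Re z \<le> real (Suc j) * s \<and> 1 \<le> Im z}"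

lemma
  assumes "0 < s"
  shows strip_fmeasurable: "strip s j \<in> fmeasurable \<H>"
    and measure_strip: "measure \<H> (strip s j) = s"
proof -
  have [measurable]: "Im \<in> borel_measurable borel" "Re \<in> borel_measurable borel"
    by (intro borel_measurable_continuous_onI continuous_intros)+
  have A: "strip s j \<in> sets borel" "strip s j \<subseteq> upper_half_plane"
    unfolding strip_def upper_half_plane_def by (measurable, auto)
  have "emeasure \<H> (strip s j) = (\<integral>\<^sup>+y. ennreal (if 1 \<le> y then s else 0) * ennreal (1 / y\<^sup>2) * indicator {0<..} y \<partial>lborel)"
  proof (rule emeasure_hyperbolic_slices[OF A])
    fix y :: real
    have "{x. Complex x y \<in> strip s j} = (if 1 \<le> y then {real j * s<..real (Suc j) * s} else {})"
      by (auto simp: strip_def)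
    then show "emeasure lborel {x. Complex x y \<in> strip s j} = ennreal (if 1 \<le> y then s else 0)"
      using assms by (simp add: algebra_simps)
  qed
  also have "\<dots> = (\<integral>\<^sup>+y. ennreal (s / y\<^sup>2) * indicator {1..} y \<partial>lborel)"
    using assms by (intro nn_integral_cong) (auto simp: indicator_def ennreal_mult[symmetric])
  also have "\<dots> = ennreal s" using assms by (subst nn_integral_inverse_square_atLeast) auto
  finally have *: "emeasure \<H> (strip s j) = ennreal s" .
  then show "strip s j \<in> fmeasurable \<H>" using A by (intro fmeasurableI) (auto simp: sets_hyperbolic)
  show "measure \<H> (strip s j) = s" using * assms by (simp add: measure_def)
qed

lemma disjoint_strips:
  assumes "0 < s"
  shows "disjoint_family (strip s)"
proof -
  have False if "z \<in> strip s i" "z \<in> strip s j" "i < j" for z i j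
  proof -
    have "real (Suc i) * s \<le> real j * s" using that(3) assms by (intro mult_right_mono) auto
    with that show False by (auto simp: strip_def)
  qed
  then show ?thesis unfolding disjoint_family_on_def by (metis disjoint_iff linorder_neqE_nat)
qed

text \<open>Only the cones at the two end points matter, because both cone inequalities are monotone
  in the apex.\<close>

lemma cone_common_Icc:
  assumes "b \<le> c"
  shows "cone_common {b..c} = {z. 0 < Im z \<and> c - Im z / 2 < Re z \<and> Re z \<le> b + Im z / 2}"
proof -
  have iff: "z \<in> cone_common {b..c} \<longleftrightarrow> z \<in> cone b \<and> z \<in> cone c" for z
  proof
    assume "z \<in> cone b \<and> z \<in> cone c"
    then show "z \<in> cone_common {b..c}"
      by (auto simp: cone_common_def cone_def)
  qed (use assms in \<open>auto simp: cone_common_def\<close>)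
  show ?thesis
    unfolding set_eq_iff iff using assms by (auto simp: cone_def upper_half_plane_def)
qed

text \<open>The overlap of the truncated cones at \<open>x\<close> and \<open>y\<close>. Since these
  cones do not meet below height \<open>y - x\<close>, the cutoff \<open>h\<close> will be the
  maximum of that height and the truncation.\<close>

definition band :: "real \<Rightarrow> real \<Rightarrow> real \<Rightarrow> complex set" where
  "band h x y = {z. h \<le> Im z \<and> y - Im z / 2 < Re z \<and> Re z \<le> x + Im z / 2} - cone_common {0..1}"

text \<open>At a height t between \<open>h\<close> and 1 the horizontal slice has length t - (y -
  x). Above height 1 the part common to all cones is removed and 1 - (y - x) remains. Integration
  against t^-2 produces the logarithm.\<close>

lemma
  assumes xy: "0 \<le> x" "x \<le> y" "y \<le> 1" and h: "y - x \<le> h" "0 < h" "h \<le> 1"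
  shows band_fmeasurable: "band h x y \<in> fmeasurable \<H>"
    and measure_band: "measure \<H> (band h x y) = ln (1 / h) + 1 - (y - x) / h"
proof -
  have [measurable]: "Im \<in> borel_measurable borel" "Re \<in> borel_measurable borel"
    by (intro borel_measurable_continuous_onI continuous_intros)+
  have A: "band h x y \<in> sets borel" "band h x y \<subseteq> upper_half_plane"
    unfolding band_def using h by (simp add: cone_common_Icc, measurable, auto simp: upper_half_plane_def)
  let ?w = "\<lambda>t. if t < h then 0 else if t \<le> 1 then t - (y - x) else 1 - (y - x)"
  have "emeasure \<H> (band h x y) = (\<integral>\<^sup>+t. ennreal (?w t) * ennreal (1 / t\<^sup>2) * indicator {0<..} t \<partial>lborel)"
  proof (rule emeasure_hyperbolic_slices[OF A])
    fix t :: real assume "0 < t"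
    consider "t < h" | "h \<le> t" "t \<le> 1" | "h \<le> t" "1 < t" by fastforce
    then show "emeasure lborel {r. Complex r t \<in> band h x y} = ennreal (?w t)"
    proof cases
      case 1
      then have "{r. Complex r t \<in> band h x y} = {}" by (auto simp: band_def)
      then show ?thesis using 1 by simp
    next
      case 2
      then have "{r. Complex r t \<in> band h x y} = {y - t / 2<..x + t / 2}" by (auto simp: band_def cone_common_Icc)
      then show ?thesis using 2 xy h by simp
    next
      case 3
      then have "{r. Complex r t \<in> band h x y} = {y - t / 2<..x + t / 2} - {1 - t / 2<..t / 2}"
        using \<open>0 < t\<close> by (auto simp: band_def cone_common_Icc)
      also have "\<dots> = {y - t / 2<..1 - t / 2} \<union> {t / 2<..x + t / 2}"
        using 3 xy by auto
      also have "emeasure lborel \<dots> = ennreal (1 - y) + ennreal x"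
        using 3 xy by (subst plus_emeasure[symmetric]) auto
      also have "\<dots> = ennreal (?w t)"
        using 3 xy by (simp add: ennreal_plus[symmetric] del: ennreal_plus)
      finally show ?thesis .
    qed
  qed
  also have "\<dots> = (\<integral>\<^sup>+t. ennreal ((t - (y - x)) / t\<^sup>2) * indicator {h..1} t + ennreal ((1 - (y - x)) / t\<^sup>2) * indicator {1..} t \<partial>lborel)"
  proof (intro nn_integral_cong_AE)
    have "AE t in lborel. t \<noteq> (1::real)" by (rule AE_lborel_singleton)
    then show "AE t in lborel. ennreal (?w t) * ennreal (1 / t\<^sup>2) * indicator {0<..} t =
      ennreal ((t - (y - x)) / t\<^sup>2) * indicator {h..1} t + ennreal ((1 - (y - x)) / t\<^sup>2) * indicator {1..} t"
      by eventually_elim (use xy h in \<open>auto simp: indicator_def ennreal_mult[symmetric]\<close>)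
  qed
  also have "\<dots> = (\<integral>\<^sup>+t. ennreal ((t - (y - x)) / t\<^sup>2) * indicator {h..1} t \<partial>lborel) +
      (\<integral>\<^sup>+t. ennreal ((1 - (y - x)) / t\<^sup>2) * indicator {1..} t \<partial>lborel)"
    by (rule nn_integral_add) auto
  also have "(\<integral>\<^sup>+t. ennreal ((t - (y - x)) / t\<^sup>2) * indicator {h..1} t \<partial>lborel) =
      ennreal ((ln 1 + (y - x) / 1) - (ln h + (y - x) / h))"
    using h by (intro nn_integral_FTC_Icc)
      (auto intro!: derivative_eq_intros simp: field_simps power2_eq_square)
  also have "(\<integral>\<^sup>+t. ennreal ((1 - (y - x)) / t\<^sup>2) * indicator {1..} t \<partial>lborel) = ennreal (1 - (y - x))"
    using xy by (subst nn_integral_inverse_square_atLeast) auto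
  also have "ennreal ((ln 1 + (y - x) / 1) - (ln h + (y - x) / h)) + ennreal (1 - (y - x)) =
      ennreal ((ln 1 + (y - x) / 1) - (ln h + (y - x) / h) + (1 - (y - x)))"
  proof (rule ennreal_plus[symmetric])
    have "ln (1 / h) \<ge> 1 - h" using ln_le_minus_one[of h] h by (simp add: ln_div)
    moreover have "(y - x) * (1 / h - 1) \<le> h * (1 / h - 1)"
      using h xy by (intro mult_right_mono) auto
    ultimately show "0 \<le> (ln 1 + (y - x) / 1) - (ln h + (y - x) / h)"
      using h by (simp add: algebra_simps ln_div)
  qed (use xy in auto)
  also have "(ln 1 + (y - x) / 1) - (ln h + (y - x) / h) + (1 - (y - x)) = ln (1 / h) + 1 - (y - x) / h"
    using h by (simp add: ln_div)
  finally have *: "emeasure \<H> (band h x y) = ennreal (ln (1 / h) + 1 - (y - x) / h)" .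
  then show "band h x y \<in> fmeasurable \<H>" using A by (intro fmeasurableI) (auto simp: sets_hyperbolic)
  have "(y - x) / h \<le> 1" "0 \<le> ln (1 / h)" using h by auto
  then show "measure \<H> (band h x y) = ln (1 / h) + 1 - (y - x) / h"
    using * by (simp add: measure_def)
qed

lemma cone_trunc_Int:
  assumes "x \<le> y" "0 < e"
  shows "cone_trunc {0..1} e x \<inter> cone_trunc {0..1} e y = band (max e (y - x)) x y"
  using assms by (auto simp: cone_trunc_def cone_rel_def cone_def band_def upper_half_plane_def)

lemma cone_trunc_fmeasurable:
  assumes "x \<in> {0..1}" "0 < e" "e \<le> 1"
  shows "cone_trunc {0..1} e x \<in> fmeasurable \<H>"
  using cone_trunc_Int[of x x e] band_fmeasurable[of x x e] assms by (simp add: max_def)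

text \<open>For cutoff height \<open>m\<close> and d = y - x the area is - ln m + 1 - d / m, and ln
  u \<le> u - 1 at u = d / m turns this into a bound free of the truncation.\<close>

lemma measure_cone_trunc_Int_le:
  assumes "0 \<le> x" "x < y" "y \<le> 1" "0 < e" "e \<le> 1"
  shows "measure \<H> (cone_trunc {0..1} e x \<inter> cone_trunc {0..1} e y) \<le> - ln (y - x)"
proof -
  define m where "m = max e (y - x)"
  have m: "0 < m" "e \<le> m" "y - x \<le> m" using assms by (auto simp: m_def)
  have "measure \<H> (cone_trunc {0..1} e x \<inter> cone_trunc {0..1} e y) = ln (1 / m) + 1 - (y - x) / m"
    using assms unfolding m_def by (subst cone_trunc_Int) (auto intro!: measure_band)
  also have "\<dots> \<le> - ln (y - x)"
    using ln_le_minus_one[of "(y - x) / m"] assms m(1) by (simp add: ln_div)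
  finally show ?thesis .
qed

text \<open>In the formula for the area, 1 - d / m is nonnegative and the cutoff height
  \<open>m\<close> is at most \<open>h\<close>. Later \<open>h\<close> is (j - i + 1) / n, a bound
  for the distance of points in the cells i and j.\<close>

lemma measure_cone_trunc_Int_ge:
  assumes "0 \<le> x" "x \<le> y" "y \<le> 1" "0 < e" "e \<le> h" "y - x \<le> h" "h \<le> 1"
  shows "- ln h \<le> measure \<H> (cone_trunc {0..1} e x \<inter> cone_trunc {0..1} e y)"
proof -
  define m where "m = max e (y - x)"
  have m: "0 < m" "e \<le> m" "y - x \<le> m" using assms by (auto simp: m_def)
  have "measure \<H> (cone_trunc {0..1} e x \<inter> cone_trunc {0..1} e y) = ln (1 / m) + 1 - (y - x) / m"
    using assms unfolding m_def by (subst cone_trunc_Int) (auto intro!: measure_band)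
  moreover have "(y - x) / m \<le> 1"
    using m by simp
  moreover have "ln m \<le> ln h"
    using assms m(1) by (auto simp: m_def)
  moreover have "ln (1 / m) = - ln m"
    using m(1) by (simp add: ln_div)
  ultimately show ?thesis by linarith
qed

section \<open>Scaling of the cones onto the two halves of the unit interval\<close>

definition half_map :: "real \<Rightarrow> complex \<Rightarrow> complex" where
  "half_map b z = of_real b + (1 / 2) *\<^sub>R z"

lemma inj_half_map: "inj (half_map b)"
  by (auto simp: inj_def half_map_def)

lemma half_map_image_iff: "z \<in> half_map b ` A \<longleftrightarrow> 2 *\<^sub>R (z - of_real b) \<in> A"
proof
  assume *: "2 *\<^sub>R (z - of_real b) \<in> A"
  have "z = half_map b (2 *\<^sub>R (z - of_real b))" by (simp add: half_map_def)
  with * show "z \<in> half_map b ` A" by blast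
qed (auto simp: half_map_def)

text \<open>The map is a hyperbolic isometry: its Jacobian 1/4 cancels against the factor 4 that
  halving the height produces in the density.\<close>

lemma
  assumes "A \<in> sets \<H>"
  shows half_map_sets: "half_map b ` A \<in> sets \<H>"
    and emeasure_half_map: "emeasure \<H> (half_map b ` A) = emeasure \<H> A"
proof -
  have [measurable]: "Im \<in> borel_measurable borel"
    by (intro borel_measurable_continuous_onI continuous_intros)
  have [measurable]: "half_map b \<in> borel_measurable borel"
    unfolding half_map_def by (intro borel_measurable_continuous_onI continuous_intros)
  have A: "A \<in> sets borel" "A \<subseteq> upper_half_plane" using assms by (auto simp: sets_hyperbolic)
  have "(\<lambda>z::complex. 2 *\<^sub>R (z - of_real b)) \<in> borel_measurable borel"
    by (intro borel_measurable_continuous_onI continuous_intros)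
  from measurable_sets[OF this A(1)]
  have B: "half_map b ` A \<in> sets borel"
    by (simp add: vimage_def half_map_image_iff[symmetric])
  have B': "half_map b ` A \<subseteq> upper_half_plane"
    using A(2) by (auto simp: upper_half_plane_def half_map_def)
  show "half_map b ` A \<in> sets \<H>" using B B' by (simp add: sets_hyperbolic)
  let ?f = "\<lambda>z. indicator (half_map b ` A) z * ennreal (1 / (Im z)\<^sup>2)"
  have "emeasure \<H> (half_map b ` A) = (\<integral>\<^sup>+z. ?f z \<partial>lborel)"
    by (rule emeasure_hyperbolic[OF B B'])
  also have "\<dots> = (\<integral>\<^sup>+z. ?f z \<partial>density (distr lborel borel (half_map b)) (\<lambda>_. ennreal ((1 / 2) ^ 2)))"
    using lborel_affine[of "1/2" "of_real b :: complex"] by (simp add: half_map_def[abs_def])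
  also have "\<dots> = (\<integral>\<^sup>+z. ennreal ((1 / 2) ^ 2) * ?f (half_map b z) \<partial>lborel)"
    using B by (subst nn_integral_density) (auto simp: nn_integral_distr)
  also have "\<dots> = (\<integral>\<^sup>+z. indicator A z * ennreal (1 / (Im z)\<^sup>2) \<partial>lborel)"
  proof (rule nn_integral_cong)
    fix z
    have mem: "half_map b z \<in> half_map b ` A \<longleftrightarrow> z \<in> A"
      using inj_half_map[of b] by (simp add: inj_image_mem_iff)
    have eq: "ennreal ((1 / 2) ^ 2) * ennreal (1 / (Im (half_map b z))\<^sup>2) = ennreal (1 / (Im z)\<^sup>2)"
      by (subst ennreal_mult[symmetric]) (simp_all add: half_map_def power2_eq_square)
    have "indicator (half_map b ` A) (half_map b z) = (indicator A z :: ennreal)"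
      unfolding indicator_def mem ..
    then have "ennreal ((1 / 2) ^ 2) * ?f (half_map b z) =
        indicator A z * (ennreal ((1 / 2) ^ 2) * ennreal (1 / (Im (half_map b z))\<^sup>2))"
      by (simp only: mult.left_commute)
    then show "ennreal ((1 / 2) ^ 2) * ?f (half_map b z) = indicator A z * ennreal (1 / (Im z)\<^sup>2)"
      unfolding eq .
  qed
  also have "\<dots> = emeasure \<H> A" by (rule emeasure_hyperbolic[OF A, symmetric])
  finally show "emeasure \<H> (half_map b ` A) = emeasure \<H> A" .
qed

text \<open>The points shared by all cones over one half but not by all cones over the unit
  interval. They carry the random factor common to that half of the cascade.\<close>

definition half_cone :: "real \<Rightarrow> complex set" where
  "half_cone b = cone_common {b..b + 1 / 2} - cone_common {0..1}"

lemma
  assumes "0 \<le> b" "b \<le> 1 / 2"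
  shows half_cone_fmeasurable: "half_cone b \<in> fmeasurable \<H>"
    and measure_half_cone: "measure \<H> (half_cone b) = ln 2"
proof -
  have "half_cone b = band (1 / 2) b (b + 1 / 2)"
    unfolding half_cone_def band_def by (auto simp: cone_common_Icc)
  then show "half_cone b \<in> fmeasurable \<H>" "measure \<H> (half_cone b) = ln 2"
    using assms band_fmeasurable[of b "b + 1 / 2" "1 / 2"] measure_band[of b "b + 1 / 2" "1 / 2"] by auto
qed

text \<open>Self-similarity of the cones. The shared part lies above height 1/2, so a truncation at
  \<open>e \<le> 1 / 2\<close> does not cut it. What remains of the cone is the image of a cone of
  the unit interval truncated at the doubled height.\<close>

lemma
  assumes b: "0 \<le> b" "b \<le> 1 / 2" and x: "0 \<le> x" "x \<le> 1" and e: "0 < e" "e \<le> 1 / 2"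
  shows cone_trunc_half: "cone_trunc {0..1} e (b + x / 2) = half_cone b \<union> half_map b ` cone_trunc {0..1} (2 * e) x"
    and half_cone_disjoint: "half_cone b \<inter> half_map b ` cone_trunc {0..1} (2 * e) x = {}"
proof -
  have "z \<in> cone_trunc {0..1} e (b + x / 2) \<longleftrightarrow> z \<in> half_cone b \<union> half_map b ` cone_trunc {0..1} (2 * e) x" for z
    using assms unfolding half_map_image_iff Un_iff half_cone_def
    by (simp add: cone_trunc_def cone_rel_def cone_def cone_common_Icc upper_half_plane_def)
      (smt (verit) field_sum_of_halves)
  then show "cone_trunc {0..1} e (b + x / 2) = half_cone b \<union> half_map b ` cone_trunc {0..1} (2 * e) x"
    by blast
  show "half_cone b \<inter> half_map b ` cone_trunc {0..1} (2 * e) x = {}"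
  proof -
    have "z \<notin> half_map b ` cone_trunc {0..1} (2 * e) x" if "z \<in> half_cone b" for z
      using that unfolding half_map_image_iff half_cone_def
      by (auto simp: cone_trunc_def cone_rel_def cone_common_Icc)
    then show ?thesis by blast
  qed
qed

section \<open>Joint exponential moments of the cascade field\<close>

text \<open>For \<open>j \<ge> 1\<close> this is the second difference of \<open>levy_p\<close> at
  \<open>j\<close>. It becomes the weight of a pair of points whose ranks differ by
  \<open>j\<close>.\<close>

definition levy_al :: "real measure \<Rightarrow> nat \<Rightarrow> real" where
  "levy_al \<nu> j = (LINT x|\<nu>. exp ((real j - 1) * x) * (1 - exp x)\<^sup>2)"

text \<open>The logarithm of the \<open>k\<close>-th exponential moment per unit area, for jumps on
  the negative half-line with finite variation. The first term is the drift, chosen so that the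
  value at \<open>k = 1\<close> is zero.\<close>

definition levy_p :: "real measure \<Rightarrow> nat \<Rightarrow> real" where
  "levy_p \<nu> k = real k * (LINT x|\<nu>. 1 - exp x) - (LINT x|\<nu>. 1 - exp (real k * x))"

lemma levy_al_nonneg: "0 \<le> levy_al \<nu> j"
  unfolding levy_al_def by (rule integral_nonneg_AE) simp

context negative_levy
begin

abbreviation gam :: real where "gam \<equiv> LINT x|\<nu>. 1 - exp x"

lemma integrable_one_minus_exp: "integrable \<nu> (\<lambda>x. 1 - exp x)"
  using integrable_exp[of 1] by simp

lemma integrable_levy_al:
  assumes "1 \<le> j"
  shows "integrable \<nu> (\<lambda>x. exp ((real j - 1) * x) * (1 - exp x)\<^sup>2)"
proof (rule Bochner_Integration.integrable_bound[OF integrable_one_minus_exp])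
  show "AE x in \<nu>. norm (exp ((real j - 1) * x) * (1 - exp x)\<^sup>2) \<le> norm (1 - exp x)"
    using neg
  proof eventually_elim
    case (elim x)
    have 1: "exp ((real j - 1) * x) \<le> 1" using elim assms by (simp add: mult_nonneg_nonpos)
    have 2: "0 \<le> 1 - exp x" "1 - exp x \<le> 1" using elim by auto
    have "exp ((real j - 1) * x) * (1 - exp x)\<^sup>2 \<le> 1 * (1 - exp x)\<^sup>2"
      using 1 by (intro mult_right_mono) auto
    also have "\<dots> \<le> 1 - exp x" using 2 by (simp add: power2_eq_square mult_left_le)
    finally show ?case using 2 by simp
  qed
qed measurable

text \<open>The geometric sum of exp ((k - 1) x) telescopes against one of the two factors 1 - exp
  x. For negative x the integrand increases to 1 - exp x as n grows, which yields both the bound and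
  the limit \<open>gam\<close> of the partial sums.\<close>

lemma sum_levy_al: "(\<Sum>k=1..n. levy_al \<nu> k) = (LINT x|\<nu>. (1 - exp x) * (1 - exp (real n * x)))"
proof -
  have "(\<Sum>k=1..n. levy_al \<nu> k) = (LINT x|\<nu>. (\<Sum>k=1..n. exp ((real k - 1) * x) * (1 - exp x)\<^sup>2))"
    unfolding levy_al_def
    by (rule Bochner_Integration.integral_sum[symmetric]) (use integrable_levy_al in auto)
  also have "(\<lambda>x. \<Sum>k=1..n. exp ((real k - 1) * x) * (1 - exp x)\<^sup>2) = (\<lambda>x. (1 - exp x) * (1 - exp (real n * x)))"
  proof
    fix x :: real
    show "(\<Sum>k=1..n. exp ((real k - 1) * x) * (1 - exp x)\<^sup>2) = (1 - exp x) * (1 - exp (real n * x))"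
      by (induction n) (auto simp: algebra_simps power2_eq_square exp_add)
  qed
  finally show ?thesis .
qed

lemma levy_p_0 [simp]: "levy_p \<nu> 0 = 0"
  by (simp add: levy_p_def)

lemma levy_p_1 [simp]: "levy_p \<nu> (Suc 0) = 0"
  by (simp add: levy_p_def)

lemma levy_p_Suc: "levy_p \<nu> (Suc n) = levy_p \<nu> n + (\<Sum>k=1..n. levy_al \<nu> k)"
proof -
  have "levy_p \<nu> (Suc n) - levy_p \<nu> n =
      gam + (LINT x|\<nu>. 1 - exp (real n * x)) - (LINT x|\<nu>. 1 - exp (real (Suc n) * x))"
    by (simp add: levy_p_def algebra_simps)
  also have "\<dots> = (LINT x|\<nu>. (1 - exp x) + (1 - exp (real n * x)) - (1 - exp (real (Suc n) * x)))"
    using integrable_one_minus_exp integrable_exp[of n] integrable_exp[of "Suc n"]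
    by (simp only: Bochner_Integration.integral_add Bochner_Integration.integral_diff Bochner_Integration.integrable_add)
  also have "\<dots> = (LINT x|\<nu>. (1 - exp x) * (1 - exp (real n * x)))"
    by (simp add: algebra_simps exp_add)
  finally show ?thesis unfolding sum_levy_al by simp
qed

lemma sum_levy_al_le: "(\<Sum>k=1..n. levy_al \<nu> k) \<le> gam"
  unfolding sum_levy_al
proof (rule integral_mono_AE)
  show "AE x in \<nu>. (1 - exp x) * (1 - exp (real n * x)) \<le> 1 - exp x"
    using neg by eventually_elim (simp add: mult_left_le)
  show "integrable \<nu> (\<lambda>x. (1 - exp x) * (1 - exp (real n * x)))"
  proof (rule Bochner_Integration.integrable_bound[OF integrable_one_minus_exp])
    show "AE x in \<nu>. norm ((1 - exp x) * (1 - exp (real n * x))) \<le> norm (1 - exp x)"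
      using neg
    proof eventually_elim
      case (elim x)
      then have "0 \<le> 1 - exp (real n * x)" "1 - exp (real n * x) \<le> 1" by (auto simp: mult_nonneg_nonpos)
      then show ?case unfolding norm_mult by (intro mult_left_le) auto
    qed
  qed measurable
qed (rule integrable_one_minus_exp)

lemma sum_levy_al_tendsto: "(\<lambda>n. \<Sum>k=1..n. levy_al \<nu> k) \<longlonglongrightarrow> gam"
  unfolding sum_levy_al
proof (rule integral_dominated_convergence[where w="\<lambda>x. 1 - exp x"])
  show "AE x in \<nu>. (\<lambda>n. (1 - exp x) * (1 - exp (real n * x))) \<longlonglongrightarrow> 1 - exp x"
    using neg
  proof eventually_elim
    case (elim x)
    then have "(\<lambda>n. (1 - exp x) * (1 - exp (real n * x))) \<longlonglongrightarrow> (1 - exp x) * (1 - 0)"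
      by (intro tendsto_intros) real_asymp
    then show ?case by simp
  qed
  show "AE x in \<nu>. norm ((1 - exp x) * (1 - exp (real n * x))) \<le> 1 - exp x" for n
    using neg
  proof eventually_elim
    case (elim x)
    then have "0 \<le> 1 - exp (real n * x)" "1 - exp (real n * x) \<le> 1" "0 \<le> 1 - exp x" by (auto simp: mult_nonneg_nonpos)
    then show ?case by (simp add: mult_left_le)
  qed
qed (measurable, rule integrable_one_minus_exp)

lemma levy_p_le: "levy_p \<nu> n \<le> real n * gam"
proof -
  have "0 \<le> (LINT x|\<nu>. 1 - exp (real n * x))"
    by (rule integral_nonneg_AE, use neg in eventually_elim) (simp add: mult_nonneg_nonpos)
  then show ?thesis by (simp add: levy_p_def)
qed

lemma gap_weights_levy_al:
  assumes "gam \<le> 1"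
  shows "gap_weights (levy_al \<nu>)"
proof
  show "(\<Sum>k=1..n. levy_al \<nu> k) \<le> 1" for n
    using sum_levy_al_le[of n] assms by simp
  have "0 < (LINT x|\<nu>. exp x * (1 - exp x))"
  proof -
    have int: "integrable \<nu> (\<lambda>x. exp x * (1 - exp x))"
      by (rule Bochner_Integration.integrable_bound[OF integrable_one_minus_exp], measurable,
          use neg in eventually_elim) (simp add: abs_mult mult_left_le_one_le)
    have nn: "AE x in \<nu>. 0 \<le> exp x * (1 - exp x)" using neg by eventually_elim simp
    have "(LINT x|\<nu>. exp x * (1 - exp x)) \<noteq> 0"
    proof
      assume "(LINT x|\<nu>. exp x * (1 - exp x)) = 0"
      then have "AE x in \<nu>. exp x * (1 - exp x) = 0"
        using integral_nonneg_eq_0_iff_AE[OF int nn] by simp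
      with neg have "AE x in \<nu>. False" by eventually_elim simp
      then show False by (simp add: not_AE_False)
    qed
    moreover have "0 \<le> (LINT x|\<nu>. exp x * (1 - exp x))" by (rule integral_nonneg_AE[OF nn])
    ultimately show ?thesis by simp
  qed
  moreover have "levy_al \<nu> 1 = gam - (LINT x|\<nu>. exp x * (1 - exp x))"
  proof -
    have "integrable \<nu> (\<lambda>x. exp x * (1 - exp x))"
      by (rule Bochner_Integration.integrable_bound[OF integrable_one_minus_exp], measurable,
          use neg in eventually_elim) (simp add: abs_mult mult_left_le_one_le)
    then have "gam - (LINT x|\<nu>. exp x * (1 - exp x)) = (LINT x|\<nu>. (1 - exp x) - exp x * (1 - exp x))"
      using integrable_one_minus_exp by simp
    also have "\<dots> = levy_al \<nu> 1"
      unfolding levy_al_def by (simp add: power2_eq_square algebra_simps)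
    finally show ?thesis ..
  qed
  ultimately show "levy_al \<nu> 1 < 1" using assms by simp
qed (rule levy_al_nonneg)

end

locale negative_cascade = negative_levy \<nu> + scattered M \<psi> \<H> \<Lambda>
  for \<nu> and M :: "'w measure" and \<psi> and \<Lambda> +
  assumes psi: "\<And>\<theta>. \<psi> \<theta> = \<i> * of_real (\<theta> * (LINT x|\<nu>. 1 - exp x)) + (CLINT x|\<nu>. iexp (\<theta> * x) - 1)"
begin

text \<open>Subtracting the drift leaves a pure jump law, to which
  \<open>nn_integral_exp_law\<close> applies with the area in the role of time.\<close>

lemma nn_integral_exp_Lam:
  assumes A: "A \<in> fmeasurable \<H>"
  shows "(\<integral>\<^sup>+\<omega>. ennreal (exp (real k * \<Lambda> A \<omega>)) \<partial>M) = ennreal (exp (levy_p \<nu> k * measure \<H> A))"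
proof -
  define t where "t = measure \<H> A"
  have t: "0 \<le> t" by (simp add: t_def)
  note [measurable] = A
  let ?X = "\<lambda>\<omega>. \<Lambda> A \<omega> - gam * t"
  let ?\<mu> = "distr M borel ?X"
  have \<mu>: "real_distribution ?\<mu>" by (intro real_distribution_distr) measurable
  have "char ?\<mu> \<theta> = exp (of_real t * (CLINT x|\<nu>. iexp (\<theta> * x) - 1))" for \<theta>
  proof -
    have "char ?\<mu> \<theta> = (CLINT \<omega>|M. iexp (\<theta> * \<Lambda> A \<omega>) * iexp (- (\<theta> * (gam * t))))"
      unfolding char_def by (subst integral_distr) (auto simp: exp_add[symmetric] algebra_simps)
    also have "\<dots> = (CLINT \<omega>|M. iexp (\<theta> * \<Lambda> A \<omega>)) * iexp (- (\<theta> * (gam * t)))"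
      by simp
    also have "(CLINT \<omega>|M. iexp (\<theta> * \<Lambda> A \<omega>)) = exp (\<psi> \<theta> * of_real t)"
      using char_Lam[OF A, of \<theta>] unfolding char_def t_def by (subst (asm) integral_distr) auto
    also have "\<dots> * iexp (- (\<theta> * (gam * t))) = exp (of_real t * (CLINT x|\<nu>. iexp (\<theta> * x) - 1))"
      unfolding psi by (simp add: exp_add[symmetric] algebra_simps)
    finally show ?thesis .
  qed
  from nn_integral_exp_law[OF t \<mu> this, of k]
  have "(\<integral>\<^sup>+\<omega>. ennreal (exp (real k * ?X \<omega>)) \<partial>M) = ennreal (exp (t * (LINT x|\<nu>. exp (real k * x) - 1)))"
    by (subst (asm) nn_integral_distr) auto
  then have "ennreal (exp (real k * (gam * t))) * (\<integral>\<^sup>+\<omega>. ennreal (exp (real k * ?X \<omega>)) \<partial>M) =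
      ennreal (exp (real k * (gam * t))) * ennreal (exp (t * (LINT x|\<nu>. exp (real k * x) - 1)))"
    by simp
  also have "ennreal (exp (real k * (gam * t))) * (\<integral>\<^sup>+\<omega>. ennreal (exp (real k * ?X \<omega>)) \<partial>M) =
      (\<integral>\<^sup>+\<omega>. ennreal (exp (real k * \<Lambda> A \<omega>)) \<partial>M)"
    by (subst nn_integral_cmult[symmetric]) (auto simp: ennreal_mult[symmetric] exp_add[symmetric] algebra_simps)
  also have "(LINT x|\<nu>. exp (real k * x) - 1) = - (LINT x|\<nu>. 1 - exp (real k * x))"
    by (subst Bochner_Integration.integral_minus[symmetric]) simp
  also have "ennreal (exp (real k * (gam * t))) * ennreal (exp (t * - (LINT x|\<nu>. 1 - exp (real k * x)))) =
      ennreal (exp (levy_p \<nu> k * t))"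
    by (simp add: ennreal_mult[symmetric] exp_add[symmetric] levy_p_def algebra_simps)
  finally show ?thesis by (simp add: t_def)
qed

end

locale subcritical_cascade = negative_cascade +
  assumes gam_le: "gam \<le> 1"

sublocale subcritical_cascade \<subseteq> gap_weights "levy_al \<nu>"
  by (rule gap_weights_levy_al[OF gam_le])

text \<open>Membership in a cone bounds its apex from both sides, while the truncation and the
  removed common part do not depend on the apex. Hence the ranks of the cones that contain a given
  point are consecutive.\<close>

lemma cone_trunc_between:
  assumes "z \<in> cone_trunc I e x" "z \<in> cone_trunc I e y" "x \<le> u" "u \<le> y"
  shows "z \<in> cone_trunc I e u"
  using assms by (auto simp: cone_trunc_def cone_rel_def cone_def)

context subcritical_cascade
begin

lemma pair_sum_eq_levy_p:
  assumes "a \<le> b" shows "pair_sum a b = levy_p \<nu> (Suc b - a)"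
  using assms
proof (induction b rule: dec_induct)
  case (step n)
  then show ?case using pair_sum_Suc[of a n] levy_p_Suc[of "Suc n - a"] by (simp add: Suc_diff_le)
qed simp

lemma excess_eq: "excess 0 n = real n - levy_p \<nu> (Suc n)"
  by (simp add: excess_def pair_sum_eq_levy_p)

text \<open>For sorted points the ranks of the cones containing \<open>z\<close> form an interval,
  and the weights of its pairs add up to \<open>levy_p\<close> of its length. Sorting is essential
  because the weight of a pair is read off from ranks.\<close>

lemma nn_integral_exp_cones:
  assumes x: "\<And>i. i < n \<Longrightarrow> x i \<in> {0..1}" and mono: "\<And>i j. i \<le> j \<Longrightarrow> j < n \<Longrightarrow> x i \<le> x j"
    and e: "0 < e" "e \<le> 1"
  shows "(\<integral>\<^sup>+\<omega>. ennreal (exp (\<Sum>i<n. \<Lambda> (cone_trunc {0..1} e (x i)) \<omega>)) \<partial>M) =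
    ennreal (exp (\<Sum>i<n. \<Sum>j\<in>{i<..<n}. levy_al \<nu> (j - i) *
      measure \<H> (cone_trunc {0..1} e (x i) \<inter> cone_trunc {0..1} e (x j))))"
proof (rule nn_integral_exp_sum_Lam_pairs)
  let ?B = "\<lambda>i. cone_trunc {0..1} e (x i)"
  show "?B i \<in> fmeasurable \<H>" if "i < n" for i
    by (intro cone_trunc_fmeasurable x that e)
  show "(\<integral>\<^sup>+\<omega>. ennreal (exp (real k * \<Lambda> A \<omega>)) \<partial>M) = ennreal (exp (levy_p \<nu> k * measure \<H> A))"
    if "A \<in> fmeasurable \<H>" for A k
    using that by (rule nn_integral_exp_Lam)
  fix z assume z: "z \<in> (\<Union>i<n. ?B i)"
  define S where "S = {i\<in>{..<n}. z \<in> ?B i}"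
  have S: "finite S" "S \<noteq> {}" using z by (auto simp: S_def)
  define a b where "a = Min S" and "b = Max S"
  have ab: "a \<in> S" "b \<in> S" "a \<le> b" using S Min_in Max_in by (auto simp: a_def b_def)
  have S_eq: "S = {a..b}"
  proof
    show "S \<subseteq> {a..b}" using S by (auto simp: a_def b_def)
    show "{a..b} \<subseteq> S"
    proof
      fix i assume i: "i \<in> {a..b}"
      have zb: "z \<in> ?B a" "z \<in> ?B b" "b < n" using ab(1,2) unfolding S_def by blast+
      have "z \<in> ?B i"
        by (rule cone_trunc_between[OF zb(1,2)]; rule mono) (use i zb(3) in simp_all)
      then show "i \<in> S" using i zb(3) by (simp add: S_def)
    qed
  qed
  have "(\<Sum>i<n. \<Sum>j\<in>{i<..<n}. if z \<in> ?B i \<and> z \<in> ?B j then levy_al \<nu> (j - i) else 0) =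
      (\<Sum>i<n. if i \<in> S then (\<Sum>j\<in>{i<..<n}. if j \<in> S then levy_al \<nu> (j - i) else 0) else 0)"
    by (intro sum.cong refl) (auto simp: S_def intro!: sum.cong)
  also have "\<dots> = (\<Sum>i\<in>S. \<Sum>j\<in>{i<..<n}. if j \<in> S then levy_al \<nu> (j - i) else 0)"
    by (subst sum.inter_filter[symmetric]) (auto simp: S_def intro!: sum.cong)
  also have "\<dots> = (\<Sum>i\<in>S. \<Sum>j\<in>{j\<in>{i<..<n}. j \<in> S}. levy_al \<nu> (j - i))"
    by (subst sum.inter_filter) auto
  also have "\<dots> = pair_sum a b"
    unfolding pair_sum_def S_eq
  proof (intro sum.cong refl)
    fix i assume "i \<in> {a..b}"
    then show "{j \<in> {i<..<n}. j \<in> {a..b}} = {i<..b}" using ab by (auto simp: S_def)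
  qed
  also have "\<dots> = levy_p \<nu> (card S)" using ab by (simp add: pair_sum_eq_levy_p S_eq)
  finally show "levy_p \<nu> (card {i\<in>{..<n}. z \<in> ?B i}) =
    (\<Sum>i<n. \<Sum>j\<in>{i<..<n}. if z \<in> ?B i \<and> z \<in> ?B j then levy_al \<nu> (j - i) else 0)"
    by (simp add: S_def)
qed

end

section \<open>Powers of integrals as integrals over ordered points\<close>

abbreviation before :: "real \<Rightarrow> real \<Rightarrow> ennreal" where
  "before x y \<equiv> (if x < y then 1 else 0)"

text \<open>The integral of \<open>g y\<^sub>1 \<cdots> g y\<^sub>n\<close> over \<open>x < y\<^sub>1 < \<cdots> < y\<^sub>n\<close>.\<close>

fun ordered_integral :: "(real \<Rightarrow> ennreal) \<Rightarrow> nat \<Rightarrow> real \<Rightarrow> ennreal" where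
  "ordered_integral g 0 x = 1"
| "ordered_integral g (Suc n) x = (\<integral>\<^sup>+y. g y * before x y * ordered_integral g n y \<partial>lborel)"

context
  fixes g :: "real \<Rightarrow> ennreal"
  assumes g [measurable]: "g \<in> borel_measurable borel"
begin

lemma ordered_integral_measurable [measurable]: "ordered_integral g n \<in> borel_measurable borel"
proof (induction n)
  case (Suc n)
  note [measurable] = Suc
  have "(\<lambda>x. \<integral>\<^sup>+y. g y * before x y * ordered_integral g n y \<partial>lborel) \<in> borel_measurable borel"
    by measurable
  then show ?case by (simp add: ordered_integral.simps(2)[abs_def])
qed simp

text \<open>A further variable beyond \<open>x\<close> takes one of \<open>n + 1\<close> positions
  relative to the ordered points. Either it precedes the first point \<open>z\<close>, which gives
  one ordered integral, or it lies beyond \<open>z\<close>, where the induction hypothesis counts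
  the other positions.\<close>

lemma tail_times_ordered_integral:
  "(\<integral>\<^sup>+y. g y * before x y \<partial>lborel) * ordered_integral g n x = of_nat (Suc n) * ordered_integral g (Suc n) x"
proof (induction n arbitrary: x)
  case (Suc n)
  define I where "I x = (\<integral>\<^sup>+y. g y * before x y \<partial>lborel)" for x
  define S where "S = ordered_integral g n"
  have [measurable]: "S \<in> borel_measurable borel" "I \<in> borel_measurable borel"
    unfolding S_def I_def[abs_def] by measurable
  have IH: "I z * S z = of_nat (Suc n) * ordered_integral g (Suc n) z" for z
    using Suc.IH[of z] by (simp only: I_def S_def)
  have split: "I x = (\<integral>\<^sup>+y. g y * before x y * before y z \<partial>lborel) + I z" if "x < z" for z
  proof -
    have "I x = (\<integral>\<^sup>+y. g y * before x y * before y z + g y * before z y \<partial>lborel)"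
      unfolding I_def
    proof (rule nn_integral_cong_AE)
      have "AE y in lborel. y \<noteq> z" by (rule AE_lborel_singleton)
      then show "AE y in lborel. g y * before x y = g y * before x y * before y z + g y * before z y"
        by eventually_elim (use that in auto)
    qed
    also have "\<dots> = (\<integral>\<^sup>+y. g y * before x y * before y z \<partial>lborel) + I z"
      unfolding I_def by (rule nn_integral_add) measurable
    finally show ?thesis .
  qed
  have "I x * ordered_integral g (Suc n) x = (\<integral>\<^sup>+z. I x * (g z * before x z * S z) \<partial>lborel)"
    by (simp add: nn_integral_cmult S_def)
  also have "\<dots> = (\<integral>\<^sup>+z. (\<integral>\<^sup>+y. g y * before x y * (g z * before y z * S z) \<partial>lborel) +
      of_nat (Suc n) * (g z * before x z * ordered_integral g (Suc n) z) \<partial>lborel)"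
  proof (rule nn_integral_cong)
    fix z :: real
    show "I x * (g z * before x z * S z) = (\<integral>\<^sup>+y. g y * before x y * (g z * before y z * S z) \<partial>lborel) +
      of_nat (Suc n) * (g z * before x z * ordered_integral g (Suc n) z)"
    proof (cases "x < z")
      case True
      have "I x * (g z * S z) = (\<integral>\<^sup>+y. g y * before x y * before y z \<partial>lborel) * (g z * S z) + g z * (I z * S z)"
        unfolding split[OF True] by (simp add: distrib_left distrib_right mult_ac)
      also have "(\<integral>\<^sup>+y. g y * before x y * before y z \<partial>lborel) * (g z * S z) =
          (\<integral>\<^sup>+y. g y * before x y * (g z * before y z * S z) \<partial>lborel)"
        by (subst nn_integral_multc[symmetric]) (auto intro!: nn_integral_cong simp: mult_ac)
      finally show ?thesis using True unfolding IH by (simp add: mult_ac)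
    next
      case False
      have "(\<integral>\<^sup>+y. g y * before x y * (g z * before y z * S z) \<partial>lborel) = (\<integral>\<^sup>+y. 0 \<partial>(lborel :: real measure))"
        using False by (intro nn_integral_cong) auto
      then show ?thesis using False by simp
    qed
  qed
  also have "\<dots> = (\<integral>\<^sup>+z. \<integral>\<^sup>+y. g y * before x y * (g z * before y z * S z) \<partial>lborel \<partial>lborel) +
      of_nat (Suc n) * ordered_integral g (Suc (Suc n)) x"
    by (subst nn_integral_add) (auto simp: nn_integral_cmult simp del: of_nat_Suc)
  also have "(\<integral>\<^sup>+z. \<integral>\<^sup>+y. g y * before x y * (g z * before y z * S z) \<partial>lborel \<partial>lborel) =
      (\<integral>\<^sup>+y. \<integral>\<^sup>+z. g y * before x y * (g z * before y z * S z) \<partial>lborel \<partial>lborel)"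
    by (rule lborel_pair.Fubini') measurable
  also have "\<dots> = ordered_integral g (Suc (Suc n)) x"
    by (simp add: nn_integral_cmult S_def)
  finally show ?case
    by (simp add: I_def distrib_right add.commute)
qed simp

lemma tail_power: "(\<integral>\<^sup>+y. g y * before x y \<partial>lborel) ^ n = fact n * ordered_integral g n x"
proof (induction n)
  case (Suc n)
  have "(\<integral>\<^sup>+y. g y * before x y \<partial>lborel) ^ Suc n =
      fact n * ((\<integral>\<^sup>+y. g y * before x y \<partial>lborel) * ordered_integral g n x)"
    by (simp add: Suc mult_ac)
  also have "\<dots> = fact (Suc n) * ordered_integral g (Suc n) x"
    unfolding tail_times_ordered_integral by (simp only: fact_Suc mult_ac of_nat_mult)
  finally show ?case .
qed simp

end

text \<open>The points are \<open>x\<close> plus partial sums of the gaps. The offset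
  \<open>a\<close> of the index set allows the first gap to be split off without renumbering the
  others.\<close>

definition gap_points :: "(real \<Rightarrow> ennreal) \<Rightarrow> nat \<Rightarrow> nat \<Rightarrow> real \<Rightarrow> (nat \<Rightarrow> real) \<Rightarrow> ennreal" where
  "gap_points g a n x s = (\<Prod>l\<in>{a..<a + n}. g (x + (\<Sum>k\<in>{a..l}. s k)) * before 0 (s l))"

lemma gap_points_measurable [measurable]:
  assumes [measurable]: "(\<lambda>p. g (fst p) (snd p)) \<in> borel_measurable (borel \<Otimes>\<^sub>M N)"
    and [measurable]: "x \<in> borel_measurable K" "\<omega> \<in> K \<rightarrow>\<^sub>M N"
    and s [measurable]: "s \<in> K \<rightarrow>\<^sub>M PiM {a..<a + n} (\<lambda>_. lborel)"
  shows "(\<lambda>k. gap_points (\<lambda>y. g y (\<omega> k)) a n (x k) (s k)) \<in> borel_measurable K"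
  unfolding gap_points_def
proof (rule borel_measurable_prod_ennreal)
  fix l assume l: "l \<in> {a..<a + n}"
  have comp: "(\<lambda>k. s k j) \<in> borel_measurable K" if "j \<in> {a..<a + n}" for j
    using measurable_compose[OF s measurable_component_singleton[OF that]] by simp
  have [measurable]: "(\<lambda>k. s k l) \<in> borel_measurable K" by (rule comp[OF l])
  have [measurable]: "(\<lambda>k. \<Sum>j\<in>{a..l}. s k j) \<in> borel_measurable K"
    by (rule borel_measurable_sum, rule comp) (use l in auto)
  have "(\<lambda>k. (x k + (\<Sum>j\<in>{a..l}. s k j), \<omega> k)) \<in> K \<rightarrow>\<^sub>M borel \<Otimes>\<^sub>M N" by measurable
  from measurable_compose[OF this assms(1)]
  have [measurable]: "(\<lambda>k. g (x k + (\<Sum>j\<in>{a..l}. s k j)) (\<omega> k)) \<in> borel_measurable K" by simp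
  show "(\<lambda>k. g (x k + (\<Sum>j\<in>{a..l}. s k j)) (\<omega> k) * before 0 (s k l)) \<in> borel_measurable K"
    by measurable
qed

lemma gap_points_measurable':
  assumes [measurable]: "g \<in> borel_measurable borel"
  shows "gap_points g a n x \<in> borel_measurable (PiM {a..<a + n} (\<lambda>_. lborel))"
proof (rule gap_points_measurable[where g="\<lambda>y (_::real). g y" and N=borel and x="\<lambda>_. x" and \<omega>="\<lambda>_. 0" and s="\<lambda>s. s"])
  show "(\<lambda>p. g (fst p)) \<in> borel_measurable (borel \<Otimes>\<^sub>M borel)" by measurable
qed (rule measurable_const measurable_ident | simp)+

lemma ordered_integral_eq_gaps:
  assumes [measurable]: "g \<in> borel_measurable borel"
  shows "ordered_integral g n x = (\<integral>\<^sup>+s. gap_points g a n x s \<partial>PiM {a..<a + n} (\<lambda>_. lborel))"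
proof (induction n arbitrary: a x)
  case 0
  show ?case by (simp add: gap_points_def PiM_empty nn_integral_count_space_finite)
next
  case (Suc n)
  interpret product_sigma_finite "\<lambda>_::nat. lborel :: real measure" by standard
  let ?J = "{Suc a..<Suc a + n}"
  have eq: "{a..<a + Suc n} = insert a ?J" by auto
  have meas: "gap_points g a (Suc n) x \<in> borel_measurable (PiM (insert a ?J) (\<lambda>_. lborel))"
    unfolding eq[symmetric] by (rule gap_points_measurable'[OF assms])
  have meas': "gap_points g (Suc a) n y \<in> borel_measurable (PiM ?J (\<lambda>_. lborel))" for y
    by (rule gap_points_measurable'[OF assms])
  have "ordered_integral g (Suc n) x = (\<integral>\<^sup>+t. g (x + t) * before 0 t * ordered_integral g n (x + t) \<partial>lborel)"
    using nn_integral_real_affine[of "\<lambda>y. g y * before x y * ordered_integral g n y" 1 x]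
    by simp
  also have "\<dots> = (\<integral>\<^sup>+t. \<integral>\<^sup>+s. gap_points g a (Suc n) x (s(a := t)) \<partial>PiM ?J (\<lambda>_. lborel) \<partial>lborel)"
  proof (rule nn_integral_cong)
    fix t :: real
    have "gap_points g a (Suc n) x (s(a := t)) = g (x + t) * before 0 t * gap_points g (Suc a) n (x + t) s" for s
    proof -
      have "(\<Sum>k\<in>{a..l}. (s(a := t)) k) = t + (\<Sum>k\<in>{Suc a..l}. s k)" if "Suc a \<le> l" for l
      proof -
        have "{a..l} = insert a {Suc a..l}" using that by auto
        then have "(\<Sum>k\<in>{a..l}. (s(a := t)) k) = t + (\<Sum>k\<in>{Suc a..l}. (s(a := t)) k)" by simp
        also have "(\<Sum>k\<in>{Suc a..l}. (s(a := t)) k) = (\<Sum>k\<in>{Suc a..l}. s k)" by (rule sum.cong) auto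
        finally show ?thesis .
      qed
      then have "(\<Prod>l\<in>?J. g (x + (\<Sum>k\<in>{a..l}. (s(a := t)) k)) * before 0 ((s(a := t)) l)) = gap_points g (Suc a) n (x + t) s"
        unfolding gap_points_def by (intro prod.cong refl) (auto simp: add.assoc)
      then show ?thesis
        unfolding gap_points_def[of g a] eq by (subst prod.insert) (auto simp: mult_ac)
    qed
    then have "(\<integral>\<^sup>+s. gap_points g a (Suc n) x (s(a := t)) \<partial>PiM ?J (\<lambda>_. lborel)) =
        (\<integral>\<^sup>+s. g (x + t) * before 0 t * gap_points g (Suc a) n (x + t) s \<partial>PiM ?J (\<lambda>_. lborel))"
      by (simp only:)
    also have "\<dots> = g (x + t) * before 0 t * (\<integral>\<^sup>+s. gap_points g (Suc a) n (x + t) s \<partial>PiM ?J (\<lambda>_. lborel))"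
      by (rule nn_integral_cmult[OF meas'])
    also have "(\<integral>\<^sup>+s. gap_points g (Suc a) n (x + t) s \<partial>PiM ?J (\<lambda>_. lborel)) = ordered_integral g n (x + t)"
      by (rule Suc.IH[symmetric])
    finally show "g (x + t) * before 0 t * ordered_integral g n (x + t) =
        (\<integral>\<^sup>+s. gap_points g a (Suc n) x (s(a := t)) \<partial>PiM ?J (\<lambda>_. lborel))" ..
  qed
  also have "\<dots> = (\<integral>\<^sup>+s. gap_points g a (Suc n) x s \<partial>PiM (insert a ?J) (\<lambda>_. lborel))"
    by (rule product_nn_integral_insert_rev[OF _ _ meas, symmetric]) auto
  finally show ?case unfolding eq .
qed

text \<open>Ordering the points costs the factorial; the first point is kept as \<open>x\<close> and
  the others are described by gaps. The ordered integral is started at -1, to the left of the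
  support of \<open>G\<close>. Tonelli moves the expectation inside.\<close>

lemma nn_integral_power_eq_gaps:
  fixes G :: "real \<Rightarrow> 'w \<Rightarrow> ennreal"
  assumes "sigma_finite_measure M"
    and G: "(\<lambda>p. G (fst p) (snd p)) \<in> borel_measurable (borel \<Otimes>\<^sub>M M)"
    and zero: "\<And>x \<omega>. x \<le> -1 \<Longrightarrow> G x \<omega> = 0"
  shows "(\<integral>\<^sup>+\<omega>. (\<integral>\<^sup>+x. G x \<omega> \<partial>lborel) ^ Suc n \<partial>M) =
    fact (Suc n) * (\<integral>\<^sup>+x. \<integral>\<^sup>+s. \<integral>\<^sup>+\<omega>. G x \<omega> * gap_points (\<lambda>y. G y \<omega>) 0 n x s \<partial>M
      \<partial>PiM {0..<n} (\<lambda>_. lborel) \<partial>lborel)"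
proof -
  interpret M: sigma_finite_measure M by fact
  interpret product_sigma_finite "\<lambda>_::nat. lborel :: real measure" by standard
  let ?P = "PiM {0..<n} (\<lambda>_. lborel :: real measure)"
  interpret P: sigma_finite_measure ?P
    using sigma_finite[of "{0..<n}"] by simp
  note [measurable] = G
  have Gw: "(\<lambda>x. G x \<omega>) \<in> borel_measurable borel" if "\<omega> \<in> space M" for \<omega>
  proof -
    have "(\<lambda>x. (x, \<omega>)) \<in> borel \<rightarrow>\<^sub>M borel \<Otimes>\<^sub>M M" using that by measurable
    from measurable_compose[OF this G] show ?thesis by simp
  qed
  have gp [measurable]: "(\<lambda>k. gap_points (\<lambda>y. G y (\<omega> k)) 0 n (x k) (s k)) \<in> borel_measurable K"
    if "x \<in> borel_measurable K" "\<omega> \<in> K \<rightarrow>\<^sub>M M" "s \<in> K \<rightarrow>\<^sub>M ?P" for K :: "'k measure" and x \<omega> s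
    using gap_points_measurable[OF G that(1,2), of s 0 n] that(3) by simp
  have GG [measurable]: "(\<lambda>k. G (x k) (\<omega> k)) \<in> borel_measurable K"
    if "x \<in> borel_measurable K" "\<omega> \<in> K \<rightarrow>\<^sub>M M" for K :: "'k measure" and x \<omega>
  proof -
    have "(\<lambda>k. (x k, \<omega> k)) \<in> K \<rightarrow>\<^sub>M borel \<Otimes>\<^sub>M M" using that by measurable
    from measurable_compose[OF this G] show ?thesis by simp
  qed
  have inner: "(\<lambda>k. \<integral>\<^sup>+s. G (x k) (\<omega> k) * gap_points (\<lambda>y. G y (\<omega> k)) 0 n (x k) s \<partial>?P) \<in> borel_measurable K"
    if [measurable]: "x \<in> borel_measurable K" "\<omega> \<in> K \<rightarrow>\<^sub>M M" for K :: "'k measure" and x \<omega>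
    by (rule P.borel_measurable_nn_integral)
      (simp only: case_prod_beta', intro borel_measurable_times_ennreal GG gp; measurable)
  have "(\<integral>\<^sup>+\<omega>. (\<integral>\<^sup>+x. G x \<omega> \<partial>lborel) ^ Suc n \<partial>M) =
    (\<integral>\<^sup>+\<omega>. fact (Suc n) * (\<integral>\<^sup>+x. \<integral>\<^sup>+s. G x \<omega> * gap_points (\<lambda>y. G y \<omega>) 0 n x s \<partial>?P \<partial>lborel) \<partial>M)"
  proof (rule nn_integral_cong)
    fix \<omega> assume \<omega>: "\<omega> \<in> space M"
    let ?g = "\<lambda>x. G x \<omega>"
    have [measurable]: "?g \<in> borel_measurable borel" by (rule Gw[OF \<omega>])
    have before: "G x \<omega> * before (- 1) x = G x \<omega>" for x using zero[of x \<omega>] by auto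
    have "(\<integral>\<^sup>+x. G x \<omega> \<partial>lborel) ^ Suc n = (\<integral>\<^sup>+x. G x \<omega> * before (- 1) x \<partial>lborel) ^ Suc n"
      by (simp only: before)
    also have "\<dots> = fact (Suc n) * ordered_integral ?g (Suc n) (- 1)"
      by (rule tail_power) measurable
    also have "ordered_integral ?g (Suc n) (- 1) = (\<integral>\<^sup>+x. G x \<omega> * (\<integral>\<^sup>+s. gap_points ?g 0 n x s \<partial>?P) \<partial>lborel)"
      using ordered_integral_eq_gaps[of ?g n _ 0] by (simp add: before)
    also have "\<dots> = (\<integral>\<^sup>+x. \<integral>\<^sup>+s. G x \<omega> * gap_points ?g 0 n x s \<partial>?P \<partial>lborel)"
      using \<omega> by (intro nn_integral_cong nn_integral_cmult[symmetric] gp) auto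
    finally show "(\<integral>\<^sup>+x. G x \<omega> \<partial>lborel) ^ Suc n =
      fact (Suc n) * (\<integral>\<^sup>+x. \<integral>\<^sup>+s. G x \<omega> * gap_points ?g 0 n x s \<partial>?P \<partial>lborel)" .
  qed
  also have "\<dots> = fact (Suc n) * (\<integral>\<^sup>+\<omega>. \<integral>\<^sup>+x. \<integral>\<^sup>+s. G x \<omega> * gap_points (\<lambda>y. G y \<omega>) 0 n x s \<partial>?P \<partial>lborel \<partial>M)"
    by (rule nn_integral_cmult, rule lborel.borel_measurable_nn_integral)
      (simp only: case_prod_beta', rule inner; measurable)
  also have "(\<integral>\<^sup>+\<omega>. \<integral>\<^sup>+x. \<integral>\<^sup>+s. G x \<omega> * gap_points (\<lambda>y. G y \<omega>) 0 n x s \<partial>?P \<partial>lborel \<partial>M) =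
    (\<integral>\<^sup>+x. \<integral>\<^sup>+\<omega>. \<integral>\<^sup>+s. G x \<omega> * gap_points (\<lambda>y. G y \<omega>) 0 n x s \<partial>?P \<partial>M \<partial>lborel)"
  proof -
    interpret pair_sigma_finite lborel M ..
    show ?thesis
      by (rule Fubini')
        (simp only: case_prod_beta', rule inner; measurable)
  qed
  also have "\<dots> = (\<integral>\<^sup>+x. \<integral>\<^sup>+s. \<integral>\<^sup>+\<omega>. G x \<omega> * gap_points (\<lambda>y. G y \<omega>) 0 n x s \<partial>M \<partial>?P \<partial>lborel)"
  proof (rule nn_integral_cong)
    fix x :: real
    interpret pair_sigma_finite ?P M ..
    show "(\<integral>\<^sup>+\<omega>. \<integral>\<^sup>+s. G x \<omega> * gap_points (\<lambda>y. G y \<omega>) 0 n x s \<partial>?P \<partial>M) =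
      (\<integral>\<^sup>+s. \<integral>\<^sup>+\<omega>. G x \<omega> * gap_points (\<lambda>y. G y \<omega>) 0 n x s \<partial>M \<partial>?P)"
      by (rule Fubini')
        (simp only: case_prod_beta', intro borel_measurable_times_ennreal GG gp; measurable)
  qed
  finally show ?thesis .
qed

section \<open>Moments of the truncated cascade\<close>

lemma cadlag_on_right_limit:
  assumes "cadlag_on I f" "t \<in> I" "\<And>n. x n \<in> I" "\<And>n. t \<le> x n" "x \<longlonglongrightarrow> t"
  shows "(\<lambda>n. f (x n)) \<longlonglongrightarrow> f t"
proof -
  let ?S = "insert t (I \<inter> {t<..})"
  have "?S - {t} = I \<inter> {t<..} - {t}" by auto
  then have "at t within ?S = at t within I \<inter> {t<..}"
    unfolding at_within_def by (simp only:)
  then have "continuous (at t within ?S) f"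
    using assms(1,2) by (simp add: continuous_within cadlag_on_def)
  moreover have "x n \<in> ?S" for n using assms(3,4)[of n] by auto
  ultimately show ?thesis
    using assms(5) unfolding continuous_within_sequentially by (auto simp: o_def)
qed

text \<open>The least multiple of \<open>1 / (k + 1)\<close> that is not below \<open>x\<close>. The
  approximation is from the right because that is the side on which cadlag paths are
  continuous.\<close>

definition right_grid :: "nat \<Rightarrow> real \<Rightarrow> real" where
  "right_grid k x = real_of_int \<lceil>real (Suc k) * x\<rceil> / real (Suc k)"

lemma right_grid_ge: "x \<le> right_grid k x"
  by (simp add: right_grid_def le_divide_eq mult.commute del: of_nat_Suc)

lemma right_grid_le: "right_grid k x \<le> x + 1 / real (Suc k)"
proof -
  have "real_of_int \<lceil>real (Suc k) * x\<rceil> \<le> real (Suc k) * x + 1" by linarith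
  then show ?thesis by (simp add: right_grid_def field_simps del: of_nat_Suc)
qed

lemma right_grid_tendsto: "(\<lambda>k. right_grid k x) \<longlonglongrightarrow> x"
proof (rule tendsto_sandwich)
  show "(\<lambda>_. x) \<longlonglongrightarrow> x" by simp
  show "(\<lambda>k. x + 1 / real (Suc k)) \<longlonglongrightarrow> x" by real_asymp
qed (intro always_eventually allI right_grid_ge right_grid_le)+

lemma right_grid_mem:
  assumes x: "x \<in> {0..1}"
  shows "right_grid k x \<in> {0..1}"
proof -
  have "0 \<le> right_grid k x" using right_grid_ge[of x k] x by simp
  moreover have "\<lceil>real (Suc k) * x\<rceil> \<le> int (Suc k)"
    using x by (simp add: ceiling_le_iff mult_left_le del: of_nat_Suc)
  then have "real_of_int \<lceil>real (Suc k) * x\<rceil> \<le> real (Suc k)" by linarith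
  then have "right_grid k x \<le> 1" by (simp add: right_grid_def del: of_nat_Suc)
  ultimately show ?thesis by simp
qed

locale cascade_versions = scattered M \<psi> \<H> \<Lambda>
  for M :: "'w measure" and \<psi> and \<Lambda> +
  fixes Y :: "real \<Rightarrow> real \<Rightarrow> 'w \<Rightarrow> real"
  assumes Y: "\<And>\<epsilon>. 0 < \<epsilon> \<Longrightarrow> cadlag_modification M {0..1} (\<lambda>t. \<Lambda> (cone_trunc {0..1} \<epsilon> t)) (Y \<epsilon>)"
begin

definition dens :: "real \<Rightarrow> real \<Rightarrow> 'w \<Rightarrow> ennreal" where
  "dens e x \<omega> = (if x \<in> {0..1} then ennreal (exp (Y e x \<omega>)) else 0)"

definition approx_mass :: "real \<Rightarrow> 'w \<Rightarrow> ennreal" where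
  "approx_mass e \<omega> = (\<integral>\<^sup>+x. dens e x \<omega> \<partial>lborel)"

lemma Y_measurable: "0 < e \<Longrightarrow> x \<in> {0..1} \<Longrightarrow> Y e x \<in> borel_measurable M"
  using Y[of e] by (simp add: cadlag_modification_def)

lemma dens_AE:
  assumes "0 < e" "x \<in> {0..1}"
  shows "AE \<omega> in M. dens e x \<omega> = ennreal (exp (\<Lambda> (cone_trunc {0..1} e x) \<omega>))"
  using Y[OF assms(1)] assms(2) by (auto simp: cadlag_modification_def dens_def)

lemma Y_right_limit:
  assumes "0 < e" "\<omega> \<in> space M" "t \<in> {0..1}" "\<And>n. x n \<in> {0..1}" "\<And>n. t \<le> x n" "x \<longlonglongrightarrow> t"
  shows "(\<lambda>n. Y e (x n) \<omega>) \<longlonglongrightarrow> Y e t \<omega>"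
  using cadlag_on_right_limit[of "{0..1}" "\<lambda>t. Y e t \<omega>" t x] Y[OF assms(1)] assms(2-)
  by (simp add: cadlag_modification_def)

text \<open>For fixed position the field is a random variable, and for fixed outcome the path is
  right-continuous. Evaluated at grid points the field depends on the position through countably
  many values and is jointly measurable; right-continuity carries this over to the limit.\<close>

lemma dens_measurable:
  assumes e: "0 < e"
  shows "(\<lambda>p. dens e (fst p) (snd p)) \<in> borel_measurable (borel \<Otimes>\<^sub>M M)"
proof -
  \<comment> \<open>Clamping keeps the grid points inside the unit interval, the only place where
    \<open>Y\<close> is known to be measurable. For positions in the interval it changes
    nothing.\<close>
  let ?q = "\<lambda>k (i::int). max 0 (min 1 (real_of_int i / real (Suc k)))"
  let ?F = "\<lambda>k p. indicator {0..1} (fst p) * exp (Y e (?q k \<lceil>real (Suc k) * fst p\<rceil>) (snd p))"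
  have "?F k \<in> borel_measurable (borel \<Otimes>\<^sub>M M)" for k
  proof -
    have "(\<lambda>p. Y e (?q k i) (snd p)) \<in> borel_measurable (borel \<Otimes>\<^sub>M M)" for i
      by (rule measurable_compose[OF measurable_snd Y_measurable[OF e]]) auto
    moreover have "(\<lambda>p. \<lceil>real (Suc k) * fst p\<rceil>) \<in> borel \<Otimes>\<^sub>M M \<rightarrow>\<^sub>M count_space UNIV"
      by measurable
    ultimately have "(\<lambda>p. Y e (?q k \<lceil>real (Suc k) * fst p\<rceil>) (snd p)) \<in> borel_measurable (borel \<Otimes>\<^sub>M M)"
      by (rule measurable_compose_countable)
    moreover have "(\<lambda>p. indicator {0..1::real} (fst p) :: real) \<in> borel_measurable (borel \<Otimes>\<^sub>M M)"
      by (rule measurable_compose[OF measurable_fst borel_measurable_indicator]) simp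
    ultimately show ?thesis
      by (intro borel_measurable_times borel_measurable_exp[THEN measurable_compose[rotated]])
  qed
  moreover have "(\<lambda>k. ?F k p) \<longlonglongrightarrow> indicator {0..1} (fst p) * exp (Y e (fst p) (snd p))"
    if "p \<in> space (borel \<Otimes>\<^sub>M M)" for p
  proof (cases "fst p \<in> {0..1}")
    case True
    have q: "?q k \<lceil>real (Suc k) * fst p\<rceil> = right_grid k (fst p)" for k
      using right_grid_mem[OF True, of k] by (simp add: right_grid_def del: of_nat_Suc)
    have "(\<lambda>k. Y e (right_grid k (fst p)) (snd p)) \<longlonglongrightarrow> Y e (fst p) (snd p)"
      using that True right_grid_mem[OF True]
      by (intro Y_right_limit e right_grid_tendsto right_grid_ge) (auto simp: space_pair_measure)
    then show ?thesis unfolding q by (intro tendsto_intros)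
  qed simp
  ultimately have "(\<lambda>p. indicator {0..1} (fst p) * exp (Y e (fst p) (snd p))) \<in> borel_measurable (borel \<Otimes>\<^sub>M M)"
    by (rule borel_measurable_LIMSEQ_metric)
  then have "(\<lambda>p. ennreal (indicator {0..1} (fst p) * exp (Y e (fst p) (snd p)))) \<in> borel_measurable (borel \<Otimes>\<^sub>M M)"
    by (rule measurable_compose[OF _ measurable_ennreal])
  also have "(\<lambda>p. ennreal (indicator {0..1} (fst p) * exp (Y e (fst p) (snd p)))) = (\<lambda>p. dens e (fst p) (snd p))"
    by (auto simp: dens_def indicator_def)
  finally show ?thesis .
qed

lemma dens_measurable_fst:
  assumes "0 < e" "\<omega> \<in> space M"
  shows "(\<lambda>x. dens e x \<omega>) \<in> borel_measurable borel"
proof -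
  have "(\<lambda>x. (x, \<omega>)) \<in> borel \<rightarrow>\<^sub>M borel \<Otimes>\<^sub>M M" using assms(2) by measurable
  from measurable_compose[OF this dens_measurable[OF assms(1)]] show ?thesis by simp
qed

lemma dens_measurable_snd:
  assumes "0 < e"
  shows "dens e x \<in> borel_measurable M"
proof -
  have "(\<lambda>\<omega>. (x, \<omega>)) \<in> M \<rightarrow>\<^sub>M borel \<Otimes>\<^sub>M M" by measurable
  from measurable_compose[OF this dens_measurable[OF assms(1)]] show ?thesis by simp
qed

lemma approx_mass_measurable:
  assumes "0 < e"
  shows "approx_mass e \<in> borel_measurable M"
proof -
  have "(\<lambda>p. (snd p, fst p)) \<in> M \<Otimes>\<^sub>M lborel \<rightarrow>\<^sub>M borel \<Otimes>\<^sub>M M" by measurable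
  from measurable_compose[OF this dens_measurable[OF assms]]
  show ?thesis
    unfolding approx_mass_def[abs_def]
    by (intro lborel.borel_measurable_nn_integral) (simp add: case_prod_beta')
qed

end

locale subcritical_versions = cascade_versions M \<psi> \<Lambda> Y + subcritical_cascade \<nu> M \<psi> \<Lambda>
  for M :: "'w measure" and \<psi> \<Lambda> Y \<nu>
begin

lemma nn_integral_prod_dens:
  assumes e: "0 < e" "e \<le> 1" and x: "\<And>i. i < n \<Longrightarrow> x i \<in> {0..1}"
    and mono: "\<And>i j. i \<le> j \<Longrightarrow> j < n \<Longrightarrow> x i \<le> x j"
  shows "(\<integral>\<^sup>+\<omega>. (\<Prod>i<n. dens e (x i) \<omega>) \<partial>M) = ennreal (exp (\<Sum>i<n. \<Sum>j\<in>{i<..<n}. levy_al \<nu> (j - i) *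
      measure \<H> (cone_trunc {0..1} e (x i) \<inter> cone_trunc {0..1} e (x j))))"
proof -
  have "AE \<omega> in M. \<forall>i\<in>{..<n}. dens e (x i) \<omega> = ennreal (exp (\<Lambda> (cone_trunc {0..1} e (x i)) \<omega>))"
    using dens_AE[OF e(1)] x by (subst AE_finite_all) auto
  then have "(\<integral>\<^sup>+\<omega>. (\<Prod>i<n. dens e (x i) \<omega>) \<partial>M) =
      (\<integral>\<^sup>+\<omega>. ennreal (exp (\<Sum>i<n. \<Lambda> (cone_trunc {0..1} e (x i)) \<omega>)) \<partial>M)"
  proof (intro nn_integral_cong_AE, eventually_elim)
    case (elim \<omega>)
    then show ?case by (simp add: exp_sum prod_ennreal)
  qed
  then show ?thesis using nn_integral_exp_cones[OF x mono e] by simp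
qed

text \<open>On the support the gaps add up to at most one, so exp \<theta> times the product of the
  factors exp (- \<theta> s) is at least one. Inserting it costs exp \<theta> and replaces the joint
  constraint by weights on single gaps.\<close>

lemma nn_integral_gap_points_dens_le:
  assumes e: "0 < e" "e \<le> 1" and \<theta>: "0 \<le> \<theta>"
  shows "(\<integral>\<^sup>+\<omega>. dens e x \<omega> * gap_points (\<lambda>y. dens e y \<omega>) 0 n x s \<partial>M) \<le>
    ennreal (exp \<theta> * indicator {0..1} x) * ennreal (gap_prod 0 n s * (\<Prod>l\<in>{0..<n}. gap_weight \<theta> 1 (s l)))"
proof -
  \<comment> \<open>\<open>n\<close> gaps give \<open>n + 1\<close> points; the point of rank 0 is
    \<open>x\<close> itself.\<close>
  define pt where "pt i = x + (\<Sum>k\<in>{0..<i}. s k)" for i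
  have shift: "pt (Suc i) = x + (\<Sum>k\<in>{0..i}. s k)" for i by (simp add: pt_def atLeastLessThanSuc_atLeastAtMost)
  have eq: "dens e x \<omega> * gap_points (\<lambda>y. dens e y \<omega>) 0 n x s =
      (\<Prod>i<Suc n. dens e (pt i) \<omega>) * (\<Prod>l<n. before 0 (s l))" for \<omega>
    unfolding gap_points_def prod.distrib prod.lessThan_Suc_shift shift[symmetric]
    by (simp add: pt_def lessThan_atLeast0 mult.assoc)
  show ?thesis
  proof (cases "(\<forall>l<n. 0 < s l) \<and> (\<forall>i<Suc n. pt i \<in> {0..1})")
    case False
    then consider l where "l < n" "\<not> 0 < s l" | i where "i < Suc n" "pt i \<notin> {0..1}" by auto
    then have z: "(\<Prod>i<Suc n. dens e (pt i) \<omega>) * (\<Prod>l<n. before 0 (s l)) = 0" for \<omega>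
    proof cases
      case 1
      then have "(\<Prod>l<n. before 0 (s l)) = 0" by (intro prod_zero) auto
      then show ?thesis by simp
    next
      case 2
      then have "(\<Prod>i<Suc n. dens e (pt i) \<omega>) = 0" by (intro prod_zero) (auto simp: dens_def)
      then show ?thesis by simp
    qed
    show ?thesis unfolding eq z by simp
  next
    case True
    then have pos: "\<And>l. l < n \<Longrightarrow> 0 < s l" and pt: "\<And>i. i < Suc n \<Longrightarrow> pt i \<in> {0..1}" by auto
    have diff: "pt j - pt i = (\<Sum>l\<in>{i..<j}. s l)" if "i \<le> j" for i j
    proof -
      have "{0..<j} = {0..<i} \<union> {i..<j}" using that by auto
      then show ?thesis by (simp add: pt_def sum.union_disjoint)
    qed
    have less: "pt i < pt j" if "i < j" "j < Suc n" for i j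
    proof -
      have "0 < (\<Sum>l\<in>{i..<j}. s l)" using that pos by (intro sum_pos) auto
      with diff[of i j] that show ?thesis by simp
    qed
    have mono: "pt i \<le> pt j" if "i \<le> j" "j < Suc n" for i j
      using less[of i j] that by (cases "i = j") auto
    have before: "(\<Prod>l<n. before 0 (s l)) = 1" using pos by (intro prod.neutral) auto
    have "(\<integral>\<^sup>+\<omega>. dens e x \<omega> * gap_points (\<lambda>y. dens e y \<omega>) 0 n x s \<partial>M) =
        ennreal (exp (\<Sum>i<Suc n. \<Sum>j\<in>{i<..<Suc n}. levy_al \<nu> (j - i) *
          measure \<H> (cone_trunc {0..1} e (pt i) \<inter> cone_trunc {0..1} e (pt j))))"
      unfolding eq before mult_1_right by (rule nn_integral_prod_dens[OF e pt mono])
    also have "\<dots> \<le> ennreal (gap_prod 0 n s)"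
    proof (rule ennreal_leI)
      have "gap_prod 0 n s = (\<Prod>i<Suc n. \<Prod>j\<in>{i<..<Suc n}. exp (levy_al \<nu> (j - i) * - ln (pt j - pt i)))"
        unfolding gap_prod_def
      proof (intro prod.cong)
        fix i j assume "i \<in> {..<Suc n}" "j \<in> {i<..<Suc n}"
        then have ij: "i < j" "j < Suc n" by auto
        then have "0 < (\<Sum>l\<in>{i..<j}. s l)" using less[OF ij] diff[of i j] by simp
        then show "(\<Sum>l\<in>{i..<j}. s l) powr - levy_al \<nu> (j - i) = exp (levy_al \<nu> (j - i) * - ln (pt j - pt i))"
          using ij by (simp add: powr_def diff)
      qed auto
      also have "\<dots> = exp (\<Sum>i<Suc n. \<Sum>j\<in>{i<..<Suc n}. levy_al \<nu> (j - i) * - ln (pt j - pt i))"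
        by (simp only: exp_sum finite_lessThan finite_greaterThanLessThan)
      finally have "gap_prod 0 n s = exp (\<Sum>i<Suc n. \<Sum>j\<in>{i<..<Suc n}. levy_al \<nu> (j - i) * - ln (pt j - pt i))" .
      moreover have "(\<Sum>i<Suc n. \<Sum>j\<in>{i<..<Suc n}. levy_al \<nu> (j - i) *
          measure \<H> (cone_trunc {0..1} e (pt i) \<inter> cone_trunc {0..1} e (pt j))) \<le>
        (\<Sum>i<Suc n. \<Sum>j\<in>{i<..<Suc n}. levy_al \<nu> (j - i) * - ln (pt j - pt i))"
      proof (intro sum_mono mult_left_mono levy_al_nonneg)
        fix i j assume "i \<in> {..<Suc n}" "j \<in> {i<..<Suc n}"
        then have ij: "i < j" "i < Suc n" "j < Suc n" by auto
        show "measure \<H> (cone_trunc {0..1} e (pt i) \<inter> cone_trunc {0..1} e (pt j)) \<le> - ln (pt j - pt i)"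
          using pt[OF ij(2)] pt[OF ij(3)] less[OF ij(1,3)] e by (intro measure_cone_trunc_Int_le) auto
      qed
      ultimately show "exp (\<Sum>i<Suc n. \<Sum>j\<in>{i<..<Suc n}. levy_al \<nu> (j - i) *
          measure \<H> (cone_trunc {0..1} e (pt i) \<inter> cone_trunc {0..1} e (pt j))) \<le> gap_prod 0 n s"
        by (simp only: exp_le_cancel_iff)
    qed
    also have "\<dots> \<le> ennreal (exp \<theta> * indicator {0..1} x * (gap_prod 0 n s * (\<Prod>l\<in>{0..<n}. gap_weight \<theta> 1 (s l))))"
    proof (rule ennreal_leI)
      have x: "x \<in> {0..1}" using pt[of 0] by (simp add: pt_def)
      have sum: "(\<Sum>l\<in>{0..<n}. s l) \<le> 1" using pt[of n] x diff[of 0 n] by (simp add: pt_def)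
      have "s l \<le> 1" if "l < n" for l
      proof -
        have "s l \<le> (\<Sum>l\<in>{0..<n}. s l)"
          using that pos by (intro member_le_sum) (auto intro: less_imp_le)
        with sum show ?thesis by simp
      qed
      then have "(\<Prod>l\<in>{0..<n}. gap_weight \<theta> 1 (s l)) = (\<Prod>l\<in>{0..<n}. exp (- (\<theta> * s l)))"
        using pos by (intro prod.cong) (auto simp: gap_weight_def)
      also have "\<dots> = exp (- (\<theta> * (\<Sum>l\<in>{0..<n}. s l)))"
        by (simp add: exp_sum[symmetric] sum_negf sum_distrib_left)
      finally have "exp \<theta> * (\<Prod>l\<in>{0..<n}. gap_weight \<theta> 1 (s l)) = exp (\<theta> - \<theta> * (\<Sum>l\<in>{0..<n}. s l))"
        by (simp add: exp_diff exp_minus field_simps)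
      moreover have "0 \<le> \<theta> - \<theta> * (\<Sum>l\<in>{0..<n}. s l)"
        using mult_left_mono[OF sum \<theta>] by simp
      ultimately have "1 \<le> exp \<theta> * (\<Prod>l\<in>{0..<n}. gap_weight \<theta> 1 (s l))" by simp
      then have "gap_prod 0 n s * 1 \<le> gap_prod 0 n s * (exp \<theta> * (\<Prod>l\<in>{0..<n}. gap_weight \<theta> 1 (s l)))"
        by (intro mult_left_mono gap_prod_nonneg)
      then show "gap_prod 0 n s \<le> exp \<theta> * indicator {0..1} x * (gap_prod 0 n s * (\<Prod>l\<in>{0..<n}. gap_weight \<theta> 1 (s l)))"
        using x by (simp add: mult_ac)
    qed
    also have "\<dots> = ennreal (exp \<theta> * indicator {0..1} x) * ennreal (gap_prod 0 n s * (\<Prod>l\<in>{0..<n}. gap_weight \<theta> 1 (s l)))"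
      by (rule ennreal_mult) (auto intro!: mult_nonneg_nonneg gap_prod_nonneg prod_nonneg gap_weight_nonneg)
    finally show ?thesis .
  qed
qed

text \<open>The gap integral bound for \<theta> = n + 1. Any choice of \<theta> proportional to n
  would change it by a geometric factor only, which is invisible at the scale n ln n. The truncation
  does not occur, so the bound passes to the limit.\<close>

definition upper_const :: "nat \<Rightarrow> real" where
  "upper_const n = fact (Suc n) * (exp (real (Suc n)) * (gap_base ^ n * (1 / real (Suc n)) powr excess 0 n))"

lemma approx_moment_le:
  assumes e: "0 < e" "e \<le> 1"
  shows "(\<integral>\<^sup>+\<omega>. approx_mass e \<omega> ^ Suc n \<partial>M) \<le> ennreal (upper_const n)"
proof -
  define \<theta> where "\<theta> = real (Suc n)"
  have \<theta>: "0 < \<theta>" "1 \<le> \<theta>" by (auto simp: \<theta>_def)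
  have sf: "sigma_finite_measure M" ..
  have "(\<integral>\<^sup>+\<omega>. approx_mass e \<omega> ^ Suc n \<partial>M) = fact (Suc n) *
      (\<integral>\<^sup>+x. \<integral>\<^sup>+s. \<integral>\<^sup>+\<omega>. dens e x \<omega> * gap_points (\<lambda>y. dens e y \<omega>) 0 n x s \<partial>M
      \<partial>PiM {0..<n} (\<lambda>_. lborel) \<partial>lborel)"
    unfolding approx_mass_def
    by (rule nn_integral_power_eq_gaps[OF sf dens_measurable[OF e(1)]]) (auto simp: dens_def)
  also have "\<dots> \<le> fact (Suc n) * (\<integral>\<^sup>+x. \<integral>\<^sup>+s. ennreal (exp \<theta> * indicator {0..1::real} x) *
      ennreal (gap_prod 0 n s * (\<Prod>l\<in>{0..<n}. gap_weight \<theta> 1 (s l))) \<partial>PiM {0..<n} (\<lambda>_. lborel) \<partial>lborel)"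
    by (rule mult_left_mono, intro nn_integral_mono nn_integral_gap_points_dens_le e) (use \<theta> in auto)
  also have "(\<integral>\<^sup>+x. \<integral>\<^sup>+s. ennreal (exp \<theta> * indicator {0..1::real} x) *
      ennreal (gap_prod 0 n s * (\<Prod>l\<in>{0..<n}. gap_weight \<theta> 1 (s l))) \<partial>PiM {0..<n} (\<lambda>_. lborel) \<partial>lborel) =
      (\<integral>\<^sup>+x. ennreal (exp \<theta>) * indicator {0..1::real} x * gap_integral \<theta> 0 n 1 \<partial>lborel)"
    unfolding gap_integral_def
    by (intro nn_integral_cong, subst nn_integral_cmult)
      (auto intro!: measurable_compose[OF gap_integrand_measurable measurable_ennreal] simp: indicator_def)
  also have "\<dots> = ennreal (exp \<theta>) * gap_integral \<theta> 0 n 1"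
    by (subst nn_integral_multc) (auto simp: nn_integral_cmult)
  also have "gap_integral \<theta> 0 n 1 \<le> ennreal (gap_base ^ n * (1 / \<theta>) powr excess 0 n)"
  proof -
    have "gap_integral \<theta> 0 n 1 \<le> ennreal (gap_base ^ n / (real (n + 1))\<^sup>2 * (1 / \<theta>) powr excess 0 n)"
      using gap_integral_le[OF \<theta>(1), of 1 0 n] \<theta> by (simp add: min_absorb2)
    also have "\<dots> \<le> ennreal (gap_base ^ n / 1 * (1 / \<theta>) powr excess 0 n)"
      using gap_base_pos by (intro ennreal_leI mult_right_mono divide_left_mono) auto
    finally show ?thesis by simp
  qed
  finally have "(\<integral>\<^sup>+\<omega>. approx_mass e \<omega> ^ Suc n \<partial>M) \<le>
      fact (Suc n) * (ennreal (exp \<theta>) * ennreal (gap_base ^ n * (1 / \<theta>) powr excess 0 n))"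
    by (simp add: mult_left_mono)
  also have "\<dots> = ennreal (upper_const n)"
  proof -
    have "(fact (Suc n) :: ennreal) = ennreal (fact (Suc n))"
      by (metis ennreal_of_nat_eq_real_of_nat of_nat_fact)
    then show ?thesis
      using gap_base_pos by (simp add: upper_const_def \<theta>_def ennreal_mult)
  qed
  finally show ?thesis .
qed

end

section \<open>Lower bound for the moments of the truncated masses\<close>

lemma ennreal_power_add_ge:
  fixes a b :: ennreal
  shows "of_nat (Suc n) * a ^ n * b \<le> (a + b) ^ Suc n"
proof (induction n)
  case (Suc n)
  have "of_nat (Suc (Suc n)) * a ^ Suc n * b = a * (of_nat (Suc n) * a ^ n * b) + b * a ^ Suc n"
    by (simp add: distrib_right distrib_left mult_ac add_ac)
  also have "\<dots> \<le> a * (a + b) ^ Suc n + b * (a + b) ^ Suc n"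
    by (intro add_mono mult_left_mono Suc power_mono) auto
  also have "\<dots> = (a + b) ^ Suc (Suc n)"
    by (simp add: distrib_right)
  finally show ?case .
qed simp

text \<open>The multinomial term in which every variable occurs once. In the induction one keeps the
  term of the binomial expansion that is linear in the new variable.\<close>

lemma fact_mult_prod_le_power_sum:
  fixes a :: "nat \<Rightarrow> ennreal"
  shows "fact n * (\<Prod>i<n. a i) \<le> (\<Sum>i<n. a i) ^ n"
proof (induction n)
  case (Suc n)
  have "fact (Suc n) * (\<Prod>i<Suc n. a i) = of_nat (Suc n) * (fact n * (\<Prod>i<n. a i)) * a n"
    by (simp add: mult_ac del: of_nat_Suc)
  also have "\<dots> \<le> of_nat (Suc n) * (\<Sum>i<n. a i) ^ n * a n"
    by (intro mult_right_mono mult_left_mono Suc) auto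
  also have "\<dots> \<le> (\<Sum>i<Suc n. a i) ^ Suc n"
    using ennreal_power_add_ge by simp
  finally show ?case .
qed simp

definition grid_cell :: "nat \<Rightarrow> nat \<Rightarrow> real set" where
  "grid_cell n i = {real i / real n<..<(real i + 1) / real n}"

lemma grid_cell_measurable [measurable]: "grid_cell n i \<in> sets borel"
  by (simp add: grid_cell_def)

lemma disjoint_grid_cells: "disjoint_family (grid_cell n)"
proof -
  have False if "x \<in> grid_cell n i" "x \<in> grid_cell n j" "i < j" for x i j
  proof -
    have "(real i + 1) / real n \<le> real j / real n" using that(3) by (intro divide_right_mono) auto
    with that show False by (simp add: grid_cell_def)
  qed
  then show ?thesis unfolding disjoint_family_on_def by (metis disjoint_iff linorder_neqE_nat)
qed

lemma sum_indicator_grid_cells_le: "(\<Sum>i<n. indicator (grid_cell n i) x) \<le> (1::ennreal)"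
proof -
  have "(\<Sum>i<n. indicator (grid_cell n i) x) = (indicator (\<Union>i<n. grid_cell n i) x :: ennreal)"
    by (rule indicator_UN_disjoint[symmetric])
      (use disjoint_family_on_mono[OF _ disjoint_grid_cells] in auto)
  then show ?thesis by (simp add: indicator_def)
qed

lemma grid_cell_mem:
  assumes "x \<in> grid_cell n i" "i < n"
  shows "x \<in> {0..1}"
proof -
  have 1: "0 \<le> real i / real n" "(real i + 1) / real n \<le> 1" using assms(2) by (auto simp: divide_le_eq)
  have "real i / real n < x" "x < (real i + 1) / real n" using assms(1) by (auto simp: grid_cell_def)
  with 1 have "0 \<le> x" "x \<le> 1" by linarith+
  then show ?thesis by simp
qed

context subcritical_versions
begin

text \<open>Points in the cells i < j are within (j - i + 1) / n of each other, which bounds the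
  overlap of their cones from below by ln (n / (j - i + 1)). The prefactor combines the n! orders of
  the points with the volume of the cells.\<close>

definition lower_const :: "nat \<Rightarrow> real" where
  "lower_const n = fact n / real n ^ n *
    exp (\<Sum>i<n. \<Sum>j\<in>{i<..<n}. levy_al \<nu> (j - i) * ln (real n / (real (j - i) + 1)))"

lemma nn_integral_prod_dens_cells_ge:
  assumes e: "0 < e" "e \<le> 1 / real n"
  shows "ennreal (exp (\<Sum>i<n. \<Sum>j\<in>{i<..<n}. levy_al \<nu> (j - i) * ln (real n / (real (j - i) + 1)))) *
      (\<Prod>i<n. indicator (grid_cell n i) (x i)) \<le>
    (\<integral>\<^sup>+\<omega>. (\<Prod>i<n. dens e (x i) \<omega> * indicator (grid_cell n i) (x i)) \<partial>M)"
proof (cases "\<forall>i<n. x i \<in> grid_cell n i")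
  case False
  then have z: "(\<Prod>i<n. indicator (grid_cell n i) (x i) :: ennreal) = 0"
    by (intro prod_zero) (auto simp: indicator_def)
  show ?thesis unfolding z by simp
next
  case True
  have n1: "e \<le> 1" if "0 < n" using e(2) that order_trans[of e "1 / real n" 1] by simp
  have x: "x i \<in> {0..1}" if "i < n" for i using True that grid_cell_mem by blast
  have diff: "x j - x i \<le> (real (j - i) + 1) / real n" if "i \<le> j" "j < n" for i j
  proof -
    have "x j < (real j + 1) / real n" "real i / real n < x i" using True that by (auto simp: grid_cell_def)
    then have "x j - x i \<le> (real j + 1) / real n - real i / real n" by simp
    also have "\<dots> = (real (j - i) + 1) / real n" using that by (simp add: diff_divide_distrib[symmetric] of_nat_diff)
    finally show ?thesis .
  qed
  have mono: "x i \<le> x j" if "i \<le> j" "j < n" for i j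
  proof (cases "i = j")
    case False
    have "(real i + 1) / real n \<le> real j / real n" using that False by (intro divide_right_mono) auto
    moreover have "x i < (real i + 1) / real n" "real j / real n < x j" using True that by (auto simp: grid_cell_def)
    ultimately show ?thesis by simp
  qed simp
  have ind: "indicator (grid_cell n i) (x i) = (1::ennreal)" if "i < n" for i using True that by simp
  have "exp (\<Sum>i<n. \<Sum>j\<in>{i<..<n}. levy_al \<nu> (j - i) * ln (real n / (real (j - i) + 1))) \<le>
      exp (\<Sum>i<n. \<Sum>j\<in>{i<..<n}. levy_al \<nu> (j - i) *
      measure \<H> (cone_trunc {0..1} e (x i) \<inter> cone_trunc {0..1} e (x j)))"
    unfolding exp_le_cancel_iff
  proof (intro sum_mono mult_left_mono levy_al_nonneg)
    fix i j assume "i \<in> {..<n}" "j \<in> {i<..<n}"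
    then have ij: "i < j" "i < n" "j < n" by auto
    let ?h = "(real (j - i) + 1) / real n"
    have "1 / real n \<le> ?h" by (intro divide_right_mono) auto
    moreover have "?h \<le> 1" using ij by (simp add: of_nat_diff)
    ultimately have "- ln ?h \<le> measure \<H> (cone_trunc {0..1} e (x i) \<inter> cone_trunc {0..1} e (x j))"
      using x[OF ij(2)] x[OF ij(3)] mono[of i j] diff[of i j] ij e
      by (intro measure_cone_trunc_Int_ge) auto
    moreover have "ln (real n / (real (j - i) + 1)) = - ln ?h"
      using ij by (simp add: ln_div)
    ultimately show "ln (real n / (real (j - i) + 1)) \<le> measure \<H> (cone_trunc {0..1} e (x i) \<inter> cone_trunc {0..1} e (x j))"
      by simp
  qed
  then show ?thesis
  proof (cases "n = 0")
    case True
    then show ?thesis by (simp add: emeasure_space_1)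
  next
    case False
    then have "(\<integral>\<^sup>+\<omega>. (\<Prod>i<n. dens e (x i) \<omega>) \<partial>M) = ennreal (exp (\<Sum>i<n. \<Sum>j\<in>{i<..<n}. levy_al \<nu> (j - i) *
      measure \<H> (cone_trunc {0..1} e (x i) \<inter> cone_trunc {0..1} e (x j))))"
      using n1 by (intro nn_integral_prod_dens e(1) x mono) auto
    moreover have "(\<Prod>i<n. dens e (x i) \<omega> * indicator (grid_cell n i) (x i)) = (\<Prod>i<n. dens e (x i) \<omega>)" for \<omega>
      by (intro prod.cong) (auto simp: ind)
    moreover have "(\<Prod>i<n. indicator (grid_cell n i) (x i) :: ennreal) = 1"
      by (intro prod.neutral) (auto simp: ind)
    ultimately show ?thesis
      using \<open>exp _ \<le> exp _\<close> by (simp add: ennreal_leI)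
  qed
qed

text \<open>The power of the total mass dominates n! times the product of the masses of the cells,
  whose expectation is an integral over one point in each cell. The truncation must be at most 1 / n
  so that it does not cut into the overlaps of neighbouring cones that are being used.\<close>

lemma approx_moment_ge:
  assumes e: "0 < e" "e \<le> 1 / real n" and n: "0 < n"
  shows "ennreal (lower_const n) \<le> (\<integral>\<^sup>+\<omega>. approx_mass e \<omega> ^ n \<partial>M)"
proof -
  interpret product_sigma_finite "\<lambda>_::nat. lborel :: real measure" by standard
  let ?P = "PiM {..<n} (\<lambda>_. lborel :: real measure)"
  interpret P: sigma_finite_measure ?P using sigma_finite[of "{..<n}"] by simp
  interpret pair_sigma_finite ?P M ..
  let ?c = "\<Sum>i<n. \<Sum>j\<in>{i<..<n}. levy_al \<nu> (j - i) * ln (real n / (real (j - i) + 1))"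
  have cell: "(\<integral>\<^sup>+x. indicator (grid_cell n i) x \<partial>lborel) = ennreal (1 / real n)" for i
    using n by (simp add: grid_cell_def divide_right_mono add_divide_distrib)
  have "ennreal (lower_const n) = fact n * (ennreal (exp ?c) * (\<Prod>i<n. ennreal (1 / real n)))"
  proof -
    have "(fact n :: ennreal) = ennreal (fact n)"
      by (metis ennreal_of_nat_eq_real_of_nat of_nat_fact)
    then show ?thesis
      by (simp add: lower_const_def prod_ennreal ennreal_mult[symmetric] ennreal_power power_one_over power_inverse divide_inverse mult_ac)
  qed
  also have "(\<Prod>i<n. ennreal (1 / real n)) = (\<integral>\<^sup>+x. (\<Prod>i<n. indicator (grid_cell n i) (x i)) \<partial>?P)"
    by (subst product_nn_integral_prod) (auto simp: cell)
  also have "ennreal (exp ?c) * \<dots> = (\<integral>\<^sup>+x. ennreal (exp ?c) * (\<Prod>i<n. indicator (grid_cell n i) (x i)) \<partial>?P)"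
    by (rule nn_integral_cmult[symmetric], rule borel_measurable_prod_ennreal,
        rule measurable_compose[OF measurable_component_singleton]) auto
  also have "\<dots> \<le> (\<integral>\<^sup>+x. \<integral>\<^sup>+\<omega>. (\<Prod>i<n. dens e (x i) \<omega> * indicator (grid_cell n i) (x i)) \<partial>M \<partial>?P)"
    by (intro nn_integral_mono nn_integral_prod_dens_cells_ge e)
  also have "\<dots> = (\<integral>\<^sup>+\<omega>. \<integral>\<^sup>+x. (\<Prod>i<n. dens e (x i) \<omega> * indicator (grid_cell n i) (x i)) \<partial>?P \<partial>M)"
  proof (rule Fubini'[symmetric])
    have "(\<lambda>p. \<Prod>i<n. dens e (fst p i) (snd p) * indicator (grid_cell n i) (fst p i)) \<in> borel_measurable (?P \<Otimes>\<^sub>M M)"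
    proof (rule borel_measurable_prod_ennreal)
      fix i assume i: "i \<in> {..<n}"
      have c: "(\<lambda>p. fst p i) \<in> ?P \<Otimes>\<^sub>M M \<rightarrow>\<^sub>M borel"
      proof -
        have "(\<lambda>x. x i) \<in> ?P \<rightarrow>\<^sub>M lborel" by (rule measurable_component_singleton[OF i])
        from measurable_compose[OF measurable_fst this] show ?thesis by simp
      qed
      have "(\<lambda>p. (fst p i, snd p)) \<in> ?P \<Otimes>\<^sub>M M \<rightarrow>\<^sub>M borel \<Otimes>\<^sub>M M"
        by (rule measurable_Pair[OF c measurable_snd])
      from measurable_compose[OF this dens_measurable[OF e(1)]]
      have 1: "(\<lambda>p. dens e (fst p i) (snd p)) \<in> borel_measurable (?P \<Otimes>\<^sub>M M)" by simp
      have 2: "(\<lambda>p. indicator (grid_cell n i) (fst p i) :: ennreal) \<in> borel_measurable (?P \<Otimes>\<^sub>M M)"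
        by (rule measurable_compose[OF c borel_measurable_indicator]) measurable
      show "(\<lambda>p. dens e (fst p i) (snd p) * indicator (grid_cell n i) (fst p i)) \<in> borel_measurable (?P \<Otimes>\<^sub>M M)"
        by (rule borel_measurable_times_ennreal[OF 1 2])
    qed
    then show "(\<lambda>(x, \<omega>). \<Prod>i<n. dens e (x i) \<omega> * indicator (grid_cell n i) (x i)) \<in> borel_measurable (?P \<Otimes>\<^sub>M M)"
      by (simp only: case_prod_beta')
  qed
  also have "fact n * \<dots> = (\<integral>\<^sup>+\<omega>. fact n * (\<Prod>i<n. \<integral>\<^sup>+x. dens e x \<omega> * indicator (grid_cell n i) x \<partial>lborel) \<partial>M)"
  proof -
    have eq: "(\<integral>\<^sup>+x. (\<Prod>i<n. dens e (x i) \<omega> * indicator (grid_cell n i) (x i)) \<partial>?P) =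
        (\<Prod>i<n. \<integral>\<^sup>+x. dens e x \<omega> * indicator (grid_cell n i) x \<partial>lborel)" if "\<omega> \<in> space M" for \<omega>
      by (rule product_nn_integral_prod) (use dens_measurable_fst[OF e(1) that] in auto)
    have "(\<lambda>\<omega>. \<Prod>i<n. \<integral>\<^sup>+x. dens e x \<omega> * indicator (grid_cell n i) x \<partial>lborel) \<in> borel_measurable M"
    proof (rule borel_measurable_prod_ennreal, rule lborel.borel_measurable_nn_integral)
      fix i
      have "(\<lambda>p. (snd p, fst p)) \<in> M \<Otimes>\<^sub>M lborel \<rightarrow>\<^sub>M borel \<Otimes>\<^sub>M M" by measurable
      from measurable_compose[OF this dens_measurable[OF e(1)]]
      have 1: "(\<lambda>p. dens e (snd p) (fst p)) \<in> borel_measurable (M \<Otimes>\<^sub>M lborel)" by simp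
      have 2: "(\<lambda>p. indicator (grid_cell n i) (snd p) :: ennreal) \<in> borel_measurable (M \<Otimes>\<^sub>M lborel)"
        by (rule measurable_compose[OF measurable_snd borel_measurable_indicator]) simp
      show "(\<lambda>(\<omega>, x). dens e x \<omega> * indicator (grid_cell n i) x) \<in> borel_measurable (M \<Otimes>\<^sub>M lborel)"
        using borel_measurable_times_ennreal[OF 1 2] by (simp only: case_prod_beta')
    qed
    then show ?thesis using eq by (simp add: nn_integral_cmult cong: nn_integral_cong)
  qed
  also have "\<dots> \<le> (\<integral>\<^sup>+\<omega>. approx_mass e \<omega> ^ n \<partial>M)"
  proof (rule nn_integral_mono)
    fix \<omega> assume \<omega>: "\<omega> \<in> space M"
    note [measurable] = dens_measurable_fst[OF e(1) \<omega>]
    have "fact n * (\<Prod>i<n. \<integral>\<^sup>+x. dens e x \<omega> * indicator (grid_cell n i) x \<partial>lborel) \<le>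
        (\<Sum>i<n. \<integral>\<^sup>+x. dens e x \<omega> * indicator (grid_cell n i) x \<partial>lborel) ^ n"
      by (rule fact_mult_prod_le_power_sum)
    also have "(\<Sum>i<n. \<integral>\<^sup>+x. dens e x \<omega> * indicator (grid_cell n i) x \<partial>lborel) =
        (\<integral>\<^sup>+x. dens e x \<omega> * (\<Sum>i<n. indicator (grid_cell n i) x) \<partial>lborel)"
      by (subst nn_integral_sum[symmetric]) (auto simp: sum_distrib_left)
    also have "\<dots> ^ n \<le> approx_mass e \<omega> ^ n"
      unfolding approx_mass_def
      by (intro power_mono nn_integral_mono mult_left_le sum_indicator_grid_cells_le) auto
    finally show "fact n * (\<Prod>i<n. \<integral>\<^sup>+x. dens e x \<omega> * indicator (grid_cell n i) x \<partial>lborel) \<le> approx_mass e \<omega> ^ n" .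
  qed
  finally show ?thesis by (simp add: mult_left_mono)
qed

end

section \<open>Moments of a limit from uniform bounds on the approximations\<close>

lemma tendsto_power_ennreal:
  fixes f :: "'a \<Rightarrow> ennreal"
  assumes "(f \<longlongrightarrow> l) F"
  shows "((\<lambda>x. f x ^ n) \<longlongrightarrow> l ^ n) F"
proof (induction n)
  case (Suc n)
  have "((\<lambda>x. f x * f x ^ n) \<longlongrightarrow> l * l ^ n) F"
    by (rule tendsto_mult_ennreal[OF assms Suc]) (auto simp: ennreal_top_eq_mult_iff power_eq_top_ennreal)
  then show ?case by simp
qed simp

text \<open>The bounded moment of order \<open>n + 1\<close> gives uniform integrability of the \<open>n\<close>-th powers.\<close>

lemma (in finite_measure) nn_integral_power_limit_ge:
  fixes X :: "nat \<Rightarrow> 'a \<Rightarrow> ennreal" and Z :: "'a \<Rightarrow> ennreal"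
  assumes X [measurable]: "\<And>k. X k \<in> borel_measurable M" and Z [measurable]: "Z \<in> borel_measurable M"
    and lim: "AE \<omega> in M. (\<lambda>k. X k \<omega>) \<longlonglongrightarrow> Z \<omega>"
    and B: "\<And>k. (\<integral>\<^sup>+\<omega>. X k \<omega> ^ Suc n \<partial>M) \<le> ennreal B"
    and L: "eventually (\<lambda>k. ennreal L \<le> (\<integral>\<^sup>+\<omega>. X k \<omega> ^ n \<partial>M)) sequentially"
  shows "ennreal L \<le> (\<integral>\<^sup>+\<omega>. Z \<omega> ^ n \<partial>M)"
proof -
  have bound: "ennreal L \<le> (\<integral>\<^sup>+\<omega>. Z \<omega> ^ n \<partial>M) + ennreal (B / real (Suc m))" for m
  proof -
    let ?m = "ennreal (real (Suc m))"
    let ?T = "\<lambda>x::ennreal. min x ?m ^ n"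
    \<comment> \<open>Above the level \<open>m + 1\<close> the quotient x / (m + 1) is at least one,
      so the part of the \<open>n\<close>-th power removed by the minimum is controlled by the next
      power.\<close>
    have T_le: "x ^ n \<le> ?T x + ennreal (1 / real (Suc m)) * x ^ Suc n" for x
    proof (cases "x \<le> ?m")
      case False
      then have "1 \<le> ennreal (1 / real (Suc m)) * x"
      proof -
        have "1 = ennreal (1 / real (Suc m)) * ?m" by (subst ennreal_mult[symmetric]) (auto simp del: of_nat_Suc)
        also have "\<dots> \<le> ennreal (1 / real (Suc m)) * x" using False by (intro mult_left_mono) auto
        finally show ?thesis .
      qed
      then have "1 * x ^ n \<le> ennreal (1 / real (Suc m)) * x * x ^ n" by (rule mult_right_mono) simp
      then show ?thesis by (simp add: mult.assoc add_increasing)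
    qed (simp add: min_absorb1)
    have "(\<lambda>k. \<integral>\<^sup>+\<omega>. ?T (X k \<omega>) \<partial>M) \<longlonglongrightarrow> (\<integral>\<^sup>+\<omega>. ?T (Z \<omega>) \<partial>M)"
    proof (rule nn_integral_dominated_convergence[where w="\<lambda>_. ?m ^ n"])
      show "AE \<omega> in M. (\<lambda>k. ?T (X k \<omega>)) \<longlonglongrightarrow> ?T (Z \<omega>)"
        using lim
      proof eventually_elim
        case (elim \<omega>)
        then show ?case by (intro tendsto_power_ennreal tendsto_min tendsto_const)
      qed
      show "(\<integral>\<^sup>+\<omega>. ?m ^ n \<partial>M) < \<infinity>"
        by (simp add: ennreal_mult_less_top ennreal_power emeasure_eq_measure del: of_nat_Suc)
    qed (auto intro!: AE_I2 power_mono)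
    then have lim': "(\<lambda>k. (\<integral>\<^sup>+\<omega>. ?T (X k \<omega>) \<partial>M) + ennreal (B / real (Suc m))) \<longlonglongrightarrow>
        (\<integral>\<^sup>+\<omega>. ?T (Z \<omega>) \<partial>M) + ennreal (B / real (Suc m))"
      by (intro tendsto_add tendsto_const)
    have "ennreal L \<le> (\<integral>\<^sup>+\<omega>. ?T (Z \<omega>) \<partial>M) + ennreal (B / real (Suc m))"
    proof (rule tendsto_lowerbound[OF lim'])
      show "eventually (\<lambda>k. ennreal L \<le> (\<integral>\<^sup>+\<omega>. ?T (X k \<omega>) \<partial>M) + ennreal (B / real (Suc m))) sequentially"
        using L
      proof eventually_elim
        case (elim k)
        note elim
        also have "(\<integral>\<^sup>+\<omega>. X k \<omega> ^ n \<partial>M) \<le> (\<integral>\<^sup>+\<omega>. ?T (X k \<omega>) + ennreal (1 / real (Suc m)) * X k \<omega> ^ Suc n \<partial>M)"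
          by (intro nn_integral_mono T_le)
        also have "\<dots> = (\<integral>\<^sup>+\<omega>. ?T (X k \<omega>) \<partial>M) + ennreal (1 / real (Suc m)) * (\<integral>\<^sup>+\<omega>. X k \<omega> ^ Suc n \<partial>M)"
          by (subst nn_integral_add) (auto simp: nn_integral_cmult simp del: power_Suc)
        also have "\<dots> \<le> (\<integral>\<^sup>+\<omega>. ?T (X k \<omega>) \<partial>M) + ennreal (1 / real (Suc m)) * ennreal B"
          by (intro add_mono mult_left_mono B) auto
        also have "ennreal (1 / real (Suc m)) * ennreal B = ennreal (B / real (Suc m))"
          by (subst ennreal_mult'[symmetric]) (auto simp del: of_nat_Suc)
        finally show ?case .
      qed
    qed simp
    also have "\<dots> \<le> (\<integral>\<^sup>+\<omega>. Z \<omega> ^ n \<partial>M) + ennreal (B / real (Suc m))"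
      by (intro add_mono nn_integral_mono power_mono) auto
    finally show ?thesis .
  qed
  have "(\<lambda>m. B / real (Suc m)) \<longlonglongrightarrow> 0" by real_asymp
  then have "(\<lambda>m. (\<integral>\<^sup>+\<omega>. Z \<omega> ^ n \<partial>M) + ennreal (B / real (Suc m))) \<longlonglongrightarrow> (\<integral>\<^sup>+\<omega>. Z \<omega> ^ n \<partial>M) + ennreal 0"
    by (intro tendsto_add tendsto_const tendsto_ennrealI)
  then show ?thesis
    using bound by (intro tendsto_lowerbound[where F=sequentially]) auto
qed

lemma nn_integral_power_limit_le:
  fixes X :: "nat \<Rightarrow> 'a \<Rightarrow> ennreal" and Z :: "'a \<Rightarrow> ennreal"
  assumes X [measurable]: "\<And>k. X k \<in> borel_measurable M"
    and lim: "AE \<omega> in M. (\<lambda>k. X k \<omega>) \<longlonglongrightarrow> Z \<omega>"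
    and B: "\<And>k. (\<integral>\<^sup>+\<omega>. X k \<omega> ^ n \<partial>M) \<le> B"
  shows "(\<integral>\<^sup>+\<omega>. Z \<omega> ^ n \<partial>M) \<le> B"
proof -
  have "(\<integral>\<^sup>+\<omega>. Z \<omega> ^ n \<partial>M) = (\<integral>\<^sup>+\<omega>. liminf (\<lambda>k. X k \<omega> ^ n) \<partial>M)"
  proof (rule nn_integral_cong_AE, use lim in eventually_elim)
    case (elim \<omega>)
    then have "(\<lambda>k. X k \<omega> ^ n) \<longlonglongrightarrow> Z \<omega> ^ n"
      by (rule tendsto_power_ennreal)
    then show ?case by (simp add: lim_imp_Liminf)
  qed
  also have "\<dots> \<le> liminf (\<lambda>k. \<integral>\<^sup>+\<omega>. X k \<omega> ^ n \<partial>M)"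
    by (rule nn_integral_liminf) measurable
  also have "\<dots> \<le> B"
    by (rule Liminf_le) (use B in auto)
  finally show ?thesis .
qed

section \<open>Growth of the moments of the limit\<close>

lemma ln_fact_ge: "real n * ln (real n) - real n \<le> ln (fact n)"
proof (induction n)
  case (Suc n)
  show ?case
  proof (cases "n = 0")
    case False
    then have n: "0 < real n" by simp
    have "real n * (ln (real (Suc n)) - ln (real n)) \<le> real n * (1 / real n)"
    proof (rule mult_left_mono)
      have "1 + 1 / real n = real (Suc n) / real n" using n by (simp add: field_simps)
      then have "ln (real (Suc n)) - ln (real n) = ln (1 + 1 / real n)"
        using n by (simp add: ln_div)
      also have "\<dots> \<le> 1 / real n" using n by (intro ln_add_one_self_le_self) auto
      finally show "ln (real (Suc n)) - ln (real n) \<le> 1 / real n" .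
    qed simp
    then have "real (Suc n) * ln (real (Suc n)) - real (Suc n) \<le> (real n * ln (real n) - real n) + ln (real (Suc n))"
      using n by (simp add: algebra_simps)
    also have "\<dots> \<le> ln (fact n) + ln (real (Suc n))" using Suc by simp
    also have "\<dots> = ln (fact (Suc n))" by (simp add: ln_mult)
    finally show ?thesis .
  qed simp
qed simp

text \<open>Weak convergence and the chosen modifications matter only through the total masses along
  the truncations 1 / (k + 1).\<close>

locale cascade_total = cascade_versions M \<psi> \<Lambda> Y
  for M :: "'w measure" and \<psi> \<Lambda> Y +
  fixes Z :: "'w \<Rightarrow> real"
  assumes Z_measurable [measurable]: "Z \<in> borel_measurable M"
    and Z_nonneg: "\<And>\<omega>. 0 \<le> Z \<omega>"
    and Z_lim: "AE \<omega> in M. (\<lambda>k. approx_mass (1 / real (Suc k)) \<omega>) \<longlonglongrightarrow> ennreal (Z \<omega>)"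

locale subcritical_total = subcritical_versions M \<psi> \<Lambda> Y \<nu> + cascade_total M \<psi> \<Lambda> Y Z
  for M :: "'w measure" and \<psi> \<Lambda> Y \<nu> Z
begin

lemma power_moment_le: "(\<integral>\<^sup>+\<omega>. ennreal (Z \<omega>) ^ Suc n \<partial>M) \<le> ennreal (upper_const n)"
  by (rule nn_integral_power_limit_le[OF approx_mass_measurable Z_lim approx_moment_le]) auto

lemma power_moment_ge:
  assumes n: "0 < n"
  shows "ennreal (lower_const n) \<le> (\<integral>\<^sup>+\<omega>. ennreal (Z \<omega>) ^ n \<partial>M)"
proof (rule nn_integral_power_limit_ge[OF approx_mass_measurable _ Z_lim approx_moment_le])
  show "eventually (\<lambda>k. ennreal (lower_const n) \<le> (\<integral>\<^sup>+\<omega>. approx_mass (1 / real (Suc k)) \<omega> ^ n \<partial>M)) sequentially"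
    using eventually_ge_at_top[of n]
  proof eventually_elim
    case (elim k)
    then show ?case using n by (intro approx_moment_ge) (auto simp: field_simps)
  qed
qed auto

lemma lower_const_pos: "0 < n \<Longrightarrow> 0 < lower_const n"
  by (simp add: lower_const_def)

text \<open>For real exponents, z powr q is at most 1 for z up to one and at most z^(n + 1) beyond.
  The additive 1 is negligible at the scale q ln q.\<close>

lemma moment_le:
  assumes "0 < q" "q \<le> real (Suc n)"
  shows "moment M Z q \<le> ennreal (1 + upper_const n)"
proof -
  have "moment M Z q \<le> (\<integral>\<^sup>+\<omega>. 1 + ennreal (Z \<omega>) ^ Suc n \<partial>M)"
    unfolding moment_def
  proof (rule nn_integral_mono)
    fix \<omega>
    have "Z \<omega> powr q \<le> 1 + Z \<omega> ^ Suc n"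
    proof (cases "Z \<omega> \<le> 1")
      case True
      then have "Z \<omega> powr q \<le> 1" using Z_nonneg[of \<omega>] assms(1) by (intro powr_le1) auto
      then show ?thesis using Z_nonneg[of \<omega>] by (simp add: add_increasing2)
    next
      case False
      then have "Z \<omega> powr q \<le> Z \<omega> powr real (Suc n)" using assms(2) by (intro powr_mono) auto
      then show ?thesis using False by (simp add: powr_realpow del: of_nat_Suc power_Suc)
    qed
    then show "ennreal (Z \<omega> powr q) \<le> 1 + ennreal (Z \<omega>) ^ Suc n"
      using Z_nonneg[of \<omega>]
      by (simp add: ennreal_power ennreal_1[symmetric] ennreal_plus[symmetric] ennreal_leI del: ennreal_plus ennreal_1 power_Suc)
  qed
  also have "\<dots> = 1 + (\<integral>\<^sup>+\<omega>. ennreal (Z \<omega>) ^ Suc n \<partial>M)"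
    by (subst nn_integral_add) (auto simp: emeasure_space_1 simp del: power_Suc)
  also have "\<dots> \<le> 1 + ennreal (upper_const n)"
    by (intro add_left_mono power_moment_le)
  also have "\<dots> = ennreal (1 + upper_const n)"
    using gap_base_pos by (simp add: upper_const_def)
  finally show ?thesis .
qed

lemma moment_ge:
  assumes "0 < n" "real n \<le> q"
  shows "ennreal (lower_const n) \<le> moment M Z q + 1"
proof -
  have "ennreal (lower_const n) \<le> (\<integral>\<^sup>+\<omega>. ennreal (Z \<omega>) ^ n \<partial>M)"
    by (rule power_moment_ge[OF assms(1)])
  also have "\<dots> \<le> (\<integral>\<^sup>+\<omega>. ennreal (Z \<omega> powr q) + 1 \<partial>M)"
  proof (rule nn_integral_mono)
    fix \<omega>
    have "Z \<omega> ^ n \<le> Z \<omega> powr q + 1"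
    proof (cases "Z \<omega> \<le> 1")
      case True
      then have "Z \<omega> ^ n \<le> 1" using Z_nonneg[of \<omega>] by (intro power_le_one) auto
      then show ?thesis by (simp add: add_increasing)
    next
      case False
      then have "Z \<omega> powr real n \<le> Z \<omega> powr q" using assms(2) by (intro powr_mono) auto
      then show ?thesis using False by (simp add: powr_realpow)
    qed
    then show "ennreal (Z \<omega>) ^ n \<le> ennreal (Z \<omega> powr q) + 1"
      using Z_nonneg[of \<omega>]
      by (simp add: ennreal_power ennreal_1[symmetric] ennreal_plus[symmetric] ennreal_leI del: ennreal_plus ennreal_1)
  qed
  also have "\<dots> = moment M Z q + 1"
    unfolding moment_def by (subst nn_integral_add) (auto simp: emeasure_space_1)
  finally show ?thesis .
qed

theorem moments_pos_finite:
  assumes "0 < q"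
  shows "0 < moment M Z q" "moment M Z q < \<infinity>"
proof -
  have "q \<le> real (Suc (nat \<lceil>q\<rceil>))" by linarith
  from moment_le[OF assms this] show "moment M Z q < \<infinity>"
    using order.strict_trans1 by fastforce
  show "0 < moment M Z q"
  proof (rule ccontr)
    assume "\<not> 0 < moment M Z q"
    then have "AE \<omega> in M. ennreal (Z \<omega> powr q) = 0"
      by (subst nn_integral_0_iff_AE[symmetric]) (auto simp: moment_def)
    \<comment> \<open>A vanishing moment forces Z = 0 almost surely, which contradicts the positive
      lower bound \<open>lower_const 1\<close> for the mean. This is the nondegeneracy of the
      cascade.\<close>
    then have "AE \<omega> in M. ennreal (Z \<omega>) ^ 1 = 0"
    proof eventually_elim
      case (elim \<omega>)
      then have "Z \<omega> powr q \<le> 0" by (simp add: ennreal_eq_0_iff)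
      then show ?case using Z_nonneg[of \<omega>] powr_gt_zero[of "Z \<omega>" q] by (auto simp: not_le[symmetric])
    qed
    then have "(\<integral>\<^sup>+\<omega>. ennreal (Z \<omega>) ^ 1 \<partial>M) = 0"
      by (subst nn_integral_0_iff_AE) auto
    with power_moment_ge[of 1] lower_const_pos[of 1] show False by (simp add: ennreal_eq_0_iff)
  qed
qed

lemma gam_pos: "0 < gam"
proof -
  have nn: "AE x in \<nu>. 0 \<le> 1 - exp x" using neg by eventually_elim simp
  have "gam \<noteq> 0"
  proof
    assume "gam = 0"
    then have "AE x in \<nu>. 1 - exp x = 0"
      using integral_nonneg_eq_0_iff_AE[OF integrable_one_minus_exp nn] by simp
    with neg have "AE x in \<nu>. False" by eventually_elim simp
    then show False by (simp add: not_AE_False)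
  qed
  moreover have "0 \<le> gam" by (rule integral_nonneg_AE[OF nn])
  ultimately show ?thesis by simp
qed

text \<open>The factorial is at most (n + 1)^(n + 1), and by \<open>excess_eq\<close> the excess is
  n - \<open>levy_p \<nu> (Suc n)\<close>, at least n - (n + 1) \<open>gam\<close>. The powers of n
  + 1 combine to the exponent 1 + (n + 1) \<open>gam\<close>; all other factors grow
  geometrically.\<close>

lemma ln_upper_const_le:
  "ln (1 + upper_const n) \<le> ln 2 + real (Suc n) * (1 + ln gap_base) + (1 + real (Suc n) * gam) * ln (real (Suc n))"
proof -
  let ?n = "real (Suc n)"
  have B: "1 \<le> gap_base" using al_1 unfolding gap_base_def by simp
  have "upper_const n \<le> ?n powr ?n * (exp ?n * (gap_base powr ?n * ?n powr - excess 0 n))"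
  proof -
    have "(fact (Suc n) :: real) \<le> ?n powr ?n"
      using fact_le_power[of "Suc n", where 'a=real] by (simp add: powr_realpow del: of_nat_Suc fact_Suc power_Suc)
    moreover have "gap_base ^ n \<le> gap_base powr ?n"
      using B by (subst powr_realpow[symmetric]) (auto intro!: powr_mono)
    moreover have "(1 / ?n) powr excess 0 n = ?n powr - excess 0 n"
      by (simp add: powr_divide powr_minus_divide del: of_nat_Suc)
    ultimately show ?thesis
      unfolding upper_const_def by (intro mult_mono) (use gap_base_pos in \<open>auto simp del: of_nat_Suc fact_Suc\<close>)
  qed
  also have "\<dots> = exp (?n * (1 + ln gap_base)) * ?n powr (?n - excess 0 n)"
    using B by (simp add: powr_diff powr_minus_divide exp_add distrib_left powr_def[of gap_base] del: of_nat_Suc)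
  also have "\<dots> \<le> exp (?n * (1 + ln gap_base)) * ?n powr (1 + ?n * gam)"
    using levy_p_le[of "Suc n"] by (intro mult_left_mono powr_mono) (auto simp: excess_eq)
  also have "\<dots> = exp (?n * (1 + ln gap_base) + (1 + ?n * gam) * ln ?n)"
    by (simp add: exp_add powr_def del: of_nat_Suc)
  finally have le: "upper_const n \<le> exp (?n * (1 + ln gap_base) + (1 + ?n * gam) * ln ?n)" .
  have "0 \<le> ?n * (1 + ln gap_base) + (1 + ?n * gam) * ln ?n"
    using B gam_pos by (intro add_nonneg_nonneg mult_nonneg_nonneg) auto
  then have "1 \<le> exp (?n * (1 + ln gap_base) + (1 + ?n * gam) * ln ?n)" by simp
  with le have "1 + upper_const n \<le> 2 * exp (?n * (1 + ln gap_base) + (1 + ?n * gam) * ln ?n)" by linarith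
  moreover have "0 < 1 + upper_const n"
    using gap_base_pos by (simp add: upper_const_def add_pos_nonneg)
  ultimately have "ln (1 + upper_const n) \<le> ln (2 * exp (?n * (1 + ln gap_base) + (1 + ?n * gam) * ln ?n))"
    by (subst ln_le_cancel_iff) auto
  then show ?thesis by (simp add: ln_mult del: of_nat_Suc)
qed

text \<open>Keep only pairs with rank difference at most \<open>K\<close>, and only first members
  with a full set of \<open>K\<close> partners. Each logarithm is then at least ln n - ln (K + 1).
  Letting n grow before \<open>K\<close> recovers \<open>gam\<close>, the full sum of the
  weights.\<close>

lemma ln_lower_const_ge:
  assumes K: "K < n"
  shows "- real n + (real n - real K) * ((ln (real n) - ln (real K + 1)) * (\<Sum>k=1..K. levy_al \<nu> k)) \<le> ln (lower_const n)"
proof -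
  let ?f = "\<lambda>k. levy_al \<nu> k * ln (real n / (real k + 1))"
  have f_nonneg: "0 \<le> ?f k" if "k < n" for k
    using that levy_al_nonneg by (intro mult_nonneg_nonneg) auto
  have n: "0 < n" using K by simp
  have "(real n - real K) * ((ln (real n) - ln (real K + 1)) * (\<Sum>k=1..K. levy_al \<nu> k)) =
      (\<Sum>i<n - K. \<Sum>k=1..K. levy_al \<nu> k * (ln (real n) - ln (real K + 1)))"
    unfolding sum_distrib_right[symmetric] using K by (simp add: mult_ac of_nat_diff)
  also have "\<dots> \<le> (\<Sum>i<n - K. \<Sum>k=1..K. ?f k)"
  proof (intro sum_mono mult_left_mono levy_al_nonneg)
    fix k assume "k \<in> {1..K}"
    then have "ln (real k + 1) \<le> ln (real K + 1)" by simp
    then show "ln (real n) - ln (real K + 1) \<le> ln (real n / (real k + 1))"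
      using n by (simp add: ln_div)
  qed
  also have "\<dots> = (\<Sum>i<n - K. \<Sum>j\<in>{i<..i + K}. ?f (j - i))"
  proof (rule sum.cong[OF refl])
    fix i
    show "(\<Sum>k=1..K. ?f k) = (\<Sum>j\<in>{i<..i + K}. ?f (j - i))"
      by (rule sum.reindex_bij_witness[of _ "\<lambda>j. j - i" "\<lambda>k. k + i"]) auto
  qed
  also have "\<dots> \<le> (\<Sum>i<n - K. \<Sum>j\<in>{i<..<n}. ?f (j - i))"
    by (intro sum_mono sum_mono2 f_nonneg) auto
  also have "\<dots> \<le> (\<Sum>i<n. \<Sum>j\<in>{i<..<n}. ?f (j - i))"
    by (intro sum_mono2 sum_nonneg f_nonneg) auto
  finally have "(real n - real K) * ((ln (real n) - ln (real K + 1)) * (\<Sum>k=1..K. levy_al \<nu> k)) \<le> \<dots>" .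
  moreover have "ln (lower_const n) = ln (fact n) - real n * ln (real n) + (\<Sum>i<n. \<Sum>j\<in>{i<..<n}. ?f (j - i))"
    using n by (simp add: lower_const_def ln_mult ln_div ln_realpow)
  ultimately show ?thesis using ln_fact_ge[of n] by linarith
qed

theorem log_moment_asymptotics:
  "((\<lambda>q. ln (enn2real (moment M Z q)) / (q * ln q)) \<longlongrightarrow> gam) at_top"
proof (rule order_tendstoI)
  define m where "m q = enn2real (moment M Z q)" for q
  have m: "moment M Z q = ennreal (m q)" "0 < m q" if "0 < q" for q
    using moments_pos_finite[OF that] by (auto simp: m_def enn2real_positive_iff)
  fix a assume "gam < a"
  \<comment> \<open>The bound of \<open>ln_upper_const_le\<close> with
    \<open>Suc n \<le> q + 1\<close>, divided by \<open>q * ln q\<close>; only its last summand has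
    a nonzero limit.\<close>
  let ?U = "\<lambda>q. ln 2 / (q * ln q) + (1 + ln gap_base) * ((q + 1) / (q * ln q)) + ln (q + 1) / (q * ln q)
    + gam * ((q + 1) * ln (q + 1) / (q * ln q))"
  have "(?U \<longlongrightarrow> 0 + (1 + ln gap_base) * 0 + 0 + gam * 1) at_top"
    by (intro tendsto_intros) real_asymp+
  then have "eventually (\<lambda>q. ?U q < a) at_top"
    using \<open>gam < a\<close> by (intro order_tendstoD) auto
  with eventually_gt_at_top[of 1]
  show "eventually (\<lambda>q. ln (enn2real (moment M Z q)) / (q * ln q) < a) at_top"
  proof eventually_elim
    case (elim q)
    define n where "n = nat \<lfloor>q\<rfloor>"
    have n: "q \<le> real (Suc n)" "real (Suc n) \<le> q + 1" using elim(1) unfolding n_def by linarith+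
    have q: "0 < q * ln q" using elim(1) by simp
    have "m q \<le> 1 + upper_const n"
    proof -
      have "ennreal (m q) \<le> ennreal (1 + upper_const n)"
        using moment_le[of q n] m(1)[of q] elim(1) n(1) by (simp only:)
      moreover have "0 \<le> 1 + upper_const n"
        using gap_base_pos by (simp add: upper_const_def)
      ultimately show ?thesis by (simp only: ennreal_le_iff)
    qed
    then have "ln (m q) \<le> ln (1 + upper_const n)"
      using m(2)[of q] elim(1) by (subst ln_le_cancel_iff) auto
    also have "\<dots> \<le> ln 2 + real (Suc n) * (1 + ln gap_base) + (1 + real (Suc n) * gam) * ln (real (Suc n))"
      by (rule ln_upper_const_le)
    also have "\<dots> \<le> ln 2 + (q + 1) * (1 + ln gap_base) + (1 + (q + 1) * gam) * ln (q + 1)"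
    proof -
      have "1 \<le> gap_base" using al_1 unfolding gap_base_def by simp
      then show ?thesis
        using n gam_pos elim(1)
        by (intro add_mono mult_mono mult_right_mono add_nonneg_nonneg mult_nonneg_nonneg order_refl) (auto simp del: of_nat_Suc)
    qed
    also have "\<dots> = ?U q * (q * ln q)"
      using q elim(1) by (simp add: field_simps)
    finally have "ln (m q) / (q * ln q) \<le> ?U q" using q by (simp add: pos_divide_le_eq)
    with elim(2) show ?case by (simp add: m_def)
  qed
next
  define m where "m q = enn2real (moment M Z q)" for q
  have m: "moment M Z q = ennreal (m q)" "0 < m q" if "0 < q" for q
    using moments_pos_finite[OF that] by (auto simp: m_def enn2real_positive_iff)
  fix a assume "a < gam"
  define S where "S = (\<lambda>K. \<Sum>k=1..K. levy_al \<nu> k)"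
  have "eventually (\<lambda>K. max a 0 < S K) sequentially"
    using sum_levy_al_tendsto \<open>a < gam\<close> gam_pos unfolding S_def by (intro order_tendstoD) auto
  \<comment> \<open>\<open>K\<close> depends on \<open>a\<close> alone and stays fixed while q tends
    to infinity.\<close>
  then obtain K where K: "a < S K" "0 < S K" by (auto simp: eventually_sequentially)
  define c where "c = ln (real K + 1)"
  let ?L = "\<lambda>q. - 1 / ln q + ((q - 1 - real K) / q) * (((ln (q - 1) - c) / ln q) * S K) - ln 2 / (q * ln q)"
  have 1: "((\<lambda>q. (q - 1 - real K) / q) \<longlongrightarrow> 1) at_top" by real_asymp
  have 2: "((\<lambda>q. (ln (q - 1) - c) / ln q) \<longlongrightarrow> 1) at_top" by real_asymp
  have "(?L \<longlongrightarrow> 0 + 1 * (1 * S K) - 0) at_top"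
    by (intro tendsto_intros 1 2) real_asymp+
  then have lim: "(?L \<longlongrightarrow> S K) at_top" by simp
  have ev1: "eventually (\<lambda>q. max a 0 < ?L q) at_top"
    using K by (intro order_tendstoD(1)[OF lim]) auto
  have ev2: "eventually (\<lambda>q. exp 1 + real K + 2 < q) at_top" by (rule eventually_gt_at_top)
  have ev3: "eventually (\<lambda>q::real. c < ln (q - 1)) at_top"
    by (rule filterlim_at_top_dense[THEN iffD1, rule_format]) real_asymp
  show "eventually (\<lambda>q. a < ln (enn2real (moment M Z q)) / (q * ln q)) at_top"
    using ev1 ev2 ev3
  proof eventually_elim
    case (elim q)
    define n where "n = nat \<lfloor>q\<rfloor>"
    have q1: "1 < q" using elim(2) exp_gt_zero[of "1::real"] by linarith
    have n: "real n \<le> q" "q - 1 \<le> real n" using q1 unfolding n_def by linarith+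
    have Kn: "K < n" using n elim(2) exp_gt_zero[of "1::real"] by linarith
    have lnq: "0 < ln q" using q1 by simp
    have q: "0 < q * ln q" using q1 by simp
    have "?L q * (q * ln q) + ln 2 = - q + (q - 1 - real K) * ((ln (q - 1) - c) * S K)"
      using q1 lnq by (simp add: field_simps)
    also have "\<dots> \<le> - real n + (real n - real K) * ((ln (real n) - c) * S K)"
    proof (intro add_mono mult_mono mult_right_mono)
      have ln_le: "ln (q - 1) \<le> ln (real n)" using n q1 by simp
      then show "ln (q - 1) - c \<le> ln (real n) - c" by simp
      show "0 \<le> ln (real n) - c" using ln_le elim(3) by simp
      show "0 \<le> (ln (q - 1) - c) * S K" using elim(3) K by (intro mult_nonneg_nonneg) auto
    qed (use n(1,2) Kn K in \<open>auto intro: less_imp_le\<close>)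
    also have "\<dots> \<le> ln (lower_const n)"
      using ln_lower_const_ge[OF Kn] by (simp add: c_def S_def)
    finally have L: "?L q * (q * ln q) + ln 2 \<le> ln (lower_const n)" .
    have "ennreal (lower_const n) \<le> ennreal (m q + 1)"
      using moment_ge[of n q] m[of q] q1 n Kn by simp
    then have "lower_const n \<le> m q + 1"
      using m(2)[of q] q1 by (subst (asm) ennreal_le_iff) auto
    \<comment> \<open>Together with \<open>lower_const n \<le> m q + 1\<close> this gives
      \<open>1 \<le> m q\<close>, so the additive one costs at most a factor 2.\<close>
    moreover have "2 \<le> lower_const n"
    proof -
      have "0 < ?L q" by (rule le_less_trans[OF max.cobounded2 elim(1)])
      from mult_pos_pos[OF this q] L have "ln 2 \<le> ln (lower_const n)" by linarith
      then show ?thesis using lower_const_pos[of n] Kn by (subst (asm) ln_le_cancel_iff) auto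
    qed
    ultimately have "lower_const n \<le> 2 * m q" by linarith
    then have "ln (lower_const n) \<le> ln (2 * m q)"
      using lower_const_pos[of n] Kn m(2)[of q] q1 by (subst ln_le_cancel_iff) auto
    also have "\<dots> = ln 2 + ln (m q)" using m(2)[of q] q1 by (simp add: ln_mult)
    finally have "?L q * (q * ln q) \<le> ln (m q)" using L by linarith
    then have "?L q \<le> ln (m q) / (q * ln q)" using q by (simp add: pos_le_divide_eq)
    with elim(1) show ?case by (simp add: m_def)
  qed
qed

end

section \<open>Levy data of bounded exponential growth\<close>

lemma tendsto_exp_difference_quotient:
  fixes z :: complex
  shows "(\<lambda>n. of_nat (Suc n) * (exp (z / of_nat (Suc n)) - 1)) \<longlonglongrightarrow> z"
proof -
  have "((\<lambda>h. (exp h - 1) / h) \<longlongrightarrow> 1) (at (0::complex))"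
    using DERIV_exp[of "0::complex"] by (simp add: DERIV_def)
  show ?thesis
  proof (cases "z = 0")
    case False
    have "(\<lambda>n. z / of_nat (Suc n)) \<longlonglongrightarrow> 0"
      by (intro tendsto_divide_0[OF tendsto_const] filterlim_compose[OF tendsto_of_nat filterlim_Suc])
    then have "filterlim (\<lambda>n. z / of_nat (Suc n)) (at 0) sequentially"
      using False by (auto simp: filterlim_at simp del: of_nat_Suc)
    from tendsto_mult[OF tendsto_const[of z] filterlim_compose[OF \<open>(_ \<longlongrightarrow> 1) (at 0)\<close> this]]
    have "(\<lambda>n. z * ((exp (z / of_nat (Suc n)) - 1) / (z / of_nat (Suc n)))) \<longlonglongrightarrow> z" by simp
    also have "(\<lambda>n. z * ((exp (z / of_nat (Suc n)) - 1) / (z / of_nat (Suc n)))) =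
        (\<lambda>n. of_nat (Suc n) * (exp (z / of_nat (Suc n)) - 1))"
      using False by (auto simp: fun_eq_iff simp del: of_nat_Suc)
    finally show ?thesis .
  qed simp
qed

lemma one_minus_cos_le:
  fixes u :: real shows "1 - cos u \<le> u\<^sup>2 / 2" "1 - cos u \<le> \<bar>u\<bar>"
proof -
  have "1 - cos u = 2 * (sin (u / 2))\<^sup>2" using cos_double_sin[of "u / 2"] by simp
  also have "\<dots> \<le> 2 * (u / 2)\<^sup>2"
    using abs_sin_x_le_abs_x[of "u / 2"] unfolding abs_le_square_iff by (rule mult_left_mono) simp
  finally show 1: "1 - cos u \<le> u\<^sup>2 / 2" by (simp add: power2_eq_square)
  show "1 - cos u \<le> \<bar>u\<bar>"
  proof (cases "\<bar>u\<bar> \<le> 2")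
    case True
    then have "\<bar>u\<bar> * \<bar>u\<bar> \<le> 2 * \<bar>u\<bar>" by (intro mult_right_mono) auto
    with 1 show ?thesis by (simp add: power2_eq_square)
  next
    case False
    then show ?thesis using cos_ge_minus_one[of u] by linarith
  qed
qed

text \<open>Second-order Taylor expansion: the coefficient 1/2 loses at most 1/6 to the cubic
  remainder.\<close>

lemma one_minus_cos_ge:
  fixes x :: real assumes "\<bar>x\<bar> \<le> 1" shows "x\<^sup>2 / 3 \<le> 1 - cos x"
proof -
  have "norm (iexp x - (\<Sum>k\<le>2. (\<i> * x) ^ k / fact k)) \<le> \<bar>x\<bar> ^ 3 / 6"
    using iexp_approx1[of x 2] by (simp add: eval_nat_numeral)
  moreover have "(\<Sum>k\<le>2. (\<i> * x) ^ k / fact k) = 1 + \<i> * x - x\<^sup>2 / 2"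
    by (simp add: eval_nat_numeral complex_eq_iff)
  ultimately have "norm (iexp x - (1 + \<i> * x - x\<^sup>2 / 2)) \<le> \<bar>x\<bar> ^ 3 / 6" by simp
  then have "\<bar>Re (iexp x - (1 + \<i> * x - x\<^sup>2 / 2))\<bar> \<le> \<bar>x\<bar> ^ 3 / 6"
    by (rule order_trans[OF abs_Re_le_cmod])
  moreover have "Re (iexp x - (1 + \<i> * x - x\<^sup>2 / 2)) = cos x - (1 - x\<^sup>2 / 2)"
    by (simp add: Re_exp power2_eq_square)
  moreover have "\<bar>x\<bar> ^ 3 / 6 \<le> x\<^sup>2 / 6"
    using power_decreasing[of 2 3 "\<bar>x\<bar>"] assms by simp
  ultimately show ?thesis by linarith
qed

lemma min_le_one_minus_exp:
  fixes y :: real assumes "0 \<le> y" shows "min 1 y \<le> 2 * (1 - exp (- y))"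
proof (cases "y \<le> 1")
  case True
  define u v where "u = 1 / (1 + y)" and "v = y / (1 + y)"
  have 1: "exp (- y) \<le> u"
    unfolding u_def using exp_ge_add_one_self[of y] assms by (simp add: exp_minus inverse_eq_divide frac_le)
  have 2: "1 - u = v" unfolding u_def v_def using assms by (simp add: field_simps)
  have "y / 2 \<le> v" unfolding v_def using assms True by (intro divide_left_mono) auto
  then have "y \<le> 2 * v" by simp
  also have "\<dots> \<le> 2 * (1 - exp (- y))" using 1 2 by simp
  finally have "y \<le> 2 * (1 - exp (- y))" .
  then show ?thesis using True by (simp add: min_def)
next
  case False
  have "exp (- y) \<le> 1 / (1 + y)"
    using exp_ge_add_one_self[of y] assms by (simp add: exp_minus inverse_eq_divide frac_le)
  also have "\<dots> \<le> 1 / 2" using False by (intro divide_left_mono) auto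
  finally show ?thesis using False by (simp add: min_def)
qed

lemma exp_mult_le_one: "exp c * p \<le> 1 \<Longrightarrow> p \<le> exp (- c)" for c p :: real
  by (simp add: exp_minus field_simps)

text \<open>Levy continuity speaks of probability laws, so finite measures are normalised first. The
  underlying measure is arbitrary because the lemma serves both the probability space, with the
  small increments as \<open>X\<close>, and the Levy measure, with negation as
  \<open>X\<close>.\<close>

lemma
  fixes u :: "real \<Rightarrow> real" and X :: "'a \<Rightarrow> real"
  assumes X [measurable]: "X \<in> borel_measurable N" and u [measurable]: "u \<in> borel_measurable borel"
    and u0: "\<And>y. 0 \<le> u y" and c: "0 < c"
    and int: "integrable N (\<lambda>x. u (X x))" and eq: "(LINT x|N. u (X x)) = c"
  shows real_distribution_weighted: "real_distribution (density (distr N borel X) (\<lambda>y. ennreal (u y / c)))"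
    and integral_weighted: "\<And>g :: real \<Rightarrow> 'b :: {banach, second_countable_topology}.
      g \<in> borel_measurable borel \<Longrightarrow>
      (\<integral>y. g y \<partial>density (distr N borel X) (\<lambda>y. ennreal (u y / c))) = (1 / c) *\<^sub>R (\<integral>x. u (X x) *\<^sub>R g (X x) \<partial>N)"
proof -
  let ?D = "density (distr N borel X) (\<lambda>y. ennreal (u y / c))"
  have "emeasure ?D (space ?D) = (\<integral>\<^sup>+y. ennreal (u y / c) \<partial>distr N borel X)"
    by (subst emeasure_density) auto
  also have "\<dots> = (\<integral>\<^sup>+x. ennreal (u (X x) / c) \<partial>N)"
    by (subst nn_integral_distr) auto
  also have "\<dots> = ennreal (LINT x|N. u (X x) / c)"
    using u0 c int by (intro nn_integral_eq_integral) auto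
  also have "\<dots> = 1" using c eq by simp
  finally have "prob_space ?D" by (rule prob_spaceI)
  then show "real_distribution ?D"
    by (simp add: real_distribution_def real_distribution_axioms_def)
  fix g :: "real \<Rightarrow> 'b" assume [measurable]: "g \<in> borel_measurable borel"
  have "(\<integral>y. g y \<partial>?D) = (\<integral>y. (u y / c) *\<^sub>R g y \<partial>distr N borel X)"
    using u0 c by (subst integral_density) auto
  also have "\<dots> = (\<integral>x. (1 / c) *\<^sub>R (u (X x) *\<^sub>R g (X x)) \<partial>N)"
    by (subst integral_distr) auto
  also have "\<dots> = (1 / c) *\<^sub>R (\<integral>x. u (X x) *\<^sub>R g (X x) \<partial>N)"
    by (rule integral_scaleR_right)
  finally show "(\<integral>y. g y \<partial>?D) = (1 / c) *\<^sub>R (\<integral>x. u (X x) *\<^sub>R g (X x) \<partial>N)" .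
qed

text \<open>The area ln 2 is that of \<open>half_cone\<close>, and the right-hand side of
  \<open>growth\<close> equals 2^k / 2. This is what halving the cascade yields when the
  \<open>k\<close>-th moment of the total mass is positive and finite.\<close>

locale bounded_levy = scattered M "levy_exponent a \<sigma> \<nu>" \<H> \<Lambda>
  for M :: "'w measure" and a \<sigma> \<nu> \<Lambda> +
  assumes levy: "levy_measure \<nu>"
    and growth: "\<And>B k. B \<in> fmeasurable \<H> \<Longrightarrow> measure \<H> B = ln 2 \<Longrightarrow> 2 \<le> k \<Longrightarrow>
      (\<integral>\<^sup>+\<omega>. ennreal (exp (real k * \<Lambda> B \<omega>)) \<partial>M) \<le> ennreal (exp (ln 2 * (real k - 1)))"
begin

lemma sets_nu [measurable_cong]: "sets \<nu> = sets borel"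
  using levy by (simp add: levy_measure_def)

text \<open>The growth condition makes \<open>gap m\<close> nonnegative. It is the increment of a subordinator whose
  Levy measure is the image of \<open>\<nu>\<close> under \<open>x \<mapsto> - x\<close>; the rescaled laws of these small increments
  recover \<open>\<nu>\<close>.\<close>

definition piece :: "nat \<Rightarrow> real" where
  "piece m = ln 2 / real (Suc m)"

definition gap :: "nat \<Rightarrow> 'w \<Rightarrow> real" where
  "gap m \<omega> = piece m - \<Lambda> (strip (piece m) 0) \<omega>"

lemma piece_pos: "0 < piece m"
  by (simp add: piece_def)

lemma gap_measurable [measurable]: "gap m \<in> borel_measurable M"
  unfolding gap_def[abs_def] using strip_fmeasurable[OF piece_pos] by measurable

text \<open>The union of \<open>Suc m\<close> disjoint strips has area ln 2, and the values on the
  strips are independent with the same law.\<close>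

lemma nn_integral_exp_strips:
  obtains U where "U \<in> fmeasurable \<H>" "measure \<H> U = ln 2"
    "\<And>c. (\<integral>\<^sup>+\<omega>. ennreal (exp (c * \<Lambda> U \<omega>)) \<partial>M) = (\<integral>\<^sup>+\<omega>. ennreal (exp (c * \<Lambda> (strip (piece m) 0) \<omega>)) \<partial>M) ^ Suc m"
proof
  let ?S = "strip (piece m)" and ?J = "{..<Suc m}"
  let ?U = "\<Union>j\<in>?J. ?S j"
  note fm = strip_fmeasurable[OF piece_pos[of m]]
  show "?U \<in> fmeasurable \<H>" by (intro fmeasurable.finite_UN fm) auto
  have dj: "disjoint_family_on ?S ?J"
    using disjoint_family_on_mono[OF _ disjoint_strips[OF piece_pos]] by auto
  have "measure \<H> ?U = (\<Sum>j\<in>?J. measure \<H> (?S j))"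
    using dj by (intro measure_finite_Union) (auto intro!: fmeasurableD fmeasurableD2 fm)
  also have "\<dots> = ln 2" by (simp add: measure_strip piece_pos piece_def)
  finally show "measure \<H> ?U = ln 2" .
  fix c :: real
  have "(\<integral>\<^sup>+\<omega>. ennreal (exp (c * \<Lambda> ?U \<omega>)) \<partial>M) = (\<integral>\<^sup>+\<omega>. (\<Prod>j\<in>?J. ennreal (exp (c * \<Lambda> (?S j) \<omega>))) \<partial>M)"
  proof (rule nn_integral_cong_AE)
    have "AE \<omega> in M. \<Lambda> ?U \<omega> = (\<Sum>j\<in>?J. \<Lambda> (?S j) \<omega>)"
      by (rule Lam_UN[OF _ fm dj]) simp
    then show "AE \<omega> in M. ennreal (exp (c * \<Lambda> ?U \<omega>)) = (\<Prod>j\<in>?J. ennreal (exp (c * \<Lambda> (?S j) \<omega>)))"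
      by eventually_elim (simp add: sum_distrib_left exp_sum prod_ennreal del: sum.lessThan_Suc prod.lessThan_Suc)
  qed
  also have "\<dots> = (\<Prod>j\<in>?J. \<integral>\<^sup>+\<omega>. ennreal (exp (c * \<Lambda> (?S j) \<omega>)) \<partial>M)"
  proof (rule indep_vars_nn_integral)
    have "indep_vars (\<lambda>_. borel) (\<lambda>j. \<Lambda> (?S j)) ?J"
      by (rule indep_vars_Lam[OF _ fm dj]) simp
    then show "indep_vars (\<lambda>_. borel) (\<lambda>j \<omega>. ennreal (exp (c * \<Lambda> (?S j) \<omega>))) ?J"
      by (rule indep_vars_compose2) measurable
  qed auto
  also have "\<dots> = (\<Prod>j\<in>?J. \<integral>\<^sup>+\<omega>. ennreal (exp (c * \<Lambda> (?S 0) \<omega>)) \<partial>M)"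
  proof (rule prod.cong[OF refl])
    fix j
    have "distr M borel (\<Lambda> (?S j)) = distr M borel (\<Lambda> (?S 0))"
      by (intro distr_Lam_eq fm) (simp add: measure_strip piece_pos)
    then have "(\<integral>\<^sup>+x. ennreal (exp (c * x)) \<partial>distr M borel (\<Lambda> (?S j))) = (\<integral>\<^sup>+x. ennreal (exp (c * x)) \<partial>distr M borel (\<Lambda> (?S 0)))"
      by simp
    then show "(\<integral>\<^sup>+\<omega>. ennreal (exp (c * \<Lambda> (?S j) \<omega>)) \<partial>M) = (\<integral>\<^sup>+\<omega>. ennreal (exp (c * \<Lambda> (?S 0) \<omega>)) \<partial>M)"
      using fm by (subst (asm) (1 2) nn_integral_distr) auto
  qed
  also have "\<dots> = (\<integral>\<^sup>+\<omega>. ennreal (exp (c * \<Lambda> (?S 0) \<omega>)) \<partial>M) ^ Suc m"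
    by (simp only: prod_constant card_lessThan)
  finally show "(\<integral>\<^sup>+\<omega>. ennreal (exp (c * \<Lambda> ?U \<omega>)) \<partial>M) = (\<integral>\<^sup>+\<omega>. ennreal (exp (c * \<Lambda> (?S 0) \<omega>)) \<partial>M) ^ Suc m" .
qed

text \<open>The root of order \<open>Suc m\<close> of the growth condition bounds the exponential
  moment on one strip by exp (\<open>piece m\<close> (k - 1)). Passing to the gap leaves exp (-
  \<open>piece m\<close>), a bound that does not grow with \<open>k\<close>.\<close>

lemma nn_integral_exp_gap_le:
  assumes k: "2 \<le> k"
  shows "(\<integral>\<^sup>+\<omega>. ennreal (exp (- (real k * gap m \<omega>))) \<partial>M) \<le> 1"
proof -
  let ?S = "strip (piece m) 0"
  note [measurable] = strip_fmeasurable[OF piece_pos[of m], of 0]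
  let ?I = "\<integral>\<^sup>+\<omega>. ennreal (exp (real k * \<Lambda> ?S \<omega>)) \<partial>M"
  obtain U where U: "U \<in> fmeasurable \<H>" "measure \<H> U = ln 2"
    "(\<integral>\<^sup>+\<omega>. ennreal (exp (real k * \<Lambda> U \<omega>)) \<partial>M) = ?I ^ Suc m"
    using nn_integral_exp_strips[of m] by metis
  have "?I ^ Suc m \<le> ennreal (exp (ln 2 * (real k - 1)))"
    using growth[OF U(1,2) k] U(3) by simp
  also have "\<dots> = ennreal (exp (piece m * (real k - 1))) ^ Suc m"
  proof -
    have "ln 2 * (real k - 1) = real (Suc m) * (piece m * (real k - 1))" by (simp add: piece_def)
    then show ?thesis by (simp only: ennreal_power exp_ge_zero exp_of_nat_mult)
  qed
  finally have power: "?I ^ Suc m \<le> ennreal (exp (piece m * (real k - 1))) ^ Suc m" .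
  have I: "?I \<le> ennreal (exp (piece m * (real k - 1)))"
  proof (cases ?I rule: ennreal_cases)
    case (real r)
    have "r ^ Suc m \<le> exp (piece m * (real k - 1)) ^ Suc m"
      using power real(1) unfolding real(2)
      by (subst (asm) (1 2) ennreal_power) (simp_all only: ennreal_le_iff exp_ge_zero zero_le_power)
    then have "r \<le> exp (piece m * (real k - 1))"
      by (rule power_le_imp_le_base) simp
    then show ?thesis unfolding real(2) by (rule ennreal_leI)
  next
    case top
    have "ennreal (exp (piece m * (real k - 1))) ^ Suc m < top"
      by (subst ennreal_power) simp_all
    moreover have "?I ^ Suc m = top" unfolding top by (simp add: ennreal_top_eq_mult_iff)
    ultimately show ?thesis using power by simp
  qed
  have "(\<integral>\<^sup>+\<omega>. ennreal (exp (- (real k * gap m \<omega>))) \<partial>M) = ennreal (exp (- (real k * piece m))) * ?I"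
    by (subst nn_integral_cmult[symmetric])
      (auto simp: gap_def ennreal_mult[symmetric] exp_add[symmetric] algebra_simps)
  also have "\<dots> \<le> ennreal (exp (- (real k * piece m))) * ennreal (exp (piece m * (real k - 1)))"
    by (intro mult_left_mono I) simp
  also have "\<dots> = ennreal (exp (- piece m))"
    by (simp add: ennreal_mult[symmetric] exp_add[symmetric] algebra_simps)
  also have "\<dots> \<le> 1" using piece_pos[of m] by simp
  finally show ?thesis .
qed

text \<open>By Markov's inequality the probability of a gap below - \<eta> is at most exp (- k
  \<eta>) for every \<open>k \<ge> 2\<close>, hence zero.\<close>

lemma gap_nonneg: "AE \<omega> in M. 0 \<le> gap m \<omega>"
proof -
  have "AE \<omega> in M. - (1 / real (Suc n)) < gap m \<omega>" for n
  proof -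
    define \<eta> where "\<eta> = 1 / real (Suc n)"
    have \<eta>: "0 < \<eta>" by (simp add: \<eta>_def)
    define A where "A = {\<omega>\<in>space M. gap m \<omega> \<le> - \<eta>}"
    have A [measurable]: "A \<in> sets M" unfolding A_def by measurable
    have "prob A \<le> exp (- (real (k + 2) * \<eta>))" for k
    proof -
      have "ennreal (exp (real (k + 2) * \<eta>)) * emeasure M A =
          (\<integral>\<^sup>+\<omega>. ennreal (exp (real (k + 2) * \<eta>)) * indicator A \<omega> \<partial>M)"
        by (simp add: nn_integral_cmult)
      also have "\<dots> \<le> (\<integral>\<^sup>+\<omega>. ennreal (exp (- (real (k + 2) * gap m \<omega>))) \<partial>M)"
      proof (rule nn_integral_mono)
        fix \<omega>
        show "ennreal (exp (real (k + 2) * \<eta>)) * indicator A \<omega> \<le> ennreal (exp (- (real (k + 2) * gap m \<omega>)))"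
        proof (cases "\<omega> \<in> A")
          case True
          then have "\<eta> \<le> - gap m \<omega>" by (simp add: A_def)
          then have "real (k + 2) * \<eta> \<le> real (k + 2) * (- gap m \<omega>)" by (rule mult_left_mono) simp
          then show ?thesis using True by (simp add: ennreal_leI)
        qed simp
      qed
      also have "\<dots> \<le> 1" by (rule nn_integral_exp_gap_le) simp
      finally have "ennreal (exp (real (k + 2) * \<eta>) * prob A) \<le> ennreal 1"
        by (simp add: emeasure_eq_measure ennreal_mult)
      then have "exp (real (k + 2) * \<eta>) * prob A \<le> 1" by (subst (asm) ennreal_le_iff) auto
      then show ?thesis by (rule exp_mult_le_one)
    qed
    moreover have "(\<lambda>k. exp (- (real (k + 2) * \<eta>))) \<longlonglongrightarrow> 0" using \<eta> by real_asymp
    ultimately have "prob A \<le> 0" by (intro LIMSEQ_le_const) auto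
    then have "prob A = 0" using measure_nonneg[of M A] by linarith
    then have "AE \<omega> in M. \<omega> \<notin> A" by (intro AE_not_in) (simp add: null_sets_def emeasure_eq_measure)
    with AE_space show ?thesis by eventually_elim (auto simp: A_def \<eta>_def)
  qed
  then have "AE \<omega> in M. \<forall>n. - (1 / real (Suc n)) < gap m \<omega>" by (subst AE_all_countable) auto
  then show ?thesis
  proof eventually_elim
    case (elim \<omega>)
    have "(\<lambda>n. - (1 / real (Suc n))) \<longlonglongrightarrow> 0" by real_asymp
    then show ?case using elim by (intro LIMSEQ_le_const2[where X="\<lambda>n. - (1 / real (Suc n))"]) (auto intro: less_imp_le)
  qed
qed

text \<open>By infinite divisibility the Laplace transforms \<open>F m\<close> at one satisfy
  \<open>F m ^ Suc m = F 0\<close>, so \<open>(m + 1) * (1 - F m)\<close> is at most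
  \<open>- ln (F 0)\<close>. For nonnegative gaps \<open>1 - exp (- y)\<close> controls
  \<open>min 1 y\<close>. The bound is the source of finite variation and of the absence of a
  Gaussian part.\<close>

lemma gap_rate_bounded:
  obtains K where "\<And>m. real (Suc m) * (LINT \<omega>|M. min 1 (gap m \<omega>)) \<le> K"
proof -
  define F where "F m = (LINT \<omega>|M. exp (- gap m \<omega>))" for m
  have int: "integrable M (\<lambda>\<omega>. exp (- gap m \<omega>))" for m
    using gap_nonneg[of m] by (intro integrable_const_bound[where B=1]) auto
  have F_pos: "0 < F m" for m
  proof -
    have "F m \<noteq> 0"
    proof
      assume "F m = 0"
      then have "AE \<omega> in M. exp (- gap m \<omega>) = 0"
        unfolding F_def using integral_nonneg_eq_0_iff_AE[OF int[of m]] by simp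
      then have "AE \<omega> in M. False" by eventually_elim simp
      then show False by simp
    qed
    moreover have "0 \<le> F m" unfolding F_def by (rule integral_nonneg_AE) simp
    ultimately show ?thesis by simp
  qed
  have F_power: "F m ^ Suc m = F 0" for m
  proof -
    have *: "(\<integral>\<^sup>+\<omega>. ennreal (exp (1 * \<Lambda> (strip (piece m) 0) \<omega>)) \<partial>M) = ennreal (exp (piece m) * F m)" for m
    proof -
      note [measurable] = strip_fmeasurable[OF piece_pos[of m], of 0]
      have "(\<integral>\<^sup>+\<omega>. ennreal (exp (1 * \<Lambda> (strip (piece m) 0) \<omega>)) \<partial>M) =
          ennreal (exp (piece m)) * (\<integral>\<^sup>+\<omega>. ennreal (exp (- gap m \<omega>)) \<partial>M)"
        by (subst nn_integral_cmult[symmetric])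
          (auto simp: gap_def ennreal_mult[symmetric] exp_add[symmetric])
      also have "(\<integral>\<^sup>+\<omega>. ennreal (exp (- gap m \<omega>)) \<partial>M) = ennreal (F m)"
        unfolding F_def by (intro nn_integral_eq_integral int) auto
      finally show ?thesis using F_pos[of m] by (simp add: ennreal_mult)
    qed
    obtain U where U: "U \<in> fmeasurable \<H>" "measure \<H> U = ln 2"
      "(\<integral>\<^sup>+\<omega>. ennreal (exp (1 * \<Lambda> U \<omega>)) \<partial>M) = (\<integral>\<^sup>+\<omega>. ennreal (exp (1 * \<Lambda> (strip (piece m) 0) \<omega>)) \<partial>M) ^ Suc m"
      using nn_integral_exp_strips[of m] by metis
    have "distr M borel (\<Lambda> U) = distr M borel (\<Lambda> (strip (piece 0) 0))"
      using U strip_fmeasurable[OF piece_pos[of 0]] by (intro distr_Lam_eq) (auto simp: measure_strip piece_pos piece_def)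
    then have "(\<integral>\<^sup>+x. ennreal (exp (1 * x)) \<partial>distr M borel (\<Lambda> U)) = (\<integral>\<^sup>+x. ennreal (exp (1 * x)) \<partial>distr M borel (\<Lambda> (strip (piece 0) 0)))"
      by simp
    then have "(\<integral>\<^sup>+\<omega>. ennreal (exp (1 * \<Lambda> U \<omega>)) \<partial>M) = (\<integral>\<^sup>+\<omega>. ennreal (exp (1 * \<Lambda> (strip (piece 0) 0) \<omega>)) \<partial>M)"
      using U(1) strip_fmeasurable[OF piece_pos[of 0]] by (subst (asm) (1 2) nn_integral_distr) auto
    with U(3) have "ennreal (exp (piece m) * F m) ^ Suc m = ennreal (exp (piece 0) * F 0)"
      unfolding * by simp
    then have "(exp (piece m) * F m) ^ Suc m = exp (piece 0) * F 0"
      using F_pos[of m] F_pos[of 0] by (simp add: ennreal_power ennreal_inj less_imp_le del: power_Suc)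
    moreover have "exp (piece m) ^ Suc m = exp (piece 0)"
      unfolding exp_of_nat_mult[symmetric] by (simp add: piece_def)
    ultimately show ?thesis by (simp only: power_mult_distrib) simp
  qed
  have "real (Suc m) * (LINT \<omega>|M. min 1 (gap m \<omega>)) \<le> 2 * (- ln (F 0))" for m
  proof -
    have "(LINT \<omega>|M. min 1 (gap m \<omega>)) \<le> (LINT \<omega>|M. 2 * (1 - exp (- gap m \<omega>)))"
    proof (rule integral_mono_AE)
      show "integrable M (\<lambda>\<omega>. min 1 (gap m \<omega>))"
        using gap_nonneg[of m] by (intro integrable_const_bound[where B=1]) auto
      show "AE \<omega> in M. min 1 (gap m \<omega>) \<le> 2 * (1 - exp (- gap m \<omega>))"
        using gap_nonneg[of m] by eventually_elim (rule min_le_one_minus_exp)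
    qed (use int[of m] in auto)
    also have "\<dots> = 2 * (1 - F m)" using int[of m] by (simp add: F_def prob_space)
    finally have 1: "(LINT \<omega>|M. min 1 (gap m \<omega>)) \<le> 2 * (1 - F m)" .
    have "1 - F m \<le> - ln (F m)" using ln_le_minus_one[OF F_pos[of m]] by simp
    also have "\<dots> = - ln (F 0) / real (Suc m)"
      using F_power[of m] F_pos[of m] by (simp add: ln_realpow[symmetric] field_simps del: power_Suc of_nat_Suc)
    finally have "real (Suc m) * (1 - F m) \<le> - ln (F 0)"
      by (simp add: field_simps del: of_nat_Suc)
    moreover have "real (Suc m) * (LINT \<omega>|M. min 1 (gap m \<omega>)) \<le> real (Suc m) * (2 * (1 - F m))"
      using 1 by (rule mult_left_mono) simp
    ultimately show ?thesis by linarith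
  qed
  then show ?thesis by (rule that)
qed

text \<open>The Levy exponent of \<lambda> B - \<Lambda> B per unit area.\<close>

definition shifted_exponent :: "real \<Rightarrow> complex" where
  "shifted_exponent \<theta> = \<i> * of_real \<theta> + levy_exponent a \<sigma> \<nu> (- \<theta>)"

lemma char_gap: "(CLINT \<omega>|M. iexp (\<theta> * gap m \<omega>)) = exp (of_real (ln 2) * shifted_exponent \<theta> / of_nat (Suc m))"
proof -
  let ?S = "strip (piece m) 0"
  note fm = strip_fmeasurable[OF piece_pos[of m], of 0]
  note [measurable] = fm
  have "(CLINT \<omega>|M. iexp (\<theta> * gap m \<omega>)) = (CLINT \<omega>|M. iexp (\<theta> * piece m) * iexp (- \<theta> * \<Lambda> ?S \<omega>))"
    by (intro Bochner_Integration.integral_cong refl) (simp add: gap_def exp_add[symmetric] algebra_simps)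
  also have "\<dots> = iexp (\<theta> * piece m) * (CLINT \<omega>|M. iexp (- \<theta> * \<Lambda> ?S \<omega>))"
    by (rule integral_mult_right_zero)
  also have "(CLINT \<omega>|M. iexp (- \<theta> * \<Lambda> ?S \<omega>)) = exp (levy_exponent a \<sigma> \<nu> (- \<theta>) * of_real (piece m))"
    using char_Lam[OF fm, of "- \<theta>"] unfolding char_def
    by (subst (asm) integral_distr) (auto simp: measure_strip piece_pos)
  also have "iexp (\<theta> * piece m) * \<dots> = exp (of_real (piece m) * shifted_exponent \<theta>)"
    by (simp add: exp_add[symmetric] shifted_exponent_def algebra_simps)
  also have "of_real (piece m) * shifted_exponent \<theta> = of_real (ln 2) * shifted_exponent \<theta> / of_nat (Suc m)"
    by (simp add: piece_def del: of_nat_Suc)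
  finally show ?thesis .
qed

lemma integrable_min_square: "integrable \<nu> (\<lambda>x. min 1 (x\<^sup>2))"
  using levy by (intro integrableI_nonneg) (auto simp: levy_measure_def)

lemma levy_integrand_bound:
  "norm (iexp (q * x) - 1 - \<i> * of_real (q * x * indicator {-1..1} x)) \<le> (q\<^sup>2 + 2) * min 1 (x\<^sup>2)"
proof (cases "x \<in> {-1..1}")
  case True
  have "norm (iexp (q * x) - (\<Sum>k\<le>1. (\<i> * (q * x)) ^ k / fact k)) \<le> \<bar>q * x\<bar> ^ Suc 1 / fact (Suc 1)"
    using iexp_approx1[of "q * x" 1] by simp
  then have "norm (iexp (q * x) - 1 - \<i> * of_real (q * x)) \<le> (q * x)\<^sup>2 / 2"
    by (simp add: eval_nat_numeral power2_eq_square diff_diff_eq abs_mult_self_eq)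
  also have "\<dots> \<le> (q\<^sup>2 + 2) * x\<^sup>2"
    by (simp add: power_mult_distrib distrib_right)
  also have "x\<^sup>2 = min 1 (x\<^sup>2)" using True by (simp add: min_absorb2 abs_square_le_1 abs_le_iff)
  finally show ?thesis using True by simp
next
  case False
  then have "1 \<le> x\<^sup>2" using abs_square_less_1[of x] by (auto simp: not_less[symmetric] abs_less_iff)
  moreover have "norm (iexp (q * x) - 1) \<le> q\<^sup>2 + 2"
  proof -
    have "norm (iexp (q * x) - 1) \<le> 2"
      using norm_triangle_ineq4[of "iexp (q * x)" 1] by simp
    then show ?thesis using zero_le_power2[of q] by linarith
  qed
  ultimately have "norm (iexp (q * x) - 1) \<le> (q\<^sup>2 + 2) * min 1 (x\<^sup>2)"
    by (simp only: min_absorb1 mult_1_right)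
  then show ?thesis using False by simp
qed

lemma integrable_levy_integrand:
  "complex_integrable \<nu> (\<lambda>x. iexp (q * x) - 1 - \<i> * of_real (q * x * indicator {-1..1} x))"
proof (rule Bochner_Integration.integrable_bound)
  show "integrable \<nu> (\<lambda>x. (q\<^sup>2 + 2) * min 1 (x\<^sup>2))" by (intro integrable_mult_right integrable_min_square)
  show "AE x in \<nu>. norm (iexp (q * x) - 1 - \<i> * of_real (q * x * indicator {-1..1} x)) \<le> norm ((q\<^sup>2 + 2) * min 1 (x\<^sup>2))"
    by (intro AE_I2 order_trans[OF levy_integrand_bound]) simp
qed measurable

lemma one_minus_cos_bound: "1 - cos (h * x) \<le> (h\<^sup>2 + 2) * min 1 (x\<^sup>2)" for h x :: real
proof -
  have "1 - cos (h * x) = - Re (iexp (h * x) - 1 - \<i> * of_real (h * x * indicator {-1..1} x))"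
    by (simp add: Re_exp)
  also have "\<dots> \<le> norm (iexp (h * x) - 1 - \<i> * of_real (h * x * indicator {-1..1} x))"
    using abs_Re_le_cmod[of "iexp (h * x) - 1 - \<i> * of_real (h * x * indicator {-1..1} x)"] by linarith
  finally show ?thesis using levy_integrand_bound[of h x] by linarith
qed

lemma integrable_one_minus_cos: "integrable \<nu> (\<lambda>x. 1 - cos (h * x))"
proof (rule Bochner_Integration.integrable_bound)
  show "integrable \<nu> (\<lambda>x. (h\<^sup>2 + 2) * min 1 (x\<^sup>2))" by (intro integrable_mult_right integrable_min_square)
  show "AE x in \<nu>. norm (1 - cos (h * x)) \<le> norm ((h\<^sup>2 + 2) * min 1 (x\<^sup>2))"
  proof (intro AE_I2)
    fix x
    have "norm (1 - cos (h * x)) = 1 - cos (h * x)" by simp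
    then show "norm (1 - cos (h * x)) \<le> norm ((h\<^sup>2 + 2) * min 1 (x\<^sup>2))"
      using one_minus_cos_bound[of h x] by (simp only: real_norm_def)
  qed
qed measurable

lemma Re_shifted_exponent: "Re (shifted_exponent \<theta>) = - (\<sigma>\<^sup>2 * \<theta>\<^sup>2 / 2) - (LINT x|\<nu>. 1 - cos (\<theta> * x))"
proof -
  have "Re (CLINT x|\<nu>. iexp (- \<theta> * x) - 1 - \<i> * of_real (- \<theta> * x * indicator {-1..1} x)) =
      (LINT x|\<nu>. Re (iexp (- \<theta> * x) - 1 - \<i> * of_real (- \<theta> * x * indicator {-1..1} x)))"
    by (rule integral_Re[symmetric, OF integrable_levy_integrand])
  also have "\<dots> = (LINT x|\<nu>. - (1 - cos (\<theta> * x)))"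
    by (intro Bochner_Integration.integral_cong refl) (simp add: Re_exp)
  also have "\<dots> = - (LINT x|\<nu>. 1 - cos (\<theta> * x))"
    by (rule Bochner_Integration.integral_minus)
  finally show ?thesis
    unfolding shifted_exponent_def levy_exponent_def by simp
qed

lemma rate_tendsto:
  "(\<lambda>m. of_nat (Suc m) * ((CLINT \<omega>|M. iexp (\<theta> * gap m \<omega>)) - 1)) \<longlonglongrightarrow> of_real (ln 2) * shifted_exponent \<theta>"
  unfolding char_gap by (rule tendsto_exp_difference_quotient)

lemma integrable_iexp_gap: "complex_integrable M (\<lambda>\<omega>. iexp (\<theta> * gap m \<omega>))"
  by (rule integrable_const_bound[where B=1]) auto

lemma integrable_cos_gap: "integrable M (\<lambda>\<omega>. cos (\<theta> * gap m \<omega>))"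
  by (rule integrable_const_bound[where B=1]) auto

text \<open>By \<open>gap_rate_bounded\<close>,
  \<open>(m + 1) * (1 - E (cos (\<theta> * gap m)))\<close> is at most linear in \<theta>. Its limit
  contains the term \<sigma>^2 \<theta>^2 / 2 next to a nonnegative integral, so the quadratic term
  must vanish.\<close>

theorem sigma_eq_0: "\<sigma> = 0"
proof -
  obtain K where K: "\<And>m. real (Suc m) * (LINT \<omega>|M. min 1 (gap m \<omega>)) \<le> K"
    using gap_rate_bounded by blast
  have min_int: "integrable M (\<lambda>\<omega>. min 1 (gap m \<omega>))" for m
    using gap_nonneg[of m] by (intro integrable_const_bound[where B=1]) auto
  have bound: "ln 2 * (\<sigma>\<^sup>2 * \<theta>\<^sup>2 / 2) \<le> 2 * \<theta> * K" if \<theta>: "1 \<le> \<theta>" for \<theta>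
  proof -
    have le: "real (Suc m) * (1 - (LINT \<omega>|M. cos (\<theta> * gap m \<omega>))) \<le> 2 * \<theta> * K" for m
    proof -
      have "1 - (LINT \<omega>|M. cos (\<theta> * gap m \<omega>)) = (LINT \<omega>|M. 1 - cos (\<theta> * gap m \<omega>))"
        by (simp add: integrable_cos_gap prob_space)
      also have "\<dots> \<le> (LINT \<omega>|M. 2 * \<theta> * min 1 (gap m \<omega>))"
      proof (rule integral_mono_AE)
        show "AE \<omega> in M. 1 - cos (\<theta> * gap m \<omega>) \<le> 2 * \<theta> * min 1 (gap m \<omega>)"
          using gap_nonneg[of m]
        proof eventually_elim
          case (elim \<omega>)
          have 1: "1 - cos (\<theta> * gap m \<omega>) \<le> \<theta> * gap m \<omega>"
            using one_minus_cos_le(2)[of "\<theta> * gap m \<omega>"] elim \<theta> by (simp add: abs_mult)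
          have 2: "1 - cos (\<theta> * gap m \<omega>) \<le> 2 * \<theta>"
            using cos_ge_minus_one[of "\<theta> * gap m \<omega>"] \<theta> by linarith
          have 3: "0 \<le> \<theta> * gap m \<omega>" using elim \<theta> by simp
          show ?case
          proof (cases "gap m \<omega> \<le> 1")
            case True
            then have "2 * \<theta> * min 1 (gap m \<omega>) = 2 * (\<theta> * gap m \<omega>)" by (simp add: min_absorb2)
            with 1 3 show ?thesis by linarith
          qed (use 2 in simp)
        qed
      qed (use integrable_cos_gap min_int in auto)
      also have "\<dots> = 2 * \<theta> * (LINT \<omega>|M. min 1 (gap m \<omega>))" by simp
      finally have "real (Suc m) * (1 - (LINT \<omega>|M. cos (\<theta> * gap m \<omega>))) \<le>
          real (Suc m) * (2 * \<theta> * (LINT \<omega>|M. min 1 (gap m \<omega>)))"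
        by (rule mult_left_mono) simp
      also have "\<dots> = 2 * \<theta> * (real (Suc m) * (LINT \<omega>|M. min 1 (gap m \<omega>)))" by (simp only: mult_ac)
      also have "\<dots> \<le> 2 * \<theta> * K" using \<theta> by (intro mult_left_mono K) auto
      finally show ?thesis .
    qed
    have Re: "Re (of_nat (Suc m) * ((CLINT \<omega>|M. iexp (\<theta> * gap m \<omega>)) - 1)) =
        - (real (Suc m) * (1 - (LINT \<omega>|M. cos (\<theta> * gap m \<omega>))))" for m
    proof -
      have "Re (CLINT \<omega>|M. iexp (\<theta> * gap m \<omega>)) = (LINT \<omega>|M. Re (iexp (\<theta> * gap m \<omega>)))"
        by (rule integral_Re[symmetric, OF integrable_iexp_gap])
      also have "\<dots> = (LINT \<omega>|M. cos (\<theta> * gap m \<omega>))" by (simp add: Re_exp)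
      finally show ?thesis by (simp add: algebra_simps)
    qed
    have "(\<lambda>m. - (real (Suc m) * (1 - (LINT \<omega>|M. cos (\<theta> * gap m \<omega>))))) \<longlonglongrightarrow> Re (of_real (ln 2) * shifted_exponent \<theta>)"
      using tendsto_Re[OF rate_tendsto[of \<theta>]] unfolding Re .
    then have "- (2 * \<theta> * K) \<le> Re (of_real (ln 2) * shifted_exponent \<theta>)"
      using le by (intro LIMSEQ_le_const) auto
    also have "\<dots> = ln 2 * (- (\<sigma>\<^sup>2 * \<theta>\<^sup>2 / 2) - (LINT x|\<nu>. 1 - cos (\<theta> * x)))"
      by (simp add: Re_shifted_exponent)
    also have "\<dots> \<le> ln 2 * (- (\<sigma>\<^sup>2 * \<theta>\<^sup>2 / 2))"
    proof (rule mult_left_mono)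
      have "0 \<le> (LINT x|\<nu>. 1 - cos (\<theta> * x))" by (rule integral_nonneg_AE) simp
      then show "- (\<sigma>\<^sup>2 * \<theta>\<^sup>2 / 2) - (LINT x|\<nu>. 1 - cos (\<theta> * x)) \<le> - (\<sigma>\<^sup>2 * \<theta>\<^sup>2 / 2)" by simp
    qed simp
    finally show ?thesis by simp
  qed
  have "ln 2 * \<sigma>\<^sup>2 / 2 \<le> 2 * K * (1 / real (Suc n))" for n
    using bound[of "real (Suc n)"] by (simp add: power2_eq_square field_simps del: of_nat_Suc)
  moreover have "(\<lambda>n. 2 * K * (1 / real (Suc n))) \<longlonglongrightarrow> 0" by real_asymp
  ultimately have "ln 2 * \<sigma>\<^sup>2 / 2 \<le> 0" by (intro LIMSEQ_le_const) auto
  then show ?thesis by (simp add: mult_le_0_iff)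
qed

text \<open>Drift and compensator are linear in the argument and drop out of a second difference;
  the Gaussian part is already excluded. Only an absolutely convergent integral against 2 (1 - cos
  (h x)) remains.\<close>

lemma second_difference_shifted_exponent:
  "2 * shifted_exponent \<theta> - shifted_exponent (\<theta> + h) - shifted_exponent (\<theta> - h) =
    (CLINT x|\<nu>. of_real (2 * (1 - cos (h * x))) * iexp (- \<theta> * x))"
proof -
  let ?g = "\<lambda>q x. iexp (q * x) - 1 - \<i> * of_real (q * x * indicator {-1..1} x)"
  have "2 * shifted_exponent \<theta> - shifted_exponent (\<theta> + h) - shifted_exponent (\<theta> - h) =
      2 * (CLINT x|\<nu>. ?g (- \<theta>) x) - (CLINT x|\<nu>. ?g (- (\<theta> + h)) x) - (CLINT x|\<nu>. ?g (- (\<theta> - h)) x)"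
  proof -
    define G where "G q = (CLINT x|\<nu>. ?g q x)" for q
    have "\<sigma>\<^sup>2 = 0" by (simp add: sigma_eq_0)
    then have shifted: "shifted_exponent q = \<i> * of_real q - \<i> * of_real (a * q) + G (- q)" for q
      unfolding shifted_exponent_def levy_exponent_def G_def by (simp only: of_real_mult of_real_minus) simp
    show ?thesis unfolding G_def[symmetric] shifted by (simp add: algebra_simps)
  qed
  also have "\<dots> = (CLINT x|\<nu>. 2 * ?g (- \<theta>) x - ?g (- (\<theta> + h)) x - ?g (- (\<theta> - h)) x)"
    using integrable_levy_integrand
    by (simp only: Bochner_Integration.integral_diff Bochner_Integration.integrable_diff
        integral_mult_right_zero integrable_mult_right)
  also have "\<dots> = (CLINT x|\<nu>. of_real (2 * (1 - cos (h * x))) * iexp (- \<theta> * x))"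
  proof (intro Bochner_Integration.integral_cong refl)
    fix x
    have cos: "of_real (2 * (1 - cos (h * x))) = 2 - iexp (h * x) - iexp (- (h * x))"
      by (simp add: complex_eq_iff Re_exp Im_exp)
    have "iexp (- (\<theta> + h) * x) = iexp (- (h * x)) * iexp (- \<theta> * x)"
      "iexp (- (\<theta> - h) * x) = iexp (h * x) * iexp (- \<theta> * x)"
      by (simp_all add: exp_add[symmetric] algebra_simps)
    then show "2 * ?g (- \<theta>) x - ?g (- (\<theta> + h)) x - ?g (- (\<theta> - h)) x = of_real (2 * (1 - cos (h * x))) * iexp (- \<theta> * x)"
      unfolding cos by (simp add: algebra_simps)
  qed
  finally show ?thesis .
qed

text \<open>Multiplication with \<open>2 * (1 - cos (h * y))\<close>, a second difference of characters, turns the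
  jump measures into finite measures, to which Levy continuity applies.\<close>

definition cos_weight :: "real \<Rightarrow> nat \<Rightarrow> real \<Rightarrow> real" where
  "cos_weight h m y = real (Suc m) * (2 * (1 - cos (h * y)))"

lemma cos_weight_nonneg: "0 \<le> cos_weight h m y"
  by (simp add: cos_weight_def)

lemma cos_weight_measurable [measurable]: "cos_weight h m \<in> borel_measurable borel"
  unfolding cos_weight_def[abs_def] by measurable

lemma integrable_cos_weight:
  fixes g :: "real \<Rightarrow> 'b :: {banach, second_countable_topology}"
  assumes [measurable]: "g \<in> borel_measurable borel" and g: "\<And>y. norm (g y) \<le> C"
  shows "integrable M (\<lambda>\<omega>. cos_weight h m (gap m \<omega>) *\<^sub>R g (gap m \<omega>))"
proof (rule integrable_const_bound[where B="real (Suc m) * 4 * C"])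
  show "AE \<omega> in M. norm (cos_weight h m (gap m \<omega>) *\<^sub>R g (gap m \<omega>)) \<le> real (Suc m) * 4 * C"
  proof (intro AE_I2)
    fix \<omega>
    have "cos_weight h m (gap m \<omega>) \<le> real (Suc m) * 4"
      unfolding cos_weight_def
    proof (intro mult_left_mono)
      have "2 * (1 - cos t) \<le> 4" for t :: real using cos_ge_minus_one[of t] by argo
      then show "2 * (1 - cos (h * gap m \<omega>)) \<le> 4" .
    qed simp
    then show "norm (cos_weight h m (gap m \<omega>) *\<^sub>R g (gap m \<omega>)) \<le> real (Suc m) * 4 * C"
      using g[of "gap m \<omega>"] cos_weight_nonneg[of h m "gap m \<omega>"]
      unfolding norm_scaleR by (intro mult_mono) auto
  qed
qed measurable

lemma cos_weight_char_tendsto: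
  "(\<lambda>m. CLINT \<omega>|M. cos_weight h m (gap m \<omega>) *\<^sub>R iexp (\<theta> * gap m \<omega>)) \<longlonglongrightarrow>
    of_real (ln 2) * (CLINT x|\<nu>. of_real (2 * (1 - cos (h * x))) * iexp (- \<theta> * x))"
proof -
  let ?\<phi> = "\<lambda>m \<theta>. CLINT \<omega>|M. iexp (\<theta> * gap m \<omega>)"
  let ?r = "\<lambda>m \<theta>. of_nat (Suc m) * (?\<phi> m \<theta> - 1)"
  have "(\<lambda>m. 2 * ?r m \<theta> - ?r m (\<theta> + h) - ?r m (\<theta> - h)) \<longlonglongrightarrow>
      2 * (of_real (ln 2) * shifted_exponent \<theta>) - of_real (ln 2) * shifted_exponent (\<theta> + h) - of_real (ln 2) * shifted_exponent (\<theta> - h)"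
    by (intro tendsto_diff tendsto_mult tendsto_const rate_tendsto)
  also have "2 * (of_real (ln 2) * shifted_exponent \<theta>) - of_real (ln 2) * shifted_exponent (\<theta> + h) - of_real (ln 2) * shifted_exponent (\<theta> - h) =
      of_real (ln 2) * (CLINT x|\<nu>. of_real (2 * (1 - cos (h * x))) * iexp (- \<theta> * x))"
    unfolding second_difference_shifted_exponent[symmetric] by (simp add: algebra_simps)
  also have "(\<lambda>m. 2 * ?r m \<theta> - ?r m (\<theta> + h) - ?r m (\<theta> - h)) =
      (\<lambda>m. CLINT \<omega>|M. cos_weight h m (gap m \<omega>) *\<^sub>R iexp (\<theta> * gap m \<omega>))"
  proof
    fix m
    have "2 * ?r m \<theta> - ?r m (\<theta> + h) - ?r m (\<theta> - h) =
        of_nat (Suc m) * (2 * ?\<phi> m \<theta> - ?\<phi> m (\<theta> + h) - ?\<phi> m (\<theta> - h))"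
      by (simp add: algebra_simps)
    also have "2 * ?\<phi> m \<theta> - ?\<phi> m (\<theta> + h) - ?\<phi> m (\<theta> - h) =
        (CLINT \<omega>|M. 2 * iexp (\<theta> * gap m \<omega>) - iexp ((\<theta> + h) * gap m \<omega>) - iexp ((\<theta> - h) * gap m \<omega>))"
      using integrable_iexp_gap
      by (simp only: Bochner_Integration.integral_diff Bochner_Integration.integrable_diff
          integral_mult_right_zero integrable_mult_right)
    also have "of_nat (Suc m) * \<dots> = (CLINT \<omega>|M. of_nat (Suc m) *
        (2 * iexp (\<theta> * gap m \<omega>) - iexp ((\<theta> + h) * gap m \<omega>) - iexp ((\<theta> - h) * gap m \<omega>)))"
      by (rule integral_mult_right_zero[symmetric])
    also have "\<dots> = (CLINT \<omega>|M. cos_weight h m (gap m \<omega>) *\<^sub>R iexp (\<theta> * gap m \<omega>))"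
    proof (intro Bochner_Integration.integral_cong refl)
      fix \<omega>
      let ?y = "gap m \<omega>"
      have cos: "of_real (2 * (1 - cos (h * ?y))) = 2 - iexp (h * ?y) - iexp (- (h * ?y))"
        by (simp add: complex_eq_iff Re_exp Im_exp)
      have "iexp ((\<theta> + h) * ?y) = iexp (h * ?y) * iexp (\<theta> * ?y)"
        "iexp ((\<theta> - h) * ?y) = iexp (- (h * ?y)) * iexp (\<theta> * ?y)"
        by (simp_all add: exp_add[symmetric] algebra_simps)
      then show "of_nat (Suc m) * (2 * iexp (\<theta> * ?y) - iexp ((\<theta> + h) * ?y) - iexp ((\<theta> - h) * ?y)) =
          cos_weight h m ?y *\<^sub>R iexp (\<theta> * ?y)"
        unfolding cos_weight_def scaleR_conv_of_real of_real_mult[of "real (Suc m)"] cos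
        by (simp add: algebra_simps)
    qed
    finally show "2 * ?r m \<theta> - ?r m (\<theta> + h) - ?r m (\<theta> - h) =
      (CLINT \<omega>|M. cos_weight h m (gap m \<omega>) *\<^sub>R iexp (\<theta> * gap m \<omega>))" .
  qed
  finally show ?thesis .
qed

text \<open>Divided by their total masses, the weighted laws of the gaps and the weighted image of
  \<nu> under negation become probability laws whose characteristic functions converge. If the
  limiting mass is zero this normalisation is impossible, but then both sides vanish in the
  limit.\<close>

theorem cos_weight_tendsto:
  fixes f :: "real \<Rightarrow> real"
  assumes cont: "\<And>y. isCont f y" and C: "\<And>y. \<bar>f y\<bar> \<le> C"
  shows "(\<lambda>m. LINT \<omega>|M. cos_weight h m (gap m \<omega>) * f (gap m \<omega>)) \<longlonglongrightarrow>
    ln 2 * (LINT x|\<nu>. 2 * (1 - cos (h * x)) * f (- x))"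
proof -
  have f [measurable]: "f \<in> borel_measurable borel"
    using cont by (intro borel_measurable_continuous_onI) (simp add: continuous_at_imp_continuous_on)
  define W where "W m = (LINT \<omega>|M. cos_weight h m (gap m \<omega>))" for m
  define W' where "W' = ln 2 * (LINT x|\<nu>. 2 * (1 - cos (h * x)))"
  have int: "integrable M (\<lambda>\<omega>. cos_weight h m (gap m \<omega>))" for m
    using integrable_cos_weight[of "\<lambda>_. 1::real" 1 h m] by simp
  have int': "integrable \<nu> (\<lambda>x. 2 * (1 - cos (h * x)))"
    by (intro integrable_mult_right integrable_one_minus_cos)
  have W_lim: "W \<longlonglongrightarrow> W'"
  proof -
    have 1: "(CLINT \<omega>|M. cos_weight h m (gap m \<omega>) *\<^sub>R iexp (0 * gap m \<omega>)) = of_real (W m)" for m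
      unfolding W_def by (simp add: scaleR_conv_of_real)
    have 2: "of_real (ln 2) * (CLINT x|\<nu>. of_real (2 * (1 - cos (h * x))) * iexp (- 0 * x)) = complex_of_real W'"
      unfolding W'_def by (simp del: of_real_diff)
    have "(\<lambda>m. complex_of_real (W m)) \<longlonglongrightarrow> of_real W'"
      using cos_weight_char_tendsto[of h 0] unfolding 1 2 .
    then show ?thesis by (simp only: tendsto_of_real_iff)
  qed
  have W'_nonneg: "0 \<le> W'" unfolding W'_def by (intro mult_nonneg_nonneg integral_nonneg_AE AE_I2) auto
  show ?thesis
  proof (cases "W' = 0")
    case True
    have "AE x in \<nu>. 2 * (1 - cos (h * x)) = 0"
      using True integral_nonneg_eq_0_iff_AE[OF int'] by (simp add: W'_def)
    then have "(LINT x|\<nu>. 2 * (1 - cos (h * x)) * f (- x)) = (LINT x|\<nu>. 0)"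
    proof (intro integral_cong_AE)
      assume "AE x in \<nu>. 2 * (1 - cos (h * x)) = 0"
      then show "AE x in \<nu>. 2 * (1 - cos (h * x)) * f (- x) = 0" by eventually_elim (simp only: mult_zero_left)
    qed measurable
    moreover have "(\<lambda>m. LINT \<omega>|M. cos_weight h m (gap m \<omega>) * f (gap m \<omega>)) \<longlonglongrightarrow> 0"
    proof (rule Lim_null_comparison)
      show "eventually (\<lambda>m. norm (LINT \<omega>|M. cos_weight h m (gap m \<omega>) * f (gap m \<omega>)) \<le> C * W m) sequentially"
      proof (intro always_eventually allI)
        fix m
        have "norm (LINT \<omega>|M. cos_weight h m (gap m \<omega>) * f (gap m \<omega>)) \<le>
            (LINT \<omega>|M. norm (cos_weight h m (gap m \<omega>) * f (gap m \<omega>)))"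
          by (rule integral_norm_bound)
        also have "\<dots> \<le> (LINT \<omega>|M. C * cos_weight h m (gap m \<omega>))"
        proof (rule integral_mono_AE)
          show "integrable M (\<lambda>\<omega>. norm (cos_weight h m (gap m \<omega>) * f (gap m \<omega>)))"
            using integrable_cos_weight[of f C h m] C by (intro integrable_norm) simp
          show "AE \<omega> in M. norm (cos_weight h m (gap m \<omega>) * f (gap m \<omega>)) \<le> C * cos_weight h m (gap m \<omega>)"
            using C cos_weight_nonneg by (intro AE_I2) (simp add: abs_mult mult.commute mult_right_mono)
        qed (use int in auto)
        finally show "norm (LINT \<omega>|M. cos_weight h m (gap m \<omega>) * f (gap m \<omega>)) \<le> C * W m"
          by (simp add: W_def)
      qed
      show "(\<lambda>m. C * W m) \<longlonglongrightarrow> 0" using tendsto_mult[OF tendsto_const W_lim, of C] True by simp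
    qed
    ultimately show ?thesis by simp
  next
    case False
    with W'_nonneg have W': "0 < W'" by simp
    \<comment> \<open>The masses \<open>W m\<close> are known to be positive only from some index
      on, so the sequence of laws starts there.\<close>
    obtain N where N: "\<And>m. N \<le> m \<Longrightarrow> 0 < W m"
      using order_tendstoD(1)[OF W_lim W'] by (auto simp: eventually_sequentially)
    have WN: "0 < W (n + N)" for n by (rule N) simp
    define P where "P n = density (distr M borel (gap (n + N))) (\<lambda>y. ennreal (cos_weight h (n + N) y / W (n + N)))" for n
    define P' where "P' = density (distr \<nu> borel uminus) (\<lambda>y. ennreal (ln 2 * (2 * (1 - cos (h * y))) / W'))"
    have eqW: "(LINT \<omega>|M. cos_weight h (n + N) (gap (n + N) \<omega>)) = W (n + N)" for n by (simp add: W_def)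
    note P_facts = gap_measurable[of "n + N" for n] cos_weight_measurable cos_weight_nonneg WN int eqW
    have P: "real_distribution (P n)" for n
      unfolding P_def by (rule real_distribution_weighted[OF gap_measurable cos_weight_measurable cos_weight_nonneg WN int eqW])
    have P_int: "(\<integral>y. g y \<partial>P n) = (1 / W (n + N)) *\<^sub>R (\<integral>\<omega>. cos_weight h (n + N) (gap (n + N) \<omega>) *\<^sub>R g (gap (n + N) \<omega>) \<partial>M)"
      if "g \<in> borel_measurable borel" for n and g :: "real \<Rightarrow> 'b :: {banach, second_countable_topology}"
      unfolding P_def by (rule integral_weighted[OF gap_measurable cos_weight_measurable cos_weight_nonneg WN int eqW that])
    have u1: "uminus \<in> borel_measurable \<nu>" by measurable
    have u2: "(\<lambda>y. ln 2 * (2 * (1 - cos (h * y)))) \<in> borel_measurable borel" by measurable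
    have u3: "0 \<le> ln 2 * (2 * (1 - cos (h * y)))" for y by simp
    have u4: "integrable \<nu> (\<lambda>x. ln 2 * (2 * (1 - cos (h * - x))))"
      using integrable_mult_right[OF int', of "ln 2"] by simp
    have u5: "(LINT x|\<nu>. ln 2 * (2 * (1 - cos (h * - x)))) = W'"
      unfolding W'_def by (simp add: integral_mult_right_zero[symmetric] del: integral_mult_right_zero)
    have P': "real_distribution P'"
      unfolding P'_def by (rule real_distribution_weighted[OF u1 u2 u3 W' u4 u5])
    have P'_int: "(\<integral>y. g y \<partial>P') = (1 / W') *\<^sub>R (\<integral>x. (ln 2 * (2 * (1 - cos (h * - x)))) *\<^sub>R g (- x) \<partial>\<nu>)"
      if "g \<in> borel_measurable borel" for g :: "real \<Rightarrow> 'b :: {banach, second_countable_topology}"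
      unfolding P'_def by (rule integral_weighted[OF u1 u2 u3 W' u4 u5 that])
    have W_lim': "(\<lambda>n. W (n + N)) \<longlonglongrightarrow> W'" using W_lim by (rule LIMSEQ_ignore_initial_segment)
    have "weak_conv_m P P'"
    proof (rule levy_continuity[OF P P'])
      fix \<theta> :: real
      have [measurable]: "(\<lambda>y. iexp (\<theta> * y)) \<in> borel_measurable borel" by measurable
      have "(\<lambda>n. (1 / W (n + N)) *\<^sub>R (CLINT \<omega>|M. cos_weight h (n + N) (gap (n + N) \<omega>) *\<^sub>R iexp (\<theta> * gap (n + N) \<omega>))) \<longlonglongrightarrow>
          (1 / W') *\<^sub>R (of_real (ln 2) * (CLINT x|\<nu>. of_real (2 * (1 - cos (h * x))) * iexp (- \<theta> * x)))"
        using W' LIMSEQ_ignore_initial_segment[OF cos_weight_char_tendsto[of h \<theta>], of N]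
        by (intro tendsto_scaleR tendsto_divide tendsto_const W_lim') auto
      also have "(\<lambda>n. (1 / W (n + N)) *\<^sub>R (CLINT \<omega>|M. cos_weight h (n + N) (gap (n + N) \<omega>) *\<^sub>R iexp (\<theta> * gap (n + N) \<omega>))) =
          (\<lambda>n. char (P n) \<theta>)"
        unfolding char_def by (rule ext, rule P_int[symmetric]) measurable
      also have "(1 / W') *\<^sub>R (of_real (ln 2) * (CLINT x|\<nu>. of_real (2 * (1 - cos (h * x))) * iexp (- \<theta> * x))) = char P' \<theta>"
      proof -
        have "char P' \<theta> = (1 / W') *\<^sub>R (CLINT x|\<nu>. (ln 2 * (2 * (1 - cos (h * - x)))) *\<^sub>R iexp (\<theta> * - x))"
          unfolding char_def by (rule P'_int) measurable
        also have "(CLINT x|\<nu>. (ln 2 * (2 * (1 - cos (h * - x)))) *\<^sub>R iexp (\<theta> * - x)) =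
            (CLINT x|\<nu>. of_real (ln 2) * (of_real (2 * (1 - cos (h * x))) * iexp (- \<theta> * x)))"
          by (intro Bochner_Integration.integral_cong refl) (simp add: scaleR_conv_of_real mult.assoc)
        also have "\<dots> = of_real (ln 2) * (CLINT x|\<nu>. of_real (2 * (1 - cos (h * x))) * iexp (- \<theta> * x))"
          by (rule integral_mult_right_zero)
        finally show ?thesis ..
      qed
      finally show "(\<lambda>n. char (P n) \<theta>) \<longlonglongrightarrow> char P' \<theta>" .
    qed
    from weak_conv_imp_integral_bdd_continuous_conv[OF P P' this cont, of C] C
    have "(\<lambda>n. LINT y|P n. f y) \<longlonglongrightarrow> (LINT y|P'. f y)" by simp
    from tendsto_mult[OF W_lim' this]
    have "(\<lambda>n. W (n + N) * (LINT y|P n. f y)) \<longlonglongrightarrow> W' * (LINT y|P'. f y)" .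
    also have "(\<lambda>n. W (n + N) * (LINT y|P n. f y)) = (\<lambda>n. LINT \<omega>|M. cos_weight h (n + N) (gap (n + N) \<omega>) * f (gap (n + N) \<omega>))"
    proof
      fix n
      show "W (n + N) * (LINT y|P n. f y) = (LINT \<omega>|M. cos_weight h (n + N) (gap (n + N) \<omega>) * f (gap (n + N) \<omega>))"
        using WN[of n] by (simp add: P_int[OF f])
    qed
    also have "W' * (LINT y|P'. f y) = (LINT x|\<nu>. ln 2 * (2 * (1 - cos (h * x)) * f (- x)))"
      using W' by (simp add: P'_int[OF f] mult.assoc)
    also have "\<dots> = ln 2 * (LINT x|\<nu>. 2 * (1 - cos (h * x)) * f (- x))"
      by (rule integral_mult_right_zero)
    finally show ?thesis by (rule LIMSEQ_offset)
  qed
qed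

text \<open>For a test function vanishing on the nonnegative half-line the approximating integrals
  are zero, because gaps are nonnegative. A single \<open>h\<close> would miss the zeros of 1 - cos
  (h x); with h = 1 / (n + 1) for all n, every positive x has some h x in (0, 1], where the cosine
  is below one.\<close>

theorem levy_measure_negative: "emeasure \<nu> {0<..} = 0"
proof -
  let ?f = "\<lambda>y::real. min 1 (max 0 (- y))"
  have "AE x in \<nu>. 0 < x \<longrightarrow> cos (1 / real (Suc n) * x) = 1" for n
  proof -
    let ?h = "1 / real (Suc n)"
    let ?F = "\<lambda>x. 2 * (1 - cos (?h * x)) * ?f (- x)"
    have lim: "(\<lambda>m. LINT \<omega>|M. cos_weight ?h m (gap m \<omega>) * ?f (gap m \<omega>)) \<longlonglongrightarrow> ln 2 * (LINT x|\<nu>. ?F x)"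
      by (rule cos_weight_tendsto[where C=1]) (auto intro!: continuous_intros)
    have z: "(LINT \<omega>|M. cos_weight ?h m (gap m \<omega>) * ?f (gap m \<omega>)) = 0" for m
    proof -
      have "(LINT \<omega>|M. cos_weight ?h m (gap m \<omega>) * ?f (gap m \<omega>)) = (LINT \<omega>|M. 0)"
        by (rule integral_cong_AE) (measurable, use gap_nonneg[of m] in eventually_elim, simp add: max_absorb1)
      then show ?thesis by simp
    qed
    have "0 = ln 2 * (LINT x|\<nu>. ?F x)"
      using LIMSEQ_unique[OF lim[unfolded z] tendsto_const] by simp
    then have "(LINT x|\<nu>. ?F x) = 0" by simp
    moreover have "integrable \<nu> ?F"
    proof (rule Bochner_Integration.integrable_bound)
      show "integrable \<nu> (\<lambda>x. 2 * (1 - cos (?h * x)))" by (intro integrable_mult_right integrable_one_minus_cos)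
      show "AE x in \<nu>. norm (?F x) \<le> norm (2 * (1 - cos (?h * x)))"
        by (intro AE_I2) (auto simp: abs_mult intro!: mult_left_le)
    qed measurable
    ultimately have "AE x in \<nu>. ?F x = 0"
      by (subst (asm) integral_nonneg_eq_0_iff_AE) auto
    then show ?thesis by eventually_elim (auto simp: min_def max_def split: if_splits)
  qed
  then have "AE x in \<nu>. \<forall>n. 0 < x \<longrightarrow> cos (1 / real (Suc n) * x) = 1" by (subst AE_all_countable) auto
  then have "AE x in \<nu>. \<not> 0 < x"
  proof eventually_elim
    case (elim x)
    show ?case
    proof
      assume x: "0 < x"
      obtain n where n: "x \<le> real n" using real_arch_simple by blast
      have "1 / real (Suc n) * x \<le> 1" using n x by (simp add: field_simps)
      then have "1 / real (Suc n) * x \<le> pi" using pi_ge_two by linarith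
      moreover have "0 < 1 / real (Suc n) * x" using x by simp
      ultimately have "cos (1 / real (Suc n) * x) < cos 0"
        by (intro cos_monotone_0_pi) auto
      with elim x show False by simp
    qed
  qed
  moreover have "{0<..} \<in> sets \<nu>" "space \<nu> = UNIV"
    using sets_eq_imp_space_eq[OF sets_nu] by (auto simp: sets_nu)
  ultimately show ?thesis
    by (subst (asm) AE_iff_measurable[of "{0<..}"]) auto
qed

text \<open>Near the origin 1 - cos x is of order x^2, so an extra factor 1 / |x| turns the weight
  into |x|. Bounded continuous approximations of this factor are tested against the gaps, where
  \<open>gap_rate_bounded\<close> gives one bound for all of them, and Fatou removes the
  approximation. Away from the origin \<open>levy_measure\<close> suffices.\<close>

theorem levy_measure_finite_variation: "(\<integral>\<^sup>+x. ennreal (min 1 \<bar>x\<bar>) \<partial>\<nu>) < \<infinity>"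
proof -
  obtain K where K: "\<And>m. real (Suc m) * (LINT \<omega>|M. min 1 (gap m \<omega>)) \<le> K"
    using gap_rate_bounded by blast
  have min_int: "integrable M (\<lambda>\<omega>. min 1 (gap m \<omega>))" for m
    using gap_nonneg[of m] by (intro integrable_const_bound[where B=1]) auto
  \<comment> \<open>The fraction increases to \<open>1 / \<bar>y\<bar>\<close> while staying bounded
    by \<open>Suc j\<close>; the last factor localises to the unit interval around the
    origin.\<close>
  define f :: "nat \<Rightarrow> real \<Rightarrow> real" where
    "f j y = real (Suc j) / (1 + real (Suc j) * \<bar>y\<bar>) * max 0 (1 - \<bar>y\<bar>)" for j y
  have f_nonneg: "0 \<le> f j y" for j y by (simp add: f_def)
  have f_cont: "isCont (f j) y" for j y
  proof -
    have "1 + real (Suc j) * \<bar>y\<bar> \<noteq> 0" using mult_nonneg_nonneg[of "real (Suc j)" "\<bar>y\<bar>"] by linarith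
    then show ?thesis unfolding f_def[abs_def] by (intro continuous_intros) auto
  qed
  have f_meas [measurable]: "f j \<in> borel_measurable borel" for j
    using f_cont by (intro borel_measurable_continuous_onI) (simp add: continuous_at_imp_continuous_on)
  have f_bound: "\<bar>f j y\<bar> \<le> real (Suc j)" for j y
  proof -
    have "real (Suc j) / (1 + real (Suc j) * \<bar>y\<bar>) \<le> real (Suc j) / 1"
      by (intro divide_left_mono) (auto simp: add_pos_nonneg)
    then have "f j y \<le> real (Suc j) * 1"
      unfolding f_def by (intro mult_mono) auto
    then show ?thesis using f_nonneg[of j y] by simp
  qed
  have f_cos: "2 * (1 - cos (1 * y)) * f j y \<le> min 1 \<bar>y\<bar>" for j y
  proof (cases "\<bar>y\<bar> < 1")
    case True
    have "f j y * \<bar>y\<bar> \<le> 1"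
    proof -
      have "real (Suc j) / (1 + real (Suc j) * \<bar>y\<bar>) * \<bar>y\<bar> \<le> 1"
        by (simp add: divide_le_eq add_pos_nonneg)
      then have "(real (Suc j) / (1 + real (Suc j) * \<bar>y\<bar>) * \<bar>y\<bar>) * max 0 (1 - \<bar>y\<bar>) \<le> 1 * 1"
        by (intro mult_mono) auto
      then show ?thesis by (simp add: f_def mult_ac)
    qed
    have "2 * (1 - cos (1 * y)) \<le> y\<^sup>2" using one_minus_cos_le(1)[of y] by simp
    then have "2 * (1 - cos (1 * y)) * f j y \<le> y\<^sup>2 * f j y" by (rule mult_right_mono[OF _ f_nonneg])
    also have "\<dots> = \<bar>y\<bar> * (f j y * \<bar>y\<bar>)" by (simp add: power2_eq_square mult_ac abs_mult_self_eq)
    also have "\<dots> \<le> \<bar>y\<bar> * 1" using \<open>f j y * \<bar>y\<bar> \<le> 1\<close> by (rule mult_left_mono) simp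
    finally show ?thesis using True by (simp add: min_def)
  qed (simp add: f_def max_absorb1)
  have int_f: "integrable \<nu> (\<lambda>x. 2 * (1 - cos (1 * x)) * f j (- x))" for j
  proof (rule Bochner_Integration.integrable_bound)
    show "integrable \<nu> (\<lambda>x. real (Suc j) * (2 * (1 - cos (1 * x))))"
      by (intro integrable_mult_right integrable_one_minus_cos)
    show "AE x in \<nu>. norm (2 * (1 - cos (1 * x)) * f j (- x)) \<le> norm (real (Suc j) * (2 * (1 - cos (1 * x))))"
    proof (intro AE_I2)
      fix x
      have "norm (2 * (1 - cos (1 * x)) * f j (- x)) = 2 * (1 - cos (1 * x)) * \<bar>f j (- x)\<bar>" by (simp add: abs_mult)
      also have "\<dots> \<le> 2 * (1 - cos (1 * x)) * real (Suc j)" by (intro mult_left_mono f_bound) auto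
      finally show "norm (2 * (1 - cos (1 * x)) * f j (- x)) \<le> norm (real (Suc j) * (2 * (1 - cos (1 * x))))"
        by (simp add: mult_ac abs_mult)
    qed
  qed measurable
  have bound: "ln 2 * (LINT x|\<nu>. 2 * (1 - cos (1 * x)) * f j (- x)) \<le> K" for j
  proof (rule LIMSEQ_le_const2[OF cos_weight_tendsto[OF f_cont f_bound]], intro exI allI impI)
    fix m :: nat
    have "(LINT \<omega>|M. cos_weight 1 m (gap m \<omega>) * f j (gap m \<omega>)) \<le> (LINT \<omega>|M. real (Suc m) * min 1 (gap m \<omega>))"
    proof (rule integral_mono_AE)
      show "integrable M (\<lambda>\<omega>. cos_weight 1 m (gap m \<omega>) * f j (gap m \<omega>))"
        using integrable_cos_weight[OF f_meas, of j "real (Suc j)" 1 m] f_bound by simp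
      show "AE \<omega> in M. cos_weight 1 m (gap m \<omega>) * f j (gap m \<omega>) \<le> real (Suc m) * min 1 (gap m \<omega>)"
        using gap_nonneg[of m]
      proof eventually_elim
        case (elim \<omega>)
        have "real (Suc m) * (2 * (1 - cos (1 * gap m \<omega>)) * f j (gap m \<omega>)) \<le> real (Suc m) * min 1 \<bar>gap m \<omega>\<bar>"
          by (intro mult_left_mono f_cos) simp
        then show ?case using elim by (simp add: cos_weight_def mult.assoc)
      qed
    qed (use min_int in auto)
    also have "\<dots> \<le> K" using K[of m] by simp
    finally show "(LINT \<omega>|M. cos_weight 1 m (gap m \<omega>) * f j (gap m \<omega>)) \<le> K" .
  qed
  let ?G = "\<lambda>x. 2 * (1 - cos (1 * x)) * (1 / \<bar>x\<bar> * max 0 (1 - \<bar>x\<bar>))"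
  have "(\<integral>\<^sup>+x. ennreal (?G x) \<partial>\<nu>) \<le> ennreal (K / ln 2)"
  proof -
    have "(\<integral>\<^sup>+x. ennreal (?G x) \<partial>\<nu>) = (\<integral>\<^sup>+x. liminf (\<lambda>j. ennreal (2 * (1 - cos (1 * x)) * f j (- x))) \<partial>\<nu>)"
    proof (rule nn_integral_cong)
      fix x
      have "(\<lambda>j. 2 * (1 - cos (1 * x)) * f j (- x)) \<longlonglongrightarrow> ?G x"
      proof (cases "x = 0")
        case False
        have "(\<lambda>j. real (Suc j) / (1 + real (Suc j) * c)) \<longlonglongrightarrow> 1 / c" if "0 < c" for c :: real
          using that by (real_asymp simp: field_simps)
        then show ?thesis unfolding f_def abs_minus_cancel
          using False by (intro tendsto_mult tendsto_const) auto
      qed simp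
      then have "(\<lambda>j. ennreal (2 * (1 - cos (1 * x)) * f j (- x))) \<longlonglongrightarrow> ennreal (?G x)"
        by (rule tendsto_ennrealI)
      then show "ennreal (?G x) = liminf (\<lambda>j. ennreal (2 * (1 - cos (1 * x)) * f j (- x)))"
        by (simp add: lim_imp_Liminf)
    qed
    also have "\<dots> \<le> liminf (\<lambda>j. \<integral>\<^sup>+x. ennreal (2 * (1 - cos (1 * x)) * f j (- x)) \<partial>\<nu>)"
      by (rule nn_integral_liminf) measurable
    also have "\<dots> \<le> ennreal (K / ln 2)"
    proof (rule Liminf_le, simp, intro always_eventually allI)
      fix j
      have "(\<integral>\<^sup>+x. ennreal (2 * (1 - cos (1 * x)) * f j (- x)) \<partial>\<nu>) = ennreal (LINT x|\<nu>. 2 * (1 - cos (1 * x)) * f j (- x))"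
        by (intro nn_integral_eq_integral int_f AE_I2 mult_nonneg_nonneg f_nonneg) auto
      also have "\<dots> \<le> ennreal (K / ln 2)"
        using bound[of j] by (intro ennreal_leI) (simp add: pos_le_divide_eq mult.commute)
      finally show "(\<integral>\<^sup>+x. ennreal (2 * (1 - cos (1 * x)) * f j (- x)) \<partial>\<nu>) \<le> ennreal (K / ln 2)" .
    qed
    finally show ?thesis .
  qed
  moreover have "(\<integral>\<^sup>+x. ennreal (min 1 \<bar>x\<bar>) \<partial>\<nu>) \<le> (\<integral>\<^sup>+x. 3 * ennreal (?G x) + 4 * ennreal (min 1 (x\<^sup>2)) \<partial>\<nu>)"
  proof (rule nn_integral_mono)
    fix x :: real
    have G: "0 \<le> ?G x" by (intro mult_nonneg_nonneg) auto
    \<comment> \<open>For \<open>\<bar>x\<bar> \<le> 1 / 2\<close> the bound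
      \<open>one_minus_cos_ge\<close> and the cutoff factor, at least 1/2, give
      \<open>?G x \<ge> \<bar>x\<bar> / 3\<close>. For larger \<open>\<bar>x\<bar>\<close> the
      square exceeds 1/4. These are the constants 3 and 4.\<close>
    have "min 1 \<bar>x\<bar> \<le> 3 * ?G x + 4 * min 1 (x\<^sup>2)"
    proof (cases "\<bar>x\<bar> \<le> 1 / 2")
      case True
      show ?thesis
      proof (cases "x = 0")
        case False
        have 1: "2 / 3 * x\<^sup>2 \<le> 2 * (1 - cos (1 * x))" using one_minus_cos_ge[of x] True by simp
        have 2: "1 / \<bar>x\<bar> * (1 / 2) \<le> 1 / \<bar>x\<bar> * max 0 (1 - \<bar>x\<bar>)"
          using True by (intro mult_left_mono) auto
        have "2 / 3 * x\<^sup>2 * (1 / \<bar>x\<bar> * (1 / 2)) \<le> ?G x"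
          by (rule mult_mono[OF 1 2]) auto
        moreover have "2 / 3 * x\<^sup>2 * (1 / \<bar>x\<bar> * (1 / 2)) = \<bar>x\<bar> / 3"
          using False by (simp add: power2_eq_square abs_if field_simps)
        ultimately have "\<bar>x\<bar> \<le> 3 * ?G x" by linarith
        moreover have "0 \<le> min 1 (x\<^sup>2)" by simp
        ultimately show ?thesis by linarith
      qed simp
    next
      case False
      have "(1 / 2)\<^sup>2 \<le> \<bar>x\<bar>\<^sup>2" using False by (intro power_mono) auto
      then have "1 \<le> 4 * min 1 (x\<^sup>2)" by (simp add: power2_eq_square min_def)
      then show ?thesis using G by linarith
    qed
    then have "ennreal (min 1 \<bar>x\<bar>) \<le> ennreal (3 * ?G x + 4 * min 1 (x\<^sup>2))" by (rule ennreal_leI)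
    also have "\<dots> = 3 * ennreal (?G x) + 4 * ennreal (min 1 (x\<^sup>2))"
    proof -
      have "ennreal (3 * u + 4 * v) = 3 * ennreal u + 4 * ennreal v" if "0 \<le> u" "0 \<le> v" for u v :: real
        using that by (simp add: ennreal_mult)
      from this[OF G, of "min 1 (x\<^sup>2)"] show ?thesis by simp
    qed
    finally show "ennreal (min 1 \<bar>x\<bar>) \<le> 3 * ennreal (?G x) + 4 * ennreal (min 1 (x\<^sup>2))" .
  qed
  moreover have "(\<integral>\<^sup>+x. 3 * ennreal (?G x) + 4 * ennreal (min 1 (x\<^sup>2)) \<partial>\<nu>) =
      3 * (\<integral>\<^sup>+x. ennreal (?G x) \<partial>\<nu>) + 4 * (\<integral>\<^sup>+x. ennreal (min 1 (x\<^sup>2)) \<partial>\<nu>)"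
    by (subst nn_integral_add) (auto simp: nn_integral_cmult)
  moreover have "(\<integral>\<^sup>+x. ennreal (min 1 (x\<^sup>2)) \<partial>\<nu>) < \<infinity>"
    using levy by (simp add: levy_measure_def)
  moreover have "X < \<infinity>" if "A \<le> ennreal c" "X \<le> Y" "Y = 3 * A + 4 * B" "B < \<infinity>" for A B X Y :: ennreal and c
  proof -
    have "A < \<infinity>" using that(1) by (rule order.strict_trans1) simp
    then have "3 * A + 4 * B < \<infinity>" using that(4) by (simp add: ennreal_mult_less_top)
    with that(2,3) show ?thesis by (simp add: order.strict_trans1)
  qed
  ultimately show ?thesis by blast
qed

end

section \<open>The two halves of the cascade\<close>

lemma cadlag_on_bounded:
  assumes "cadlag_on {0..1} f"
  shows "\<exists>C. \<forall>t\<in>{0..1}. \<bar>f t\<bar> \<le> C"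
proof -
  have "\<exists>U C. open U \<and> t \<in> U \<and> (\<forall>x\<in>U \<inter> {0..1}. \<bar>f x\<bar> \<le> C)" if t: "t \<in> {0..1}" for t
  proof -
    obtain l where r: "(f \<longlongrightarrow> f t) (at t within {0..1} \<inter> {t<..})" and l: "(f \<longlongrightarrow> l) (at t within {0..1} \<inter> {..<t})"
      using assms t unfolding cadlag_on_def by blast
    have near: "\<exists>U. open U \<and> t \<in> U \<and> (\<forall>x\<in>U. x \<noteq> t \<longrightarrow> x \<in> S \<longrightarrow> \<bar>f x\<bar> < \<bar>c\<bar> + 1)"
      if "(f \<longlongrightarrow> c) (at t within S)" for c S
    proof -
      have "((\<lambda>x. \<bar>f x\<bar>) \<longlongrightarrow> \<bar>c\<bar>) (at t within S)" by (intro tendsto_rabs that)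
      then have "eventually (\<lambda>x. \<bar>f x\<bar> < \<bar>c\<bar> + 1) (at t within S)"
        by (rule order_tendstoD) simp
      then show ?thesis by (simp add: eventually_at_topological)
    qed
    obtain U where U: "open U" "t \<in> U" "\<And>x. x \<in> U \<Longrightarrow> x \<noteq> t \<Longrightarrow> x \<in> {0..1} \<inter> {t<..} \<Longrightarrow> \<bar>f x\<bar> < \<bar>f t\<bar> + 1"
      using near[OF r] by blast
    obtain V where V: "open V" "t \<in> V" "\<And>x. x \<in> V \<Longrightarrow> x \<noteq> t \<Longrightarrow> x \<in> {0..1} \<inter> {..<t} \<Longrightarrow> \<bar>f x\<bar> < \<bar>l\<bar> + 1"
      using near[OF l] by blast
    have "\<bar>f x\<bar> \<le> \<bar>f t\<bar> + \<bar>l\<bar> + 1" if "x \<in> U \<inter> V" "x \<in> {0..1}" for x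
    proof (cases x t rule: linorder_cases)
      case less
      then have "\<bar>f x\<bar> < \<bar>l\<bar> + 1" using that by (intro V(3)) auto
      then show ?thesis by linarith
    next
      case greater
      then have "\<bar>f x\<bar> < \<bar>f t\<bar> + 1" using that by (intro U(3)) auto
      then show ?thesis by linarith
    qed simp
    moreover have "open (U \<inter> V)" "t \<in> U \<inter> V" using U(1,2) V(1,2) by auto
    ultimately show ?thesis by blast
  qed
  then obtain U C where U: "\<And>t. t \<in> {0..1} \<Longrightarrow> open (U t)" "\<And>t. t \<in> {0..1} \<Longrightarrow> t \<in> U t"
    and C: "\<And>t x. t \<in> {0..1} \<Longrightarrow> x \<in> U t \<Longrightarrow> x \<in> {0..1} \<Longrightarrow> \<bar>f x\<bar> \<le> C t"
    by (metis IntI)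
  have cover: "{0..1::real} \<subseteq> (\<Union>t\<in>{0..1}. U t)" using U(2) by blast
  obtain T where T: "T \<subseteq> {0..1}" "finite T" "{0..1} \<subseteq> (\<Union>t\<in>T. U t)"
    by (rule compactE_image[OF compact_Icc _ cover]) (auto intro: U(1))
  have "\<bar>f x\<bar> \<le> (\<Sum>t\<in>T. \<bar>C t\<bar>)" if x: "x \<in> {0..1}" for x
  proof -
    obtain t where t: "t \<in> T" "x \<in> U t" using T(3) x by blast
    then have "\<bar>f x\<bar> \<le> \<bar>C t\<bar>" using C[of t x] T(1) x by fastforce
    also have "\<dots> \<le> (\<Sum>t\<in>T. \<bar>C t\<bar>)" using T(2) t(1) by (intro member_le_sum) auto
    finally show ?thesis .
  qed
  then show ?thesis by blast
qed

text \<open>The Riemann sum at right end points. It involves finitely many values of the field, so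
  identities in law for finite vectors carry over to masses.\<close>

definition right_average :: "nat \<Rightarrow> (real \<Rightarrow> ennreal) \<Rightarrow> ennreal" where
  "right_average k g = ennreal (1 / real (Suc k)) * (\<Sum>j<Suc k. g (real (Suc j) / real (Suc k)))"

lemma right_average_eq_integral:
  "right_average k g = (\<integral>\<^sup>+x. g (right_grid k x) * indicator {0<..1} x \<partial>lborel)"
proof -
  let ?n = "real (Suc k)"
  have n: "0 < ?n" by simp
  have "g (right_grid k x) * indicator {0<..1} x =
      (\<Sum>j<Suc k. g (real (Suc j) / ?n) * indicator {real j / ?n<..real (Suc j) / ?n} x)" for x
  proof -
    have mem: "x \<in> {real j / ?n<..real (Suc j) / ?n} \<longleftrightarrow> \<lceil>?n * x\<rceil> = int (Suc j)" for j
    proof -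
      have "x \<in> {real j / ?n<..real (Suc j) / ?n} \<longleftrightarrow> real j < ?n * x \<and> ?n * x \<le> real (Suc j)"
        using n by (simp add: divide_less_eq le_divide_eq mult.commute del: of_nat_Suc)
      also have "\<dots> \<longleftrightarrow> \<lceil>?n * x\<rceil> = int (Suc j)" by (simp add: ceiling_eq_iff del: of_nat_Suc) simp
      finally show ?thesis .
    qed
    show ?thesis
    proof (cases "x \<in> {0<..1}")
      case True
      define j where "j = nat \<lceil>?n * x\<rceil> - 1"
      have "0 < ?n * x" "?n * x \<le> ?n" using True n by (auto simp: mult_left_le simp del: of_nat_Suc)
      then have c: "0 < \<lceil>?n * x\<rceil>" "\<lceil>?n * x\<rceil> \<le> int (Suc k)" by (simp_all add: ceiling_le_iff del: of_nat_Suc)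
      then have j: "\<lceil>?n * x\<rceil> = int (Suc j)" "j < Suc k" by (auto simp: j_def)
      have "(\<Sum>i<Suc k. g (real (Suc i) / ?n) * indicator {real i / ?n<..real (Suc i) / ?n} x) =
          (\<Sum>i<Suc k. if i = j then g (real (Suc i) / ?n) else 0)"
        using mem j(1) by (intro sum.cong refl) (auto simp: indicator_def simp del: of_nat_Suc)
      also have "\<dots> = g (real (Suc j) / ?n)" using j(2) by simp
      also have "real (Suc j) / ?n = right_grid k x" unfolding right_grid_def j(1) by simp
      finally show ?thesis using True by simp
    next
      case False
      have "x \<notin> {real i / ?n<..real (Suc i) / ?n}" if "i < Suc k" for i
      proof -
        have "0 \<le> real i / ?n" "real (Suc i) / ?n \<le> 1" using that by auto
        with False show ?thesis unfolding greaterThanAtMost_iff by linarith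
      qed
      then show ?thesis using False by simp
    qed
  qed
  then have "(\<integral>\<^sup>+x. g (right_grid k x) * indicator {0<..1} x \<partial>lborel) =
      (\<integral>\<^sup>+x. (\<Sum>j<Suc k. g (real (Suc j) / ?n) * indicator {real j / ?n<..real (Suc j) / ?n} x) \<partial>lborel)"
    by (simp only:)
  also have "\<dots> = (\<Sum>j<Suc k. \<integral>\<^sup>+x. g (real (Suc j) / ?n) * indicator {real j / ?n<..real (Suc j) / ?n} x \<partial>lborel)"
    by (rule nn_integral_sum) measurable
  also have "\<dots> = (\<Sum>j<Suc k. g (real (Suc j) / ?n) * emeasure lborel {real j / ?n<..real (Suc j) / ?n})"
    by (intro sum.cong refl nn_integral_cmult_indicator) simp
  also have "\<dots> = (\<Sum>j<Suc k. g (real (Suc j) / ?n) * ennreal (1 / ?n))"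
  proof (intro sum.cong refl)
    fix j
    have "real j / ?n \<le> real (Suc j) / ?n" by (intro divide_right_mono) auto
    moreover have "real (Suc j) / ?n - real j / ?n = 1 / ?n" by (simp add: diff_divide_distrib[symmetric])
    ultimately show "g (real (Suc j) / ?n) * emeasure lborel {real j / ?n<..real (Suc j) / ?n} =
        g (real (Suc j) / ?n) * ennreal (1 / ?n)"
      by (simp only: emeasure_lborel_Ioc)
  qed
  finally show ?thesis unfolding right_average_def sum_distrib_left by (simp only: mult.commute)
qed

lemma right_grid_measurable [measurable]: "right_grid k \<in> borel_measurable borel"
  unfolding right_grid_def[abs_def] by measurable

lemma right_average_tendsto:
  assumes [measurable]: "g \<in> borel_measurable borel" and bound: "\<And>x. g x \<le> ennreal C"
    and lim: "\<And>x. x \<in> {0<..1} \<Longrightarrow> (\<lambda>k. g (right_grid k x)) \<longlonglongrightarrow> g x"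
  shows "(\<lambda>k. right_average k g) \<longlonglongrightarrow> (\<integral>\<^sup>+x. g x * indicator {0<..1} x \<partial>lborel)"
  unfolding right_average_eq_integral
proof (rule nn_integral_dominated_convergence[where w="\<lambda>x. ennreal C * indicator {0<..1} x"])
  show "AE x in lborel. g (right_grid k x) * indicator {0<..1} x \<le> ennreal C * indicator {0<..1} x" for k
    by (intro AE_I2 mult_right_mono bound) simp
  show "AE x in lborel. (\<lambda>k. g (right_grid k x) * indicator {0<..1} x) \<longlonglongrightarrow> g x * indicator {0<..1} x"
  proof (intro AE_I2)
    fix x
    show "(\<lambda>k. g (right_grid k x) * indicator {0<..1} x) \<longlonglongrightarrow> g x * indicator {0<..1} x"
      using lim[of x] by (cases "x \<in> {0<..1}") auto
  qed
  show "(\<integral>\<^sup>+x. ennreal C * indicator {0<..1::real} x \<partial>lborel) < \<infinity>"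
    by (simp add: nn_integral_cmult_indicator ennreal_mult_less_top)
qed measurable

lemma atom_half_map: "atom (\<lambda>i. half_map b ` B i) n m = half_map b ` atom B n m"
  by (rule set_eqI) (simp add: atom_def half_map_image_iff)

lemma half_map_fmeasurable:
  assumes "A \<in> fmeasurable \<H>"
  shows "half_map b ` A \<in> fmeasurable \<H>"
  using assms half_map_sets[of A b] emeasure_half_map[of A b] by (auto simp: fmeasurable_def)

text \<open>The cap allows dominated convergence where no uniform integrability of the powers is
  known; it is removed at the very end by Fatou.\<close>

definition capped_power :: "nat \<Rightarrow> nat \<Rightarrow> ennreal \<Rightarrow> ennreal" where
  "capped_power p m u = min (u ^ p) (of_nat m)"

lemma tendsto_capped_power:
  "(f \<longlongrightarrow> l) F \<Longrightarrow> ((\<lambda>x. capped_power p m (f x)) \<longlongrightarrow> capped_power p m l) F"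
  unfolding capped_power_def by (intro tendsto_min tendsto_power_ennreal tendsto_const)

lemma capped_power_measurable [measurable]: "capped_power p m \<in> borel_measurable borel"
  by (intro borel_measurable_continuous_onI) (auto simp: continuous_on_def intro!: tendsto_capped_power tendsto_ident_at)

lemma capped_power_le: "capped_power p m u \<le> of_nat m"
  by (simp add: capped_power_def)

lemma power_add_superadditive:
  fixes u v :: ennreal
  shows "0 < p \<Longrightarrow> u ^ p + v ^ p \<le> (u + v) ^ p"
proof (induction p rule: nat_induct_non_zero)
  case (Suc p)
  have "u ^ Suc p + v ^ Suc p \<le> u * (u ^ p + v ^ p) + v * (u ^ p + v ^ p)"
    by (intro add_mono) (simp_all add: mult_left_mono)
  also have "\<dots> = (u + v) * (u ^ p + v ^ p)" by (simp add: distrib_right)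
  also have "\<dots> \<le> (u + v) ^ Suc p" using Suc by (simp add: mult_left_mono)
  finally show ?case .
qed simp

lemma capped_power_add:
  assumes "0 < p"
  shows "capped_power p m u + capped_power p m v \<le> capped_power p (2 * m) (u + v)"
proof -
  have "capped_power p m u + capped_power p m v \<le> (u + v) ^ p"
    by (rule order_trans[OF add_mono power_add_superadditive[OF assms]]) (auto simp: capped_power_def)
  moreover have "capped_power p m u + capped_power p m v \<le> of_nat m + of_nat m"
    by (intro add_mono capped_power_le)
  ultimately show ?thesis by (simp add: capped_power_def mult_2)
qed

context prob_space
begin

lemma nn_integral_capped_power_tendsto:
  assumes [measurable]: "\<And>n. X n \<in> borel_measurable M" "X' \<in> borel_measurable M"
    and "AE \<omega> in M. (\<lambda>n. X n \<omega>) \<longlonglongrightarrow> X' \<omega>"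
  shows "(\<lambda>n. \<integral>\<^sup>+\<omega>. capped_power p m (X n \<omega>) \<partial>M) \<longlonglongrightarrow> (\<integral>\<^sup>+\<omega>. capped_power p m (X' \<omega>) \<partial>M)"
proof (rule nn_integral_dominated_convergence[where w="\<lambda>_. of_nat m"])
  show "AE \<omega> in M. (\<lambda>n. capped_power p m (X n \<omega>)) \<longlonglongrightarrow> capped_power p m (X' \<omega>)"
    using assms(3) by eventually_elim (rule tendsto_capped_power)
  show "(\<integral>\<^sup>+\<omega>. of_nat m \<partial>M) < \<infinity>" by (simp add: emeasure_space_1 of_nat_less_top)
qed (auto intro: capped_power_le)

lemma nn_integral_capped_power_tendsto_product:
  assumes [measurable]: "R \<in> borel_measurable M" "\<And>n. X n \<in> borel_measurable M" "X' \<in> borel_measurable M"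
    and R: "\<And>\<omega>. R \<omega> < \<infinity>"
    and lim: "AE \<omega> in M. (\<lambda>n. X n \<omega>) \<longlonglongrightarrow> X' \<omega>"
  shows "(\<lambda>n. \<integral>\<^sup>+\<omega>. \<integral>\<^sup>+\<omega>'. capped_power p m (R \<omega> * X n \<omega>') \<partial>M \<partial>M) \<longlonglongrightarrow>
    (\<integral>\<^sup>+\<omega>. \<integral>\<^sup>+\<omega>'. capped_power p m (R \<omega> * X' \<omega>') \<partial>M \<partial>M)"
proof (rule nn_integral_dominated_convergence[where w="\<lambda>_. of_nat m"])
  show "AE \<omega> in M. (\<integral>\<^sup>+\<omega>'. capped_power p m (R \<omega> * X n \<omega>') \<partial>M) \<le> of_nat m" for n
  proof (intro AE_I2)
    fix \<omega>
    have "(\<integral>\<^sup>+\<omega>'. capped_power p m (R \<omega> * X n \<omega>') \<partial>M) \<le> (\<integral>\<^sup>+\<omega>'. of_nat m \<partial>M)"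
      by (intro nn_integral_mono capped_power_le)
    then show "(\<integral>\<^sup>+\<omega>'. capped_power p m (R \<omega> * X n \<omega>') \<partial>M) \<le> of_nat m" by (simp add: emeasure_space_1)
  qed
  show "(\<integral>\<^sup>+\<omega>. of_nat m \<partial>M) < \<infinity>" by (simp add: emeasure_space_1 of_nat_less_top)
  show "AE \<omega> in M. (\<lambda>n. \<integral>\<^sup>+\<omega>'. capped_power p m (R \<omega> * X n \<omega>') \<partial>M) \<longlonglongrightarrow> (\<integral>\<^sup>+\<omega>'. capped_power p m (R \<omega> * X' \<omega>') \<partial>M)"
  proof (rule AE_I2, rule nn_integral_capped_power_tendsto)
    fix \<omega>
    show "AE \<omega>' in M. (\<lambda>n. R \<omega> * X n \<omega>') \<longlonglongrightarrow> R \<omega> * X' \<omega>'"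
      using lim
    proof eventually_elim
      case (elim \<omega>')
      then show ?case using R[of \<omega>] by (intro ennreal_tendsto_cmult) auto
    qed
  qed measurable
qed measurable

end

section \<open>Each half of a truncated mass as a scaled copy with an independent factor\<close>

context cascade_versions
begin

lemma dens_bounded:
  assumes "0 < e" "\<omega> \<in> space M"
  obtains C where "\<And>x. dens e x \<omega> \<le> ennreal C"
proof -
  have "cadlag_on {0..1} (\<lambda>t. Y e t \<omega>)" using Y[OF assms(1)] assms(2) by (simp add: cadlag_modification_def)
  then obtain C where C: "\<And>t. t \<in> {0..1} \<Longrightarrow> \<bar>Y e t \<omega>\<bar> \<le> C" using cadlag_on_bounded by blast
  have "dens e x \<omega> \<le> ennreal (exp C)" for x
    using C[of x] by (auto simp: dens_def intro!: ennreal_leI)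
  then show ?thesis by (rule that)
qed

lemma dens_right_limit:
  assumes "0 < e" "\<omega> \<in> space M" "t \<in> {0..1}" "\<And>n. x n \<in> {0..1}" "\<And>n. t \<le> x n" "x \<longlonglongrightarrow> t"
  shows "(\<lambda>n. dens e (x n) \<omega>) \<longlonglongrightarrow> dens e t \<omega>"
proof -
  have "(\<lambda>n. ennreal (exp (Y e (x n) \<omega>))) \<longlonglongrightarrow> ennreal (exp (Y e t \<omega>))"
    by (intro tendsto_ennrealI tendsto_exp Y_right_limit assms)
  then show ?thesis using assms(3,4) by (simp add: dens_def)
qed

text \<open>Twice the mass of the half that starts at \<open>b\<close>, because the half is
  stretched to the unit interval.\<close>

definition half_mass :: "real \<Rightarrow> real \<Rightarrow> 'w \<Rightarrow> ennreal" where
  "half_mass b e \<omega> = (\<integral>\<^sup>+x. dens e (b + x / 2) \<omega> * indicator {0<..1} x \<partial>lborel)"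

lemma half_mass_measurable:
  assumes "0 < e"
  shows "half_mass b e \<in> borel_measurable M"
proof -
  have "(\<lambda>p. (b + snd p / 2, fst p)) \<in> M \<Otimes>\<^sub>M lborel \<rightarrow>\<^sub>M borel \<Otimes>\<^sub>M M" by measurable
  from measurable_compose[OF this dens_measurable[OF assms]]
  have [measurable]: "(\<lambda>p. dens e (b + snd p / 2) (fst p)) \<in> borel_measurable (M \<Otimes>\<^sub>M lborel)" by simp
  show ?thesis
    unfolding half_mass_def[abs_def]
    by (intro lborel.borel_measurable_nn_integral) (simp add: case_prod_beta')
qed

lemma half_mass_sum_le:
  assumes e: "0 < e" and \<omega>: "\<omega> \<in> space M"
  shows "ennreal (1 / 2) * half_mass 0 e \<omega> + ennreal (1 / 2) * half_mass (1 / 2) e \<omega> \<le> approx_mass e \<omega>"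
proof -
  note [measurable] = dens_measurable_fst[OF e \<omega>]
  have half: "ennreal (1 / 2) * half_mass b e \<omega> = (\<integral>\<^sup>+x. dens e x \<omega> * indicator {b<..b + 1 / 2} x \<partial>lborel)" for b
  proof -
    have "(\<integral>\<^sup>+x. dens e x \<omega> * indicator {b<..b + 1 / 2} x \<partial>lborel) =
        ennreal \<bar>1 / 2\<bar> * (\<integral>\<^sup>+x. dens e (b + 1 / 2 * x) \<omega> * indicator {b<..b + 1 / 2} (b + 1 / 2 * x) \<partial>lborel)"
      by (rule nn_integral_real_affine) simp_all
    also have "(\<integral>\<^sup>+x. dens e (b + 1 / 2 * x) \<omega> * indicator {b<..b + 1 / 2} (b + 1 / 2 * x) \<partial>lborel) = half_mass b e \<omega>"
      unfolding half_mass_def by (intro nn_integral_cong) (auto simp: indicator_def)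
    finally show ?thesis by simp
  qed
  have "ennreal (1 / 2) * half_mass 0 e \<omega> + ennreal (1 / 2) * half_mass (1 / 2) e \<omega> =
      (\<integral>\<^sup>+x. dens e x \<omega> * indicator {0<..0 + 1 / 2} x + dens e x \<omega> * indicator {1 / 2<..1 / 2 + 1 / 2} x \<partial>lborel)"
    unfolding half by (rule nn_integral_add[symmetric]) simp_all
  also have "\<dots> \<le> approx_mass e \<omega>"
    unfolding approx_mass_def by (intro nn_integral_mono) (auto simp: indicator_def)
  finally show ?thesis .
qed

lemma right_average_half_tendsto:
  assumes e: "0 < e" and b: "0 \<le> b" "b \<le> 1 / 2" and \<omega>: "\<omega> \<in> space M"
  shows "(\<lambda>k. right_average k (\<lambda>x. dens e (b + x / 2) \<omega>)) \<longlonglongrightarrow> half_mass b e \<omega>"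
  unfolding half_mass_def
proof -
  obtain C where C: "\<And>x. dens e x \<omega> \<le> ennreal C" using dens_bounded[OF e \<omega>] by blast
  show "(\<lambda>k. right_average k (\<lambda>x. dens e (b + x / 2) \<omega>)) \<longlonglongrightarrow> (\<integral>\<^sup>+x. dens e (b + x / 2) \<omega> * indicator {0<..1} x \<partial>lborel)"
  proof (rule right_average_tendsto[OF _ C])
    have "(\<lambda>x. b + x / 2) \<in> borel_measurable borel" by measurable
    from measurable_compose[OF this dens_measurable_fst[OF e \<omega>]]
    show "(\<lambda>x. dens e (b + x / 2) \<omega>) \<in> borel_measurable borel" .
    fix x :: real assume "x \<in> {0<..1}"
    then have x: "x \<in> {0..1}" by simp
    show "(\<lambda>k. dens e (b + right_grid k x / 2) \<omega>) \<longlonglongrightarrow> dens e (b + x / 2) \<omega>"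
    proof (rule dens_right_limit[OF e \<omega>])
      show "b + right_grid k x / 2 \<in> {0..1}" for k using right_grid_mem[OF x, of k] b by auto
      show "b + x / 2 \<le> b + right_grid k x / 2" for k using right_grid_ge[of x k] by simp
      show "(\<lambda>k. b + right_grid k x / 2) \<longlonglongrightarrow> b + x / 2"
        by (intro tendsto_intros right_grid_tendsto) simp
    qed (use x b in auto)
  qed
qed

lemma right_average_approx_tendsto:
  assumes e: "0 < e" and \<omega>: "\<omega> \<in> space M"
  shows "(\<lambda>k. right_average k (\<lambda>x. dens e x \<omega>)) \<longlonglongrightarrow> approx_mass e \<omega>"
proof -
  obtain C where C: "\<And>x. dens e x \<omega> \<le> ennreal C" using dens_bounded[OF e \<omega>] by blast
  have "(\<lambda>k. right_average k (\<lambda>x. dens e x \<omega>)) \<longlonglongrightarrow> (\<integral>\<^sup>+x. dens e x \<omega> * indicator {0<..1} x \<partial>lborel)"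
  proof (rule right_average_tendsto[OF dens_measurable_fst[OF e \<omega>] C])
    fix x :: real assume "x \<in> {0<..1}"
    then have x: "x \<in> {0..1}" by simp
    then show "(\<lambda>k. dens e (right_grid k x) \<omega>) \<longlonglongrightarrow> dens e x \<omega>"
      by (intro dens_right_limit e \<omega> right_grid_mem right_grid_ge right_grid_tendsto)
  qed
  also have "(\<integral>\<^sup>+x. dens e x \<omega> * indicator {0<..1} x \<partial>lborel) = approx_mass e \<omega>"
    unfolding approx_mass_def
  proof (rule nn_integral_cong_AE, use AE_lborel_singleton[of "0::real"] in eventually_elim)
    case (elim x)
    then show ?case by (auto simp: dens_def indicator_def)
  qed
  finally show ?thesis .
qed

lemma right_average_measurable:
  assumes "0 < e"
  shows "(\<lambda>\<omega>. right_average k (\<lambda>x. dens e (g x) \<omega>)) \<in> borel_measurable M"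
  using dens_measurable_snd[OF assms] unfolding right_average_def by measurable

text \<open>By \<open>cone_trunc_half\<close> the field in the half is a common summand plus the
  values on images under \<open>half_map\<close>. These images are disjoint from
  \<open>half_cone b\<close>, and their atoms have the areas of the original ones, so
  \<open>nn_integral_Lam_indep_copy\<close> applies. Independence is expressed by the iterated
  integral.\<close>

lemma nn_integral_right_average_half:
  assumes e: "0 < e" "e \<le> 1 / 2" and b: "0 \<le> b" "b \<le> 1 / 2" and H: "H \<in> borel_measurable borel"
  shows "(\<integral>\<^sup>+\<omega>. H (right_average k (\<lambda>x. dens e (b + x / 2) \<omega>)) \<partial>M) =
    (\<integral>\<^sup>+\<omega>. \<integral>\<^sup>+\<omega>'. H (ennreal (exp (\<Lambda> (half_cone b) \<omega>)) * right_average k (\<lambda>x. dens (2 * e) x \<omega>')) \<partial>M \<partial>M)"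
proof -
  define x where "x j = real (Suc j) / real (Suc k)" for j
  have x: "0 \<le> x j" "x j \<le> 1" if "j < Suc k" for j using that by (auto simp: x_def)
  have bx: "b + x j / 2 \<in> {0..1}" if "j < Suc k" for j using x[OF that] b by auto
  define B where "B j = cone_trunc {0..1} (2 * e) (x j)" for j
  define B' where "B' j = half_map b ` B j" for j
  define f where "f r y = H (ennreal (1 / real (Suc k)) * (\<Sum>j<Suc k. ennreal (exp (r + y j))))" for r :: real and y :: "nat \<Rightarrow> real"
  have B: "B j \<in> fmeasurable \<H>" if "j < Suc k" for j
    unfolding B_def using x[OF that] e by (intro cone_trunc_fmeasurable) auto
  have B': "B' j \<in> fmeasurable \<H>" if "j < Suc k" for j
    unfolding B'_def by (intro half_map_fmeasurable B that)
  have disj: "half_cone b \<inter> B' j = {}" if "j < Suc k" for j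
    unfolding B'_def B_def using x[OF that] by (intro half_cone_disjoint b e)
  have cone: "cone_trunc {0..1} e (b + x j / 2) = half_cone b \<union> B' j" if "j < Suc k" for j
    unfolding B'_def B_def using x[OF that] by (intro cone_trunc_half b e)
  have C: "half_cone b \<in> fmeasurable \<H>" by (rule half_cone_fmeasurable[OF b])
  have "AE \<omega> in M. \<forall>j\<in>{..<Suc k}. dens e (b + x j / 2) \<omega> = ennreal (exp (\<Lambda> (half_cone b) \<omega> + \<Lambda> (B' j) \<omega>))"
  proof (subst AE_finite_all, simp, intro ballI)
    fix j assume "j \<in> {..<Suc k}"
    then have j: "j < Suc k" by simp
    show "AE \<omega> in M. dens e (b + x j / 2) \<omega> = ennreal (exp (\<Lambda> (half_cone b) \<omega> + \<Lambda> (B' j) \<omega>))"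
      using dens_AE[OF e(1) bx[OF j]] Lam_Un[OF C B'[OF j] disj[OF j]]
      unfolding cone[OF j] by eventually_elim simp
  qed
  then have "(\<integral>\<^sup>+\<omega>. H (right_average k (\<lambda>x. dens e (b + x / 2) \<omega>)) \<partial>M) =
      (\<integral>\<^sup>+\<omega>. f (\<Lambda> (half_cone b) \<omega>) (\<lambda>j\<in>{..<Suc k}. \<Lambda> (B' j) \<omega>) \<partial>M)"
  proof (intro nn_integral_cong_AE, eventually_elim)
    case (elim \<omega>)
    have "(\<Sum>j<Suc k. dens e (b + x j / 2) \<omega>) =
        (\<Sum>j<Suc k. ennreal (exp (\<Lambda> (half_cone b) \<omega> + (\<lambda>j\<in>{..<Suc k}. \<Lambda> (B' j) \<omega>) j)))"
      using elim by (intro sum.cong refl) simp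
    then show ?case unfolding f_def right_average_def x_def by (simp only:)
  qed
  also have "\<dots> = (\<integral>\<^sup>+\<omega>. \<integral>\<^sup>+\<omega>'. f (\<Lambda> (half_cone b) \<omega>) (\<lambda>j\<in>{..<Suc k}. \<Lambda> (B j) \<omega>') \<partial>M \<partial>M)"
  proof (rule nn_integral_Lam_indep_copy[OF B B' C disj])
    show "measure \<H> (atom B' (Suc k) m) = measure \<H> (atom B (Suc k) m)" for m
    proof -
      have "atom B (Suc k) m \<in> sets \<H>" using atom_fmeasurable[of "Suc k" B \<H> m] B by blast
      then show ?thesis
        unfolding B'_def[abs_def] atom_half_map measure_def by (simp only: emeasure_half_map)
    qed
    have y: "(\<lambda>p. snd p j) \<in> borel_measurable (borel \<Otimes>\<^sub>M PiM {..<Suc k} (\<lambda>_. borel :: real measure))" if "j < Suc k" for j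
      using that by (intro measurable_compose[OF measurable_snd measurable_component_singleton]) auto
    have "(\<lambda>p. ennreal (1 / real (Suc k)) * (\<Sum>j<Suc k. ennreal (exp (fst p + snd p j))))
        \<in> borel_measurable (borel \<Otimes>\<^sub>M PiM {..<Suc k} (\<lambda>_. borel :: real measure))"
      using y by (intro borel_measurable_times_ennreal borel_measurable_sum borel_measurable_const
          measurable_compose[OF _ measurable_ennreal] borel_measurable_exp[THEN measurable_compose[rotated]]
          borel_measurable_add measurable_fst) auto
    from measurable_compose[OF this H]
    show "(\<lambda>(r, y). f r y) \<in> borel_measurable (borel \<Otimes>\<^sub>M PiM {..<Suc k} (\<lambda>_. borel))"
      unfolding f_def by (simp add: case_prod_beta')
  qed simp_all
  also have "\<dots> = (\<integral>\<^sup>+\<omega>. \<integral>\<^sup>+\<omega>'. H (ennreal (exp (\<Lambda> (half_cone b) \<omega>)) * right_average k (\<lambda>x. dens (2 * e) x \<omega>')) \<partial>M \<partial>M)"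
  proof (rule nn_integral_cong)
    fix \<omega>
    have "AE \<omega>' in M. \<forall>j\<in>{..<Suc k}. dens (2 * e) (x j) \<omega>' = ennreal (exp (\<Lambda> (B j) \<omega>'))"
      unfolding B_def using x e by (subst AE_finite_all) (auto intro!: dens_AE)
    then show "(\<integral>\<^sup>+\<omega>'. f (\<Lambda> (half_cone b) \<omega>) (\<lambda>j\<in>{..<Suc k}. \<Lambda> (B j) \<omega>') \<partial>M) =
      (\<integral>\<^sup>+\<omega>'. H (ennreal (exp (\<Lambda> (half_cone b) \<omega>)) * right_average k (\<lambda>x. dens (2 * e) x \<omega>')) \<partial>M)"
    proof (intro nn_integral_cong_AE, eventually_elim)
      case (elim \<omega>')
      have "(\<Sum>j<Suc k. ennreal (exp (\<Lambda> (half_cone b) \<omega> + (\<lambda>j\<in>{..<Suc k}. \<Lambda> (B j) \<omega>') j))) =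
          (\<Sum>j<Suc k. ennreal (exp (\<Lambda> (half_cone b) \<omega>)) * dens (2 * e) (x j) \<omega>')"
        using elim by (intro sum.cong refl) (simp add: exp_add ennreal_mult)
      then show ?case
        unfolding f_def right_average_def x_def sum_distrib_left[symmetric]
        by (simp only: mult.left_commute)
    qed
  qed
  finally show ?thesis .
qed

text \<open>Both sides are limits of the identity for Riemann sums; the cap dominates.\<close>

lemma nn_integral_capped_half_mass:
  assumes e: "0 < e" "e \<le> 1 / 2" and b: "0 \<le> b" "b \<le> 1 / 2" and c: "c < \<infinity>"
  shows "(\<integral>\<^sup>+\<omega>. capped_power p m (c * half_mass b e \<omega>) \<partial>M) =
    (\<integral>\<^sup>+\<omega>. \<integral>\<^sup>+\<omega>'. capped_power p m (c * ennreal (exp (\<Lambda> (half_cone b) \<omega>)) * approx_mass (2 * e) \<omega>') \<partial>M \<partial>M)"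
proof (rule LIMSEQ_unique)
  let ?L = "\<lambda>k. \<integral>\<^sup>+\<omega>. capped_power p m (c * right_average k (\<lambda>x. dens e (b + x / 2) \<omega>)) \<partial>M"
  have e2: "0 < 2 * e" using e by simp
  have C [measurable]: "half_cone b \<in> fmeasurable \<H>" by (rule half_cone_fmeasurable[OF b])
  note [measurable] = half_mass_measurable[OF e(1)] right_average_measurable[OF e(1)]
    right_average_measurable[OF e2] approx_mass_measurable[OF e2] Lam_measurable[OF C]
  show "?L \<longlonglongrightarrow> (\<integral>\<^sup>+\<omega>. capped_power p m (c * half_mass b e \<omega>) \<partial>M)"
    using right_average_half_tendsto[OF e(1) b] c
    by (intro nn_integral_capped_power_tendsto AE_I2 ennreal_tendsto_cmult) auto
  have "(\<lambda>k. \<integral>\<^sup>+\<omega>. \<integral>\<^sup>+\<omega>'. capped_power p m (c * ennreal (exp (\<Lambda> (half_cone b) \<omega>)) * right_average k (\<lambda>x. dens (2 * e) x \<omega>')) \<partial>M \<partial>M) \<longlonglongrightarrow>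
      (\<integral>\<^sup>+\<omega>. \<integral>\<^sup>+\<omega>'. capped_power p m (c * ennreal (exp (\<Lambda> (half_cone b) \<omega>)) * approx_mass (2 * e) \<omega>') \<partial>M \<partial>M)"
    using right_average_approx_tendsto[OF e2] c
    by (intro nn_integral_capped_power_tendsto_product) (auto simp: ennreal_mult_less_top)
  moreover have "?L k = (\<integral>\<^sup>+\<omega>. \<integral>\<^sup>+\<omega>'. capped_power p m (c * ennreal (exp (\<Lambda> (half_cone b) \<omega>)) * right_average k (\<lambda>x. dens (2 * e) x \<omega>')) \<partial>M \<partial>M)" for k
    unfolding mult.assoc
    by (rule nn_integral_right_average_half[OF e b, of "\<lambda>u. capped_power p m (c * u)"]) measurable
  ultimately show "?L \<longlonglongrightarrow> (\<integral>\<^sup>+\<omega>. \<integral>\<^sup>+\<omega>'. capped_power p m (c * ennreal (exp (\<Lambda> (half_cone b) \<omega>)) * approx_mass (2 * e) \<omega>') \<partial>M \<partial>M)"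
    by (simp only:)
qed

end

context cascade_total
begin

text \<open>Superadditivity of powers is applied to the truncated masses, where the two halves add
  up to at most the whole, and only then the truncation is removed. On the left each half has been
  replaced by its copy in law.\<close>

lemma capped_halves_le:
  assumes p: "0 < p"
  shows "(\<Sum>b\<in>{0, 1 / 2}. \<integral>\<^sup>+\<omega>. \<integral>\<^sup>+\<omega>'. capped_power p m (ennreal (1 / 2) * ennreal (exp (\<Lambda> (half_cone b) \<omega>)) * ennreal (Z \<omega>')) \<partial>M \<partial>M) \<le>
    (\<integral>\<^sup>+\<omega>. ennreal (Z \<omega>) ^ p \<partial>M)"
proof -
  define h where "h = ennreal (1 / 2)"
  have h: "h < \<infinity>" unfolding h_def infinity_ennreal_def by (rule ennreal_less_top)
  \<comment> \<open>A half truncated at \<open>e n\<close> corresponds to the whole interval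
    truncated at \<open>2 * e n\<close>. With this choice both truncations belong to the sequence 1
    / (k + 1) along which convergence is known.\<close>
  define e where "e n = 1 / real (Suc (2 * n + 1))" for n
  have e: "0 < e n" "e n \<le> 1 / 2" for n by (auto simp: e_def)
  have e2: "2 * e n = 1 / real (Suc n)" for n by (simp add: e_def field_simps)
  let ?R = "\<lambda>b \<omega>. h * ennreal (exp (\<Lambda> (half_cone b) \<omega>))"
  let ?I = "\<lambda>b X. \<integral>\<^sup>+\<omega>. \<integral>\<^sup>+\<omega>'. capped_power p m (?R b \<omega> * X \<omega>') \<partial>M \<partial>M"
  have b: "0 \<le> b" "b \<le> 1 / 2" if "b \<in> {0, 1 / 2}" for b :: real using that by auto
  have A [measurable]: "approx_mass (1 / real (Suc n)) \<in> borel_measurable M" for n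
    by (rule approx_mass_measurable) simp
  have "(\<Sum>b\<in>{0, 1 / 2}. ?I b (approx_mass (1 / real (Suc n)))) \<le> (\<integral>\<^sup>+\<omega>. capped_power p (2 * m) (approx_mass (e n) \<omega>) \<partial>M)" for n
  proof -
    note [measurable] = half_mass_measurable[OF e(1)]
    have "(\<Sum>b\<in>{0, 1 / 2}. ?I b (approx_mass (1 / real (Suc n)))) =
        (\<Sum>b\<in>{0, 1 / 2}. \<integral>\<^sup>+\<omega>. capped_power p m (h * half_mass b (e n) \<omega>) \<partial>M)"
      unfolding e2[symmetric]
      by (intro sum.cong refl nn_integral_capped_half_mass[symmetric] e h b)
    also have "\<dots> = (\<integral>\<^sup>+\<omega>. capped_power p m (h * half_mass 0 (e n) \<omega>) + capped_power p m (h * half_mass (1 / 2) (e n) \<omega>) \<partial>M)"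
      by (subst nn_integral_add) simp_all
    also have "\<dots> \<le> (\<integral>\<^sup>+\<omega>. capped_power p (2 * m) (approx_mass (e n) \<omega>) \<partial>M)"
    proof (rule nn_integral_mono)
      fix \<omega> assume \<omega>: "\<omega> \<in> space M"
      have "capped_power p m (h * half_mass 0 (e n) \<omega>) + capped_power p m (h * half_mass (1 / 2) (e n) \<omega>) \<le>
          capped_power p (2 * m) (h * half_mass 0 (e n) \<omega> + h * half_mass (1 / 2) (e n) \<omega>)"
        by (rule capped_power_add[OF p])
      also have "\<dots> \<le> capped_power p (2 * m) (approx_mass (e n) \<omega>)"
        unfolding capped_power_def h_def
        by (intro min.mono order.refl power_mono half_mass_sum_le[OF e(1) \<omega>]) simp
      finally show "capped_power p m (h * half_mass 0 (e n) \<omega>) + capped_power p m (h * half_mass (1 / 2) (e n) \<omega>) \<le>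
          capped_power p (2 * m) (approx_mass (e n) \<omega>)" .
    qed
    finally show ?thesis .
  qed
  moreover have "(\<lambda>n. \<Sum>b\<in>{0, 1 / 2}. ?I b (approx_mass (1 / real (Suc n)))) \<longlonglongrightarrow> (\<Sum>b\<in>{0, 1 / 2}. ?I b (\<lambda>\<omega>. ennreal (Z \<omega>)))"
  proof (rule tendsto_sum)
    fix b :: real assume "b \<in> {0, 1 / 2}"
    from half_cone_fmeasurable[OF b[OF this]] have [measurable]: "\<Lambda> (half_cone b) \<in> borel_measurable M" by measurable
    show "(\<lambda>n. ?I b (approx_mass (1 / real (Suc n)))) \<longlonglongrightarrow> ?I b (\<lambda>\<omega>. ennreal (Z \<omega>))"
      by (intro nn_integral_capped_power_tendsto_product)
        (use Z_lim h A in \<open>simp_all add: ennreal_mult_less_top del: of_nat_Suc\<close>)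
  qed
  moreover have "(\<lambda>n. \<integral>\<^sup>+\<omega>. capped_power p (2 * m) (approx_mass (e n) \<omega>) \<partial>M) \<longlonglongrightarrow> (\<integral>\<^sup>+\<omega>. capped_power p (2 * m) (ennreal (Z \<omega>)) \<partial>M)"
  proof (rule nn_integral_capped_power_tendsto)
    show "AE \<omega> in M. (\<lambda>n. approx_mass (e n) \<omega>) \<longlonglongrightarrow> ennreal (Z \<omega>)"
      using Z_lim
    proof eventually_elim
      case (elim \<omega>)
      have "strict_mono (\<lambda>n::nat. 2 * n + 1)" by (simp add: strict_mono_def)
      from LIMSEQ_subseq_LIMSEQ[OF elim this] show ?case by (simp add: o_def e_def del: of_nat_Suc)
    qed
  qed (auto intro: approx_mass_measurable e)
  ultimately have "(\<Sum>b\<in>{0, 1 / 2}. ?I b (\<lambda>\<omega>. ennreal (Z \<omega>))) \<le> (\<integral>\<^sup>+\<omega>. capped_power p (2 * m) (ennreal (Z \<omega>)) \<partial>M)"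
    by (intro LIMSEQ_le) auto
  also have "\<dots> \<le> (\<integral>\<^sup>+\<omega>. ennreal (Z \<omega>) ^ p \<partial>M)"
    by (intro nn_integral_mono) (simp add: capped_power_def)
  finally show ?thesis unfolding h_def .
qed

text \<open>Removing the cap gives 2 * 2^-p * E * K \<le> K, where E is the exponential moment and K
  the \<open>p\<close>-th moment of Z. As K is positive and finite it cancels, leaving E \<le> 2^p /
  2. Any set of area ln 2 may replace the half cones since the law depends on the area only.\<close>

lemma half_cone_moment_le:
  assumes p: "0 < p" and Zp: "0 < (\<integral>\<^sup>+\<omega>. ennreal (Z \<omega>) ^ p \<partial>M)" "(\<integral>\<^sup>+\<omega>. ennreal (Z \<omega>) ^ p \<partial>M) < \<infinity>"
    and B: "B \<in> fmeasurable \<H>" "measure \<H> B = ln 2"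
  shows "(\<integral>\<^sup>+\<omega>. ennreal (exp (real p * \<Lambda> B \<omega>)) \<partial>M) \<le> ennreal (exp (ln 2 * (real p - 1)))"
proof -
  define K where "K = (\<integral>\<^sup>+\<omega>. ennreal (Z \<omega>) ^ p \<partial>M)"
  define E where "E = (\<integral>\<^sup>+\<omega>. ennreal (exp (real p * \<Lambda> B \<omega>)) \<partial>M)"
  let ?X = "\<lambda>b \<omega> \<omega>'. ennreal (1 / 2) * ennreal (exp (\<Lambda> (half_cone b) \<omega>)) * ennreal (Z \<omega>')"
  have E: "(\<integral>\<^sup>+\<omega>. ennreal (exp (\<Lambda> (half_cone b) \<omega>)) ^ p \<partial>M) = E" if b: "b \<in> {0, 1 / 2}" for b :: real
  proof -
    have C: "half_cone b \<in> fmeasurable \<H>" "measure \<H> (half_cone b) = measure \<H> B"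
      using b half_cone_fmeasurable[of b] measure_half_cone[of b] B(2) by auto
    have "(\<integral>\<^sup>+\<omega>. ennreal (exp (\<Lambda> (half_cone b) \<omega>)) ^ p \<partial>M) = (\<integral>\<^sup>+\<omega>. ennreal (exp (real p * \<Lambda> (half_cone b) \<omega>)) \<partial>M)"
      by (simp add: ennreal_power exp_of_nat_mult)
    also have "\<dots> = (\<integral>\<^sup>+x. ennreal (exp (real p * x)) \<partial>distr M borel (\<Lambda> (half_cone b)))"
      using C by (subst nn_integral_distr) auto
    also have "distr M borel (\<Lambda> (half_cone b)) = distr M borel (\<Lambda> B)"
      by (rule distr_Lam_eq[OF C(1) B(1) C(2)])
    also have "(\<integral>\<^sup>+x. ennreal (exp (real p * x)) \<partial>distr M borel (\<Lambda> B)) = E"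
      unfolding E_def using B by (subst nn_integral_distr) auto
    finally show ?thesis .
  qed
  have full: "(\<integral>\<^sup>+\<omega>. \<integral>\<^sup>+\<omega>'. ?X b \<omega> \<omega>' ^ p \<partial>M \<partial>M) = ennreal (1 / 2) ^ p * (E * K)" if b: "b \<in> {0, 1 / 2}" for b :: real
  proof -
    have [measurable]: "\<Lambda> (half_cone b) \<in> borel_measurable M"
      using b half_cone_fmeasurable[of b] by (intro Lam_measurable) auto
    have "(\<integral>\<^sup>+\<omega>. \<integral>\<^sup>+\<omega>'. ?X b \<omega> \<omega>' ^ p \<partial>M \<partial>M) =
        (\<integral>\<^sup>+\<omega>. ennreal (1 / 2) ^ p * (ennreal (exp (\<Lambda> (half_cone b) \<omega>)) ^ p * K) \<partial>M)"
      unfolding K_def power_mult_distrib mult.assoc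
      by (intro nn_integral_cong) (simp add: nn_integral_cmult ennreal_power)
    also have "\<dots> = ennreal (1 / 2) ^ p * (E * K)"
      unfolding E[OF b, symmetric] by (simp add: nn_integral_cmult nn_integral_multc ennreal_power)
    finally show ?thesis .
  qed
  have "(\<Sum>b\<in>{0, 1 / 2::real}. ennreal (1 / 2) ^ p * (E * K)) \<le>
      (\<Sum>b\<in>{0, 1 / 2::real}. liminf (\<lambda>m. \<integral>\<^sup>+\<omega>. \<integral>\<^sup>+\<omega>'. capped_power p m (?X b \<omega> \<omega>') \<partial>M \<partial>M))"
  proof (rule sum_mono)
    fix b :: real assume b: "b \<in> {0, 1 / 2}"
    have [measurable]: "\<Lambda> (half_cone b) \<in> borel_measurable M"
      using b half_cone_fmeasurable[of b] by (intro Lam_measurable) auto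
    have lim: "(\<lambda>m. capped_power p m u) \<longlonglongrightarrow> u ^ p" for u
    proof -
      have "(\<lambda>m. min (u ^ p) (of_nat m)) \<longlonglongrightarrow> min (u ^ p) \<top>"
        by (intro tendsto_min tendsto_const of_nat_tendsto_top_ennreal)
      then show ?thesis by (simp add: capped_power_def)
    qed
    have "(\<integral>\<^sup>+\<omega>. \<integral>\<^sup>+\<omega>'. ?X b \<omega> \<omega>' ^ p \<partial>M \<partial>M) \<le>
        (\<integral>\<^sup>+\<omega>. liminf (\<lambda>m. \<integral>\<^sup>+\<omega>'. capped_power p m (?X b \<omega> \<omega>') \<partial>M) \<partial>M)"
    proof (rule nn_integral_mono)
      fix \<omega>
      have "(\<integral>\<^sup>+\<omega>'. ?X b \<omega> \<omega>' ^ p \<partial>M) = (\<integral>\<^sup>+\<omega>'. liminf (\<lambda>m. capped_power p m (?X b \<omega> \<omega>')) \<partial>M)"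
        by (intro nn_integral_cong) (rule lim_imp_Liminf[OF _ lim, symmetric], simp)
      also have "\<dots> \<le> liminf (\<lambda>m. \<integral>\<^sup>+\<omega>'. capped_power p m (?X b \<omega> \<omega>') \<partial>M)"
        by (rule nn_integral_liminf) measurable
      finally show "(\<integral>\<^sup>+\<omega>'. ?X b \<omega> \<omega>' ^ p \<partial>M) \<le> liminf (\<lambda>m. \<integral>\<^sup>+\<omega>'. capped_power p m (?X b \<omega> \<omega>') \<partial>M)" .
    qed
    also have "\<dots> \<le> liminf (\<lambda>m. \<integral>\<^sup>+\<omega>. \<integral>\<^sup>+\<omega>'. capped_power p m (?X b \<omega> \<omega>') \<partial>M \<partial>M)"
      by (rule nn_integral_liminf) measurable
    finally show "ennreal (1 / 2) ^ p * (E * K) \<le> liminf (\<lambda>m. \<integral>\<^sup>+\<omega>. \<integral>\<^sup>+\<omega>'. capped_power p m (?X b \<omega> \<omega>') \<partial>M \<partial>M)"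
      unfolding full[OF b] .
  qed
  also have "\<dots> \<le> liminf (\<lambda>m. \<Sum>b\<in>{0, 1 / 2::real}. \<integral>\<^sup>+\<omega>. \<integral>\<^sup>+\<omega>'. capped_power p m (?X b \<omega> \<omega>') \<partial>M \<partial>M)"
  proof -
    \<comment> \<open>Superadditivity of the lower limit is Fatou's lemma for counting measure on
      two points.\<close>
    have "liminf u + liminf v \<le> liminf (\<lambda>m. u m + v m)" for u v :: "nat \<Rightarrow> ennreal"
    proof -
      have "(\<integral>\<^sup>+b. liminf (\<lambda>m. if b then u m else v m) \<partial>count_space UNIV) \<le>
          liminf (\<lambda>m. \<integral>\<^sup>+b. (if b then u m else v m) \<partial>count_space (UNIV :: bool set))"
        by (rule nn_integral_liminf) simp
      then show ?thesis by (simp add: nn_integral_count_space_finite UNIV_bool add.commute)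
    qed
    then show ?thesis by simp
  qed
  also have "\<dots> \<le> K"
    unfolding K_def by (rule Liminf_le, simp, intro always_eventually allI capped_halves_le p)
  finally have main: "2 * (ennreal (1 / 2) ^ p * (E * K)) \<le> K" by (simp add: mult_2)
  obtain \<kappa> where \<kappa>: "K = ennreal \<kappa>" "0 < \<kappa>" using Zp unfolding K_def[symmetric] by (cases K) auto
  have "E \<noteq> \<top>"
  proof
    assume "E = \<top>"
    with main \<kappa> show False by (simp add: ennreal_top_mult ennreal_mult_top ennreal_power top_unique)
  qed
  then obtain \<rho> where \<rho>: "E = ennreal \<rho>" "0 \<le> \<rho>" by (cases E) auto
  have "ennreal (1 / 2) ^ p = ennreal ((1 / 2) ^ p)" by (rule ennreal_power) simp
  then have "2 * (ennreal (1 / 2) ^ p * (E * K)) = ennreal (2 * ((1 / 2) ^ p * (\<rho> * \<kappa>)))"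
    using \<kappa> \<rho> by (simp only:) (simp add: ennreal_mult)
  with main have "2 * ((1 / 2) ^ p * (\<rho> * \<kappa>)) \<le> \<kappa>" unfolding \<kappa>(1) using \<kappa>(2) by simp
  then have "2 * \<rho> \<le> 2 ^ p" using \<kappa>(2) by (simp add: power_one_over field_simps)
  moreover have "exp (ln 2 * (real p - 1)) = 2 ^ p / 2"
    by (simp add: right_diff_distrib exp_diff mult.commute[of "ln 2"] exp_of_nat_mult)
  ultimately show ?thesis unfolding E_def[symmetric] \<rho>(1) by (intro ennreal_leI) simp
qed

end

section \<open>Necessity and sufficiency\<close>

lemma space_levy_measure: "levy_measure \<nu> \<Longrightarrow> space \<nu> = UNIV"
  using sets_eq_imp_space_eq[of \<nu> borel] by (simp add: levy_measure_def)

lemma negative_levyI: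
  assumes levy: "levy_measure \<nu>" and nonzero: "\<nu> \<noteq> null_measure borel"
    and pos: "emeasure \<nu> {0<..} = 0" and fin: "(\<integral>\<^sup>+x\<in>{..0}. ennreal (min 1 \<bar>x\<bar>) \<partial>\<nu>) < \<infinity>"
  shows "negative_levy \<nu>"
proof
  show sets: "sets \<nu> = sets borel" using levy by (simp add: levy_measure_def)
  have space: "space \<nu> = UNIV" by (rule space_levy_measure[OF levy])
  have "{0::real} \<in> null_sets \<nu>" "{0<..} \<in> null_sets \<nu>"
    using levy pos by (auto simp: levy_measure_def null_sets_def)
  from AE_not_in[OF this(1)] AE_not_in[OF this(2)]
  show neg: "AE x in \<nu>. x < 0" by eventually_elim auto
  have "(\<integral>\<^sup>+x. ennreal (min 1 \<bar>x\<bar>) \<partial>\<nu>) = (\<integral>\<^sup>+x\<in>{..0}. ennreal (min 1 \<bar>x\<bar>) \<partial>\<nu>)"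
    by (rule nn_integral_cong_AE, use neg in eventually_elim) (simp add: indicator_def)
  with fin show "(\<integral>\<^sup>+x. ennreal (min 1 \<bar>x\<bar>) \<partial>\<nu>) < \<infinity>" by simp
  show "emeasure \<nu> UNIV \<noteq> 0"
  proof
    assume 0: "emeasure \<nu> UNIV = 0"
    have "\<nu> = null_measure borel"
    proof (rule measure_eqI)
      fix A assume A: "A \<in> sets \<nu>"
      have "emeasure \<nu> A \<le> emeasure \<nu> UNIV" by (rule emeasure_mono) (use sets in auto)
      with 0 show "emeasure \<nu> A = emeasure (null_measure borel) A" by simp
    qed (simp add: sets)
    with nonzero show False ..
  qed
qed

context negative_levy
begin

lemma levy_gamma_eq: "levy_gamma \<nu> = gam"
  unfolding levy_gamma_def set_lebesgue_integral_def
proof (rule integral_cong_AE)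
  show "AE x in \<nu>. indicat_real {..0} x *\<^sub>R (1 - exp x) = 1 - exp x"
    using neg by eventually_elim simp
qed measurable

text \<open>Finite variation allows the compensator to be integrated separately; the normalisation
  of \<open>a\<close> then turns the total linear term into the drift \<open>gam\<close>.\<close>

lemma levy_exponent_eq:
  assumes a: "a = - (LINT x|\<nu>. exp x - 1 - x * indicator {-1..1} x)"
  shows "levy_exponent a 0 \<nu> \<theta> = \<i> * of_real (\<theta> * gam) + (CLINT x|\<nu>. iexp (\<theta> * x) - 1)"
proof -
  let ?b = "LINT x|\<nu>. x * indicator {-1..1} x"
  have drift: "integrable \<nu> (\<lambda>x. x * indicator {-1..1} x)"
    by (rule integrable_dominated[where C=1]) (auto simp: indicator_def)
  have "a = gam + ?b"
  proof -
    have "(LINT x|\<nu>. exp x - 1 - x * indicator {-1..1} x) = (LINT x|\<nu>. - ((1 - exp x) + x * indicator {-1..1} x))"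
      by (intro Bochner_Integration.integral_cong) auto
    also have "\<dots> = - (gam + ?b)"
      by (simp only: integral_minus Bochner_Integration.integral_add[OF integrable_one_minus_exp drift])
    finally show ?thesis unfolding a by simp
  qed
  moreover have "(CLINT x|\<nu>. iexp (\<theta> * x) - 1 - \<i> * of_real (\<theta> * x * indicator {-1..1} x)) =
      (CLINT x|\<nu>. iexp (\<theta> * x) - 1) - (CLINT x|\<nu>. \<i> * of_real (\<theta> * (x * indicator {-1..1} x)))"
    unfolding mult.assoc
    by (intro Bochner_Integration.integral_diff integrable_iexp integrable_mult_right integrable_of_real drift)
  moreover have "(CLINT x|\<nu>. \<i> * of_real (\<theta> * (x * indicator {-1..1} x))) = \<i> * of_real (\<theta> * ?b)"
    by (simp only: integral_mult_right_zero integral_complex_of_real)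
  ultimately show ?thesis
    unfolding levy_exponent_def by (simp add: algebra_simps)
qed

text \<open>The growth rate of \<open>levy_p\<close> is \<open>gam\<close>, as the subtracted integral is sublinear.\<close>

lemma gam_le_of_levy_p_le:
  assumes "\<And>k. 2 \<le> k \<Longrightarrow> levy_p \<nu> k \<le> real k - 1"
  shows "gam \<le> 1"
proof -
  define r where "r n = (LINT x|\<nu>. (1 - exp (real (n + 2) * x)) / real (n + 2))" for n
  have "r \<longlonglongrightarrow> (LINT x|\<nu>. 0)"
    unfolding r_def
  proof (rule integral_dominated_convergence[where w="\<lambda>x. min 1 \<bar>x\<bar>"])
    show "AE x in \<nu>. (\<lambda>n. (1 - exp (real (n + 2) * x)) / real (n + 2)) \<longlonglongrightarrow> 0"
      using neg by eventually_elim real_asymp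
    show "AE x in \<nu>. norm ((1 - exp (real (n + 2) * x)) / real (n + 2)) \<le> min 1 \<bar>x\<bar>" for n
      using neg
    proof eventually_elim
      case (elim x)
      have "1 + real (n + 2) * x \<le> exp (real (n + 2) * x)" by (rule exp_ge_add_one_self)
      moreover have "real (n + 2) * \<bar>x\<bar> = - (real (n + 2) * x)" using elim by simp
      ultimately have "1 - exp (real (n + 2) * x) \<le> real (n + 2) * \<bar>x\<bar>" by linarith
      moreover have "1 - exp (real (n + 2) * x) \<le> real (n + 2) * 1" using exp_gt_zero[of "real (n + 2) * x"] by (simp del: exp_gt_zero)
      ultimately have "1 - exp (real (n + 2) * x) \<le> real (n + 2) * min 1 \<bar>x\<bar>" by (simp only: min_def split: if_split) blast
      moreover have "0 \<le> 1 - exp (real (n + 2) * x)" using elim by (simp add: mult_nonneg_nonpos)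
      moreover have "norm (u / c) \<le> v" if "u \<le> c * v" "0 \<le> u" "0 < c" for u c v :: real
        using that by (simp add: pos_divide_le_eq mult.commute)
      moreover have "0 < real (n + 2)" by simp
      ultimately show ?case by blast
    qed
  qed (measurable, rule integrable_min)
  then have "(\<lambda>n. 1 + r n) \<longlonglongrightarrow> 1 + 0" by (intro tendsto_intros) simp
  moreover have "gam \<le> 1 + r n" for n
  proof -
    have "real (n + 2) * gam - real (n + 2) * r n \<le> real (n + 2) - 1"
      using assms[of "n + 2"] by (simp add: levy_p_def r_def)
    then have "real (n + 2) * gam \<le> real (n + 2) * (1 + r n)" by (simp add: distrib_left)
    then show ?thesis by (rule mult_left_le_imp_le) simp
  qed
  ultimately show ?thesis by (intro LIMSEQ_le_const[of "\<lambda>n. 1 + r n"]) auto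
qed

end

text \<open>Testing weak convergence with the constant function 1 gives convergence of total masses.
  Restricting to integer times keeps the exceptional events of the modification countable in
  number.\<close>

lemma cascade_limit_total:
  assumes isrm: "indep_scattered_random_measure M \<psi> \<H> \<Lambda>"
    and limit: "cascade_limit M \<Lambda> {0..1} \<mu>"
  obtains Y where "cascade_total M \<psi> \<Lambda> Y (\<lambda>\<omega>. total_mass (\<mu> \<omega>))"
proof -
  let ?I = "{0..1::real}"
  obtain Y m where \<mu>: "random_measure_on M ?I \<mu>"
    and Y: "\<And>\<epsilon>. 0 < \<epsilon> \<Longrightarrow> cadlag_modification M ?I (\<lambda>t. \<Lambda> (cone_trunc ?I \<epsilon> t)) (Y \<epsilon>)"
    and m: "right_continuous_measure_modification M ?I (\<lambda>t. cascade_approx ?I (Y (1 / t))) m"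
    and conv: "AE \<omega> in M. weakly_tendsto_on ?I (\<lambda>t. m t \<omega>) (\<mu> \<omega>) at_top"
    using limit unfolding cascade_limit_def by blast
  interpret cascade_versions M \<psi> \<Lambda> Y
    using isrm Y by unfold_locales
  have space_on: "space N = ?I" if "sets N = sets (restrict_space borel ?I)" for N :: "real measure"
    using sets_eq_imp_space_eq[OF that] by (simp add: space_restrict_space)
  have approx: "emeasure (cascade_approx ?I (Y e) \<omega>) ?I = approx_mass e \<omega>"
    if e: "0 < e" and \<omega>: "\<omega> \<in> space M" for e \<omega>
  proof -
    have "(\<lambda>x. dens e x \<omega>) \<in> borel_measurable (restrict_space lborel ?I)"
      by (intro measurable_restrict_space1) (use dens_measurable_fst[OF e \<omega>] in simp)
    then have meas: "(\<lambda>x. ennreal (exp (Y e x \<omega>) / measure lborel ?I)) \<in> borel_measurable (restrict_space lborel ?I)"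
      by (rule measurable_cong[THEN iffD1, rotated]) (simp add: dens_def space_restrict_space)
    have "emeasure (cascade_approx ?I (Y e) \<omega>) ?I = emeasure (cascade_approx ?I (Y e) \<omega>) (space (cascade_approx ?I (Y e) \<omega>))"
      by (simp add: cascade_approx_def space_restrict_space)
    also have "\<dots> = (\<integral>\<^sup>+x. ennreal (exp (Y e x \<omega>) / measure lborel ?I) \<partial>restrict_space lborel ?I)"
      unfolding cascade_approx_def by (subst emeasure_density[OF meas]) (auto simp: sets_restrict_space_iff intro!: nn_integral_cong)
    also have "\<dots> = (\<integral>\<^sup>+x. ennreal (exp (Y e x \<omega>) / measure lborel ?I) * indicator ?I x \<partial>lborel)"
      by (rule nn_integral_restrict_space) simp
    also have "\<dots> = approx_mass e \<omega>"
      unfolding approx_mass_def by (intro nn_integral_cong) (auto simp: dens_def)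
    finally show ?thesis .
  qed
  have "cascade_total M \<psi> \<Lambda> Y (\<lambda>\<omega>. total_mass (\<mu> \<omega>))"
  proof unfold_locales
    have "?I \<in> sets (restrict_space borel ?I)" by (simp add: sets_restrict_space_iff)
    then have "(\<lambda>\<omega>. emeasure (\<mu> \<omega>) ?I) \<in> borel_measurable M"
      using \<mu> unfolding random_measure_on_def by blast
    from borel_measurable_enn2real[OF this]
    show "(\<lambda>\<omega>. total_mass (\<mu> \<omega>)) \<in> borel_measurable M"
      by (rule measurable_cong[THEN iffD1, rotated])
        (use \<mu> in \<open>simp add: random_measure_on_def total_mass_def measure_def space_on\<close>)
    show "0 \<le> total_mass (\<mu> \<omega>)" for \<omega> by (simp add: total_mass_def)
    have "AE \<omega> in M. \<forall>k. m (real (Suc k)) \<omega> = cascade_approx ?I (Y (1 / real (Suc k))) \<omega>"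
      unfolding AE_all_countable
    proof
      fix k
      have "0 < real (Suc k)" by simp
      then show "AE \<omega> in M. m (real (Suc k)) \<omega> = cascade_approx ?I (Y (1 / real (Suc k))) \<omega>"
        using m unfolding right_continuous_measure_modification_def by blast
    qed
    then show "AE \<omega> in M. (\<lambda>k. approx_mass (1 / real (Suc k)) \<omega>) \<longlonglongrightarrow> ennreal (total_mass (\<mu> \<omega>))"
      using conv AE_space
    proof eventually_elim
      case (elim \<omega>)
      have "bounded ((\<lambda>x. 1::real) ` ?I)" by (simp add: image_constant_conv)
      then have "((\<lambda>t. LINT x|m t \<omega>. (1::real)) \<longlongrightarrow> (LINT x|\<mu> \<omega>. 1)) at_top"
        using elim(2)[unfolded weakly_tendsto_on_def, rule_format, of "\<lambda>x. 1"] by simp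
      then have "((\<lambda>t. total_mass (m t \<omega>)) \<longlongrightarrow> total_mass (\<mu> \<omega>)) at_top"
        by (simp add: total_mass_def)
      moreover have "filterlim (\<lambda>k. real (Suc k)) at_top sequentially" by real_asymp
      ultimately have "(\<lambda>k. total_mass (m (real (Suc k)) \<omega>)) \<longlonglongrightarrow> total_mass (\<mu> \<omega>)"
        by (rule filterlim_compose)
      then have "(\<lambda>k. ennreal (total_mass (m (real (Suc k)) \<omega>))) \<longlonglongrightarrow> ennreal (total_mass (\<mu> \<omega>))"
        by (rule tendsto_ennrealI)
      moreover have "ennreal (total_mass (m (real (Suc k)) \<omega>)) = approx_mass (1 / real (Suc k)) \<omega>" for k
      proof -
        have "0 < real (Suc k)" by simp
        then have "random_measure_on M ?I (m (real (Suc k)))"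
          using m unfolding right_continuous_measure_modification_def by blast
        then have "finite_measure (m (real (Suc k)) \<omega>)" "sets (m (real (Suc k)) \<omega>) = sets (restrict_space borel ?I)"
          using elim(3) unfolding random_measure_on_def by blast+
        then have "finite_measure (m (real (Suc k)) \<omega>)" "space (m (real (Suc k)) \<omega>) = ?I"
          using space_on by blast+
        then have "ennreal (total_mass (m (real (Suc k)) \<omega>)) = emeasure (m (real (Suc k)) \<omega>) ?I"
          by (simp add: total_mass_def finite_measure.emeasure_eq_measure del: of_nat_Suc)
        also have "\<dots> = approx_mass (1 / real (Suc k)) \<omega>"
          using elim(1,3) approx[of "1 / real (Suc k)" \<omega>] by (simp del: of_nat_Suc)
        finally show ?thesis .
      qed
      ultimately show ?case by (simp only:)
    qed
  qed
  then show ?thesis by (rule that)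
qed

lemma (in cascade_total) moment_eq_power:
  assumes "0 < p"
  shows "moment M Z (real p) = (\<integral>\<^sup>+\<omega>. ennreal (Z \<omega>) ^ p \<partial>M)"
  unfolding moment_def
proof (rule nn_integral_cong)
  fix \<omega>
  have "Z \<omega> powr real p = Z \<omega> ^ p"
    using Z_nonneg[of \<omega>] assms by (cases "Z \<omega> = 0") (simp_all add: powr_realpow)
  then show "ennreal (Z \<omega> powr real p) = ennreal (Z \<omega>) ^ p"
    using Z_nonneg[of \<omega>] by (simp add: ennreal_power)
qed

theorem condition_beta_moments:
  assumes data: "cascade_levy_data a \<sigma> \<nu>"
    and total: "cascade_total M (levy_exponent a \<sigma> \<nu>) \<Lambda> Y Z"
    and beta: "condition_beta \<sigma> \<nu>"
  shows "0 < q \<Longrightarrow> 0 < moment M Z q \<and> moment M Z q < \<infinity>"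
    and "((\<lambda>q. ln (enn2real (moment M Z q)) / (q * ln q)) \<longlongrightarrow> levy_gamma \<nu>) at_top"
proof -
  have \<sigma>: "\<sigma> = 0" using beta by (simp add: condition_beta_def)
  interpret negative_levy \<nu>
    using data beta by (intro negative_levyI) (auto simp: cascade_levy_data_def condition_beta_def)
  interpret cascade_total M "levy_exponent a \<sigma> \<nu>" \<Lambda> Y Z by (rule total)
  have a: "a = - (LINT x|\<nu>. exp x - 1 - x * indicator {-1..1} x)"
    using data \<sigma> by (simp add: cascade_levy_data_def)
  interpret subcritical_total M "levy_exponent a \<sigma> \<nu>" \<Lambda> Y \<nu> Z
  proof unfold_locales
    show "levy_exponent a \<sigma> \<nu> \<theta> = \<i> * of_real (\<theta> * gam) + (CLINT x|\<nu>. iexp (\<theta> * x) - 1)" for \<theta>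
      unfolding \<sigma> by (rule levy_exponent_eq[OF a])
    show "gam \<le> 1" using beta by (simp add: condition_beta_def levy_gamma_eq)
  qed
  show "0 < q \<Longrightarrow> 0 < moment M Z q \<and> moment M Z q < \<infinity>"
    using moments_pos_finite by blast
  show "((\<lambda>q. ln (enn2real (moment M Z q)) / (q * ln q)) \<longlongrightarrow> levy_gamma \<nu>) at_top"
    unfolding levy_gamma_eq by (rule log_moment_asymptotics)
qed

text \<open>The order is forced: the absence of a Gaussian part, the support and finite variation
  must come first, since only they identify the exponential moment on an area ln 2 as exp (ln 2
  \<open>levy_p \<nu> k\<close>). Then the growth condition reads
  \<open>levy_p \<nu> k \<le> k - 1\<close>, and large \<open>k\<close> bounds the drift.\<close>

theorem moments_imp_condition_beta:
  assumes data: "cascade_levy_data a \<sigma> \<nu>"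
    and total: "cascade_total M (levy_exponent a \<sigma> \<nu>) \<Lambda> Y Z"
    and moments: "\<And>q. 1 < q \<Longrightarrow> 0 < moment M Z q \<and> moment M Z q < \<infinity>"
  shows "condition_beta \<sigma> \<nu>"
proof -
  interpret cascade_total M "levy_exponent a \<sigma> \<nu>" \<Lambda> Y Z by (rule total)
  have levy: "levy_measure \<nu>" using data by (simp add: cascade_levy_data_def)
  interpret bounded_levy M a \<sigma> \<nu> \<Lambda>
  proof unfold_locales
    fix B and k :: nat assume B: "B \<in> fmeasurable \<H>" "measure \<H> B = ln 2" and k: "2 \<le> k"
    show "(\<integral>\<^sup>+\<omega>. ennreal (exp (real k * \<Lambda> B \<omega>)) \<partial>M) \<le> ennreal (exp (ln 2 * (real k - 1)))"
      using moments[of "real k"] k moment_eq_power[of k] by (intro half_cone_moment_le B) auto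
  qed (rule levy)
  have left: "(\<integral>\<^sup>+x\<in>{..0}. ennreal (min 1 \<bar>x\<bar>) \<partial>\<nu>) < \<infinity>"
    by (rule order.strict_trans1[OF nn_integral_mono levy_measure_finite_variation]) (simp add: indicator_def)
  interpret negative_levy \<nu>
    using data sigma_eq_0 by (intro negative_levyI levy levy_measure_negative left) (auto simp: cascade_levy_data_def)
  have a: "a = - (LINT x|\<nu>. exp x - 1 - x * indicator {-1..1} x)"
    using data sigma_eq_0 by (simp add: cascade_levy_data_def)
  interpret negative_cascade \<nu> M "levy_exponent a \<sigma> \<nu>" \<Lambda>
  proof unfold_locales
    show "levy_exponent a \<sigma> \<nu> \<theta> = \<i> * of_real (\<theta> * gam) + (CLINT x|\<nu>. iexp (\<theta> * x) - 1)" for \<theta>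
      unfolding sigma_eq_0 by (rule levy_exponent_eq[OF a])
  qed
  have "gam \<le> 1"
  proof (rule gam_le_of_levy_p_le)
    fix k :: nat assume k: "2 \<le> k"
    have B: "half_cone 0 \<in> fmeasurable \<H>" "measure \<H> (half_cone 0) = ln 2"
      using half_cone_fmeasurable[of 0] measure_half_cone[of 0] by auto
    have "exp (levy_p \<nu> k * ln 2) \<le> exp (ln 2 * (real k - 1))"
      using growth[OF B k] unfolding nn_integral_exp_Lam[OF B(1)] B(2) by simp
    then show "levy_p \<nu> k \<le> real k - 1" by (simp add: mult.commute)
  qed
  then show ?thesis
    using sigma_eq_0 levy_measure_negative left by (simp add: condition_beta_def levy_gamma_eq)
qed

theorem theorem1p3:
  fixes a \<sigma> :: real
    and \<nu> :: "real measure"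
    and M :: "'w measure"
    and \<Lambda> :: "complex set \<Rightarrow> 'w \<Rightarrow> real"
    and \<mu> :: "'w \<Rightarrow> real measure"
    and Z :: "'w \<Rightarrow> real"
  assumes "cascade_levy_data a \<sigma> \<nu>"
    and "indep_scattered_random_measure M (levy_exponent a \<sigma> \<nu>) hyperbolic_measure \<Lambda>"
    and "cascade_limit M \<Lambda> {0..1} \<mu>"
    and "Z = (\<lambda>\<omega>. total_mass (\<mu> \<omega>))"
  shows "((\<forall>q>1. 0 < moment M Z q \<and> moment M Z q < \<infinity>) \<longleftrightarrow> condition_beta \<sigma> \<nu>) \<and>
    (condition_beta \<sigma> \<nu> \<longrightarrow>
       ((\<lambda>q. ln (enn2real (moment M Z q)) / (q * ln q)) \<longlongrightarrow> levy_gamma \<nu>) at_top)"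
proof -
  obtain Y where Y: "cascade_total M (levy_exponent a \<sigma> \<nu>) \<Lambda> Y Z"
    using cascade_limit_total[OF assms(2,3)] unfolding assms(4) by blast
  have "condition_beta \<sigma> \<nu>" if "\<forall>q>1. 0 < moment M Z q \<and> moment M Z q < \<infinity>"
    using moments_imp_condition_beta[OF assms(1) Y] that by blast
  moreover have "\<forall>q>1. 0 < moment M Z q \<and> moment M Z q < \<infinity>" if "condition_beta \<sigma> \<nu>"
    using condition_beta_moments(1)[OF assms(1) Y that] by simp
  ultimately show ?thesis using condition_beta_moments(2)[OF assms(1) Y] by blast
qed

end
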